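(* Let $m,n\ge 1$ and $d\ge 0$ be integers. View $\mathbf{C}^m$ and $\mathbf{C}^n$ as the defining representations of $\mathrm{GL}_m(\mathbf{C})$ and $\mathrm{GL}_n(\mathbf{C})$ respectively, so that $W=\mathrm{Sym}^d(\mathbf{C}^m\otimes\mathbf{C}^n)$ is, by functoriality of $\mathrm{Sym}^d$, a representation of $\mathrm{GL}_m(\mathbf{C})\times\mathrm{GL}_n(\mathbf{C})$. Then the decomposition of $W$ into irreducible representations of $\mathrm{GL}_m(\mathbf{C})\times\mathrm{GL}_n(\mathbf{C})$ is $$W\cong\bigoplus_{\lambda\vdash d}W^n_\lambda\otimes W^m_\lambda,$$ where $\mathrm{GL}_n(\mathbf{C})$ acts on the factor $W^n_\lambda$ and $\mathrm{GL}_m(\mathbf{C})$ acts on the factor $W^m_\lambda$.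
   Context: A polynomial representation of $\mathrm{GL}_n(\mathbf{C})$ is a finite dimensional complex representation whose matrix entries are polynomials in the entries of the group element. For a polynomial representation $(\rho,W)$, its character is $\mathrm{ch}_W(x_1,\dots,x_n)=\mathrm{tr}(\rho(\mathrm{diag}(x_1,\dots,x_n)))$. A semistandard Young tableau of shape $\lambda$ in $n$ letters is a filling of the Young diagram of $\lambda$ (with $\lambda_i$ boxes in row $i$) by numbers in $\{1,\dots,n\}$, weakly increasing along rows and strictly increasing down columns; the Schur polynomial $s_\lambda(x_1,\dots,x_n)$ is the sum over all such tableaux of $x_1^{\mu_1}\cdots x_n^{\mu_n}$, where $\mu_i$ is the number of occurrences of $i$. For a partition $\lambda$ with at most $n$ nonzero parts, $W^n_\lambda$ denotes the irreducible polynomial representation of $\mathrm{GL}_n(\mathbf{C})$ (unique up to isomorphism) with character $s_\lambda(x_1,\dots,x_n)$. Convention: $W^n_\lambda=0$ if $\lambda$ has more than $n$ nonzero parts. The notation $\lambda\vdash d$ means that $\lambda$ is a partition of $d$. *)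

theory Defs
  imports
    "Jordan_Normal_Form.VS_Connect"
    "HOL-Algebra.AbelCoset"
    "HOL-Library.Poly_Mapping"
begin

abbreviation cspace :: "nat \<Rightarrow> (complex, complex vec) module" where
  "cspace n \<equiv> module_vec TYPE(complex) n"

definition GL :: "nat \<Rightarrow> complex mat monoid" where
  "GL n = units_of (ring_mat TYPE(complex) n ())"

definition representation ::
  "('g, 'c) monoid_scheme \<Rightarrow> (complex, 'v, 'e) module_scheme \<Rightarrow> ('g \<Rightarrow> 'v \<Rightarrow> 'v) \<Rightarrow> bool" where
  "representation G V \<rho> \<longleftrightarrow>
     group G \<and> vectorspace class_ring V \<and>
     (\<forall>g\<in>carrier G. \<rho> g \<in> LinearCombinations.module_hom class_ring V V) \<and>
     (\<forall>v\<in>carrier V. \<rho> \<one>\<^bsub>G\<^esub> v = v) \<and>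
     (\<forall>g\<in>carrier G. \<forall>h\<in>carrier G. \<forall>v\<in>carrier V. \<rho> (g \<otimes>\<^bsub>G\<^esub> h) v = \<rho> g (\<rho> h v))"

definition irreducible_rep ::
  "('g, 'c) monoid_scheme \<Rightarrow> (complex, 'v, 'e) module_scheme \<Rightarrow> ('g \<Rightarrow> 'v \<Rightarrow> 'v) \<Rightarrow> bool" where
  "irreducible_rep G V \<rho> \<longleftrightarrow>
     representation G V \<rho> \<and> carrier V \<noteq> {\<zero>\<^bsub>V\<^esub>} \<and>
     (\<forall>S. VectorSpace.subspace class_ring S V \<and> (\<forall>g\<in>carrier G. \<rho> g ` S \<subseteq> S)
        \<longrightarrow> S = {\<zero>\<^bsub>V\<^esub>} \<or> S = carrier V)"

definition rep_iso ::
  "('g, 'c) monoid_scheme \<Rightarrow> (complex, 'v, 'e) module_scheme \<Rightarrow> ('g \<Rightarrow> 'v \<Rightarrow> 'v)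
     \<Rightarrow> (complex, 'w, 'f) module_scheme \<Rightarrow> ('g \<Rightarrow> 'w \<Rightarrow> 'w) \<Rightarrow> bool" where
  "rep_iso G V \<rho> W \<sigma> \<longleftrightarrow>
     representation G V \<rho> \<and> representation G W \<sigma> \<and>
     (\<exists>T. T \<in> LinearCombinations.module_hom class_ring V W \<and>
          bij_betw T (carrier V) (carrier W) \<and>
          (\<forall>g\<in>carrier G. \<forall>v\<in>carrier V. T (\<rho> g v) = \<sigma> g (T v)))"

definition free_space :: "'x set \<Rightarrow> (complex, 'x \<Rightarrow>\<^sub>0 complex) module" where
  "free_space X =
     \<lparr>carrier = {p. Poly_Mapping.keys p \<subseteq> X}, mult = undefined, one = undefined,
      zero = 0, add = (+), smult = (\<lambda>c. Poly_Mapping.map (\<lambda>z. c * z))\<rparr>"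

definition quotient_space ::
  "(complex, 'v, 'e) module_scheme \<Rightarrow> 'v set \<Rightarrow> (complex, 'v set) module" where
  "quotient_space V S =
     \<lparr>carrier = a_rcosets\<^bsub>V\<^esub> S, mult = undefined, one = undefined,
      zero = S, add = set_add V,
      smult = (\<lambda>c C. \<Union>v\<in>C. S +>\<^bsub>V\<^esub> (c \<odot>\<^bsub>V\<^esub> v))\<rparr>"

definition relation_span :: "'x set \<Rightarrow> ('x \<Rightarrow>\<^sub>0 complex) set \<Rightarrow> ('x \<Rightarrow>\<^sub>0 complex) set" where
  "relation_span X R = LinearCombinations.module.span class_ring (free_space X) R"

definition presented_space ::
  "'x set \<Rightarrow> ('x \<Rightarrow>\<^sub>0 complex) set \<Rightarrow> (complex, ('x \<Rightarrow>\<^sub>0 complex) set) module" where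
  "presented_space X R = quotient_space (free_space X) (relation_span X R)"

definition push_forward :: "('x \<Rightarrow> 'y) \<Rightarrow> ('x \<Rightarrow>\<^sub>0 complex) \<Rightarrow> ('y \<Rightarrow>\<^sub>0 complex)" where
  "push_forward f p =
     (\<Sum>x\<in>Poly_Mapping.keys p. Poly_Mapping.single (f x) (Poly_Mapping.lookup p x))"

text \<open>The endomorphism of the presented space induced by a map \<open>f\<close> of the generators; it is
  meaningful when \<open>f\<close> respects the relations, and then all cosets in the union coincide.\<close>

definition presented_map ::
  "'x set \<Rightarrow> ('x \<Rightarrow>\<^sub>0 complex) set \<Rightarrow> ('x \<Rightarrow> 'x)
     \<Rightarrow> ('x \<Rightarrow>\<^sub>0 complex) set \<Rightarrow> ('x \<Rightarrow>\<^sub>0 complex) set" where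
  "presented_map X R f C =
     (\<Union>p\<in>C. relation_span X R +>\<^bsub>free_space X\<^esub> push_forward f p)"

abbreviation gen :: "'x \<Rightarrow> ('x \<Rightarrow>\<^sub>0 complex)" where
  "gen x \<equiv> Poly_Mapping.single x 1"

definition tensor_relations ::
  "(complex, 'v, 'e) module_scheme \<Rightarrow> (complex, 'w, 'f) module_scheme
     \<Rightarrow> ('v \<times> 'w \<Rightarrow>\<^sub>0 complex) set" where
  "tensor_relations V W =
     {gen (v \<oplus>\<^bsub>V\<^esub> v', w) - gen (v, w) - gen (v', w) | v v' w.
        v \<in> carrier V \<and> v' \<in> carrier V \<and> w \<in> carrier W} \<union>
     {gen (v, w \<oplus>\<^bsub>W\<^esub> w') - gen (v, w) - gen (v, w') | v w w'.
        v \<in> carrier V \<and> w \<in> carrier W \<and> w' \<in> carrier W} \<union>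
     {gen (c \<odot>\<^bsub>V\<^esub> v, w) - Poly_Mapping.single (v, w) c | c v w.
        v \<in> carrier V \<and> w \<in> carrier W} \<union>
     {gen (v, c \<odot>\<^bsub>W\<^esub> w) - Poly_Mapping.single (v, w) c | c v w.
        v \<in> carrier V \<and> w \<in> carrier W}"

definition tensor ::
  "(complex, 'v, 'e) module_scheme \<Rightarrow> (complex, 'w, 'f) module_scheme
     \<Rightarrow> (complex, ('v \<times> 'w \<Rightarrow>\<^sub>0 complex) set) module" where
  "tensor V W = presented_space (carrier V \<times> carrier W) (tensor_relations V W)"

definition tensor_map ::
  "(complex, 'v, 'e) module_scheme \<Rightarrow> (complex, 'w, 'f) module_scheme
     \<Rightarrow> ('v \<Rightarrow> 'v) \<Rightarrow> ('w \<Rightarrow> 'w)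
     \<Rightarrow> ('v \<times> 'w \<Rightarrow>\<^sub>0 complex) set \<Rightarrow> ('v \<times> 'w \<Rightarrow>\<^sub>0 complex) set" where
  "tensor_map V W f g =
     presented_map (carrier V \<times> carrier W) (tensor_relations V W) (map_prod f g)"

text \<open>The generator \<open>[v\<^sub>1, \<dots>, v\<^sub>d]\<close> stands for the symmetric product of
  \<open>v\<^sub>1, \<dots>, v\<^sub>d\<close>: the relations say that it is multilinear and independent of the order, so
  \<open>sym_power d V\<close> is the quotient of the \<open>d\<close>-th tensor power of \<open>V\<close> by all permutations of the
  tensor factors.\<close>

definition sym_words :: "nat \<Rightarrow> (complex, 'v, 'e) module_scheme \<Rightarrow> 'v list set" where
  "sym_words d V = {vs. length vs = d \<and> set vs \<subseteq> carrier V}"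

definition sym_relations ::
  "nat \<Rightarrow> (complex, 'v, 'e) module_scheme \<Rightarrow> ('v list \<Rightarrow>\<^sub>0 complex) set" where
  "sym_relations d V =
     {gen (us @ [v \<oplus>\<^bsub>V\<^esub> w] @ vs) - gen (us @ [v] @ vs) - gen (us @ [w] @ vs) | us v w vs.
        us @ [v] @ vs \<in> sym_words d V \<and> w \<in> carrier V} \<union>
     {gen (us @ [c \<odot>\<^bsub>V\<^esub> v] @ vs) - Poly_Mapping.single (us @ [v] @ vs) c | us c v vs.
        us @ [v] @ vs \<in> sym_words d V} \<union>
     {gen us - gen vs | us vs. us \<in> sym_words d V \<and> mset us = mset vs}"

definition sym_power ::
  "nat \<Rightarrow> (complex, 'v, 'e) module_scheme \<Rightarrow> (complex, ('v list \<Rightarrow>\<^sub>0 complex) set) module" where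
  "sym_power d V = presented_space (sym_words d V) (sym_relations d V)"

definition sym_map ::
  "nat \<Rightarrow> (complex, 'v, 'e) module_scheme \<Rightarrow> ('v \<Rightarrow> 'v)
     \<Rightarrow> ('v list \<Rightarrow>\<^sub>0 complex) set \<Rightarrow> ('v list \<Rightarrow>\<^sub>0 complex) set" where
  "sym_map d V f = presented_map (sym_words d V) (sym_relations d V) (map f)"

text \<open>The external direct sum of a family indexed by a finite set, as its product.\<close>

definition dsum ::
  "'l set \<Rightarrow> ('l \<Rightarrow> (complex, 'v, 'e) module_scheme) \<Rightarrow> (complex, 'l \<Rightarrow> 'v) module" where
  "dsum L V =
     \<lparr>carrier = (\<Pi>\<^sub>E l\<in>L. carrier (V l)), mult = undefined, one = undefined,
      zero = (\<lambda>l\<in>L. \<zero>\<^bsub>V l\<^esub>), add = (\<lambda>p q. \<lambda>l\<in>L. p l \<oplus>\<^bsub>V l\<^esub> q l),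
      smult = (\<lambda>c p. \<lambda>l\<in>L. c \<odot>\<^bsub>V l\<^esub> p l)\<rparr>"

definition dsum_map :: "'l set \<Rightarrow> ('l \<Rightarrow> 'v \<Rightarrow> 'v) \<Rightarrow> ('l \<Rightarrow> 'v) \<Rightarrow> ('l \<Rightarrow> 'v)" where
  "dsum_map L f p = (\<lambda>l\<in>L. f l (p l))"

text \<open>A partition is the weakly decreasing list of its nonzero parts, so its length is the number
  of nonzero parts.\<close>

definition partitions :: "nat \<Rightarrow> nat list set" where
  "partitions d = {la. sorted_wrt (\<ge>) la \<and> 0 \<notin> set la \<and> sum_list la = d}"

definition diagram :: "nat list \<Rightarrow> (nat \<times> nat) set" where
  "diagram la = {(i, j). i < length la \<and> j < la ! i}"

text \<open>Rows, columns and letters are numbered from 0, as are the rows and columns of matrices.\<close>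

definition ssyt :: "nat \<Rightarrow> nat list \<Rightarrow> (nat \<times> nat \<Rightarrow> nat) set" where
  "ssyt n la =
     {T \<in> diagram la \<rightarrow>\<^sub>E {..<n}.
        (\<forall>i j j'. j < j' \<and> (i, j) \<in> diagram la \<and> (i, j') \<in> diagram la \<longrightarrow> T (i, j) \<le> T (i, j')) \<and>
        (\<forall>i i' j. i < i' \<and> (i, j) \<in> diagram la \<and> (i', j) \<in> diagram la \<longrightarrow> T (i, j) < T (i', j))}"

definition schur_poly :: "nat \<Rightarrow> nat list \<Rightarrow> (nat \<Rightarrow> complex) \<Rightarrow> complex" where
  "schur_poly n la x = (\<Sum>T\<in>ssyt n la. \<Prod>i<n. x i ^ card {b \<in> diagram la. T b = i})"

inductive_set poly_functions :: "nat \<Rightarrow> (complex mat \<Rightarrow> complex) set" for n where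
  const: "(\<lambda>_. c) \<in> poly_functions n"
| entry: "i < n \<Longrightarrow> j < n \<Longrightarrow> (\<lambda>A. A $$ (i, j)) \<in> poly_functions n"
| add: "p \<in> poly_functions n \<Longrightarrow> q \<in> poly_functions n \<Longrightarrow> (\<lambda>A. p A + q A) \<in> poly_functions n"
| mult: "p \<in> poly_functions n \<Longrightarrow> q \<in> poly_functions n \<Longrightarrow> (\<lambda>A. p A * q A) \<in> poly_functions n"

text \<open>A polynomial representation on \<open>cspace N\<close>, given by its matrices.\<close>

definition polynomial_rep :: "nat \<Rightarrow> nat \<Rightarrow> (complex mat \<Rightarrow> complex mat) \<Rightarrow> bool" where
  "polynomial_rep n N R \<longleftrightarrow>
     R \<in> hom (GL n) (GL N) \<and>
     (\<forall>i<N. \<forall>j<N. \<exists>p\<in>poly_functions n. \<forall>A\<in>carrier (GL n). R A $$ (i, j) = p A)"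

definition mat_trace :: "complex mat \<Rightarrow> complex" where
  "mat_trace A = (\<Sum>i<dim_row A. A $$ (i, i))"

definition rep_character ::
  "nat \<Rightarrow> (complex mat \<Rightarrow> complex mat) \<Rightarrow> (nat \<Rightarrow> complex) \<Rightarrow> complex" where
  "rep_character n R x = mat_trace (R (mat_diag n x))"

text \<open>\<open>schur_rep n la N R\<close>: the matrix representation \<open>R\<close> on \<open>cspace N\<close> is the irreducible
  polynomial representation of \<open>GL n\<close> attached to the partition \<open>la\<close>, which is the zero space if
  \<open>la\<close> has more than \<open>n\<close> parts.  Only nonzero \<open>x i\<close> occur in the character identity since
  the diagonal matrix has to be invertible; as both sides are polynomials, this determines them.\<close>

definition schur_rep :: "nat \<Rightarrow> nat list \<Rightarrow> nat \<Rightarrow> (complex mat \<Rightarrow> complex mat) \<Rightarrow> bool" where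
  "schur_rep n la N R \<longleftrightarrow>
     polynomial_rep n N R \<and>
     (if length la \<le> n
      then irreducible_rep (GL n) (cspace N) (\<lambda>A v. R A *\<^sub>v v) \<and>
           (\<forall>x. (\<forall>i<n. x i \<noteq> 0) \<longrightarrow> rep_character n R x = schur_poly n la x)
      else N = 0)"

end

theory Submission
  imports Defs "Jordan_Normal_Form.Spectral_Radius"
begin

text \<open>A polynomial representation \<open>R\<^sub>\<lambda>\<close> of \<open>GL\<^sub>n\<close> extends to the monoid of all matrices. By
  Schur's lemma the matrix coefficients of the \<open>R\<^sub>\<lambda>\<close>, \<open>\<lambda> \<turnstile> d\<close>, are linearly independent. They span the
  forms of degree \<open>d\<close> on \<open>n \<times> n\<close> matrices: since \<open>(tr X)\<^sup>d\<close> is a combination of the characters, a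
  linear combination \<open>a\<close> of matrices that is killed by all \<open>R\<^sub>\<lambda>\<close> has \<open>tr (a a\<^sup>*) = 0\<close> on the \<open>d\<close>-th
  tensor power, so it is killed there too. For \<open>m \<le> n\<close>, comparing traces shows that \<open>R\<^sub>\<lambda>\<close> restricted
  to the corner \<open>m \<times> m\<close> contains the representation \<open>S\<^sub>\<lambda>\<close> of \<open>GL\<^sub>m\<close> as the image of the idempotent
  \<open>R\<^sub>\<lambda>(1\<^sub>m \<oplus> 0)\<close>. Hence \<open>Z \<mapsto> \<Sum>\<^sub>\<lambda> tr (Z\<^sub>\<lambda> K\<^sub>\<lambda> R\<^sub>\<lambda>(X \<oplus> 0))\<close>, with \<open>K\<^sub>\<lambda>\<close> the intertwiner onto that image,
  is an equivariant isomorphism from families of matrices, that is from \<open>\<Oplus>\<^sub>\<lambda> W\<^sup>n\<^sub>\<lambda> \<otimes> W\<^sup>m\<^sub>\<lambda>\<close>, onto the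
  forms of degree \<open>d\<close> on \<open>m \<times> n\<close> matrices, that is onto \<open>Sym\<^sup>d(\<complex>\<^sup>m \<otimes> \<complex>\<^sup>n)\<close>.\<close>

section \<open>Functionals and forms\<close>

text \<open>The representations are known only through their characters, so nothing is ever
  decomposed: all comparisons go through traces. Positivity of the trace of \<open>a\<close> times
  its adjoint does the work of complete reducibility, by turning an identity of characters into the
  vanishing of \<open>a\<close> in the tensor power. The expansion of the power of the trace uses
  that Schur polynomials are symmetric; this is read off from the representations, because traces do
  not change under conjugation by permutation matrices, so no involution on tableaux occurs. The
  idempotent \<open>pad n (1\<^sub>m m)\<close> is singular, which is why the representations must
  leave the group. A pair \<open>(A, B)\<close> acts on a form by
  \<open>f X \<mapsto> f (A\<^sup>T * X * B)\<close>; this is why transposed representations appear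
  and why the case \<open>m > n\<close> reduces to \<open>m \<le> n\<close> by transposing.
  Symmetric powers and tensor products are quotients of free spaces; both sides of the isomorphism
  are realised as literally the same functions on matrices, so that the isomorphism is never written
  on cosets.\<close>

text \<open>Duality for finitely many functionals on the formal sums over a possibly infinite set
  \<open>G\<close>: a functional that vanishes on their common kernel is a combination of them.
  Spanning statements are later derived by following a single formal sum \<open>c\<close>, so no
  dimension is ever computed.\<close>

lemma functionals_span:
  fixes f :: "'i \<Rightarrow> 'g \<Rightarrow> complex"
  assumes "finite I"
    and "\<And>F c. finite F \<Longrightarrow> F \<subseteq> G \<Longrightarrow> (\<And>i. i \<in> I \<Longrightarrow> (\<Sum>g\<in>F. c g * f i g) = 0) \<Longrightarrow>
           (\<Sum>g\<in>F. c g * h g) = 0"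
  shows "\<exists>b. \<forall>g\<in>G. h g = (\<Sum>i\<in>I. b i * f i g)"
  using assms
proof (induction I arbitrary: h)
  case empty
  have "h g = 0" if "g \<in> G" for g
    using empty.prems[of "{g}" "\<lambda>_. 1"] that by simp
  then show ?case by auto
next
  case (insert k I)
  show ?case
  proof (cases "\<forall>F c. finite F \<longrightarrow> F \<subseteq> G \<longrightarrow> (\<forall>i\<in>I. (\<Sum>g\<in>F. c g * f i g) = 0)
                   \<longrightarrow> (\<Sum>g\<in>F. c g * f k g) = 0")
    case True
    have "\<exists>b. \<forall>g\<in>G. h g = (\<Sum>i\<in>I. b i * f i g)"
      by (rule insert.IH, rule insert.prems) (use True in auto)
    then obtain b where b: "\<forall>g\<in>G. h g = (\<Sum>i\<in>I. b i * f i g)" by blast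
    have "h g = (\<Sum>i\<in>insert k I. (b(k := 0)) i * f i g)" if "g \<in> G" for g
    proof -
      have "(\<Sum>i\<in>I. (b(k := 0)) i * f i g) = (\<Sum>i\<in>I. b i * f i g)"
        using insert.hyps by (intro sum.cong) auto
      then show ?thesis using b that insert.hyps by simp
    qed
    then show ?thesis by blast
  next
    case False
    then obtain F0 c0 where F0: "finite F0" "F0 \<subseteq> G"
      and kill: "\<And>i. i \<in> I \<Longrightarrow> (\<Sum>g\<in>F0. c0 g * f i g) = 0"
      and al: "(\<Sum>g\<in>F0. c0 g * f k g) \<noteq> 0" by blast
    define \<alpha> where "\<alpha> = (\<Sum>g\<in>F0. c0 g * f k g)"
    define \<beta> where "\<beta> = (\<Sum>g\<in>F0. c0 g * h g)"
    have a0: "\<alpha> \<noteq> 0" using al by (simp add: \<alpha>_def)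
    \<comment> \<open>\<open>\<beta> / \<alpha>\<close> is the only possible coefficient of
      \<open>f k\<close>, since \<open>c0\<close> sees none of the other \<open>f i\<close>.\<close>
    define h' where "h' = (\<lambda>g. h g - \<beta> / \<alpha> * f k g)"
    have "\<exists>b. \<forall>g\<in>G. h' g = (\<Sum>i\<in>I. b i * f i g)"
    proof (rule insert.IH)
      fix F c
      assume F: "finite F" "F \<subseteq> G" and kF: "\<And>i. i \<in> I \<Longrightarrow> (\<Sum>g\<in>F. c g * f i g) = 0"
      define \<gamma> where "\<gamma> = (\<Sum>g\<in>F. c g * f k g)"
      \<comment> \<open>Correcting \<open>c\<close> by a multiple of \<open>c0\<close> makes
        \<open>f k\<close> vanish on it without disturbing the \<open>f i\<close>, so that the
        hypothesis on \<open>h\<close> applies.\<close>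
      define c' where "c' = (\<lambda>g. (if g \<in> F then c g else 0) - \<gamma> / \<alpha> * (if g \<in> F0 then c0 g else 0))"
      have c': "(\<Sum>g\<in>F \<union> F0. c' g * u g)
          = (\<Sum>g\<in>F. c g * u g) - \<gamma> / \<alpha> * (\<Sum>g\<in>F0. c0 g * u g)" for u
      proof -
        have "(\<Sum>g\<in>F \<union> F0. c' g * u g)
          = (\<Sum>g\<in>F \<union> F0. if g \<in> F then c g * u g else 0)
            - \<gamma> / \<alpha> * (\<Sum>g\<in>F \<union> F0. if g \<in> F0 then c0 g * u g else 0)"
          unfolding c'_def sum_distrib_left sum_subtractf[symmetric]
          by (intro sum.cong) (auto simp: algebra_simps)
        also have "(\<Sum>g\<in>F \<union> F0. if g \<in> F then c g * u g else 0) = (\<Sum>g\<in>F. c g * u g)"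
          using F F0 by (intro sum.mono_neutral_cong_right) auto
        also have "(\<Sum>g\<in>F \<union> F0. if g \<in> F0 then c0 g * u g else 0) = (\<Sum>g\<in>F0. c0 g * u g)"
          using F F0 by (intro sum.mono_neutral_cong_right) auto
        finally show ?thesis .
      qed
      have "(\<Sum>g\<in>F \<union> F0. c' g * h g) = 0"
      proof (rule insert.prems)
        fix i assume "i \<in> insert k I"
        then show "(\<Sum>g\<in>F \<union> F0. c' g * f i g) = 0"
          using kF[of i] kill[of i] a0 unfolding c' by (auto simp: \<alpha>_def[symmetric] \<gamma>_def[symmetric])
      qed (use F F0 in auto)
      then have "(\<Sum>g\<in>F. c g * h g) = \<gamma> / \<alpha> * \<beta>" unfolding c' \<beta>_def by simp
      moreover have "(\<Sum>g\<in>F. c g * h' g) = (\<Sum>g\<in>F. c g * h g) - \<beta> / \<alpha> * \<gamma>"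
        unfolding h'_def \<gamma>_def sum_distrib_left sum_subtractf[symmetric]
        by (intro sum.cong) (auto simp: algebra_simps)
      ultimately show "(\<Sum>g\<in>F. c g * h' g) = 0" by simp
    qed
    then obtain b where b: "\<forall>g\<in>G. h' g = (\<Sum>i\<in>I. b i * f i g)" by blast
    have "h g = (\<Sum>i\<in>insert k I. (b(k := \<beta> / \<alpha>)) i * f i g)" if "g \<in> G" for g
    proof -
      have "(\<Sum>i\<in>I. (b(k := \<beta> / \<alpha>)) i * f i g) = (\<Sum>i\<in>I. b i * f i g)"
        using insert.hyps by (intro sum.cong) auto
      then show ?thesis using b[rule_format, OF that] insert.hyps by (simp add: h'_def algebra_simps)
    qed
    then show ?thesis by blast
  qed
qed

text \<open>Density of the invertible matrices is only ever used in this form: an identity is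
  restricted to a polynomial curve that leaves the group for finitely many parameters.\<close>

lemma poly_eq_0_if_cofinite:
  fixes q :: "complex poly"
  assumes "finite F" "\<And>t. t \<notin> F \<Longrightarrow> poly q t = 0"
  shows "q = 0"
proof (rule ccontr)
  assume "q \<noteq> 0"
  then have "finite {t. poly q t = 0}" by (rule poly_roots_finite)
  then have "finite (F \<union> {t. poly q t = 0})" using assms by simp
  moreover have "F \<union> {t. poly q t = 0} = UNIV" using assms by blast
  ultimately show False using infinite_UNIV_char_0 by metis
qed

text \<open>The variables stay nonzero because characters are given on invertible diagonal matrices.
  As a polynomial in the variable of \<open>a\<close> alone, the sum has at
  \<open>t ^ \<mu> a\<close> the coefficient formed by the terms in \<open>E'\<close>, where the
  exponent of \<open>a\<close> is constant; so the exponents in \<open>E'\<close> are still told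
  apart by the remaining variables.\<close>

lemma monomials_independent:
  fixes k :: "('i \<Rightarrow> nat) \<Rightarrow> complex"
  assumes "finite I" "finite E"
    and "\<And>\<mu> \<nu>. \<mu> \<in> E \<Longrightarrow> \<nu> \<in> E \<Longrightarrow> (\<And>i. i \<in> I \<Longrightarrow> \<mu> i = \<nu> i) \<Longrightarrow> \<mu> = \<nu>"
    and "\<And>x. (\<And>i. i \<in> I \<Longrightarrow> x i \<noteq> 0) \<Longrightarrow> (\<Sum>\<mu>\<in>E. k \<mu> * (\<Prod>i\<in>I. x i ^ \<mu> i)) = 0"
    and "\<mu> \<in> E"
  shows "k \<mu> = 0"
  using assms
proof (induction I arbitrary: E \<mu>)
  case empty
  then have "E = {\<mu>}" by auto
  then show ?case using empty.prems(3)[of "\<lambda>_. 1"] by simp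
next
  case (insert a I)
  define E' where "E' = {\<nu> \<in> E. \<nu> a = \<mu> a}"
  show ?case
  proof (rule insert.IH[of E'])
    fix x :: "'i \<Rightarrow> complex" assume x: "\<And>i. i \<in> I \<Longrightarrow> x i \<noteq> 0"
    define q where "q = (\<Sum>\<nu>\<in>E. monom (k \<nu> * (\<Prod>i\<in>I. x i ^ \<nu> i)) (\<nu> a))"
    have "poly q t = 0" if "t \<notin> {0}" for t
    proof -
      have "(\<Sum>\<nu>\<in>E. k \<nu> * (\<Prod>i\<in>insert a I. (x(a := t)) i ^ \<nu> i)) = 0"
        using x that by (intro insert.prems(3)) auto
      moreover have "(\<Prod>i\<in>insert a I. (x(a := t)) i ^ \<nu> i) = t ^ \<nu> a * (\<Prod>i\<in>I. x i ^ \<nu> i)" for \<nu>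
      proof -
        have "(\<Prod>i\<in>I. (x(a := t)) i ^ \<nu> i) = (\<Prod>i\<in>I. x i ^ \<nu> i)"
          using insert.hyps by (intro prod.cong) auto
        then show ?thesis using insert.hyps by simp
      qed
      ultimately show ?thesis
        unfolding q_def by (simp add: poly_sum poly_monom mult_ac)
    qed
    then have "q = 0" by (intro poly_eq_0_if_cofinite[of "{0}"]) auto
    then have "coeff q (\<mu> a) = 0" by simp
    moreover have "coeff q (\<mu> a) = (\<Sum>\<nu>\<in>E'. k \<nu> * (\<Prod>i\<in>I. x i ^ \<nu> i))"
      unfolding q_def E'_def coeff_sum coeff_monom
      using insert.prems(1) by (simp add: sum.inter_filter)
    ultimately show "(\<Sum>\<nu>\<in>E'. k \<nu> * (\<Prod>i\<in>I. x i ^ \<nu> i)) = 0" by simp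
  next
    fix \<nu> \<nu>' assume "\<nu> \<in> E'" "\<nu>' \<in> E'" "\<And>i. i \<in> I \<Longrightarrow> \<nu> i = \<nu>' i"
    then show "\<nu> = \<nu>'" by (intro insert.prems(2)) (auto simp: E'_def)
  qed (use insert.prems in \<open>auto simp: E'_def\<close>)
qed

section \<open>Invertible matrices\<close>

lemma carrier_GL_iff:
  "A \<in> carrier (GL n) \<longleftrightarrow> A \<in> carrier_mat n n \<and> (\<exists>B\<in>carrier_mat n n. B * A = 1\<^sub>m n \<and> A * B = 1\<^sub>m n)"
  by (auto simp: GL_def units_of_def Units_def ring_mat_def)

lemma GL_carrierD: "A \<in> carrier (GL n) \<Longrightarrow> A \<in> carrier_mat n n"
  by (simp add: carrier_GL_iff)

lemma GL_mult [simp]: "A \<otimes>\<^bsub>GL n\<^esub> B = A * B"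
  and GL_one [simp]: "\<one>\<^bsub>GL n\<^esub> = 1\<^sub>m n"
  by (simp_all add: GL_def units_of_def ring_mat_def)

lemma group_GL: "group (GL n)"
proof -
  interpret ring "ring_mat TYPE(complex) n ()" by (rule ring_mat)
  show ?thesis unfolding GL_def by (rule units_group)
qed

lemma GL_mult_closed: "A \<in> carrier (GL n) \<Longrightarrow> B \<in> carrier (GL n) \<Longrightarrow> A * B \<in> carrier (GL n)"
  using group.is_monoid[OF group_GL, THEN monoid.m_closed] by simp

lemma GL_one_closed: "1\<^sub>m n \<in> carrier (GL n)"
  using group.is_monoid[OF group_GL, THEN monoid.one_closed] by simp

lemma GL_if_det: 
  assumes "A \<in> carrier_mat n n" "det A \<noteq> 0"
  shows "A \<in> carrier (GL n)"
  using det_non_zero_imp_unit[OF assms] by (auto simp: GL_def units_of_def)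

lemma GL_transpose: assumes "A \<in> carrier (GL n)" shows "A\<^sup>T \<in> carrier (GL n)"
proof -
  obtain B where "A \<in> carrier_mat n n" "B \<in> carrier_mat n n" "B * A = 1\<^sub>m n" "A * B = 1\<^sub>m n"
    using assms by (auto simp: carrier_GL_iff)
  then have "B\<^sup>T * A\<^sup>T = 1\<^sub>m n" "A\<^sup>T * B\<^sup>T = 1\<^sub>m n"
    by (metis transpose_mult transpose_one)+
  with \<open>A \<in> carrier_mat n n\<close> \<open>B \<in> carrier_mat n n\<close> show ?thesis
    by (auto simp: carrier_GL_iff)
qed

text \<open>The shift by \<open>t\<close> is singular only if \<open>t\<close> is a root of the
  characteristic polynomial of \<open>- A\<close>. These shifts are the curves along which
  identities pass from the group to all matrices.\<close>

lemma finite_shift_not_GL: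
  assumes A: "A \<in> carrier_mat n n"
  shows "finite {t. A + t \<cdot>\<^sub>m 1\<^sub>m n \<notin> carrier (GL n)}"
proof -
  have mA: "- A \<in> carrier_mat n n" using A by simp
  have "{t. A + t \<cdot>\<^sub>m 1\<^sub>m n \<notin> carrier (GL n)} \<subseteq> {t. poly (char_poly (- A)) t = 0}"
  proof safe
    fix t assume "A + t \<cdot>\<^sub>m 1\<^sub>m n \<notin> carrier (GL n)"
    then have "det (A + t \<cdot>\<^sub>m 1\<^sub>m n) = 0" using GL_if_det[of "A + t \<cdot>\<^sub>m 1\<^sub>m n" n] A by auto
    moreover have "poly (char_poly (- A)) t = det (A + t \<cdot>\<^sub>m 1\<^sub>m n)"
      unfolding char_poly_matrix[OF mA] char_matrix_def
      by (rule arg_cong[of _ _ det], rule eq_matI) (use A in \<open>auto\<close>)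
    ultimately show "poly (char_poly (- A)) t = 0" by simp
  qed
  moreover have "char_poly (- A) \<noteq> 0" using degree_monic_char_poly[OF mA] by auto
  then have "finite {t. poly (char_poly (- A)) t = 0}" by (rule poly_roots_finite)
  ultimately show ?thesis by (rule finite_subset)
qed

section \<open>Homogeneous forms on matrices\<close>

definition words :: "nat \<Rightarrow> nat \<Rightarrow> nat \<Rightarrow> (nat \<times> nat) list set" where
  "words d m n = {ps. set ps \<subseteq> {..<m} \<times> {..<n} \<and> length ps = d}"

definition word_mon :: "(nat \<times> nat) list \<Rightarrow> complex mat \<Rightarrow> complex" where
  "word_mon ps X = (\<Prod>p\<leftarrow>ps. X $$ p)"

text \<open>Monomials are indexed by words and not by multisets of positions, so the coefficients
  are not unique; in exchange, words of length \<open>d\<close> are also the coordinates of the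
  \<open>d\<close>-th tensor power, which the trace computations use. Only the values on
  \<open>m\<close> by \<open>n\<close> matrices are constrained.\<close>

definition forms :: "nat \<Rightarrow> nat \<Rightarrow> nat \<Rightarrow> (complex mat \<Rightarrow> complex) set" where
  "forms d m n = {f. \<exists>c. \<forall>X\<in>carrier_mat m n. f X = (\<Sum>ps\<in>words d m n. c ps * word_mon ps X)}"

lemma finite_words [simp]: "finite (words d m n)"
  unfolding words_def by (rule finite_lists_length_eq) simp

lemma forms_cong:
  assumes "f \<in> forms d m n" "\<And>X. X \<in> carrier_mat m n \<Longrightarrow> g X = f X"
  shows "g \<in> forms d m n"
  using assms unfolding forms_def by auto

lemma forms_add: 
  assumes "f \<in> forms d m n" "g \<in> forms d m n"
  shows "(\<lambda>X. f X + g X) \<in> forms d m n"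
proof -
  obtain a b where "\<forall>X\<in>carrier_mat m n. f X = (\<Sum>ps\<in>words d m n. a ps * word_mon ps X)"
    "\<forall>X\<in>carrier_mat m n. g X = (\<Sum>ps\<in>words d m n. b ps * word_mon ps X)"
    using assms unfolding forms_def by blast
  then show ?thesis unfolding forms_def
    by (intro CollectI exI[of _ "\<lambda>ps. a ps + b ps"]) (auto simp: sum.distrib algebra_simps)
qed

lemma forms_scale: 
  assumes "f \<in> forms d m n"
  shows "(\<lambda>X. c * f X) \<in> forms d m n"
proof -
  obtain a where "\<forall>X\<in>carrier_mat m n. f X = (\<Sum>ps\<in>words d m n. a ps * word_mon ps X)"
    using assms unfolding forms_def by blast
  then show ?thesis unfolding forms_def
    by (intro CollectI exI[of _ "\<lambda>ps. c * a ps"]) (auto simp: sum_distrib_left mult_ac)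
qed

lemma forms_zero: "(\<lambda>X. 0) \<in> forms d m n"
  unfolding forms_def by (intro CollectI exI[of _ "\<lambda>_. 0"]) simp

lemma forms_sum: "(\<And>i. i \<in> I \<Longrightarrow> f i \<in> forms d m n) \<Longrightarrow> (\<lambda>X. \<Sum>i\<in>I. f i X) \<in> forms d m n"
  by (induction I rule: infinite_finite_induct) (auto simp: forms_zero forms_add)

lemma word_mon_forms:
  assumes "ps \<in> words d m n" shows "word_mon ps \<in> forms d m n"
  unfolding forms_def 
  by (intro CollectI exI[of _ "\<lambda>qs. if qs = ps then 1 else 0"])
    (use assms in \<open>simp add: if_distrib[of "\<lambda>x. x * _"] sum.delta' cong: if_cong\<close>)

lemma forms_mult:
  assumes "f \<in> forms a m n" "g \<in> forms b m n"
  shows "(\<lambda>X. f X * g X) \<in> forms (a + b) m n"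
proof -
  obtain u v where u: "\<forall>X\<in>carrier_mat m n. f X = (\<Sum>ps\<in>words a m n. u ps * word_mon ps X)"
    and v: "\<forall>X\<in>carrier_mat m n. g X = (\<Sum>ps\<in>words b m n. v ps * word_mon ps X)"
    using assms unfolding forms_def by blast
  have "(\<lambda>X. \<Sum>ps\<in>words a m n. \<Sum>qs\<in>words b m n. u ps * v qs * word_mon (ps @ qs) X) \<in> forms (a + b) m n"
    by (intro forms_sum forms_scale word_mon_forms) (auto simp: words_def)
  then show ?thesis
    by (rule forms_cong) (simp add: u v sum_product word_mon_def mult_ac)
qed

lemma forms_const: "(\<lambda>X. c) \<in> forms 0 m n"
proof -
  have "words 0 m n = {[]}" by (auto simp: words_def)
  then show ?thesis unfolding forms_def by (intro CollectI exI[of _ "\<lambda>_. c"]) (simp add: word_mon_def)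
qed

lemma forms_entry: "i < m \<Longrightarrow> j < n \<Longrightarrow> (\<lambda>X. X $$ (i, j)) \<in> forms 1 m n"
  using word_mon_forms[of "[(i, j)]" 1 m n] by (auto simp: words_def word_mon_def fun_eq_iff elim: forms_cong)

lemma forms_prod_list:
  assumes "\<And>t. t \<in> set ts \<Longrightarrow> f t \<in> forms 1 m n"
  shows "(\<lambda>X. \<Prod>t\<leftarrow>ts. f t X) \<in> forms (length ts) m n"
  using assms
proof (induction ts)
  case Nil then show ?case using forms_const[of 1] by simp
next
  case (Cons t ts)
  then show ?case using forms_mult[of "f t" 1 m n "\<lambda>X. \<Prod>t\<leftarrow>ts. f t X" "length ts"] by simp
qed

lemma forms_comp:
  assumes f: "f \<in> forms d m n" and T: "\<And>X. X \<in> carrier_mat m' n' \<Longrightarrow> T X \<in> carrier_mat m n"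
    and T1: "\<And>i j. i < m \<Longrightarrow> j < n \<Longrightarrow> (\<lambda>X. T X $$ (i, j)) \<in> forms 1 m' n'"
  shows "(\<lambda>X. f (T X)) \<in> forms d m' n'"
proof -
  obtain c where c: "\<forall>X\<in>carrier_mat m n. f X = (\<Sum>ps\<in>words d m n. c ps * word_mon ps X)"
    using f unfolding forms_def by blast
  have "(\<lambda>X. word_mon ps (T X)) \<in> forms d m' n'" if "ps \<in> words d m n" for ps
  proof -
    have "(\<lambda>X. \<Prod>p\<leftarrow>ps. T X $$ p) \<in> forms (length ps) m' n'"
      using that T1 by (intro forms_prod_list) (auto simp: words_def)
    then show ?thesis using that by (simp add: words_def word_mon_def)
  qed
  then have "(\<lambda>X. \<Sum>ps\<in>words d m n. c ps * word_mon ps (T X)) \<in> forms d m' n'"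
    by (intro forms_sum forms_scale)
  then show ?thesis by (rule forms_cong) (use c T in auto)
qed

text \<open>\<open>q A\<close> is the polynomial \<open>t \<mapsto> p (t \<cdot>\<^sub>m A)\<close>,
  and its coefficients, as functions of \<open>A\<close>, are the homogeneous parts of
  \<open>p\<close>. Following the inductive construction of \<open>p\<close> avoids coefficients in
  many variables.\<close>

lemma poly_functions_homogeneous_parts:
  assumes "p \<in> poly_functions n"
  shows "\<exists>q. (\<forall>A\<in>carrier_mat n n. \<forall>t. p (t \<cdot>\<^sub>m A) = poly (q A) t) \<and>
    (\<forall>k. (\<lambda>A. coeff (q A) k) \<in> forms k n n)"
  using assms
proof (induction rule: poly_functions.induct)
  case (const c)
  have "(\<lambda>A. coeff [:c:] k) \<in> forms k n n" for k
    by (cases k) (auto simp: forms_const forms_zero)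
  then show ?case by (intro exI[of _ "\<lambda>_. [:c:]"]) auto
next
  case (entry i j)
  have "(\<lambda>A. coeff [:0, A $$ (i, j):] k) \<in> forms k n n" for k
    using forms_entry[OF entry, simplified]
    by (cases k; cases "k - 1") (auto simp: forms_zero coeff_pCons)
  then show ?case using entry by (intro exI[of _ "\<lambda>A. [:0, A $$ (i, j):]"]) auto
next
  case (add p p')
  then obtain q q' where "\<forall>A\<in>carrier_mat n n. \<forall>t. p (t \<cdot>\<^sub>m A) = poly (q A) t"
    "\<forall>A\<in>carrier_mat n n. \<forall>t. p' (t \<cdot>\<^sub>m A) = poly (q' A) t"
    "\<And>k. (\<lambda>A. coeff (q A) k) \<in> forms k n n" "\<And>k. (\<lambda>A. coeff (q' A) k) \<in> forms k n n" by metis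
  then show ?case by (intro exI[of _ "\<lambda>A. q A + q' A"]) (auto simp: forms_add)
next
  case (mult p p')
  then obtain q q' where q: "\<forall>A\<in>carrier_mat n n. \<forall>t. p (t \<cdot>\<^sub>m A) = poly (q A) t"
    "\<forall>A\<in>carrier_mat n n. \<forall>t. p' (t \<cdot>\<^sub>m A) = poly (q' A) t"
    and qf: "\<And>k. (\<lambda>A. coeff (q A) k) \<in> forms k n n" "\<And>k. (\<lambda>A. coeff (q' A) k) \<in> forms k n n" by metis
  have "(\<lambda>A. coeff (q A * q' A) k) \<in> forms k n n" for k
    unfolding coeff_mult
  proof (rule forms_sum)
    fix i assume "i \<in> {..k}"
    then show "(\<lambda>A. coeff (q A) i * coeff (q' A) (k - i)) \<in> forms k n n"
      using forms_mult[OF qf(1)[of i] qf(2)[of "k - i"]] by simp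
  qed
  with q show ?case by (intro exI[of _ "\<lambda>A. q A * q' A"]) auto
qed

text \<open>Homogeneity for nonzero \<open>t\<close> already forces \<open>q A\<close> to be the
  single monomial \<open>p A * t ^ d\<close>; so on the group \<open>p\<close> coincides with its
  part of degree \<open>d\<close>.\<close>

lemma poly_functions_homogeneous:
  assumes p: "p \<in> poly_functions n"
    and h: "\<And>A t. A \<in> carrier (GL n) \<Longrightarrow> t \<noteq> 0 \<Longrightarrow> p (t \<cdot>\<^sub>m A) = t ^ d * p A"
  shows "\<exists>f\<in>forms d n n. \<forall>A\<in>carrier (GL n). p A = f A"
proof -
  obtain q where q: "\<forall>A\<in>carrier_mat n n. \<forall>t. p (t \<cdot>\<^sub>m A) = poly (q A) t"
    and qf: "\<And>k. (\<lambda>A. coeff (q A) k) \<in> forms k n n"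
    using poly_functions_homogeneous_parts[OF p] by metis
  have "p A = coeff (q A) d" if A: "A \<in> carrier (GL n)" for A
  proof -
    have "q A - monom (p A) d = 0"
      by (rule poly_eq_0_if_cofinite[of "{0}"])
        (use q h[OF A] GL_carrierD[OF A] in \<open>auto simp: poly_monom\<close>)
    then have "coeff (q A) d = coeff (monom (p A) d) d" by simp
    then show ?thesis by simp
  qed
  then show ?thesis using qf[of d] by (intro bexI[of _ "\<lambda>A. coeff (q A) d"]) auto
qed

section \<open>Schur polynomials\<close>

definition part :: "nat list \<Rightarrow> nat \<Rightarrow> nat" where
  "part la i = (if i < length la then la ! i else 0)"

text \<open>Weights are extensional, so that a weight is determined by its \<open>n\<close> entries
  and there are finitely many of them.\<close>

definition wts :: "nat \<Rightarrow> nat \<Rightarrow> (nat \<Rightarrow> nat) set" where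
  "wts n d = {\<mu> \<in> {..<n} \<rightarrow>\<^sub>E UNIV. (\<Sum>i<n. \<mu> i) = d}"

definition content :: "nat list \<Rightarrow> (nat \<times> nat \<Rightarrow> nat) \<Rightarrow> nat \<Rightarrow> nat" where
  "content la T i = card {b \<in> diagram la. T b = i}"

definition kostka :: "nat \<Rightarrow> nat list \<Rightarrow> (nat \<Rightarrow> nat) \<Rightarrow> nat" where
  "kostka n la \<mu> = card {T \<in> ssyt n la. \<forall>i<n. content la T i = \<mu> i}"

text \<open>Strictly monotone for the dominance order, hence a measure for induction along it.\<close>

definition dom_rank :: "nat \<Rightarrow> (nat \<Rightarrow> nat) \<Rightarrow> nat" where
  "dom_rank n \<mu> = (\<Sum>k\<le>n. \<Sum>i<k. \<mu> i)"

lemma finite_wts [simp]: "finite (wts n d)"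
proof (rule finite_subset)
  show "wts n d \<subseteq> {..<n} \<rightarrow>\<^sub>E {..d}"
  proof
    fix \<mu> assume \<mu>: "\<mu> \<in> wts n d"
    have "\<mu> i \<le> d" if "i < n" for i
      using \<mu> member_le_sum[of i "{..<n}" \<mu>] that by (auto simp: wts_def)
    then show "\<mu> \<in> {..<n} \<rightarrow>\<^sub>E {..d}" using \<mu> by (auto simp: wts_def PiE_iff)
  qed
  show "finite ({..<n} \<rightarrow>\<^sub>E {..d})" by (intro finite_PiE) auto
qed

lemma diagram_Sigma: "diagram la = Sigma {..<length la} (\<lambda>i. {..<la ! i})"
  by (auto simp: diagram_def)

lemma finite_diagram [simp]: "finite (diagram la)"
  unfolding diagram_Sigma by simp

lemma card_diagram: "card (diagram la) = sum_list la"
  unfolding diagram_Sigma by (simp add: sum_list_sum_nth atLeast0LessThan)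

lemma card_fibres:
  assumes "finite D" "finite S"
  shows "card {b \<in> D. g b \<in> S} = (\<Sum>i\<in>S. card {b \<in> D. g b = i})"
proof -
  have "{b \<in> D. g b \<in> S} = (\<Union>i\<in>S. {b \<in> D. g b = i})" by auto
  also have "card \<dots> = (\<Sum>i\<in>S. card {b \<in> D. g b = i})"
    using assms by (intro card_UN_disjoint) auto
  finally show ?thesis .
qed

lemma card_row: "card {b \<in> diagram la. fst b = i} = part la i"
proof -
  have "{b \<in> diagram la. fst b = i} = (if i < length la then {i} \<times> {..<la ! i} else {})"
    by (auto simp: diagram_def)
  then show ?thesis by (simp add: part_def)
qed

lemma finite_ssyt [simp]: "finite (ssyt n la)"
  by (rule finite_subset[of _ "diagram la \<rightarrow>\<^sub>E {..<n}"]) (auto simp: ssyt_def intro!: finite_PiE)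

text \<open>Letters start at 0 and increase strictly down the column. That the parts decrease
  ensures that the box above belongs to the diagram.\<close>

lemma ssyt_row_le:
  assumes "la \<in> partitions d" "T \<in> ssyt n la" "(i, j) \<in> diagram la"
  shows "i \<le> T (i, j)"
  using assms(3)
proof (induction i)
  case (Suc i)
  have "la ! Suc i \<le> la ! i"
    using assms(1) Suc.prems by (auto simp: partitions_def diagram_def sorted_wrt_iff_nth_less)
  then have ij: "(i, j) \<in> diagram la" using Suc.prems by (auto simp: diagram_def)
  then have "T (i, j) < T (Suc i, j)" using assms(2) Suc.prems by (auto simp: ssyt_def)
  with Suc.IH[OF ij] show ?case by simp
qed simp

lemma ssyt_empty:
  assumes "la \<in> partitions d" "length la > n"
  shows "ssyt n la = {}"
proof (rule ccontr)
  assume "ssyt n la \<noteq> {}"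
  then obtain T where T: "T \<in> ssyt n la" by blast
  have "la ! n \<noteq> 0" using assms by (auto simp: partitions_def in_set_conv_nth)
  then have b: "(n, 0) \<in> diagram la" using assms by (auto simp: diagram_def)
  then have "T (n, 0) < n" using T by (auto simp: ssyt_def)
  with ssyt_row_le[OF assms(1) T b] show False by simp
qed

lemma ssyt_entries: "T \<in> ssyt n la \<Longrightarrow> b \<in> diagram la \<Longrightarrow> T b < n"
  by (auto simp: ssyt_def PiE_iff)

lemma sum_content:
  assumes "T \<in> ssyt n la" "la \<in> partitions d"
  shows "(\<Sum>i<n. content la T i) = d"
proof -
  have "(\<Sum>i<n. content la T i) = card {b \<in> diagram la. T b \<in> {..<n}}"
    unfolding content_def by (subst card_fibres) auto
  also have "{b \<in> diagram la. T b \<in> {..<n}} = diagram la" using ssyt_entries[OF assms(1)] by auto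
  finally show ?thesis using assms(2) by (simp add: card_diagram partitions_def)
qed

text \<open>By \<open>ssyt_row_le\<close> the letters below \<open>k\<close> all sit in the first
  \<open>k\<close> rows: the content is dominated by the shape.\<close>

lemma content_dominated:
  assumes "la \<in> partitions d" "T \<in> ssyt n la"
  shows "(\<Sum>i<k. content la T i) \<le> (\<Sum>i<k. part la i)"
proof -
  have "(\<Sum>i<k. content la T i) = card {b \<in> diagram la. T b \<in> {..<k}}"
    unfolding content_def by (subst card_fibres) auto
  also have "\<dots> \<le> card {b \<in> diagram la. fst b \<in> {..<k}}"
  proof (rule card_mono)
    show "{b \<in> diagram la. T b \<in> {..<k}} \<subseteq> {b \<in> diagram la. fst b \<in> {..<k}}"
    proof safe
      fix i j assume ij: "(i, j) \<in> diagram la" "T (i, j) < k"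
      show "fst (i, j) < k" using ssyt_row_le[OF assms ij(1)] ij(2) by simp
    qed
  qed simp
  also have "\<dots> = (\<Sum>i<k. part la i)" by (subst card_fibres) (auto simp: card_row)
  finally show ?thesis .
qed

lemma kostka_nonzeroD:
  assumes "kostka n la \<mu> \<noteq> 0" "la \<in> partitions d" "k \<le> n"
  shows "(\<Sum>i<k. \<mu> i) \<le> (\<Sum>i<k. part la i)"
proof -
  have "{T \<in> ssyt n la. \<forall>i<n. content la T i = \<mu> i} \<noteq> {}"
    using assms(1) unfolding kostka_def by (metis card.empty)
  then obtain T where T: "T \<in> ssyt n la" "\<forall>i<n. content la T i = \<mu> i" by blast
  have "(\<Sum>i<k. \<mu> i) = (\<Sum>i<k. content la T i)" using T(2) assms(3) by (intro sum.cong) auto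
  with content_dominated[OF assms(2) T(1), of k] show ?thesis by simp
qed

lemma dominated_rank_le:
  assumes "\<And>k. k \<le> n \<Longrightarrow> (\<Sum>i<k. \<mu> i) \<le> (\<Sum>i<k. \<nu> i)"
  shows "dom_rank n \<mu> \<le> dom_rank n \<nu>"
  unfolding dom_rank_def by (intro sum_mono assms) auto

lemma dominated_rank_eq:
  assumes "\<And>k. k \<le> n \<Longrightarrow> (\<Sum>i<k. \<mu> i) \<le> (\<Sum>i<k. \<nu> i)" "dom_rank n \<mu> = dom_rank n \<nu>" "i < n"
  shows "\<mu> i = \<nu> i"
proof -
  have *: "(\<Sum>i<k. \<mu> i) = (\<Sum>i<k. \<nu> i)" if "k \<le> n" for k
    by (rule sum_mono_inv[of _ "{..n}"]) (use assms that in \<open>auto simp: dom_rank_def\<close>)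
  from *[of i] *[of "Suc i"] assms(3) show ?thesis by simp
qed

text \<open>The only tableau whose content is its shape has \<open>i\<close> throughout row
  \<open>i\<close>: the boxes with letters at most \<open>i\<close> lie in the rows up to
  \<open>i\<close>, and both sets have the same size, so they coincide.\<close>

lemma kostka_self:
  assumes la: "la \<in> partitions d" "length la \<le> n" and \<mu>: "\<And>i. i < n \<Longrightarrow> \<mu> i = part la i"
  shows "kostka n la \<mu> = 1"
proof -
  define C where "C = (\<lambda>b\<in>diagram la. fst b)"
  have cC: "content la C i = part la i" for i
    unfolding content_def card_row[symmetric] by (intro arg_cong[of _ _ card]) (auto simp: C_def)
  have "C \<in> ssyt n la" using la(2) by (auto simp: C_def ssyt_def PiE_iff diagram_def)
  moreover have "T = C" if T: "T \<in> ssyt n la" "\<forall>i<n. content la T i = \<mu> i" for T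
  proof
    fix b
    show "T b = C b"
    proof (cases "b \<in> diagram la")
      case False
      then show ?thesis using T(1) PiE_arb[of T "diagram la"] by (auto simp: C_def ssyt_def)
    next
      case True
      obtain i j where b: "b = (i, j)" by force
      have i: "i < n" using True la(2) by (auto simp: b diagram_def)
      let ?A = "{b \<in> diagram la. T b \<in> {..<Suc i}}" and ?B = "{b \<in> diagram la. fst b \<in> {..<Suc i}}"
      have "?A = ?B"
      proof (rule card_seteq)
        show "?A \<subseteq> ?B"
        proof safe
          fix i' j' assume ij: "(i', j') \<in> diagram la" "T (i', j') < Suc i"
          show "fst (i', j') < Suc i" using ssyt_row_le[OF la(1) T(1) ij(1)] ij(2) by simp
        qed
        have "card ?A = (\<Sum>k<Suc i. content la T k)" unfolding content_def by (subst card_fibres) auto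
        also have "\<dots> = (\<Sum>k<Suc i. part la k)" using T(2) \<mu> i by (intro sum.cong) auto
        also have "\<dots> = card ?B" by (subst card_fibres) (auto simp: card_row)
        finally show "card ?B \<le> card ?A" by simp
      qed simp
      moreover have "b \<in> ?B" using True b by simp
      ultimately have "b \<in> ?A" by (simp only:)
      then have "T b < Suc i" by simp
      with ssyt_row_le[OF la(1) T(1), of i j] True show ?thesis by (simp add: C_def b)
    qed
  qed
  moreover have "\<forall>i<n. content la C i = \<mu> i" by (simp add: cC \<mu>)
  ultimately have "{T \<in> ssyt n la. \<forall>i<n. content la T i = \<mu> i} = {C}" by blast
  then show ?thesis by (simp add: kostka_def)
qed

lemma schur_poly_kostka:
  assumes "la \<in> partitions d"
  shows "schur_poly n la x = (\<Sum>\<mu>\<in>wts n d. of_nat (kostka n la \<mu>) * (\<Prod>i<n. x i ^ \<mu> i))"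
proof -
  define g where "g = (\<lambda>T. restrict (content la T) {..<n})"
  have "schur_poly n la x = (\<Sum>T\<in>ssyt n la. \<Prod>i<n. x i ^ g T i)"
    unfolding schur_poly_def by (simp add: g_def content_def)
  also have "\<dots> = (\<Sum>\<mu>\<in>wts n d. \<Sum>T\<in>{T \<in> ssyt n la. g T = \<mu>}. \<Prod>i<n. x i ^ g T i)"
  proof (rule sum.group[symmetric])
    show "g ` ssyt n la \<subseteq> wts n d" using sum_content[OF _ assms] by (auto simp: g_def wts_def split: if_splits)
  qed auto
  also have "\<dots> = (\<Sum>\<mu>\<in>wts n d. of_nat (kostka n la \<mu>) * (\<Prod>i<n. x i ^ \<mu> i))"
  proof (rule sum.cong)
    fix \<mu> assume \<mu>: "\<mu> \<in> wts n d"
    have "g T = \<mu> \<longleftrightarrow> (\<forall>i<n. content la T i = \<mu> i)" for T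
      using \<mu> unfolding g_def wts_def by (auto simp: fun_eq_iff PiE_iff extensional_def)
    then have eq: "{T \<in> ssyt n la. g T = \<mu>} = {T \<in> ssyt n la. \<forall>i<n. content la T i = \<mu> i}" by blast
    have "(\<Sum>T\<in>{T \<in> ssyt n la. g T = \<mu>}. \<Prod>i<n. x i ^ g T i)
        = (\<Sum>T\<in>{T \<in> ssyt n la. g T = \<mu>}. \<Prod>i<n. x i ^ \<mu> i)" by (rule sum.cong) auto
    then show "(\<Sum>T\<in>{T \<in> ssyt n la. g T = \<mu>}. \<Prod>i<n. x i ^ g T i)
        = of_nat (kostka n la \<mu>) * (\<Prod>i<n. x i ^ \<mu> i)"
      by (simp add: kostka_def eq)
  qed simp
  finally show ?thesis .
qed

lemma finite_partitions [simp]: "finite (partitions d)"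
proof (rule finite_subset)
  show "partitions d \<subseteq> {la. set la \<subseteq> {..d} \<and> length la \<le> d}"
  proof
    fix la assume "la \<in> partitions d"
    then have la: "0 \<notin> set la" "sum_list la = d" by (auto simp: partitions_def)
    have "length la \<le> sum_list la" using la(1) by (induction la) auto
    then show "la \<in> {la. set la \<subseteq> {..d} \<and> length la \<le> d}"
      using la(2) member_le_sum_list by fastforce
  qed
  show "finite {la. set la \<subseteq> {..d} \<and> length la \<le> d}"
    by (rule finite_lists_length_le) simp
qed

lemma part_inj:
  assumes "la \<in> partitions d" "lb \<in> partitions d'" "length la \<le> n" "length lb \<le> n"
    and "\<And>i. i < n \<Longrightarrow> part la i = part lb i"
  shows "la = lb"
proof -
  have nz: "part la i \<noteq> 0 \<longleftrightarrow> i < length la" "part lb i \<noteq> 0 \<longleftrightarrow> i < length lb" for i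
    using assms(1,2) by (auto simp: partitions_def part_def in_set_conv_nth)
  have "length la = length lb"
  proof (rule linorder_cases[of "length la" "length lb"])
    assume "length la < length lb"
    then show ?thesis using nz[of "length la"] assms(4) assms(5)[of "length la"] by auto
  next
    assume "length lb < length la"
    then show ?thesis using nz[of "length lb"] assms(3) assms(5)[of "length lb"] by auto
  qed
  moreover have "la ! i = lb ! i" if "i < length la" for i
    using that assms(3) assms(5)[of i] \<open>length la = length lb\<close> by (auto simp: part_def)
  ultimately show ?thesis by (intro nth_equalityI) auto
qed

lemma partition_of_decreasing:
  assumes \<mu>: "\<mu> \<in> wts n d" and dec: "\<And>i. Suc i < n \<Longrightarrow> \<mu> (Suc i) \<le> \<mu> i"
  shows "\<exists>la\<in>partitions d. length la \<le> n \<and> (\<forall>i<n. \<mu> i = part la i)"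
proof -
  have mono: "\<mu> j \<le> \<mu> i" if "i \<le> j" "j < n" for i j
    using that by (induction rule: dec_induct) (auto intro: order_trans[OF dec])
  \<comment> \<open>The number of nonzero entries: a decreasing weight vanishes from its first zero
    on, and a partition lists only its nonzero parts.\<close>
  define k where "k = (LEAST k. k = n \<or> \<mu> k = 0)"
  have k: "k = n \<or> \<mu> k = 0" unfolding k_def by (rule LeastI) auto
  have kn: "k \<le> n" unfolding k_def by (rule Least_le) auto
  have nz: "\<mu> i \<noteq> 0" if "i < k" for i using not_less_Least[of i] that unfolding k_def by blast
  have z: "\<mu> i = 0" if "k \<le> i" "i < n" for i using k mono[OF that] that by auto
  define la where "la = map \<mu> [0..<k]"
  have p: "\<mu> i = part la i" if "i < n" for i
    using z that by (auto simp: part_def la_def)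
  have "sum_list la = (\<Sum>i<k. \<mu> i)"
    by (simp add: la_def interv_sum_list_conv_sum_set_nat atLeast0LessThan)
  also have "\<dots> = (\<Sum>i<n. \<mu> i)" by (rule sum.mono_neutral_left) (use kn z in auto)
  also have "\<dots> = d" using \<mu> by (simp add: wts_def)
  finally have "la \<in> partitions d"
    using nz mono kn by (force simp: partitions_def la_def sorted_wrt_iff_nth_less)
  then show ?thesis using p kn by (intro bexI[of _ la]) (auto simp: la_def)
qed

section \<open>Symmetric polynomials as combinations of Schur polynomials\<close>

abbreviation swp :: "nat \<Rightarrow> nat \<Rightarrow> nat" where "swp i \<equiv> Transposition.transpose i (Suc i)"

lemma swp_permutes: "Suc i < n \<Longrightarrow> swp i permutes {..<n}"
  by (rule permutes_swap_id) auto

lemma wts_swp: 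
  assumes "\<mu> \<in> wts n d" "Suc i < n" shows "\<mu> \<circ> swp i \<in> wts n d"
proof -
  have "(\<Sum>l<n. (\<mu> \<circ> swp i) l) = (\<Sum>l<n. \<mu> l)"
    using sum.permute[OF swp_permutes[OF assms(2)], of \<mu>] by simp
  moreover have "(\<mu> \<circ> swp i) l = undefined" if "\<not> l < n" for l
    using that assms by (auto simp: wts_def PiE_iff extensional_def transpose_def)
  ultimately show ?thesis using assms(1) by (auto simp: wts_def PiE_iff extensional_def)
qed

text \<open>Swapping an ascent moves the larger entry forward: only the partial sum of the first
  \<open>Suc i\<close> entries changes, and it grows.\<close>

lemma dom_rank_swp:
  assumes "Suc i < n" "\<mu> i < \<mu> (Suc i)"
  shows "dom_rank n \<mu> < dom_rank n (\<mu> \<circ> swp i)"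
  unfolding dom_rank_def
proof (rule sum_strict_mono_ex1)
  have lo: "(\<Sum>l<i. (\<mu> \<circ> swp i) l) = (\<Sum>l<i. \<mu> l)"
    by (rule sum.cong) (auto simp: transpose_def)
  show "\<forall>k\<in>{..n}. (\<Sum>l<k. \<mu> l) \<le> (\<Sum>l<k. (\<mu> \<circ> swp i) l)"
  proof
    fix k
    consider "k \<le> i" | "k = Suc i" | "Suc i < k" by linarith
    then show "(\<Sum>l<k. \<mu> l) \<le> (\<Sum>l<k. (\<mu> \<circ> swp i) l)"
    proof cases
      case 1
      then show ?thesis by (intro eq_refl sum.cong) (auto simp: transpose_def)
    next
      case 2
      then show ?thesis using lo assms(2) by simp
    next
      case 3
      then show ?thesis using sum.permute[OF swp_permutes[OF 3], of \<mu>] by simp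
    qed
  qed
  show "\<exists>k\<in>{..n}. (\<Sum>l<k. \<mu> l) < (\<Sum>l<k. (\<mu> \<circ> swp i) l)"
    using lo assms by (intro bexI[of _ "Suc i"]) auto
qed simp

text \<open>Permuting the variables permutes the monomials, so by their linear independence an
  invariance of the function is an invariance of its coefficients.\<close>

lemma symmetric_coefficients:
  fixes f :: "(nat \<Rightarrow> nat) \<Rightarrow> complex"
  assumes i: "Suc i < n"
    and F: "\<And>x. F x = (\<Sum>\<mu>\<in>wts n d. f \<mu> * (\<Prod>l<n. x l ^ \<mu> l))"
    and s: "\<And>x. (\<And>l. l < n \<Longrightarrow> x l \<noteq> 0) \<Longrightarrow> F (x \<circ> swp i) = F x"
    and \<mu>: "\<mu> \<in> wts n d"
  shows "f (\<mu> \<circ> swp i) = f \<mu>"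
proof -
  have "f (\<mu> \<circ> swp i) - f \<mu> = 0"
  proof (rule monomials_independent[where I = "{..<n}" and E = "wts n d" and k = "\<lambda>\<nu>. f (\<nu> \<circ> swp i) - f \<nu>"])
    fix x :: "nat \<Rightarrow> complex" assume x: "\<And>l. l \<in> {..<n} \<Longrightarrow> x l \<noteq> 0"
    have "F (x \<circ> swp i) = (\<Sum>\<nu>\<in>wts n d. f \<nu> * (\<Prod>l<n. x l ^ (\<nu> \<circ> swp i) l))"
      unfolding F
    proof (rule sum.cong)
      fix \<nu>
      have "(\<Prod>l<n. x l ^ (\<nu> \<circ> swp i) l) = (\<Prod>l<n. ((\<lambda>l. x l ^ (\<nu> \<circ> swp i) l) \<circ> swp i) l)"
        unfolding comp_def[of "\<lambda>l. x l ^ (\<nu> \<circ> swp i) l"]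
        using prod.permute[OF swp_permutes[OF i], of "\<lambda>l. x l ^ (\<nu> \<circ> swp i) l", unfolded comp_def[of "\<lambda>l. x l ^ (\<nu> \<circ> swp i) l"]] .
      also have "\<dots> = (\<Prod>l<n. (x \<circ> swp i) l ^ \<nu> l)" by (rule prod.cong) simp_all
      finally show "f \<nu> * (\<Prod>l<n. (x \<circ> swp i) l ^ \<nu> l) = f \<nu> * (\<Prod>l<n. x l ^ (\<nu> \<circ> swp i) l)"
        by (simp only:)
    qed simp
    also have "\<dots> = (\<Sum>\<nu>\<in>wts n d. f (\<nu> \<circ> swp i) * (\<Prod>l<n. x l ^ \<nu> l))"
      by (rule sum.reindex_bij_witness[of _ "\<lambda>\<nu>. \<nu> \<circ> swp i" "\<lambda>\<nu>. \<nu> \<circ> swp i"])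
        (use wts_swp[OF _ i] in \<open>auto simp: comp_assoc\<close>)
    finally have "F (x \<circ> swp i) = (\<Sum>\<nu>\<in>wts n d. f (\<nu> \<circ> swp i) * (\<Prod>l<n. x l ^ \<nu> l))" .
    moreover have "F (x \<circ> swp i) = F x" by (rule s) (use x in auto)
    ultimately show "(\<Sum>\<nu>\<in>wts n d. (f (\<nu> \<circ> swp i) - f \<nu>) * (\<Prod>l\<in>{..<n}. x l ^ \<nu> l)) = 0"
      unfolding left_diff_distrib sum_subtractf by (simp only: F[of x] diff_self)
  next
    fix \<mu> \<nu> assume "\<mu> \<in> wts n d" "\<nu> \<in> wts n d" "\<And>i. i \<in> {..<n} \<Longrightarrow> \<mu> i = \<nu> i"
    then show "\<mu> = \<nu>" by (auto simp: wts_def intro: PiE_ext)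
  qed (use \<mu> in auto)
  then show ?thesis by simp
qed

definition parts_le :: "nat \<Rightarrow> nat \<Rightarrow> nat list set" where
  "parts_le n d = {la \<in> partitions d. length la \<le> n}"

lemma finite_parts_le [simp]: "finite (parts_le n d)"
  by (simp add: parts_le_def)

text \<open>The Kostka numbers are unitriangular for dominance, and each weight is carried to a
  partition by swaps of ascents, which raise the rank. Induction on a bound for the rank of the
  support: the values of top rank are removed by subtracting multiples of the functions
  \<open>kostka n la\<close>.\<close>

lemma symmetric_span_kostka:
  fixes f :: "(nat \<Rightarrow> nat) \<Rightarrow> complex"
  assumes ks: "\<And>la i \<mu>. la \<in> parts_le n d \<Longrightarrow> Suc i < n \<Longrightarrow> \<mu> \<in> wts n d \<Longrightarrow>
      kostka n la (\<mu> \<circ> swp i) = kostka n la \<mu>"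
    and fs: "\<And>i \<mu>. Suc i < n \<Longrightarrow> \<mu> \<in> wts n d \<Longrightarrow> f (\<mu> \<circ> swp i) = f \<mu>"
  shows "\<exists>c. \<forall>\<mu>\<in>wts n d. f \<mu> = (\<Sum>la\<in>parts_le n d. c la * of_nat (kostka n la \<mu>))"
proof -
  have "\<exists>c. \<forall>\<mu>\<in>wts n d. f \<mu> = (\<Sum>la\<in>parts_le n d. c la * of_nat (kostka n la \<mu>))"
    if "\<And>i \<mu>. Suc i < n \<Longrightarrow> \<mu> \<in> wts n d \<Longrightarrow> f (\<mu> \<circ> swp i) = f \<mu>"
      "\<And>\<mu>. \<mu> \<in> wts n d \<Longrightarrow> f \<mu> \<noteq> 0 \<Longrightarrow> dom_rank n \<mu> < b" for f :: "_ \<Rightarrow> complex" and b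
    using that
  proof (induction b arbitrary: f)
    case 0
    then show ?case by (intro exI[of _ "\<lambda>_. 0"]) auto
  next
    case (Suc b)
    \<comment> \<open>The value of \<open>f\<close> at the weight \<open>la\<close>, taken only for
      partitions of the top rank \<open>b\<close>; lower ranks are left to the induction.\<close>
    define e where "e = (\<lambda>la. if dom_rank n (part la) = b then f (restrict (part la) {..<n}) else 0)"
    define f' where "f' = (\<lambda>\<mu>. f \<mu> - (\<Sum>la\<in>parts_le n d. e la * of_nat (kostka n la \<mu>)))"
    have "\<exists>c. \<forall>\<mu>\<in>wts n d. f' \<mu> = (\<Sum>la\<in>parts_le n d. c la * of_nat (kostka n la \<mu>))"
    proof (rule Suc.IH)
      fix i \<mu> assume "Suc i < n" "\<mu> \<in> wts n d"
      then show "f' (\<mu> \<circ> swp i) = f' \<mu>" unfolding f'_def by (simp add: Suc.prems(1) ks)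
    next
      fix \<mu> assume \<mu>: "\<mu> \<in> wts n d" and nz: "f' \<mu> \<noteq> 0"
      show "dom_rank n \<mu> < b"
      proof (rule ccontr)
        assume ge: "\<not> dom_rank n \<mu> < b"
        \<comment> \<open>In rank at least \<open>b\<close> only the partition equal to
          \<open>\<mu>\<close> can contribute: a nonzero Kostka number means that \<open>la\<close>
          dominates \<open>\<mu>\<close>, and as \<open>la\<close> has rank \<open>b\<close> this
          leaves only equality.\<close>
        have trm: "e la * of_nat (kostka n la \<mu>) = (if (\<forall>i<n. \<mu> i = part la i) then f \<mu> else 0)"
          if la: "la \<in> parts_le n d" for la
        proof (cases "\<forall>i<n. \<mu> i = part la i")
          case True
          then have k: "kostka n la \<mu> = 1" 
            using la by (intro kostka_self[of la d]) (auto simp: parts_le_def)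
          have r: "restrict (part la) {..<n} = \<mu>"
            using True \<mu> by (auto simp: fun_eq_iff wts_def PiE_iff extensional_def)
          have rk: "dom_rank n (part la) = dom_rank n \<mu>"
            unfolding dom_rank_def using True by (intro sum.cong) auto
          have "f \<mu> = 0" if "dom_rank n \<mu> \<noteq> b"
            using Suc.prems(2)[OF \<mu>] ge that by fastforce
          then show ?thesis using True k r rk by (auto simp: e_def)
        next
          case False
          have "kostka n la \<mu> = 0 \<or> e la = 0"
          proof (rule ccontr)
            assume *: "\<not> ?thesis"
            then have dm: "\<And>k. k \<le> n \<Longrightarrow> (\<Sum>i<k. \<mu> i) \<le> (\<Sum>i<k. part la i)"
              using kostka_nonzeroD[of n la \<mu> d] la by (auto simp: parts_le_def)
            have "dom_rank n (part la) = b" using * by (auto simp: e_def split: if_splits)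
            then have "dom_rank n \<mu> = dom_rank n (part la)"
              using dominated_rank_le[of n \<mu> "part la"] dm ge by fastforce
            then have "\<mu> i = part la i" if "i < n" for i
              using dominated_rank_eq[of n \<mu> "part la", OF dm _ that] by blast
            with False show False by blast
          qed
          then show ?thesis using False by auto
        qed
        have sum: "f' \<mu> = f \<mu> - (\<Sum>la\<in>parts_le n d. if (\<forall>i<n. \<mu> i = part la i) then f \<mu> else 0)"
          unfolding f'_def by (simp add: trm)
        show False
        proof (cases "\<exists>la\<in>parts_le n d. \<forall>i<n. \<mu> i = part la i")
          case True
          then obtain la where la: "la \<in> parts_le n d" "\<forall>i<n. \<mu> i = part la i" by blast
          have "(\<forall>i<n. \<mu> i = part lb i) \<longleftrightarrow> lb = la" if "lb \<in> parts_le n d" for lb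
          proof
            assume h: "\<forall>i<n. \<mu> i = part lb i"
            show "lb = la"
            proof (rule part_inj)
              show "part lb i = part la i" if "i < n" for i
                using h[rule_format, OF that] la(2)[rule_format, OF that] by simp
            qed (use la(1) \<open>lb \<in> parts_le n d\<close> in \<open>auto simp: parts_le_def\<close>)
          qed (use la(2) in blast)
          then have "f' \<mu> = f \<mu> - (\<Sum>lb\<in>parts_le n d. if lb = la then f \<mu> else 0)"
            unfolding sum by (intro arg_cong2[of _ _ _ _ minus] sum.cong) auto
          then show False using la(1) nz by simp
        next
          case False
          then have "f' \<mu> = f \<mu> - (\<Sum>la\<in>parts_le n d. 0)"
            unfolding sum by (intro arg_cong2[of _ _ _ _ minus] sum.cong) auto
          then have fnz: "f \<mu> \<noteq> 0" using nz by simp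
          \<comment> \<open>No partition matches \<open>\<mu>\<close>, so \<open>\<mu>\<close> has
            an ascent. Swapping it gives a weight of rank above \<open>b\<close> at which
            \<open>f\<close> is still nonzero, against the bound on the support.\<close>
          have "\<not> (\<forall>i. Suc i < n \<longrightarrow> \<mu> (Suc i) \<le> \<mu> i)"
            using partition_of_decreasing[OF \<mu>] False by (auto simp: parts_le_def)
          then obtain i where i: "Suc i < n" "\<mu> i < \<mu> (Suc i)" by force
          have "f (\<mu> \<circ> swp i) \<noteq> 0" using Suc.prems(1)[OF i(1) \<mu>] fnz by metis
          then have "dom_rank n (\<mu> \<circ> swp i) < Suc b" using Suc.prems(2) wts_swp[OF \<mu> i(1)] by blast
          then show False using dom_rank_swp[OF i] ge by linarith
        qed
      qed
    qed
    then obtain c where c: "\<forall>\<mu>\<in>wts n d. f' \<mu> = (\<Sum>la\<in>parts_le n d. c la * of_nat (kostka n la \<mu>))"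
      by blast
    have "f \<mu> = (\<Sum>la\<in>parts_le n d. (c la + e la) * of_nat (kostka n la \<mu>))" if "\<mu> \<in> wts n d" for \<mu>
      using c[rule_format, OF that] by (simp add: f'_def algebra_simps sum.distrib)
    then show ?case by (intro exI[of _ "\<lambda>la. c la + e la"] ballI)
  qed
  note * = this
  show ?thesis
  proof (rule *)
    fix \<mu> assume "\<mu> \<in> wts n d"
    then have "dom_rank n \<mu> \<le> (\<Sum>\<nu>\<in>wts n d. dom_rank n \<nu>)" by (intro member_le_sum) auto
    then show "dom_rank n \<mu> < Suc (\<Sum>\<nu>\<in>wts n d. dom_rank n \<nu>)" by simp
  qed (rule fs)
qed

lemma linear_power_coefficients:
  "\<exists>f. \<forall>x::nat \<Rightarrow> complex. (\<Sum>i<n. x i) ^ d = (\<Sum>\<mu>\<in>wts n d. f \<mu> * (\<Prod>i<n. x i ^ \<mu> i))"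
proof (induction d)
  case 0
  have "wts n 0 = {\<lambda>i\<in>{..<n}. 0}"
    by (auto simp: wts_def PiE_iff extensional_def fun_eq_iff)
  then show ?case by (intro exI[of _ "\<lambda>_. 1"]) simp
next
  case (Suc d)
  then obtain f where f: "\<And>x::nat \<Rightarrow> complex. (\<Sum>i<n. x i) ^ d = (\<Sum>\<mu>\<in>wts n d. f \<mu> * (\<Prod>i<n. x i ^ \<mu> i))"
    by blast
  \<comment> \<open>Multiplication of a monomial by one more variable. The new coefficient of a
    weight collects all ways to reach it, as in the recursion for multinomial coefficients.\<close>
  define u where "u = (\<lambda>(\<mu> :: nat \<Rightarrow> nat, i). \<mu>(i := Suc (\<mu> i)))"
  define f' where "f' = (\<lambda>\<nu>. \<Sum>p\<in>{p \<in> wts n d \<times> {..<n}. u p = \<nu>}. f (fst p))"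
  have mon: "(\<Prod>l<n. x l ^ u (\<mu>, i) l) = x i * (\<Prod>l<n. x l ^ \<mu> l)" if "i < n" for x :: "nat \<Rightarrow> complex" and \<mu> i
  proof -
    have "(\<Prod>l<n. x l ^ u (\<mu>, i) l) = (\<Prod>l<n. (if l = i then x i else 1) * x l ^ \<mu> l)"
      by (rule prod.cong) (auto simp: u_def)
    then show ?thesis using that by (simp add: prod.distrib)
  qed
  have "(\<Sum>i<n. x i) ^ Suc d = (\<Sum>\<nu>\<in>wts n (Suc d). f' \<nu> * (\<Prod>i<n. x i ^ \<nu> i))" for x :: "nat \<Rightarrow> complex"
  proof -
    have "(\<Sum>i<n. x i) ^ Suc d = (\<Sum>\<mu>\<in>wts n d. f \<mu> * (\<Prod>i<n. x i ^ \<mu> i)) * (\<Sum>i<n. x i)"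
      by (simp add: f)
    also have "\<dots> = (\<Sum>p\<in>wts n d \<times> {..<n}. f (fst p) * (\<Prod>l<n. x l ^ u p l))"
      unfolding sum_product sum.cartesian_product by (rule sum.cong) (auto simp: mon mult_ac)
    also have "\<dots> = (\<Sum>\<nu>\<in>wts n (Suc d). \<Sum>p\<in>{p \<in> wts n d \<times> {..<n}. u p = \<nu>}. f (fst p) * (\<Prod>l<n. x l ^ u p l))"
    proof (rule sum.group[symmetric])
      show "u ` (wts n d \<times> {..<n}) \<subseteq> wts n (Suc d)"
      proof safe
        fix \<mu> i assume \<mu>: "\<mu> \<in> wts n d" and i: "i < n"
        have "(\<Sum>l<n. u (\<mu>, i) l) = (\<Sum>l<n. (if l = i then 1 else 0) + \<mu> l)"
          by (rule sum.cong) (auto simp: u_def)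
        also have "\<dots> = Suc d" using \<mu> i by (simp add: sum.distrib wts_def)
        finally show "u (\<mu>, i) \<in> wts n (Suc d)"
          using \<mu> i by (auto simp: wts_def u_def PiE_iff extensional_def)
      qed
    qed auto
    also have "\<dots> = (\<Sum>\<nu>\<in>wts n (Suc d). f' \<nu> * (\<Prod>i<n. x i ^ \<nu> i))"
      unfolding f'_def sum_distrib_right by (intro sum.cong) auto
    finally show ?thesis .
  qed
  then show ?case by (intro exI[of _ f'] allI)
qed

text \<open>The symmetry of Schur polynomials is an assumption here; it is discharged in
  \<open>trace_power_characters\<close>, where they occur as characters. Longer partitions are left
  out, having no tableaux with \<open>n\<close> letters.\<close>

lemma linear_power_schur:
  assumes "\<And>la i x. la \<in> parts_le n d \<Longrightarrow> Suc i < n \<Longrightarrow> (\<And>l. l < n \<Longrightarrow> x l \<noteq> 0) \<Longrightarrow>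
      schur_poly n la (x \<circ> swp i) = schur_poly n la x"
  shows "\<exists>c. \<forall>x. (\<Sum>i<n. x i) ^ d = (\<Sum>la\<in>parts_le n d. c la * schur_poly n la x)"
proof -
  obtain f where f: "\<And>x::nat \<Rightarrow> complex. (\<Sum>i<n. x i) ^ d = (\<Sum>\<mu>\<in>wts n d. f \<mu> * (\<Prod>i<n. x i ^ \<mu> i))"
    using linear_power_coefficients by blast
  have "\<exists>c. \<forall>\<mu>\<in>wts n d. f \<mu> = (\<Sum>la\<in>parts_le n d. c la * of_nat (kostka n la \<mu>))"
  proof (rule symmetric_span_kostka)
    fix la i \<mu> assume *: "la \<in> parts_le n d" "Suc i < n" "\<mu> \<in> wts n d"
    have "complex_of_nat (kostka n la (\<mu> \<circ> swp i)) = of_nat (kostka n la \<mu>)"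
    proof (rule symmetric_coefficients[where F = "schur_poly n la" and f = "\<lambda>\<mu>. of_nat (kostka n la \<mu>)"])
      show "schur_poly n la x = (\<Sum>\<mu>\<in>wts n d. of_nat (kostka n la \<mu>) * (\<Prod>i<n. x i ^ \<mu> i))" for x
        using *(1) by (intro schur_poly_kostka) (simp add: parts_le_def)
      show "schur_poly n la (x \<circ> swp i) = schur_poly n la x" if "\<And>l. l < n \<Longrightarrow> x l \<noteq> 0" for x
        by (rule assms[OF *(1,2) that])
    qed (fact *)+
    then show "kostka n la (\<mu> \<circ> swp i) = kostka n la \<mu>" by simp
  next
    fix i \<mu> assume i: "Suc i < n" and \<mu>: "\<mu> \<in> wts n d"
    show "f (\<mu> \<circ> swp i) = f \<mu>"
    proof (rule symmetric_coefficients[OF i f _ \<mu>])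
      fix x :: "nat \<Rightarrow> complex"
      show "(\<Sum>l<n. (x \<circ> swp i) l) ^ d = (\<Sum>l<n. x l) ^ d"
        using sum.permute[OF swp_permutes[OF i], of x] by simp
    qed
  qed
  then obtain c where c: "\<forall>\<mu>\<in>wts n d. f \<mu> = (\<Sum>la\<in>parts_le n d. c la * of_nat (kostka n la \<mu>))" by blast
  have "(\<Sum>i<n. x i) ^ d = (\<Sum>la\<in>parts_le n d. c la * schur_poly n la x)" for x
  proof -
    have "(\<Sum>i<n. x i) ^ d = (\<Sum>\<mu>\<in>wts n d. \<Sum>la\<in>parts_le n d. c la * of_nat (kostka n la \<mu>) * (\<Prod>i<n. x i ^ \<mu> i))"
      unfolding f using c by (simp add: sum_distrib_right)
    also have "\<dots> = (\<Sum>la\<in>parts_le n d. c la * schur_poly n la x)"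
    proof (subst sum.swap, rule sum.cong)
      fix la assume "la \<in> parts_le n d"
      then have "schur_poly n la x = (\<Sum>\<mu>\<in>wts n d. of_nat (kostka n la \<mu>) * (\<Prod>i<n. x i ^ \<mu> i))"
        by (intro schur_poly_kostka) (simp add: parts_le_def)
      then show "(\<Sum>\<mu>\<in>wts n d. c la * of_nat (kostka n la \<mu>) * (\<Prod>i<n. x i ^ \<mu> i)) = c la * schur_poly n la x"
        by (simp add: sum_distrib_left mult.assoc)
    qed simp
    finally show ?thesis .
  qed
  then show ?thesis by (intro exI[of _ c] allI)
qed

text \<open>Equal polynomials have equal Kostka numbers, so each shape occurs as a content of the
  other one; two partitions that dominate each other agree. This is what separates the
  characters.\<close>

lemma schur_poly_inj:
  assumes la: "la \<in> parts_le n d" and lb: "lb \<in> parts_le n d"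
    and eq: "\<And>x. (\<And>i. i < n \<Longrightarrow> x i \<noteq> 0) \<Longrightarrow> schur_poly n la x = schur_poly n lb x"
  shows "la = lb"
proof -
  have k: "kostka n la \<mu> = kostka n lb \<mu>" if "\<mu> \<in> wts n d" for \<mu>
  proof -
    have "complex_of_nat (kostka n la \<mu>) - of_nat (kostka n lb \<mu>) = 0"
    proof (rule monomials_independent[where I = "{..<n}" and E = "wts n d"
          and k = "\<lambda>\<nu>. of_nat (kostka n la \<nu>) - of_nat (kostka n lb \<nu>)"])
      fix x :: "nat \<Rightarrow> complex" assume "\<And>l. l \<in> {..<n} \<Longrightarrow> x l \<noteq> 0"
      then show "(\<Sum>\<nu>\<in>wts n d. (of_nat (kostka n la \<nu>) - of_nat (kostka n lb \<nu>)) * (\<Prod>l\<in>{..<n}. x l ^ \<nu> l)) = 0"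
        using eq[of x] la lb by (simp add: algebra_simps sum_subtractf schur_poly_kostka[where d = d] parts_le_def)
    next
      fix \<mu> \<nu> assume "\<mu> \<in> wts n d" "\<nu> \<in> wts n d" "\<And>i. i \<in> {..<n} \<Longrightarrow> \<mu> i = \<nu> i"
      then show "\<mu> = \<nu>" by (auto simp: wts_def intro: PiE_ext)
    qed (use that in auto)
    then show ?thesis by simp
  qed
  have w: "restrict (part l) {..<n} \<in> wts n d" if "l \<in> parts_le n d" for l
  proof -
    have "(\<Sum>i<n. restrict (part l) {..<n} i) = (\<Sum>i<length l. l ! i)"
      using that by (intro sum.mono_neutral_cong_right) (auto simp: part_def parts_le_def)
    also have "\<dots> = d" using that by (simp add: parts_le_def partitions_def sum_list_sum_nth atLeast0LessThan)
    finally show ?thesis by (simp add: wts_def)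
  qed
  have le: "(\<Sum>i<k. part l i) \<le> (\<Sum>i<k. part l' i)"
    if "l \<in> parts_le n d" "l' \<in> parts_le n d" "k \<le> n"
      "\<And>\<mu>. \<mu> \<in> wts n d \<Longrightarrow> kostka n l \<mu> = kostka n l' \<mu>" for l l' k
  proof -
    have "kostka n l (restrict (part l) {..<n}) = 1"
      by (rule kostka_self[of l d]) (use that in \<open>auto simp: parts_le_def\<close>)
    then have "kostka n l' (restrict (part l) {..<n}) \<noteq> 0" using that(4)[OF w[OF that(1)]] by simp
    from kostka_nonzeroD[OF this _ that(3)] that(2)
    have "(\<Sum>i<k. restrict (part l) {..<n} i) \<le> (\<Sum>i<k. part l' i)" by (auto simp: parts_le_def)
    moreover have "(\<Sum>i<k. restrict (part l) {..<n} i) = (\<Sum>i<k. part l i)"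
      by (rule sum.cong) (use that(3) in auto)
    ultimately show ?thesis by simp
  qed
  have "part la i = part lb i" if "i < n" for i
  proof -
    have "(\<Sum>i<k. part la i) = (\<Sum>i<k. part lb i)" if "k \<le> n" for k
      using le[OF la lb that] le[OF lb la that] k by (simp add: order_antisym)
    from this[of i] this[of "Suc i"] that show ?thesis by simp
  qed
  then show ?thesis using la lb part_inj[of la d lb d n] by (auto simp: parts_le_def)
qed

text \<open>Setting the variables from \<open>m\<close> on to 0 removes the tableaux that use such a
  letter. This is the character identity behind the restriction of a representation to the corner of
  size \<open>m\<close>.\<close>

lemma schur_poly_restrict:
  assumes "m \<le> n" 
  shows "schur_poly n la (\<lambda>i. if i < m then x i else 0) = schur_poly m la x"
proof -
  have sub: "ssyt m la \<subseteq> ssyt n la" using assms by (fastforce simp: ssyt_def PiE_iff)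
  have "schur_poly n la (\<lambda>i. if i < m then x i else 0)
    = (\<Sum>T\<in>ssyt n la. \<Prod>i<n. (if i < m then x i else 0) ^ content la T i)"
    by (simp add: schur_poly_def content_def)
  also have "\<dots> = (\<Sum>T\<in>ssyt m la. \<Prod>i<m. x i ^ content la T i)"
  proof (rule sum.mono_neutral_cong_right)
    show "\<forall>T\<in>ssyt n la - ssyt m la. (\<Prod>i<n. (if i < m then x i else 0) ^ content la T i) = 0"
    proof
      fix T assume T: "T \<in> ssyt n la - ssyt m la"
      have "T \<in> ssyt m la" if "\<And>b. b \<in> diagram la \<Longrightarrow> T b < m"
      proof -
        have Tn: "T \<in> ssyt n la" using T by blast
        then have "T \<in> diagram la \<rightarrow>\<^sub>E {..<m}" using that unfolding ssyt_def PiE_iff by blast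
        with Tn show ?thesis unfolding ssyt_def by blast
      qed
      with T have "\<exists>b\<in>diagram la. m \<le> T b" by (meson DiffD2 not_less)
      then obtain b where b: "b \<in> diagram la" "m \<le> T b" by blast
      have "T b < n" using ssyt_entries[of T n la b] T b by auto
      \<comment> \<open>The exponent has to be positive, as \<open>0 ^ 0\<close> is 1; it is,
        because the letter \<open>T b\<close> does occur.\<close>
      moreover have "content la T (T b) \<noteq> 0"
      proof -
        have "b \<in> {b' \<in> diagram la. T b' = T b}" using b(1) by simp
        then have ne: "{b' \<in> diagram la. T b' = T b} \<noteq> {}" by blast
        have fin: "finite {b' \<in> diagram la. T b' = T b}" by simp
        show ?thesis unfolding content_def card_0_eq[OF fin] by (rule ne)
      qed
      ultimately show "(\<Prod>i<n. (if i < m then x i else 0) ^ content la T i) = 0"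
        using b(2) by (intro prod_zero bexI[of _ "T b"]) (auto simp: zero_power)
    qed
    fix T assume T: "T \<in> ssyt m la"
    have "content la T i = 0" if "i \<ge> m" for i
      using ssyt_entries[OF T] that by (fastforce simp: content_def)
    then show "(\<Prod>i<n. (if i < m then x i else 0) ^ content la T i) = (\<Prod>i<m. x i ^ content la T i)"
      using assms by (intro prod.mono_neutral_cong_right) auto
  qed (use sub in auto)
  finally show ?thesis by (simp add: schur_poly_def content_def)
qed

lemma schur_poly_empty: "la \<in> partitions d \<Longrightarrow> n < length la \<Longrightarrow> schur_poly n la x = 0"
  by (simp add: schur_poly_def ssyt_empty)

lemma schur_poly_scale:
  assumes "la \<in> partitions d"
  shows "schur_poly n la (\<lambda>i. t * x i) = t ^ d * schur_poly n la x"
proof -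
  have "(\<Prod>i<n. (t * x i) ^ content la T i) = t ^ d * (\<Prod>i<n. x i ^ content la T i)"
    if "T \<in> ssyt n la" for T
    using sum_content[OF that assms] by (simp add: power_mult_distrib prod.distrib power_sum[symmetric])
  then show ?thesis by (simp add: schur_poly_def content_def[symmetric] sum_distrib_left)
qed

lemma schur_poly_curve: "\<exists>q. \<forall>t. schur_poly n la (\<lambda>i. x i + t) = poly q t"
  by (intro exI[of _ "\<Sum>T\<in>ssyt n la. \<Prod>i<n. [:x i, 1:] ^ content la T i"])
    (simp add: schur_poly_def content_def poly_sum poly_prod)

section \<open>Class functions and Schur's lemma\<close>

lemma mat_mult_entry:
  assumes "A \<in> carrier_mat a b" "B \<in> carrier_mat b c" "i < a" "j < c"
  shows "(A * B) $$ (i, j) = (\<Sum>k<b. A $$ (i, k) * B $$ (k, j))"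
  using assms by (auto simp: scalar_prod_def atLeast0LessThan intro!: sum.cong)

lemma mat_vec_entry:
  assumes "A \<in> carrier_mat a b" "v \<in> carrier_vec b" "i < a"
  shows "(A *\<^sub>v v) $ i = (\<Sum>k<b. A $$ (i, k) * v $ k)"
  using assms by (auto simp: scalar_prod_def atLeast0LessThan intro!: sum.cong)

lemma mat_trace_eq: "A \<in> carrier_mat a b \<Longrightarrow> mat_trace A = (\<Sum>i<a. A $$ (i, i))"
  by (simp add: mat_trace_def)

lemma mat_trace_mult:
  assumes "A \<in> carrier_mat a b" "B \<in> carrier_mat b a"
  shows "mat_trace (A * B) = (\<Sum>i<a. \<Sum>j<b. A $$ (i, j) * B $$ (j, i))"
proof -
  have "A * B \<in> carrier_mat a a" using assms by simp
  then show ?thesis using assms by (simp only: mat_trace_eq) (intro sum.cong refl mat_mult_entry, auto)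
qed

lemma mat_trace_comm:
  assumes "A \<in> carrier_mat a b" "B \<in> carrier_mat b a"
  shows "mat_trace (A * B) = mat_trace (B * A)"
  unfolding mat_trace_mult[OF assms] mat_trace_mult[OF assms(2,1)]
  by (subst sum.swap) (simp add: mult.commute)

lemma mat_trace_one: "mat_trace (1\<^sub>m n) = of_nat n"
  by (simp add: mat_trace_def)

lemma mat_trace_transpose: "A \<in> carrier_mat a a \<Longrightarrow> mat_trace A\<^sup>T = mat_trace A"
  by (auto simp: mat_trace_def)

text \<open>Polynomiality is tested along curves with polynomial entries. In this form it passes
  through sums, products and composition with maps of matrices without any choice of
  coefficients.\<close>

definition curve_poly :: "nat \<Rightarrow> (complex mat \<Rightarrow> complex) \<Rightarrow> bool" where
  "curve_poly n p \<longleftrightarrow> (\<forall>A. (\<forall>t. A t \<in> carrier_mat n n) \<longrightarrow>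
     (\<forall>i<n. \<forall>j<n. \<exists>q. \<forall>t. A t $$ (i, j) = poly q t) \<longrightarrow> (\<exists>q. \<forall>t. p (A t) = poly q t))"

lemma poly_curve_sum:
  fixes f :: "'i \<Rightarrow> complex \<Rightarrow> complex"
  assumes "\<And>i. i \<in> I \<Longrightarrow> \<exists>q. \<forall>t. f i t = poly q t"
  shows "\<exists>q. \<forall>t. (\<Sum>i\<in>I. f i t) = poly q t"
proof -
  obtain q where "\<And>i t. i \<in> I \<Longrightarrow> f i t = poly (q i) t" using assms by metis
  then show ?thesis by (intro exI[of _ "\<Sum>i\<in>I. q i"]) (simp add: poly_sum)
qed

lemma poly_curve_mult:
  fixes f g :: "complex \<Rightarrow> complex"
  assumes "\<exists>q. \<forall>t. f t = poly q t" "\<exists>q. \<forall>t. g t = poly q t"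
  shows "\<exists>q. \<forall>t. f t * g t = poly q t"
proof -
  obtain p q where "\<forall>t. f t = poly p t" "\<forall>t. g t = poly q t" using assms by blast
  then show ?thesis by (intro exI[of _ "p * q"]) simp
qed

lemma poly_curve_diff:
  fixes f g :: "complex \<Rightarrow> complex"
  assumes "\<exists>q. \<forall>t. f t = poly q t" "\<exists>q. \<forall>t. g t = poly q t"
  shows "\<exists>q. \<forall>t. f t - g t = poly q t"
proof -
  obtain p q where "\<forall>t. f t = poly p t" "\<forall>t. g t = poly q t" using assms by blast
  then show ?thesis by (intro exI[of _ "p - q"]) simp
qed

lemma poly_curve_const: "\<exists>q. \<forall>t. (c::complex) = poly q t"
  by (rule exI[of _ "[:c:]"]) simp

lemma forms_curve_poly:
  assumes "f \<in> forms d n n" shows "curve_poly n f"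
  unfolding curve_poly_def
proof (intro allI impI)
  fix A :: "complex \<Rightarrow> complex mat" assume A: "\<forall>t. A t \<in> carrier_mat n n" "\<forall>i<n. \<forall>j<n. \<exists>q. \<forall>t. A t $$ (i, j) = poly q t"
  obtain c where c: "\<forall>X\<in>carrier_mat n n. f X = (\<Sum>ps\<in>words d n n. c ps * word_mon ps X)"
    using assms unfolding forms_def by blast
  have "\<exists>q. \<forall>t. word_mon ps (A t) = poly q t" if "set ps \<subseteq> {..<n} \<times> {..<n}" for ps
    using that
  proof (induction ps)
    case Nil
    show ?case using poly_curve_const[of 1] by (simp add: word_mon_def)
  next
    case (Cons p ps)
    then show ?case unfolding word_mon_def list.map prod_list.Cons
      by (intro poly_curve_mult) (use A(2) in \<open>auto simp: word_mon_def\<close>)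
  qed
  then have "\<exists>q. \<forall>t. (\<Sum>ps\<in>words d n n. c ps * word_mon ps (A t)) = poly q t"
    by (intro poly_curve_sum poly_curve_mult poly_curve_const) (auto simp: words_def)
  then show "\<exists>q. \<forall>t. f (A t) = poly q t" using c A(1) by simp
qed

lemma curve_poly_cong:
  assumes "curve_poly n p" "\<And>X. X \<in> carrier_mat n n \<Longrightarrow> p' X = p X"
  shows "curve_poly n p'"
  using assms by (simp add: curve_poly_def)

lemma curve_poly_diff: "curve_poly n p \<Longrightarrow> curve_poly n q \<Longrightarrow> curve_poly n (\<lambda>X. p X - q X)"
  unfolding curve_poly_def by (intro allI impI poly_curve_diff) blast+

lemma curve_poly_mult: "curve_poly n p \<Longrightarrow> curve_poly n q \<Longrightarrow> curve_poly n (\<lambda>X. p X * q X)"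
  unfolding curve_poly_def by (intro allI impI poly_curve_mult) blast+

lemma curve_poly_const: "curve_poly n (\<lambda>X. c)"
  unfolding curve_poly_def by (intro allI impI poly_curve_const)

lemma curve_poly_sum: "(\<And>i. i \<in> I \<Longrightarrow> curve_poly n (p i)) \<Longrightarrow> curve_poly n (\<lambda>X. \<Sum>i\<in>I. p i X)"
  unfolding curve_poly_def by (intro allI impI poly_curve_sum) blast

lemma curve_poly_entry: "i < n \<Longrightarrow> j < n \<Longrightarrow> curve_poly n (\<lambda>X. X $$ (i, j))"
  unfolding curve_poly_def by blast

lemma curve_poly_power: "curve_poly n p \<Longrightarrow> curve_poly n (\<lambda>X. p X ^ k)"
  by (induction k) (auto intro: curve_poly_const curve_poly_mult)

lemma curve_poly_comp:
  assumes "curve_poly m p" "\<And>X. X \<in> carrier_mat n n \<Longrightarrow> T X \<in> carrier_mat m m"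
    and "\<And>i j. i < m \<Longrightarrow> j < m \<Longrightarrow> curve_poly n (\<lambda>X. T X $$ (i, j))"
  shows "curve_poly n (\<lambda>X. p (T X))"
  unfolding curve_poly_def
proof (intro allI impI)
  fix A :: "complex \<Rightarrow> complex mat" assume A: "\<forall>t. A t \<in> carrier_mat n n" "\<forall>i<n. \<forall>j<n. \<exists>q. \<forall>t. A t $$ (i, j) = poly q t"
  have "\<forall>t. T (A t) \<in> carrier_mat m m" using A(1) assms(2) by blast
  moreover have "\<forall>i<m. \<forall>j<m. \<exists>q. \<forall>t. T (A t) $$ (i, j) = poly q t"
    using assms(3) A unfolding curve_poly_def by blast
  ultimately show "\<exists>q. \<forall>t. p (T (A t)) = poly q t"
    using assms(1)[unfolded curve_poly_def, rule_format, of "\<lambda>t. T (A t)"] by blast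
qed

text \<open>Conjugating an upper triangular matrix by \<open>diag(1, t, t\<^sup>2, \<dots>)\<close> and letting \<open>t\<close> tend to 0
  kills everything above the diagonal.\<close>

lemma class_function_zero:
  assumes p: "curve_poly n p"
    and conj: "\<And>X P Q. X \<in> carrier_mat n n \<Longrightarrow> P \<in> carrier_mat n n \<Longrightarrow> Q \<in> carrier_mat n n \<Longrightarrow>
      P * Q = 1\<^sub>m n \<Longrightarrow> Q * P = 1\<^sub>m n \<Longrightarrow> p (P * X * Q) = p X"
    and diag: "\<And>x. p (mat_diag n x) = 0" and X: "X \<in> carrier_mat n n"
  shows "p X = 0"
proof -
  obtain as where "char_poly X = (\<Prod>a\<leftarrow>as. [:- a, 1:])" using char_poly_factorized[OF X] by blast
  then obtain B where B: "B \<in> carrier_mat n n" "upper_triangular B" "similar_mat X B"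
    using schur_decomposition_exists[OF X] by blast
  then obtain P Q where PQ: "similar_mat_wit X B P Q" unfolding similar_mat_def by blast
  have pX: "p X = p B" using similar_mat_witD2[OF X PQ] conj[OF B(1)] by metis
  \<comment> \<open>The conjugation multiplies the entry \<open>(i, j)\<close> by
    \<open>t ^ (j - i)\<close>. Triangularity excludes negative exponents, so the curve is also
    defined at \<open>t = 0\<close>, where it is the diagonal part of \<open>B\<close>.\<close>
  define A where "A = (\<lambda>t. mat n n (\<lambda>(i, j). if i \<le> j then B $$ (i, j) * t ^ (j - i) else 0))"
  have "\<exists>q. \<forall>t. p (A t) = poly q t"
  proof (rule p[unfolded curve_poly_def, rule_format])
    show "A t \<in> carrier_mat n n" for t by (simp add: A_def)
    fix i j assume "i < n" "j < n"
    then show "\<exists>q. \<forall>t. A t $$ (i, j) = poly q t"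
      by (intro exI[of _ "if i \<le> j then monom (B $$ (i, j)) (j - i) else 0"]) (simp add: A_def poly_monom)
  qed
  then obtain q where q: "\<And>t. p (A t) = poly q t" by blast
  have "q - [:p B:] = 0"
  proof (rule poly_eq_0_if_cofinite[of "{0}"])
    fix t :: complex assume t: "t \<notin> {0}"
    define D E where "D = mat_diag n (\<lambda>i. t ^ i)" and "E = mat_diag n (\<lambda>i. inverse t ^ i)"
    have c: "D \<in> carrier_mat n n" "E \<in> carrier_mat n n" by (simp_all add: D_def E_def)
    have tt: "t ^ i * inverse t ^ i = 1" "inverse t ^ i * t ^ i = 1" for i
      using t by (simp_all add: power_mult_distrib[symmetric])
    have DE: "D * E = 1\<^sub>m n" "E * D = 1\<^sub>m n"
      by (simp_all only: D_def E_def mat_diag_diag tt mat_diag_one)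
    have BD: "E * B \<in> carrier_mat n n" using c B by simp
    have "E * B * D = A t"
    proof (rule eq_matI)
      fix i j assume ij: "i < dim_row (A t)" "j < dim_col (A t)"
      then have ij: "i < n" "j < n" by (auto simp: A_def)
      have e: "(E * B * D) $$ (i, j) = inverse t ^ i * B $$ (i, j) * t ^ j"
        unfolding D_def mat_diag_mult_right[OF BD] using ij
        by (simp add: E_def mat_diag_mult_left[OF B(1)])
      show "(E * B * D) $$ (i, j) = A t $$ (i, j)"
      proof (cases "i \<le> j")
        case True
        then have "t ^ j = t ^ i * t ^ (j - i)" by (simp add: power_add[symmetric])
        then have "inverse t ^ i * B $$ (i, j) * t ^ j = (inverse t ^ i * t ^ i) * (B $$ (i, j) * t ^ (j - i))"
          by (simp only: mult_ac)
        then show ?thesis unfolding e tt using True ij by (simp add: A_def)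
      next
        case False
        then have "B $$ (i, j) = 0" using B(1,2) ij by (auto simp: upper_triangular_def)
        then show ?thesis unfolding e using ij False by (simp add: A_def)
      qed
    qed (use c B in \<open>auto simp: A_def\<close>)
    then show "poly (q - [:p B:]) t = 0"
      using conj[OF B(1) c(2,1) DE(2,1)] q[of t] by simp
  qed simp
  then have "p (A 0) = p B" using q[of 0] by simp
  moreover have "A 0 = mat_diag n (\<lambda>i. B $$ (i, i))"
    by (rule eq_matI) (auto simp: A_def mat_diag_def)
  ultimately show ?thesis using pX diag by simp
qed

section \<open>Schur's lemma\<close>

lemma mult_mat_zero_vec: "A \<in> carrier_mat a b \<Longrightarrow> A *\<^sub>v 0\<^sub>v b = 0\<^sub>v a"
  by (intro eq_vecI) auto

lemma smult_one_mult_vec: "v \<in> carrier_vec N \<Longrightarrow> ((c::complex) \<cdot>\<^sub>m 1\<^sub>m N) *\<^sub>v v = c \<cdot>\<^sub>v v"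
proof (rule eq_vecI)
  fix i assume v: "v \<in> carrier_vec N" and "i < dim_vec (c \<cdot>\<^sub>v v)"
  then have i: "i < N" by simp
  have "((c \<cdot>\<^sub>m 1\<^sub>m N) *\<^sub>v v) $ i = (\<Sum>k<N. (c \<cdot>\<^sub>m 1\<^sub>m N) $$ (i, k) * v $ k)"
    by (rule mat_vec_entry) (use v i in auto)
  also have "\<dots> = (\<Sum>k<N. if k = i then c * v $ i else 0)"
    by (rule sum.cong) (use i in auto)
  finally show "((c \<cdot>\<^sub>m 1\<^sub>m N) *\<^sub>v v) $ i = (c \<cdot>\<^sub>v v) $ i" using i v by simp
qed simp

lemma mat_unit_vec_entry: 
  "M \<in> carrier_mat a b \<Longrightarrow> i < a \<Longrightarrow> j < b \<Longrightarrow> (M *\<^sub>v unit_vec b j) $ i = (M :: complex mat) $$ (i, j)"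
  by (subst mat_vec_entry[of M a b]) (auto simp: if_distrib[of "\<lambda>x. _ * x"] cong: if_cong)

definition irr :: "nat \<Rightarrow> nat \<Rightarrow> (complex mat \<Rightarrow> complex mat) \<Rightarrow> bool" where
  "irr n N R \<longleftrightarrow> R \<in> hom (GL n) (GL N) \<and> irreducible_rep (GL n) (cspace N) (\<lambda>A v. R A *\<^sub>v v)"

lemma hom_GL:
  assumes "R \<in> hom (GL n) (GL N)"
  shows "A \<in> carrier (GL n) \<Longrightarrow> R A \<in> carrier_mat N N"
    and "A \<in> carrier (GL n) \<Longrightarrow> B \<in> carrier (GL n) \<Longrightarrow> R (A * B) = R A * R B"
    and "R (1\<^sub>m n) = 1\<^sub>m N"
proof -
  show "A \<in> carrier (GL n) \<Longrightarrow> R A \<in> carrier_mat N N"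
    using assms by (auto simp: hom_def Pi_iff GL_carrierD)
  show "A \<in> carrier (GL n) \<Longrightarrow> B \<in> carrier (GL n) \<Longrightarrow> R (A * B) = R A * R B"
    using assms by (auto simp: hom_def)
  have "R \<one>\<^bsub>GL n\<^esub> = \<one>\<^bsub>GL N\<^esub>"
    by (rule hom_one[OF assms group_GL group_GL])
  then show "R (1\<^sub>m n) = 1\<^sub>m N" by simp
qed

lemma irr_stable:
  assumes irr: "irr n N R" and U: "U \<subseteq> carrier_vec N" "0\<^sub>v N \<in> U"
    and add: "\<And>u v. u \<in> U \<Longrightarrow> v \<in> U \<Longrightarrow> u + v \<in> U"
    and smult: "\<And>c u. u \<in> U \<Longrightarrow> c \<cdot>\<^sub>v u \<in> U"
    and stable: "\<And>A u. A \<in> carrier (GL n) \<Longrightarrow> u \<in> U \<Longrightarrow> R A *\<^sub>v u \<in> U"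
  shows "U = {0\<^sub>v N} \<or> U = carrier_vec N"
proof -
  have vs: "vectorspace class_ring (cspace N)"
    using irr by (simp add: irr_def irreducible_rep_def representation_def)
  have "VectorSpace.subspace class_ring U (cspace N)"
    unfolding VectorSpace.subspace_def LinearCombinations.submodule_def
    using vs U add smult vectorspace.axioms(1)[OF vs] by (auto simp: module_vec_simps)
  moreover have "\<forall>A\<in>carrier (GL n). (\<lambda>v. R A *\<^sub>v v) ` U \<subseteq> U" using stable by blast
  ultimately have "U = {\<zero>\<^bsub>cspace N\<^esub>} \<or> U = carrier (cspace N)"
    using irr unfolding irr_def irreducible_rep_def by blast
  then show ?thesis by (simp add: module_vec_simps)
qed

lemma irr_pos: assumes "irr n N R" shows "N > 0"
proof (rule ccontr)
  assume "\<not> N > 0"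
  then have "carrier (cspace N) = {\<zero>\<^bsub>cspace N\<^esub>}" by (auto simp: module_vec_simps intro: eq_vecI)
  moreover have "carrier (cspace N) \<noteq> {\<zero>\<^bsub>cspace N\<^esub>}"
    using assms unfolding irr_def irreducible_rep_def by (elim conjE)
  ultimately show False by (rule notE[rotated])
qed

text \<open>Kernel and image of a nonzero intertwiner are stable, hence trivial and everything.
  Injectivity is kept in the conclusion because \<open>intertwiner_scalar\<close> applies it to an
  eigenvector.\<close>

lemma intertwiner_inverse:
  assumes R: "irr n N R" and R': "irr n N' R'" and T: "T \<in> carrier_mat N' N"
    and comm: "\<And>A. A \<in> carrier (GL n) \<Longrightarrow> R' A * T = T * R A"
    and nz: "T \<noteq> 0\<^sub>m N' N"
  shows "(\<forall>v\<in>carrier_vec N. T *\<^sub>v v = 0\<^sub>v N' \<longrightarrow> v = 0\<^sub>v N) \<and>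
    (\<exists>T'\<in>carrier_mat N N'. T' * T = 1\<^sub>m N \<and> T * T' = 1\<^sub>m N')"
proof -
  note h = hom_GL[of R n N] hom_GL[of R' n N']
  have hR: "R \<in> hom (GL n) (GL N)" and hR': "R' \<in> hom (GL n) (GL N')" using R R' by (auto simp: irr_def)
  have "\<exists>i<N'. \<exists>j<N. T $$ (i, j) \<noteq> 0" using nz T by (auto intro: eq_matI)
  then obtain i j where ij: "i < N'" "j < N" "T $$ (i, j) \<noteq> 0" by blast
  have Tj: "T *\<^sub>v unit_vec N j \<noteq> 0\<^sub>v N'"
  proof
    assume "T *\<^sub>v unit_vec N j = 0\<^sub>v N'"
    then have "(T *\<^sub>v unit_vec N j) $ i = 0" using ij by simp
    then show False using ij T by simp
  qed
  have TR: "T *\<^sub>v (R A *\<^sub>v v) = R' A *\<^sub>v (T *\<^sub>v v)" if "A \<in> carrier (GL n)" "v \<in> carrier_vec N" for A v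
    using comm[OF that(1)] T that hom_GL(1)[OF hR that(1)] hom_GL(1)[OF hR' that(1)]
    by (metis assoc_mult_mat_vec)
  have "{v \<in> carrier_vec N. T *\<^sub>v v = 0\<^sub>v N'} = {0\<^sub>v N} \<or> {v \<in> carrier_vec N. T *\<^sub>v v = 0\<^sub>v N'} = carrier_vec N"
  proof (rule irr_stable[OF R])
    fix A u assume "A \<in> carrier (GL n)" "u \<in> {v \<in> carrier_vec N. T *\<^sub>v v = 0\<^sub>v N'}"
    then show "R A *\<^sub>v u \<in> {v \<in> carrier_vec N. T *\<^sub>v v = 0\<^sub>v N'}"
      using TR[of A u] hom_GL(1)[OF hR] mult_mat_zero_vec[OF hom_GL(1)[OF hR']]
      by (auto intro!: mult_mat_vec_carrier)
  qed (use T in \<open>auto simp: mult_add_distrib_mat_vec mult_mat_vec\<close>)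
  then have inj: "v = 0\<^sub>v N" if "v \<in> carrier_vec N" "T *\<^sub>v v = 0\<^sub>v N'" for v
    using Tj that unit_vec_carrier[of N j] by blast
  have "(*\<^sub>v) T ` carrier_vec N = {0\<^sub>v N'} \<or> (*\<^sub>v) T ` carrier_vec N = carrier_vec N'"
  proof (rule irr_stable[OF R'])
    show "0\<^sub>v N' \<in> (*\<^sub>v) T ` carrier_vec N" using T by (intro image_eqI[of _ _ "0\<^sub>v N"]) auto
    fix A u assume "A \<in> carrier (GL n)" "u \<in> (*\<^sub>v) T ` carrier_vec N"
    then show "R' A *\<^sub>v u \<in> (*\<^sub>v) T ` carrier_vec N"
      using TR[of A] hom_GL(1)[OF hR] by (auto intro!: image_eqI[of _ _ "R A *\<^sub>v _"] mult_mat_vec_carrier)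
  next
    fix u v assume "u \<in> (*\<^sub>v) T ` carrier_vec N" "v \<in> (*\<^sub>v) T ` carrier_vec N"
    then obtain a b where "a \<in> carrier_vec N" "b \<in> carrier_vec N" "u = T *\<^sub>v a" "v = T *\<^sub>v b" by blast
    then show "u + v \<in> (*\<^sub>v) T ` carrier_vec N"
      using T by (intro image_eqI[of _ _ "a + b"]) (auto simp: mult_add_distrib_mat_vec)
  next
    fix c u assume "u \<in> (*\<^sub>v) T ` carrier_vec N"
    then obtain a where "a \<in> carrier_vec N" "u = T *\<^sub>v a" by blast
    then show "c \<cdot>\<^sub>v u \<in> (*\<^sub>v) T ` carrier_vec N"
      using T by (intro image_eqI[of _ _ "c \<cdot>\<^sub>v a"]) (auto simp: mult_mat_vec)
  qed (use T in auto)
  then have surj: "(*\<^sub>v) T ` carrier_vec N = carrier_vec N'"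
    using Tj unit_vec_carrier[of N j] by (metis imageI singletonD)
  have "\<exists>w\<in>carrier_vec N. T *\<^sub>v w = unit_vec N' k" if "k < N'" for k
    using surj unit_vec_carrier[of N' k] by (metis imageE)
  then obtain w where w: "\<And>k. k < N' \<Longrightarrow> w k \<in> carrier_vec N" "\<And>k. k < N' \<Longrightarrow> T *\<^sub>v w k = unit_vec N' k"
    by metis
  \<comment> \<open>The columns are preimages of the unit vectors. This gives a right inverse, which
    injectivity makes a left inverse.\<close>
  define T' where "T' = mat N N' (\<lambda>(i, k). w k $ i)"
  have T': "T' \<in> carrier_mat N N'" by (simp add: T'_def)
  have TT': "T * T' = 1\<^sub>m N'"
  proof (rule eq_matI)
    fix a b assume ab: "a < dim_row (1\<^sub>m N' :: complex mat)" "b < dim_col (1\<^sub>m N' :: complex mat)"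
    have "(T * T') $$ (a, b) = (T *\<^sub>v w b) $ a"
      unfolding mat_vec_entry[OF T w(1)[of b], of a, simplified ab, simplified] 
      using ab mat_mult_entry[OF T T', of a b] mat_vec_entry[OF T w(1)[of b], of a] by (simp add: T'_def)
    then show "(T * T') $$ (a, b) = 1\<^sub>m N' $$ (a, b)" using w(2)[of b] ab by auto
  qed (use T T' in auto)
  have T'T: "T' * T = 1\<^sub>m N"
  proof (rule eq_matI)
    fix a b assume ab: "a < dim_row (1\<^sub>m N :: complex mat)" "b < dim_col (1\<^sub>m N :: complex mat)"
    have c: "T' *\<^sub>v (T *\<^sub>v unit_vec N b) \<in> carrier_vec N" using T T' by simp
    have "T *\<^sub>v (T' *\<^sub>v (T *\<^sub>v unit_vec N b)) = (T * T') *\<^sub>v (T *\<^sub>v unit_vec N b)"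
      using T T' by (intro assoc_mult_mat_vec[symmetric]) auto
    also have "\<dots> = T *\<^sub>v unit_vec N b" unfolding TT' using T by simp
    finally have "T *\<^sub>v (T' *\<^sub>v (T *\<^sub>v unit_vec N b) - unit_vec N b) = 0\<^sub>v N'"
      using c T by (simp add: mult_minus_distrib_mat_vec)
    then have z: "T' *\<^sub>v (T *\<^sub>v unit_vec N b) - unit_vec N b = 0\<^sub>v N" using c by (intro inj) auto
    have "(T' * T) $$ (a, b) = ((T' * T) *\<^sub>v unit_vec N b) $ a"
      by (rule mat_unit_vec_entry[symmetric, of _ N]) (use ab T T' in auto)
    also have "\<dots> = (T' *\<^sub>v (T *\<^sub>v unit_vec N b)) $ a"
      using T T' by (subst assoc_mult_mat_vec[of T' N N' T N]) auto
    also have "\<dots> = unit_vec N b $ a"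
      using arg_cong[OF z, of "\<lambda>v. v $ a"] ab T' by simp
    finally show "(T' * T) $$ (a, b) = 1\<^sub>m N $$ (a, b)" using ab by auto
  qed (use T T' in auto)
  show ?thesis using inj T' TT' T'T by blast
qed

text \<open>Used contrapositively: irreducible representations whose traces differ somewhere admit
  only the zero intertwiner.\<close>

lemma intertwiner_trace:
  assumes R: "irr n N R" and R': "irr n N' R'" and T: "T \<in> carrier_mat N' N"
    and comm: "\<And>A. A \<in> carrier (GL n) \<Longrightarrow> R' A * T = T * R A"
    and nz: "T \<noteq> 0\<^sub>m N' N" and A: "A \<in> carrier (GL n)"
  shows "mat_trace (R' A) = mat_trace (R A)"
proof -
  obtain T' where T': "T' \<in> carrier_mat N N'" "T' * T = 1\<^sub>m N" "T * T' = 1\<^sub>m N'"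
    using intertwiner_inverse[OF R R' T comm nz] by blast
  have hR: "R A \<in> carrier_mat N N" "R' A \<in> carrier_mat N' N'" using R R' A hom_GL(1) by (auto simp: irr_def)
  have "mat_trace (R' A) = mat_trace (R' A * (T * T'))" using T' hR by simp
  also have "\<dots> = mat_trace (R' A * T * T')" using T T' hR by (metis assoc_mult_mat)
  also have "\<dots> = mat_trace (T * R A * T')" using comm[OF A] by simp
  also have "\<dots> = mat_trace (T' * (T * R A))" using T T' hR by (intro mat_trace_comm) auto
  also have "\<dots> = mat_trace (T' * T * R A)" using T T' hR by (metis assoc_mult_mat)
  finally show ?thesis using T' hR by simp
qed

text \<open>Over the complex numbers \<open>T\<close> has an eigenvalue \<open>c\<close>; the
  intertwiner \<open>T - c \<cdot>\<^sub>m 1\<^sub>m N\<close> is not injective, hence zero.\<close>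

lemma intertwiner_scalar:
  assumes R: "irr n N R" and T: "T \<in> carrier_mat N N"
    and comm: "\<And>A. A \<in> carrier (GL n) \<Longrightarrow> R A * T = T * R A"
  shows "\<exists>c. T = c \<cdot>\<^sub>m 1\<^sub>m N"
proof -
  obtain c where "eigenvalue T c" using spectrum_non_empty[OF T irr_pos[OF R]] by (auto simp: spectrum_def)
  then obtain v where v: "v \<in> carrier_vec N" "v \<noteq> 0\<^sub>v N" "T *\<^sub>v v = c \<cdot>\<^sub>v v"
    using T by (auto simp: eigenvalue_def eigenvector_def)
  define T' where "T' = T - c \<cdot>\<^sub>m 1\<^sub>m N"
  have T': "T' \<in> carrier_mat N N" using T by (simp add: T'_def minus_carrier_mat)
  have "T' *\<^sub>v v = 0\<^sub>v N"
    using T v smult_one_mult_vec[of v N c] by (simp add: T'_def minus_mult_distrib_mat_vec)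
  moreover have "R A * T' = T' * R A" if "A \<in> carrier (GL n)" for A
  proof -
    have rA: "R A \<in> carrier_mat N N" using R that hom_GL(1) by (auto simp: irr_def)
    show ?thesis unfolding T'_def using T rA comm[OF that]
      by (simp add: mult_minus_distrib_mat[OF rA T] minus_mult_distrib_mat[OF T _ rA]
          mult_smult_distrib[OF rA one_carrier_mat] mult_smult_assoc_mat[OF one_carrier_mat rA])
  qed
  ultimately have "T' = 0\<^sub>m N N" using intertwiner_inverse[OF R R T', THEN conjunct1] v(1,2) by metis
  then have "T $$ (i, j) = (c \<cdot>\<^sub>m 1\<^sub>m N) $$ (i, j)" if "i < N" "j < N" for i j
  proof -
    have "T' $$ (i, j) = 0" using \<open>T' = 0\<^sub>m N N\<close> that by (simp only: index_zero_mat)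
    then show ?thesis unfolding T'_def using that T by simp
  qed
  then show ?thesis using T by (intro exI[of _ c] eq_matI) auto
qed

section \<open>Matrix coefficients\<close>

text \<open>A pair \<open>(l, i)\<close> names row \<open>i\<close> of \<open>R l\<close>, and
  \<open>v\<close> holds the coefficients of a relation between the rows in \<open>P\<close>. Rows
  are removed one at a time: the coefficient vectors that the row \<open>p0\<close> can have in a
  relation form a stable subspace \<open>U\<close>. If \<open>U\<close> is zero the induction
  applies. If it is everything, the row \<open>p0\<close> depends on the other rows through
  intertwiners, and Schur's lemma makes these zero or scalar, which is absurd at the
  identity.\<close>

lemma coefficient_rows_independent:
  fixes N :: "'l \<Rightarrow> nat" and R :: "'l \<Rightarrow> complex mat \<Rightarrow> complex mat" and v :: "'l \<times> nat \<Rightarrow> nat \<Rightarrow> complex"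
  assumes irr: "\<And>l. l \<in> L \<Longrightarrow> irr n (N l) (R l)"
    and distinct: "\<And>l l'. l \<in> L \<Longrightarrow> l' \<in> L \<Longrightarrow> l \<noteq> l' \<Longrightarrow>
      \<exists>A\<in>carrier (GL n). mat_trace (R l A) \<noteq> mat_trace (R l' A)"
    and "finite P" "P \<subseteq> Sigma L (\<lambda>l. {..<N l})"
    and "\<And>A. A \<in> carrier (GL n) \<Longrightarrow>
      (\<Sum>p\<in>P. \<Sum>j<N (fst p). R (fst p) A $$ (snd p, j) * v p j) = 0"
    and "p \<in> P" "j < N (fst p)"
  shows "v p j = 0"
  using assms(3-)
proof (induction P arbitrary: v p j)
  case (insert p0 P)
  obtain l0 i0 where p0: "p0 = (l0, i0)" by force
  define N0 where "N0 = N l0"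
  have l0: "l0 \<in> L" "i0 < N0" using insert.prems(1) by (auto simp: p0 N0_def)
  have PL: "fst p \<in> L" "snd p < N (fst p)" if "p \<in> P" for p
    using insert.prems(1) that by auto
  have R0: "irr n N0 (R l0)" using irr[OF l0(1)] by (simp add: N0_def)
  have hom: "R l \<in> hom (GL n) (GL (N l))" if "l \<in> L" for l using irr[OF that] by (simp add: irr_def)
  define Q where "Q = (\<lambda>A (w :: 'l \<times> nat \<Rightarrow> nat \<Rightarrow> complex).
    \<Sum>p\<in>P. \<Sum>j<N (fst p). R (fst p) A $$ (snd p, j) * w p j)"
  \<comment> \<open>\<open>u\<close> holds the coefficients on the row \<open>p0\<close> and
    \<open>w\<close> those on the remaining rows. Replacing \<open>A\<close> by \<open>A * B\<close>
    turns one relation into another, with \<open>R l0 B\<close> applied to \<open>u\<close>; hence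
    \<open>U\<close> is stable.\<close>
  define rel where "rel = (\<lambda>(u :: complex vec) w. \<forall>A\<in>carrier (GL n).
    (\<Sum>j<N0. R l0 A $$ (i0, j) * u $ j) + Q A w = 0)"
  have Rmul: "R l (A * B) $$ (i, j) = (\<Sum>k<N l. R l A $$ (i, k) * R l B $$ (k, j))"
    if "l \<in> L" "A \<in> carrier (GL n)" "B \<in> carrier (GL n)" "i < N l" "j < N l" for l A B i j
    unfolding hom_GL(2)[OF hom[OF that(1)] that(2,3)]
    by (rule mat_mult_entry[OF hom_GL(1) hom_GL(1)]) (use hom that in auto)
  have Qadd: "Q A (\<lambda>p j. w p j + w' p j) = Q A w + Q A w'" for A w w'
    by (simp add: Q_def algebra_simps sum.distrib)
  have Qscale: "Q A (\<lambda>p j. c * w p j) = c * Q A w" for A c w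
    by (simp add: Q_def algebra_simps sum_distrib_left)
  have Qsum: "Q A (\<lambda>p j. \<Sum>k\<in>K. c k * w k p j) = (\<Sum>k\<in>K. c k * Q A (w k))" for A K c w
  proof (induction K rule: infinite_finite_induct)
    case (insert k K)
    then show ?case using Qadd[of A "\<lambda>p j. c k * w k p j"] Qscale[of A "c k" "w k"] by simp
  qed (simp_all add: Q_def)
  have Qshift: "Q A (\<lambda>p j. \<Sum>l<N (fst p). R (fst p) B $$ (j, l) * w p l) = Q (A * B) w"
    if "A \<in> carrier (GL n)" "B \<in> carrier (GL n)" for A B w
    unfolding Q_def
  proof (rule sum.cong)
    fix p assume p: "p \<in> P"
    have "(\<Sum>j<N (fst p). R (fst p) A $$ (snd p, j) * (\<Sum>l<N (fst p). R (fst p) B $$ (j, l) * w p l))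
      = (\<Sum>l<N (fst p). (\<Sum>j<N (fst p). R (fst p) A $$ (snd p, j) * R (fst p) B $$ (j, l)) * w p l)"
      unfolding sum_distrib_left sum_distrib_right by (subst sum.swap) (simp add: mult.assoc)
    also have "\<dots> = (\<Sum>l<N (fst p). R (fst p) (A * B) $$ (snd p, l) * w p l)"
      using Rmul[OF PL(1)[OF p] that PL(2)[OF p]] by simp
    finally show "(\<Sum>j<N (fst p). R (fst p) A $$ (snd p, j) * (\<Sum>l<N (fst p). R (fst p) B $$ (j, l) * w p l))
      = (\<Sum>l<N (fst p). R (fst p) (A * B) $$ (snd p, l) * w p l)" .
  qed simp
  have IH: "w p j = 0" if "\<And>A. A \<in> carrier (GL n) \<Longrightarrow> Q A w = 0" "p \<in> P" "j < N (fst p)" for w p j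
    by (rule insert.IH[of w p j]) (use that insert.prems(1) in \<open>auto simp: Q_def\<close>)
  have split: "(\<Sum>j<N0. R l0 A $$ (i0, j) * v p0 j) + Q A v = 0" if "A \<in> carrier (GL n)" for A
    using insert.prems(2)[OF that] insert.hyps by (simp add: Q_def p0 N0_def)
  define U where "U = {u \<in> carrier_vec N0. \<exists>w. rel u w}"
  have "U = {0\<^sub>v N0} \<or> U = carrier_vec N0"
  proof (rule irr_stable[OF R0])
    have "rel (0\<^sub>v N0) (\<lambda>_ _. 0)" by (simp add: rel_def Q_def)
    then show "0\<^sub>v N0 \<in> U" by (auto simp: U_def)
    fix u assume "u \<in> U"
    then obtain w where u: "u \<in> carrier_vec N0" "rel u w" by (auto simp: U_def)
    show "c \<cdot>\<^sub>v u \<in> U" for c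
    proof -
      have "rel (c \<cdot>\<^sub>v u) (\<lambda>p j. c * w p j)" unfolding rel_def
      proof
        fix A assume A: "A \<in> carrier (GL n)"
        have "(\<Sum>j<N0. R l0 A $$ (i0, j) * (c \<cdot>\<^sub>v u) $ j) = c * (\<Sum>j<N0. R l0 A $$ (i0, j) * u $ j)"
          unfolding sum_distrib_left using u(1) by (intro sum.cong) auto
        then show "(\<Sum>j<N0. R l0 A $$ (i0, j) * (c \<cdot>\<^sub>v u) $ j) + Q A (\<lambda>p j. c * w p j) = 0"
          using u(2) A unfolding Qscale rel_def by (simp add: distrib_left[symmetric])
      qed
      then show ?thesis using u(1) unfolding U_def by auto
    qed
    show "u + u' \<in> U" if u'U: "u' \<in> U" for u'
    proof -
      obtain w' where u': "u' \<in> carrier_vec N0" "rel u' w'" using u'U by (auto simp: U_def)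
      have sum0: "a + b + (q + q') = 0" if "a + q = 0" "b + q' = 0" for a b q q' :: complex
        using that by (simp add: add_eq_0_iff2)
      have "rel (u + u') (\<lambda>p j. w p j + w' p j)" unfolding rel_def
      proof
        fix A assume A: "A \<in> carrier (GL n)"
        have "(\<Sum>j<N0. R l0 A $$ (i0, j) * (u + u') $ j)
          = (\<Sum>j<N0. R l0 A $$ (i0, j) * u $ j) + (\<Sum>j<N0. R l0 A $$ (i0, j) * u' $ j)"
          unfolding sum.distrib[symmetric] using u(1) u'(1) by (intro sum.cong) (auto simp: algebra_simps)
        then show "(\<Sum>j<N0. R l0 A $$ (i0, j) * (u + u') $ j) + Q A (\<lambda>p j. w p j + w' p j) = 0"
          using sum0[OF bspec[OF u(2)[unfolded rel_def] A] bspec[OF u'(2)[unfolded rel_def] A]] unfolding Qadd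
          by (simp only:)
      qed
      then show ?thesis using u(1) u'(1) unfolding U_def by auto
    qed
    fix B assume B: "B \<in> carrier (GL n)"
    have RB: "R l0 B \<in> carrier_mat N0 N0" using hom_GL(1)[OF hom[OF l0(1)] B] by (simp add: N0_def)
    have "rel (R l0 B *\<^sub>v u) (\<lambda>p j. \<Sum>l<N (fst p). R (fst p) B $$ (j, l) * w p l)" unfolding rel_def
    proof
      fix A assume A: "A \<in> carrier (GL n)"
      have "(\<Sum>j<N0. R l0 A $$ (i0, j) * (R l0 B *\<^sub>v u) $ j)
        = (\<Sum>j<N0. R l0 A $$ (i0, j) * (\<Sum>l<N0. R l0 B $$ (j, l) * u $ l))"
        by (intro sum.cong refl arg_cong2[of _ _ _ _ "(*)"] mat_vec_entry[OF RB u(1)]) simp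
      also have "\<dots> = (\<Sum>l<N0. (\<Sum>j<N0. R l0 A $$ (i0, j) * R l0 B $$ (j, l)) * u $ l)"
        unfolding sum_distrib_left sum_distrib_right by (subst sum.swap) (simp add: mult.assoc)
      also have "\<dots> = (\<Sum>l<N0. R l0 (A * B) $$ (i0, l) * u $ l)"
        using Rmul[OF l0(1) A B, folded N0_def, OF l0(2)] by simp
      finally show "(\<Sum>j<N0. R l0 A $$ (i0, j) * (R l0 B *\<^sub>v u) $ j)
         + Q A (\<lambda>p j. \<Sum>l<N (fst p). R (fst p) B $$ (j, l) * w p l) = 0"
        using bspec[OF u(2)[unfolded rel_def] GL_mult_closed[OF A B]] unfolding Qshift[OF A B] by simp
    qed
    then show "R l0 B *\<^sub>v u \<in> U" using RB u(1) unfolding U_def by auto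
  qed (auto simp: U_def)
  then show ?case
  proof
    assume U0: "U = {0\<^sub>v N0}"
    have "rel (vec N0 (v p0)) v" unfolding rel_def using split by simp
    then have "vec N0 (v p0) \<in> U" unfolding U_def by auto
    then have v0: "v p0 j = 0" if "j < N0" for j
    proof -
      have "vec N0 (v p0) = 0\<^sub>v N0" using \<open>vec N0 (v p0) \<in> U\<close> U0 by simp
      from arg_cong[OF this, of "\<lambda>u. u $ j", unfolded index_vec[OF that]] that show ?thesis by simp
    qed
    then have "Q A v = 0" if "A \<in> carrier (GL n)" for A using split[OF that] by simp
    then show "v p j = 0" using IH[of v p j] v0 insert.prems(3,4) by (cases "p = p0") (auto simp: p0 N0_def)
  next
    assume U1: "U = carrier_vec N0"
    have "\<exists>w. rel (unit_vec N0 k) w" for k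
      using U1 unit_vec_carrier[of N0 k] unfolding U_def by blast
    then obtain w where w: "\<And>k. rel (unit_vec N0 k) (w k)" by metis
    have wrel: "R l0 A $$ (i0, k) + Q A (w k) = 0" if "A \<in> carrier (GL n)" "k < N0" for A k
    proof -
      have "(\<Sum>j<N0. R l0 A $$ (i0, j) * unit_vec N0 k $ j) = (\<Sum>j<N0. if j = k then R l0 A $$ (i0, k) else 0)"
        by (rule sum.cong) (use that in auto)
      then show ?thesis using bspec[OF w[of k, unfolded rel_def] that(1)] that(2) by simp
    qed
    \<comment> \<open>By induction the coefficients of the remaining rows are determined by those of
      the row \<open>p0\<close>. This makes \<open>T p\<close>, with columns \<open>w k p\<close>,
      an intertwiner from \<open>R l0\<close> to \<open>R (fst p)\<close>.\<close>
    define T where "T = (\<lambda>p. mat (N (fst p)) N0 (\<lambda>(j, k). w k p j))"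
    have comm: "R (fst p) B * T p = T p * R l0 B" if p: "p \<in> P" and B: "B \<in> carrier (GL n)" for p B
    proof (rule eq_matI)
      have RB: "R l0 B \<in> carrier_mat N0 N0" using hom_GL(1)[OF hom[OF l0(1)] B] by (simp add: N0_def)
      have RpB: "R (fst p) B \<in> carrier_mat (N (fst p)) (N (fst p))" by (rule hom_GL(1)[OF hom[OF PL(1)[OF p]] B])
      have Tp: "T p \<in> carrier_mat (N (fst p)) N0" by (simp add: T_def)
      fix j k assume "j < dim_row (T p * R l0 B)" "k < dim_col (T p * R l0 B)"
      then have jk: "j < N (fst p)" "k < N0" using RB Tp by auto
      define z where "z = (\<lambda>p j. (\<Sum>l<N (fst p). R (fst p) B $$ (j, l) * w k p l)
         + (\<Sum>l<N0. (- R l0 B $$ (l, k)) * w l p j))"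
      have "Q A z = 0" if A: "A \<in> carrier (GL n)" for A
      proof -
        have "Q A z = Q (A * B) (w k) + (\<Sum>l<N0. (- R l0 B $$ (l, k)) * Q A (w l))"
          unfolding z_def Qadd Qshift[OF A B] Qsum ..
        also have "Q (A * B) (w k) = - (\<Sum>l<N0. R l0 A $$ (i0, l) * R l0 B $$ (l, k))"
          using wrel[OF GL_mult_closed[OF A B] jk(2)] Rmul[OF l0(1) A B, folded N0_def, OF l0(2) jk(2)]
          by (simp add: add_eq_0_iff2)
        also have "(\<Sum>l<N0. (- R l0 B $$ (l, k)) * Q A (w l)) = (\<Sum>l<N0. R l0 A $$ (i0, l) * R l0 B $$ (l, k))"
        proof (rule sum.cong)
          fix l assume "l \<in> {..<N0}"
          then have "Q A (w l) = - R l0 A $$ (i0, l)" using wrel[OF A, of l] by (simp add: eq_neg_iff_add_eq_0 add.commute)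
          then show "- R l0 B $$ (l, k) * Q A (w l) = R l0 A $$ (i0, l) * R l0 B $$ (l, k)" by simp
        qed simp
        finally show ?thesis by simp
      qed
      then have "z p j = 0" by (rule IH[OF _ p jk(1)])
      then have "(\<Sum>l<N (fst p). R (fst p) B $$ (j, l) * w k p l) = (\<Sum>l<N0. w l p j * R l0 B $$ (l, k))"
        unfolding z_def by (simp add: sum_negf mult.commute)
      then show "(R (fst p) B * T p) $$ (j, k) = (T p * R l0 B) $$ (j, k)"
        unfolding mat_mult_entry[OF RpB Tp jk] mat_mult_entry[OF Tp RB jk]
        using jk by (simp add: T_def)
    qed (use hom_GL(1)[OF hom[OF l0(1)] B] hom_GL(1)[OF hom[OF PL(1)[OF p]] B] in \<open>auto simp: T_def N0_def\<close>)
    \<comment> \<open>At the identity the relation for \<open>k = i0\<close> involves only the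
      entries \<open>(snd p, i0)\<close> of the \<open>T p\<close>. They vanish: \<open>T p\<close>
      is zero for a different representation, and for \<open>l0\<close> itself it is scalar while
      \<open>snd p \<noteq> i0\<close>. What remains is 1 = 0.\<close>
    have w0: "w i0 p (snd p) = 0" if p: "p \<in> P" for p
    proof (cases "fst p = l0")
      case True
      have "\<exists>c. T p = c \<cdot>\<^sub>m 1\<^sub>m N0"
        by (rule intertwiner_scalar[OF R0]) (use comm[OF p] True in \<open>auto simp: T_def N0_def\<close>)
      then obtain c where c: "T p = c \<cdot>\<^sub>m 1\<^sub>m N0" by blast
      have "snd p \<noteq> i0" using p insert.hyps True p0 by (metis prod.collapse)
      then have "(c \<cdot>\<^sub>m 1\<^sub>m N0) $$ (snd p, i0) = 0" using PL(2)[OF p] True l0 by (simp add: N0_def)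
      then show ?thesis using PL(2)[OF p] l0(2) unfolding c[symmetric] by (simp add: T_def)
    next
      case False
      then obtain A where A: "A \<in> carrier (GL n)" "mat_trace (R (fst p) A) \<noteq> mat_trace (R l0 A)"
        using distinct[OF PL(1)[OF p] l0(1)] by blast
      have "T p = 0\<^sub>m (N (fst p)) N0"
        using intertwiner_trace[OF R0 irr[OF PL(1)[OF p]], of "T p" A] comm[OF p] A
        by (auto simp: T_def)
      then have "T p $$ (snd p, i0) = 0" using PL(2)[OF p] l0(2) by simp
      then show ?thesis using PL(2)[OF p] l0(2) by (simp add: T_def)
    qed
    have "Q (1\<^sub>m n) (w i0) = 0" unfolding Q_def
    proof (rule sum.neutral, rule)
      fix p assume p: "p \<in> P"
      have "(\<Sum>j<N (fst p). R (fst p) (1\<^sub>m n) $$ (snd p, j) * w i0 p j)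
        = (\<Sum>j<N (fst p). if j = snd p then w i0 p (snd p) else 0)"
        unfolding hom_GL(3)[OF hom[OF PL(1)[OF p]]] using PL(2)[OF p] by (intro sum.cong) auto
      then show "(\<Sum>j<N (fst p). R (fst p) (1\<^sub>m n) $$ (snd p, j) * w i0 p j) = 0"
        using w0[OF p] by simp
    qed
    moreover have "R l0 (1\<^sub>m n) $$ (i0, i0) = 1"
      unfolding hom_GL(3)[OF hom[OF l0(1)]] using l0(2) by (simp add: N0_def)
    ultimately have False using wrel[OF GL_one_closed l0(2)] by simp
    then show "v p j = 0" ..
  qed
qed simp

lemma coefficients_independent:
  fixes N :: "'l \<Rightarrow> nat" and R :: "'l \<Rightarrow> complex mat \<Rightarrow> complex mat"
  assumes "\<And>l. l \<in> L \<Longrightarrow> irr n (N l) (R l)"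
    and "\<And>l l'. l \<in> L \<Longrightarrow> l' \<in> L \<Longrightarrow> l \<noteq> l' \<Longrightarrow>
      \<exists>A\<in>carrier (GL n). mat_trace (R l A) \<noteq> mat_trace (R l' A)"
    and fin: "finite L"
    and rel: "\<And>A. A \<in> carrier (GL n) \<Longrightarrow>
      (\<Sum>l\<in>L. \<Sum>i<N l. \<Sum>j<N l. b l i j * R l A $$ (i, j)) = 0"
    and lij: "l \<in> L" "i < N l" "j < N l"
  shows "b l i j = 0"
proof -
  have "(\<lambda>(l, i). b l i) (l, i) j = 0"
  proof (rule coefficient_rows_independent[where P = "Sigma L (\<lambda>l. {..<N l})", OF assms(1,2)])
    fix A assume "A \<in> carrier (GL n)"
    from rel[OF this]
    show "(\<Sum>p\<in>Sigma L (\<lambda>l. {..<N l}). \<Sum>j<N (fst p). R (fst p) A $$ (snd p, j) * (\<lambda>(l, i). b l i) p j) = 0"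
      using fin by (subst (asm) sum.Sigma) (auto simp: split_def mult.commute)
  qed (use fin lij in auto)
  then show ?thesis by simp
qed

section \<open>Extension to the monoid of all matrices\<close>

definition mrep :: "nat \<Rightarrow> nat \<Rightarrow> nat \<Rightarrow> (complex mat \<Rightarrow> complex mat) \<Rightarrow> bool" where
  "mrep d n N r \<longleftrightarrow> (\<forall>X\<in>carrier_mat n n. r X \<in> carrier_mat N N) \<and>
     (\<forall>X\<in>carrier_mat n n. \<forall>Y\<in>carrier_mat n n. r (X * Y) = r X * r Y) \<and>
     r (1\<^sub>m n) = 1\<^sub>m N \<and> (\<forall>i<N. \<forall>j<N. (\<lambda>X. r X $$ (i, j)) \<in> forms d n n)"

lemma mrepD:
  assumes "mrep d n N r"
  shows "X \<in> carrier_mat n n \<Longrightarrow> r X \<in> carrier_mat N N"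
    and "X \<in> carrier_mat n n \<Longrightarrow> Y \<in> carrier_mat n n \<Longrightarrow> r (X * Y) = r X * r Y"
    and "r (1\<^sub>m n) = 1\<^sub>m N"
    and "i < N \<Longrightarrow> j < N \<Longrightarrow> (\<lambda>X. r X $$ (i, j)) \<in> forms d n n"
  using assms by (auto simp: mrep_def)

lemma shift_curve:
  assumes "A \<in> carrier_mat n n" "i < n" "j < n"
  shows "\<exists>q. \<forall>t. (A + t \<cdot>\<^sub>m 1\<^sub>m n) $$ (i, j) = poly q t"
  by (intro exI[of _ "[:A $$ (i, j), if i = j then 1 else 0:]"]) (use assms in simp)

text \<open>Scalar matrices are central, so Schur's lemma makes
  \<open>R (t \<cdot>\<^sub>m 1\<^sub>m n)\<close> a scalar \<open>c\<close>. Its trace is the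
  character with all variables equal to \<open>t\<close>, which is \<open>t ^ d\<close> times the
  dimension; hence \<open>c = t ^ d\<close>.\<close>

lemma irr_homogeneous:
  assumes R: "irr n N R" and la: "la \<in> partitions d"
    and ch: "\<And>x. (\<And>i. i < n \<Longrightarrow> x i \<noteq> 0) \<Longrightarrow> rep_character n R x = schur_poly n la x"
    and t: "t \<noteq> 0" and A: "A \<in> carrier (GL n)"
  shows "R (t \<cdot>\<^sub>m A) = t ^ d \<cdot>\<^sub>m R A"
proof -
  have hR: "R \<in> hom (GL n) (GL N)" using R by (simp add: irr_def)
  have tG: "t \<cdot>\<^sub>m 1\<^sub>m n \<in> carrier (GL n)" 
    by (rule GL_if_det) (use t in \<open>simp_all add: det_smult\<close>)
  have "R B * R (t \<cdot>\<^sub>m 1\<^sub>m n) = R (t \<cdot>\<^sub>m 1\<^sub>m n) * R B" if B: "B \<in> carrier (GL n)" for B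
    using hom_GL(2)[OF hR B tG] hom_GL(2)[OF hR tG B] GL_carrierD[OF B]
    by (simp add: mult_smult_distrib[OF _ one_carrier_mat] mult_smult_assoc_mat[OF one_carrier_mat])
  then obtain c where c: "R (t \<cdot>\<^sub>m 1\<^sub>m n) = c \<cdot>\<^sub>m 1\<^sub>m N"
    using intertwiner_scalar[OF R hom_GL(1)[OF hR tG]] by blast
  have dg: "mat_diag n (\<lambda>_. s) = s \<cdot>\<^sub>m 1\<^sub>m n" for s :: complex by (rule eq_matI) (auto simp: mat_diag_def)
  have one: "1 \<cdot>\<^sub>m 1\<^sub>m n = (1\<^sub>m n :: complex mat)" by (rule eq_matI) auto
  have "c * of_nat N = rep_character n R (\<lambda>_. t)" by (simp add: rep_character_def dg c mat_trace_def)
  also have "\<dots> = t ^ d * schur_poly n la (\<lambda>_. 1)"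
    using ch[of "\<lambda>_. t"] t schur_poly_scale[OF la, of n t "\<lambda>_. 1"] by simp
  also have "schur_poly n la (\<lambda>_. 1) = rep_character n R (\<lambda>_. 1)" using ch[of "\<lambda>_. 1"] by simp
  also have "\<dots> = of_nat N" by (simp add: rep_character_def dg one hom_GL(3)[OF hR] mat_trace_one)
  finally have "c = t ^ d" using irr_pos[OF R] by simp
  moreover have "R (t \<cdot>\<^sub>m A) = R (t \<cdot>\<^sub>m 1\<^sub>m n) * R A"
    using hom_GL(2)[OF hR tG A] GL_carrierD[OF A] by (simp add: mult_smult_assoc_mat[OF one_carrier_mat])
  ultimately show ?thesis
    using hom_GL(1)[OF hR A] by (simp add: c mult_smult_assoc_mat[OF one_carrier_mat])
qed

text \<open>By homogeneity the entries of \<open>R\<close> are given by forms, which make sense at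
  singular matrices too. Multiplicativity and the character formula then extend from the group along
  shifts by scalars.\<close>

lemma schur_rep_extend:
  assumes sr: "schur_rep n la N R" and la: "la \<in> partitions d"
  shows "\<exists>r. mrep d n N r \<and> (\<forall>A\<in>carrier (GL n). r A = R A) \<and>
    (\<forall>x. mat_trace (r (mat_diag n x)) = schur_poly n la x)"
proof (cases "length la \<le> n")
  case False
  \<comment> \<open>With more than \<open>n\<close> parts both sides of the character formula
    vanish: an empty matrix has trace 0, and there are no tableaux.\<close>
  then have N: "N = 0" and hR: "R \<in> hom (GL n) (GL 0)" using sr by (auto simp: schur_rep_def polynomial_rep_def)
  define r :: "complex mat \<Rightarrow> complex mat" where "r = (\<lambda>_. 1\<^sub>m 0)"
  have "mrep d n N r" by (auto simp: mrep_def r_def N)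
  moreover have "r A = R A" if "A \<in> carrier (GL n)" for A
    using hom_GL(1)[OF hR that] by (auto simp: r_def intro: eq_matI)
  moreover have "mat_trace (r (mat_diag n x)) = schur_poly n la x" for x
    using False schur_poly_empty[OF la] by (simp add: r_def mat_trace_def)
  ultimately show ?thesis by blast
next
  case True
  have R: "irr n N R"
    and ch: "\<And>x. (\<And>i. i < n \<Longrightarrow> x i \<noteq> 0) \<Longrightarrow> rep_character n R x = schur_poly n la x"
    using sr True by (auto simp: schur_rep_def polynomial_rep_def irr_def)
  have hR: "R \<in> hom (GL n) (GL N)" using R by (simp add: irr_def)
  have "\<exists>f\<in>forms d n n. \<forall>A\<in>carrier (GL n). R A $$ (i, j) = f A" if ij: "i < N" "j < N" for i j
  proof -
    obtain p where p: "p \<in> poly_functions n" "\<And>A. A \<in> carrier (GL n) \<Longrightarrow> R A $$ (i, j) = p A"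
      using sr ij unfolding schur_rep_def polynomial_rep_def by meson
    have "\<exists>f\<in>forms d n n. \<forall>A\<in>carrier (GL n). p A = f A"
    proof (rule poly_functions_homogeneous[OF p(1)])
      fix A and t :: complex assume A: "A \<in> carrier (GL n)" and t: "t \<noteq> 0"
      have "t \<cdot>\<^sub>m A \<in> carrier (GL n)"
      proof -
        have "t \<cdot>\<^sub>m 1\<^sub>m n \<in> carrier (GL n)" by (rule GL_if_det) (use t in \<open>simp_all add: det_smult\<close>)
        from GL_mult_closed[OF this A] show ?thesis
          using GL_carrierD[OF A] by (simp add: mult_smult_assoc_mat[OF one_carrier_mat])
      qed
      then show "p (t \<cdot>\<^sub>m A) = t ^ d * p A"
        using irr_homogeneous[OF R la ch t A] p(2)[of "t \<cdot>\<^sub>m A"] p(2)[OF A] hom_GL(1)[OF hR A] ij by simp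
    qed
    then show ?thesis using p(2) by auto
  qed
  then obtain f where f: "\<And>i j. i < N \<Longrightarrow> j < N \<Longrightarrow> f i j \<in> forms d n n"
    "\<And>i j A. i < N \<Longrightarrow> j < N \<Longrightarrow> A \<in> carrier (GL n) \<Longrightarrow> R A $$ (i, j) = f i j A" by metis
  define r where "r = (\<lambda>X. mat N N (\<lambda>(i, j). f i j X))"
  have rc: "r X \<in> carrier_mat N N" for X by (simp add: r_def)
  have rR: "r A = R A" if "A \<in> carrier (GL n)" for A
    by (rule eq_matI) (use f(2)[OF _ _ that] hom_GL(1)[OF hR that] in \<open>auto simp: r_def\<close>)
  have cp: "\<exists>q. \<forall>t. f i j (A t) = poly q t"
    if "i < N" "j < N" "\<And>t. A t \<in> carrier_mat n n"
      "\<And>i j. i < n \<Longrightarrow> j < n \<Longrightarrow> \<exists>q. \<forall>t. A t $$ (i, j) = poly q t" for i j A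
    using forms_curve_poly[OF f(1)[OF that(1,2)]] that(3,4) unfolding curve_poly_def by blast
  have mult: "r (X * Y) = r X * r Y" if X: "X \<in> carrier_mat n n" and Y: "Y \<in> carrier_mat n n" for X Y
  proof (rule eq_matI)
    fix i j assume "i < dim_row (r X * r Y)" "j < dim_col (r X * r Y)"
    then have ij: "i < N" "j < N" by (auto simp: r_def)
    \<comment> \<open>Both arguments are shifted by the same \<open>t\<close>; only finitely many
      \<open>t\<close> make one of them singular.\<close>
    define X' Y' where "X' = (\<lambda>t. X + t \<cdot>\<^sub>m 1\<^sub>m n)" and "Y' = (\<lambda>t. Y + t \<cdot>\<^sub>m 1\<^sub>m n)"
    have c: "X' t \<in> carrier_mat n n" "Y' t \<in> carrier_mat n n" for t using X Y by (auto simp: X'_def Y'_def)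
    have cX: "\<exists>q. \<forall>t. X' t $$ (i, j) = poly q t" and cY: "\<exists>q. \<forall>t. Y' t $$ (i, j) = poly q t"
      if "i < n" "j < n" for i j
      using shift_curve[OF X that] shift_curve[OF Y that] by (auto simp: X'_def Y'_def)
    have cXY: "\<exists>q. \<forall>t. (X' t * Y' t) $$ (i, j) = poly q t" if "i < n" "j < n" for i j
      unfolding mat_mult_entry[OF c that] using that by (intro poly_curve_sum poly_curve_mult cX cY) auto
    have "\<exists>q. \<forall>t. f i j (X' t * Y' t) - (\<Sum>k<N. f i k (X' t) * f k j (Y' t)) = poly q t"
      by (intro poly_curve_diff poly_curve_sum poly_curve_mult cp ij c cX cY cXY mult_carrier_mat[OF c]) auto
    then obtain q where q: "\<And>t. f i j (X' t * Y' t) - (\<Sum>k<N. f i k (X' t) * f k j (Y' t)) = poly q t" by blast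
    have "q = 0"
    proof (rule poly_eq_0_if_cofinite)
      show "finite ({t. X' t \<notin> carrier (GL n)} \<union> {t. Y' t \<notin> carrier (GL n)})"
        unfolding X'_def Y'_def using finite_shift_not_GL X Y by simp
      fix t assume "t \<notin> {t. X' t \<notin> carrier (GL n)} \<union> {t. Y' t \<notin> carrier (GL n)}"
      then have G: "X' t \<in> carrier (GL n)" "Y' t \<in> carrier (GL n)" by auto
      have "f i j (X' t * Y' t) = R (X' t * Y' t) $$ (i, j)" using f(2) ij GL_mult_closed[OF G] by simp
      also have "\<dots> = (\<Sum>k<N. R (X' t) $$ (i, k) * R (Y' t) $$ (k, j))"
        unfolding hom_GL(2)[OF hR G] by (rule mat_mult_entry) (use hom_GL(1)[OF hR] G ij in auto)
      also have "\<dots> = (\<Sum>k<N. f i k (X' t) * f k j (Y' t))" using f(2) ij G by simp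
      finally show "poly q t = 0" unfolding q[symmetric] by simp
    qed
    moreover have "X' 0 = X" "Y' 0 = Y" using X Y by (auto simp: X'_def Y'_def intro!: eq_matI)
    ultimately have "f i j (X * Y) = (\<Sum>k<N. f i k X * f k j Y)" using q[of 0] by simp
    then show "r (X * Y) $$ (i, j) = (r X * r Y) $$ (i, j)"
      unfolding mat_mult_entry[OF rc rc ij] using ij by (simp add: r_def)
  qed (auto simp: r_def)
  have "mat_trace (r (mat_diag n x)) = schur_poly n la x" for x
  proof -
    define D where "D = (\<lambda>t. mat_diag n (\<lambda>i. x i + t))"
    have cD: "\<exists>q. \<forall>t. D t $$ (i, j) = poly q t" if "i < n" "j < n" for i j
      by (intro exI[of _ "if i = j then [:x j, 1:] else 0"]) (use that in \<open>simp add: D_def mat_diag_def\<close>)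
    have "\<exists>q. \<forall>t. (\<Sum>i<N. f i i (D t)) - schur_poly n la (\<lambda>i. x i + t) = poly q t"
      by (intro poly_curve_diff poly_curve_sum cp cD schur_poly_curve) (auto simp: D_def)
    then obtain q where q: "\<And>t. (\<Sum>i<N. f i i (D t)) - schur_poly n la (\<lambda>i. x i + t) = poly q t" by blast
    have "q = 0"
    proof (rule poly_eq_0_if_cofinite[of "(\<lambda>i. - x i) ` {..<n}"])
      fix t assume t: "t \<notin> (\<lambda>i. - x i) ` {..<n}"
      have nz: "x i + t \<noteq> 0" if "i < n" for i using t that by (auto simp: add_eq_0_iff)
      have G: "D t \<in> carrier (GL n)"
      proof -
        have "D t * mat_diag n (\<lambda>i. inverse (x i + t)) = 1\<^sub>m n" "mat_diag n (\<lambda>i. inverse (x i + t)) * D t = 1\<^sub>m n"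
          unfolding D_def mat_diag_diag using nz by (auto simp: mat_diag_def intro!: eq_matI)
        then show ?thesis unfolding carrier_GL_iff 
          by (auto simp: D_def intro!: bexI[of _ "mat_diag n (\<lambda>i. inverse (x i + t))"])
      qed
      have "(\<Sum>i<N. f i i (D t)) = rep_character n R (\<lambda>i. x i + t)"
        by (simp add: rep_character_def fun_cong[OF D_def, symmetric] mat_trace_eq[OF hom_GL(1)[OF hR G]] f(2)[OF _ _ G])
      then show "poly q t = 0" unfolding q[symmetric] using ch[of "\<lambda>i. x i + t"] nz by simp
    qed simp
    then show ?thesis using q[of 0] by (simp add: D_def mat_trace_def r_def)
  qed
  moreover have "r (1\<^sub>m n) = 1\<^sub>m N" using rR[OF GL_one_closed] hom_GL(3)[OF hR] by simp
  moreover have "(\<lambda>X. r X $$ (i, j)) \<in> forms d n n" if "i < N" "j < N" for i j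
    using f(1)[OF that] that by (simp add: r_def)
  ultimately show ?thesis using rc mult rR by (intro exI[of _ r]) (simp add: mrep_def)
qed


text \<open>The last clause, joint linear independence of all matrix coefficients on the group, is
  the form in which irreducibility and distinctness of the characters enter the spanning,
  restriction and injectivity arguments.\<close>

definition family :: "nat \<Rightarrow> nat \<Rightarrow> (nat list \<Rightarrow> nat) \<Rightarrow> (nat list \<Rightarrow> complex mat \<Rightarrow> complex mat) \<Rightarrow> bool" where
  "family n d N r \<longleftrightarrow> (\<forall>la\<in>partitions d. mrep d n (N la) (r la)) \<and>
     (\<forall>la\<in>partitions d. \<forall>x. mat_trace (r la (mat_diag n x)) = schur_poly n la x) \<and>
     (\<forall>b. (\<forall>A\<in>carrier (GL n). (\<Sum>la\<in>partitions d. \<Sum>i<N la. \<Sum>j<N la. b la i j * r la A $$ (i, j)) = 0)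
        \<longrightarrow> (\<forall>la\<in>partitions d. \<forall>i<N la. \<forall>j<N la. b la i j = 0))"

text \<open>Partitions with more than \<open>n\<close> parts have \<open>N la = 0\<close> and
  contribute no coefficients; for the others \<open>schur_poly_inj\<close> makes the characters
  pairwise distinct, as independence requires.\<close>

lemma family_exists:
  assumes sr: "\<And>la. la \<in> partitions d \<Longrightarrow> schur_rep n la (N la) (R la)"
  shows "\<exists>r. family n d N r \<and> (\<forall>la\<in>partitions d. \<forall>A\<in>carrier (GL n). r la A = R la A)"
proof -
  have "\<forall>la\<in>partitions d. \<exists>r. mrep d n (N la) r \<and> (\<forall>A\<in>carrier (GL n). r A = R la A) \<and>
    (\<forall>x. mat_trace (r (mat_diag n x)) = schur_poly n la x)"
    using schur_rep_extend[OF sr] by blast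
  then obtain r where r: "\<And>la. la \<in> partitions d \<Longrightarrow> mrep d n (N la) (r la)"
    "\<And>la A. la \<in> partitions d \<Longrightarrow> A \<in> carrier (GL n) \<Longrightarrow> r la A = R la A"
    "\<And>la x. la \<in> partitions d \<Longrightarrow> mat_trace (r la (mat_diag n x)) = schur_poly n la x"
    by metis
  have ch: "rep_character n (R la) x = schur_poly n la x"
    if "la \<in> parts_le n d" "\<And>i. i < n \<Longrightarrow> x i \<noteq> 0" for la x
    using sr[of la] that by (auto simp: parts_le_def schur_rep_def)
  have irr: "irr n (N la) (R la)" if "la \<in> parts_le n d" for la
    using sr[of la] that by (auto simp: parts_le_def schur_rep_def irr_def polynomial_rep_def)
  have diagG: "mat_diag n x \<in> carrier (GL n)" if "\<And>i. i < n \<Longrightarrow> x i \<noteq> 0" for x :: "nat \<Rightarrow> complex"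
  proof -
    have "mat_diag n x * mat_diag n (\<lambda>i. inverse (x i)) = 1\<^sub>m n" "mat_diag n (\<lambda>i. inverse (x i)) * mat_diag n x = 1\<^sub>m n"
      unfolding mat_diag_diag using that by (auto simp: mat_diag_def intro!: eq_matI)
    then show ?thesis unfolding carrier_GL_iff
      by (auto intro!: bexI[of _ "mat_diag n (\<lambda>i. inverse (x i))"])
  qed
  have ind: "b la i j = 0"
    if rel: "\<And>A. A \<in> carrier (GL n) \<Longrightarrow> (\<Sum>la\<in>partitions d. \<Sum>i<N la. \<Sum>j<N la. b la i j * r la A $$ (i, j)) = 0"
      and la: "la \<in> partitions d" "i < N la" "j < N la" for b la i j
  proof -
    have N0: "N la = 0" if "la \<in> partitions d - parts_le n d" for la
      using sr[of la] that by (auto simp: parts_le_def schur_rep_def)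
    have "la \<in> parts_le n d" using N0[of la] la by auto
    show ?thesis
    proof (rule coefficients_independent[where L = "parts_le n d" and N = N and R = R and b = b])
      fix A assume A: "A \<in> carrier (GL n)"
      have "(\<Sum>la\<in>parts_le n d. \<Sum>i<N la. \<Sum>j<N la. b la i j * R la A $$ (i, j))
        = (\<Sum>la\<in>partitions d. \<Sum>i<N la. \<Sum>j<N la. b la i j * r la A $$ (i, j))"
        by (rule sum.mono_neutral_cong_left) (use N0 r(2) A in \<open>auto simp: parts_le_def\<close>)
      then show "(\<Sum>la\<in>parts_le n d. \<Sum>i<N la. \<Sum>j<N la. b la i j * R la A $$ (i, j)) = 0"
        using rel[OF A] by simp
    next
      fix l l' assume l: "l \<in> parts_le n d" "l' \<in> parts_le n d" "l \<noteq> l'"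
      then obtain x where x: "\<And>i. i < n \<Longrightarrow> x i \<noteq> 0" "schur_poly n l x \<noteq> schur_poly n l' x"
        using schur_poly_inj by metis
      then have "mat_trace (R l (mat_diag n x)) \<noteq> mat_trace (R l' (mat_diag n x))"
        using ch[OF l(1) x(1)] ch[OF l(2) x(1)] by (simp add: rep_character_def)
      then show "\<exists>A\<in>carrier (GL n). mat_trace (R l A) \<noteq> mat_trace (R l' A)"
        using diagG[of x] x(1) by blast
    qed (use irr la \<open>la \<in> parts_le n d\<close> in auto)
  qed
  have "family n d N r"
    unfolding family_def
  proof (intro conjI allI ballI impI)
    fix b la i j
    assume "\<forall>A\<in>carrier (GL n). (\<Sum>la\<in>partitions d. \<Sum>i<N la. \<Sum>j<N la. b la i j * r la A $$ (i, j)) = 0"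
      and "la \<in> partitions d" "i < N la" "j < N la"
    then show "b la i j = 0" using ind by blast
  qed (use r in auto)
  then show ?thesis using r(2) by blast
qed

section \<open>The matrix coefficients span the forms\<close>

lemma mrep_trace_conj:
  assumes r: "mrep d n N r" and c: "X \<in> carrier_mat n n" "P \<in> carrier_mat n n" "Q \<in> carrier_mat n n"
    and QP: "Q * P = 1\<^sub>m n"
  shows "mat_trace (r (P * X * Q)) = mat_trace (r X)"
proof -
  note rc = mrepD(1)[OF r c(1)] mrepD(1)[OF r c(2)] mrepD(1)[OF r c(3)]
  have "r (P * X * Q) = r P * (r X * r Q)"
    using mrepD(2)[OF r] c rc by (simp add: assoc_mult_mat[of _ N N _ N _ N])
  then have "mat_trace (r (P * X * Q)) = mat_trace ((r X * r Q) * r P)"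
    using mat_trace_comm[of "r P" N N "r X * r Q"] rc by simp
  also have "\<dots> = mat_trace (r X * r (Q * P))"
    using mrepD(2)[OF r] c rc by (simp add: assoc_mult_mat[of _ N N _ N _ N])
  finally show ?thesis using rc by (simp add: QP mrepD(3)[OF r])
qed

lemma mrep_trace_curve_poly:
  assumes "mrep d n N r" shows "curve_poly n (\<lambda>X. mat_trace (r X))"
proof (rule curve_poly_cong)
  show "curve_poly n (\<lambda>X. \<Sum>i<N. r X $$ (i, i))"
    using mrepD(4)[OF assms] by (intro curve_poly_sum forms_curve_poly) auto
  show "mat_trace (r X) = (\<Sum>i<N. r X $$ (i, i))" if "X \<in> carrier_mat n n" for X
    by (rule mat_trace_eq[OF mrepD(1)[OF assms that]])
qed

text \<open>Conjugation by the matrix of a transposition swaps two diagonal entries and preserves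
  the trace, so a Schur polynomial that is a character is symmetric.\<close>

lemma mrep_schur_symmetric:
  assumes r: "mrep d n N r" and ch: "\<And>x. mat_trace (r (mat_diag n x)) = schur_poly n la x" and i: "Suc i < n"
  shows "schur_poly n la (x \<circ> swp i) = schur_poly n la x"
proof -
  define P :: "complex mat" where "P = mat n n (\<lambda>(a, b). if b = swp i a then 1 else 0)"
  have P: "P \<in> carrier_mat n n" by (simp add: P_def)
  have sw: "swp i a < n" if "a < n" for a using that i by (auto simp: transpose_def)
  have PD: "(P * mat_diag n y * P) $$ (a, b) = (if a = b then y (swp i a) else 0)"
    if ab: "a < n" "b < n" for a b and y :: "nat \<Rightarrow> complex"
  proof -
    have c: "P * mat_diag n y \<in> carrier_mat n n" using P mat_diag_dim[of n y] by simp
    have "(P * mat_diag n y * P) $$ (a, b) = (\<Sum>k<n. (P * mat_diag n y) $$ (a, k) * P $$ (k, b))"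
      by (rule mat_mult_entry[OF c P ab])
    also have "\<dots> = (\<Sum>k<n. if k = swp i a then (if b = a then y (swp i a) else 0) else 0)"
      unfolding mat_diag_mult_right[OF P] by (rule sum.cong) (use ab in \<open>auto simp: P_def\<close>)
    finally show ?thesis using sw[OF ab(1)] by auto
  qed
  have "P * P = 1\<^sub>m n"
  proof (rule eq_matI)
    fix a b assume "a < dim_row (1\<^sub>m n :: complex mat)" "b < dim_col (1\<^sub>m n :: complex mat)"
    then have ab: "a < n" "b < n" by auto
    have "P * mat_diag n (\<lambda>_. 1) = P" using P by simp
    then show "(P * P) $$ (a, b) = 1\<^sub>m n $$ (a, b)" using PD[OF ab, of "\<lambda>_. 1"] ab by simp
  qed (simp_all add: P_def)
  then have "mat_trace (r (P * mat_diag n x * P)) = mat_trace (r (mat_diag n x))"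
    by (intro mrep_trace_conj[OF r _ P P]) auto
  moreover have "P * mat_diag n x * P = mat_diag n (x \<circ> swp i)"
    by (rule eq_matI) (use PD P in \<open>auto simp: mat_diag_def P_def\<close>)
  ultimately show ?thesis by (simp add: ch)
qed

text \<open>\<open>mat_trace X ^ d\<close> is the character of the \<open>d\<close>-th tensor power.
  Both sides are class functions, so it suffices to compare them on diagonal matrices, where
  \<open>linear_power_schur\<close> applies.\<close>

lemma trace_power_characters:
  assumes fam: "family n d N r"
  shows "\<exists>c. \<forall>X\<in>carrier_mat n n. mat_trace X ^ d = (\<Sum>la\<in>parts_le n d. c la * mat_trace (r la X))"
proof -
  have r: "mrep d n (N la) (r la)" and ch: "\<And>x. mat_trace (r la (mat_diag n x)) = schur_poly n la x"
    if "la \<in> parts_le n d" for la using fam that by (auto simp: family_def parts_le_def)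
  obtain c where c: "\<And>x. (\<Sum>i<n. x i) ^ d = (\<Sum>la\<in>parts_le n d. c la * schur_poly n la x)"
    using linear_power_schur[of n d] mrep_schur_symmetric[OF r ch] by metis
  have "mat_trace X ^ d - (\<Sum>la\<in>parts_le n d. c la * mat_trace (r la X)) = 0" if "X \<in> carrier_mat n n" for X
  proof (rule class_function_zero[OF _ _ _ that])
    have "curve_poly n mat_trace"
      by (rule curve_poly_cong[of n "\<lambda>X. \<Sum>i<n. X $$ (i, i)"])
        (auto intro: curve_poly_sum curve_poly_entry simp: mat_trace_eq)
    moreover have "curve_poly n (\<lambda>X. \<Sum>la\<in>parts_le n d. c la * mat_trace (r la X))"
      by (intro curve_poly_sum curve_poly_mult curve_poly_const mrep_trace_curve_poly[OF r])
    ultimately show "curve_poly n (\<lambda>X. mat_trace X ^ d - (\<Sum>la\<in>parts_le n d. c la * mat_trace (r la X)))"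
      by (intro curve_poly_diff curve_poly_power)
    fix X P Q :: "complex mat"
    assume X: "X \<in> carrier_mat n n" "P \<in> carrier_mat n n" "Q \<in> carrier_mat n n" and QP: "Q * P = 1\<^sub>m n"
    have "mat_trace (P * X * Q) = mat_trace (Q * (P * X))" using X by (intro mat_trace_comm) auto
    also have "Q * (P * X) = X" using X QP by (simp add: assoc_mult_mat[of Q n n P n X n, symmetric])
    finally show "mat_trace (P * X * Q) ^ d - (\<Sum>la\<in>parts_le n d. c la * mat_trace (r la (P * X * Q)))
      = mat_trace X ^ d - (\<Sum>la\<in>parts_le n d. c la * mat_trace (r la X))"
      using mrep_trace_conj[OF r X QP] by simp
  next
    fix x
    have "mat_trace (mat_diag n x) = (\<Sum>i<n. x i)" by (simp add: mat_trace_def mat_diag_def)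
    then show "mat_trace (mat_diag n x) ^ d - (\<Sum>la\<in>parts_le n d. c la * mat_trace (r la (mat_diag n x))) = 0"
      using c[of x] ch by simp
  qed
  then show ?thesis by (intro exI[of _ c] ballI) (simp only: right_minus_eq)
qed

lemma sum_power_lists:
  fixes f :: "'a \<Rightarrow> complex"
  assumes "finite S"
  shows "(\<Sum>p\<in>S. f p) ^ d = (\<Sum>ps\<in>{ps. set ps \<subseteq> S \<and> length ps = d}. \<Prod>p\<leftarrow>ps. f p)"
proof (induction d)
  case 0
  have "{ps. set ps \<subseteq> S \<and> length ps = 0} = {[]}" by auto
  then show ?case by simp
next
  case (Suc d)
  let ?W = "{ps. set ps \<subseteq> S \<and> length ps = d}"
  have "(\<Sum>ps\<in>{ps. set ps \<subseteq> S \<and> length ps = Suc d}. \<Prod>p\<leftarrow>ps. f p)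
    = (\<Sum>q\<in>S \<times> ?W. f (fst q) * (\<Prod>p\<leftarrow>snd q. f p))"
    by (rule sum.reindex_bij_witness[of _ "\<lambda>(p, ps). p # ps" "\<lambda>ps. (hd ps, tl ps)"])
      (auto simp: length_Suc_conv)
  also have "\<dots> = (\<Sum>p\<in>S. f p) * (\<Sum>ps\<in>?W. \<Prod>p\<leftarrow>ps. f p)"
    by (simp add: sum_product sum.cartesian_product split_def)
  finally show ?case using Suc.IH by simp
qed

text \<open>With the conjugate transpose of \<open>B\<close>, the power of the trace becomes the
  Hermitian inner product of the \<open>d\<close>-th tensor powers of \<open>A\<close> and
  \<open>B\<close> in word coordinates: a positive form expressed by traces.\<close>

lemma trace_adjoint_power:
  assumes A: "A \<in> carrier_mat n n" and B: "B \<in> carrier_mat n n"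
  shows "mat_trace (A * mat n n (\<lambda>(i, j). cnj (B $$ (j, i)))) ^ d
    = (\<Sum>ps\<in>words d n n. word_mon ps A * cnj (word_mon ps B))"
proof -
  have "mat_trace (A * mat n n (\<lambda>(i, j). cnj (B $$ (j, i)))) = (\<Sum>i<n. \<Sum>j<n. A $$ (i, j) * cnj (B $$ (i, j)))"
    by (subst mat_trace_mult[OF A]) auto
  also have "\<dots> = (\<Sum>p\<in>{..<n} \<times> {..<n}. A $$ p * cnj (B $$ p))"
    by (simp add: sum.cartesian_product split_def)
  finally have "mat_trace (A * mat n n (\<lambda>(i, j). cnj (B $$ (j, i)))) ^ d
    = (\<Sum>ps\<in>words d n n. \<Prod>p\<leftarrow>ps. A $$ p * cnj (B $$ p))"
    unfolding words_def by (simp add: sum_power_lists)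
  moreover have "(\<Prod>p\<leftarrow>ps. A $$ p * cnj (B $$ p)) = word_mon ps A * cnj (word_mon ps B)" for ps
    by (induction ps) (auto simp: word_mon_def)
  ultimately show ?thesis by (simp only:)
qed

text \<open>If a linear combination \<open>a\<close> of matrices is killed by all the representations, then
  \<open>tr(a a\<^sup>*)\<close>, computed in the tensor power, vanishes since the character of the tensor power is
  a combination of the given ones; hence \<open>a\<close> is killed by all monomials of degree \<open>d\<close>.\<close>

lemma family_spans:
  assumes fam: "family n d N r" and f: "f \<in> forms d n n"
  shows "\<exists>b. \<forall>X\<in>carrier_mat n n. f X = (\<Sum>la\<in>partitions d. \<Sum>i<N la. \<Sum>j<N la. b la i j * r la X $$ (i, j))"
proof -
  have r: "mrep d n (N la) (r la)" if "la \<in> partitions d" for la using fam that by (auto simp: family_def)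
  obtain c where c: "\<And>X. X \<in> carrier_mat n n \<Longrightarrow> mat_trace X ^ d = (\<Sum>la\<in>parts_le n d. c la * mat_trace (r la X))"
    using trace_power_characters[OF fam] by metis
  define I where "I = Sigma (partitions d) (\<lambda>la. {..<N la} \<times> {..<N la})"
  define g where "g = (\<lambda>(la, ij) X. r la X $$ ij)"
  have "\<exists>b. \<forall>X\<in>carrier_mat n n. f X = (\<Sum>q\<in>I. b q * g q X)"
  proof (rule functionals_span)
    show "finite I" by (auto simp: I_def)
    fix F a assume F: "finite F" "F \<subseteq> carrier_mat n n" and k: "\<And>q. q \<in> I \<Longrightarrow> (\<Sum>X\<in>F. a X * g q X) = 0"
    \<comment> \<open>The coordinates of the formal sum \<open>a\<close> in the tensor power; the
      aim is to show that they all vanish.\<close>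
    define s where "s = (\<lambda>ps. \<Sum>X\<in>F. a X * word_mon ps X)"
    define H where "H = (\<lambda>Y :: complex mat. mat n n (\<lambda>(i, j). cnj (Y $$ (j, i))))"
    have Hc: "H Y \<in> carrier_mat n n" for Y by (simp add: H_def)
    \<comment> \<open>By multiplicativity a formal sum killed by \<open>r la\<close> stays killed
      after right multiplication by any \<open>Y\<close>, invertible or not.\<close>
    have tr0: "(\<Sum>X\<in>F. a X * mat_trace (r la (X * Y))) = 0" if la: "la \<in> partitions d" and Y: "Y \<in> carrier_mat n n" for la Y
    proof -
      have "(\<Sum>X\<in>F. a X * mat_trace (r la (X * Y)))
        = (\<Sum>X\<in>F. \<Sum>i<N la. \<Sum>j<N la. a X * r la X $$ (i, j) * r la Y $$ (j, i))"
      proof (rule sum.cong)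
        fix X assume "X \<in> F"
        then have X: "X \<in> carrier_mat n n" using F by blast
        show "a X * mat_trace (r la (X * Y)) = (\<Sum>i<N la. \<Sum>j<N la. a X * r la X $$ (i, j) * r la Y $$ (j, i))"
          unfolding mrepD(2)[OF r[OF la] X Y] mat_trace_mult[OF mrepD(1)[OF r[OF la] X] mrepD(1)[OF r[OF la] Y]]
          by (simp add: sum_distrib_left mult.assoc)
      qed simp
      also have "\<dots> = (\<Sum>i<N la. \<Sum>j<N la. (\<Sum>X\<in>F. a X * r la X $$ (i, j)) * r la Y $$ (j, i))"
        by (subst sum.swap, rule sum.cong[OF refl], subst sum.swap) (simp add: sum_distrib_right)
      also have "\<dots> = 0"
      proof (intro sum.neutral ballI)
        fix i j assume "i \<in> {..<N la}" "j \<in> {..<N la}"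
        then show "(\<Sum>X\<in>F. a X * r la X $$ (i, j)) * r la Y $$ (j, i) = 0"
          using k[of "(la, i, j)"] la by (simp add: I_def g_def)
      qed
      finally show ?thesis .
    qed
    \<comment> \<open>The squared norm of these coordinates. Expanded, it consists of powers of
      traces of \<open>X * H Y\<close>, to which the expansion into characters and then
      \<open>tr0\<close> apply.\<close>
    have "(\<Sum>ps\<in>words d n n. s ps * cnj (s ps))
      = (\<Sum>Y\<in>F. \<Sum>X\<in>F. cnj (a Y) * a X * (\<Sum>ps\<in>words d n n. word_mon ps X * cnj (word_mon ps Y)))"
    proof -
      have "(\<Sum>ps\<in>words d n n. s ps * cnj (s ps))
        = (\<Sum>ps\<in>words d n n. \<Sum>X\<in>F. \<Sum>Y\<in>F. (a X * word_mon ps X) * (cnj (a Y) * cnj (word_mon ps Y)))"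
        by (simp add: s_def sum_product)
      also have "\<dots> = (\<Sum>X\<in>F. \<Sum>ps\<in>words d n n. \<Sum>Y\<in>F. (a X * word_mon ps X) * (cnj (a Y) * cnj (word_mon ps Y)))"
        by (rule sum.swap)
      also have "\<dots> = (\<Sum>X\<in>F. \<Sum>Y\<in>F. \<Sum>ps\<in>words d n n. (a X * word_mon ps X) * (cnj (a Y) * cnj (word_mon ps Y)))"
        by (rule sum.cong[OF refl], rule sum.swap)
      also have "\<dots> = (\<Sum>Y\<in>F. \<Sum>X\<in>F. \<Sum>ps\<in>words d n n. (a X * word_mon ps X) * (cnj (a Y) * cnj (word_mon ps Y)))"
        by (rule sum.swap)
      finally show ?thesis by (simp add: sum_distrib_left mult_ac)
    qed
    also have "\<dots> = (\<Sum>Y\<in>F. \<Sum>X\<in>F. cnj (a Y) * a X * (\<Sum>la\<in>parts_le n d. c la * mat_trace (r la (X * H Y))))"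
    proof (intro sum.cong refl)
      fix X Y assume "X \<in> F" "Y \<in> F"
      then have XY: "X \<in> carrier_mat n n" "Y \<in> carrier_mat n n" using F by auto
      have "(\<Sum>ps\<in>words d n n. word_mon ps X * cnj (word_mon ps Y)) = mat_trace (X * H Y) ^ d"
        unfolding H_def by (rule trace_adjoint_power[OF XY, symmetric])
      also have "\<dots> = (\<Sum>la\<in>parts_le n d. c la * mat_trace (r la (X * H Y)))"
        by (rule c) (use XY Hc[of Y] in simp)
      finally show "cnj (a Y) * a X * (\<Sum>ps\<in>words d n n. word_mon ps X * cnj (word_mon ps Y))
        = cnj (a Y) * a X * (\<Sum>la\<in>parts_le n d. c la * mat_trace (r la (X * H Y)))"
        by (simp only:)
    qed
    also have "\<dots> = (\<Sum>Y\<in>F. cnj (a Y) * (\<Sum>la\<in>parts_le n d. c la * (\<Sum>X\<in>F. a X * mat_trace (r la (X * H Y)))))"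
    proof (rule sum.cong[OF refl])
      fix Y
      have "(\<Sum>X\<in>F. cnj (a Y) * a X * (\<Sum>la\<in>parts_le n d. c la * mat_trace (r la (X * H Y))))
        = (\<Sum>X\<in>F. \<Sum>la\<in>parts_le n d. cnj (a Y) * (c la * (a X * mat_trace (r la (X * H Y)))))"
        by (simp add: sum_distrib_left mult_ac)
      also have "\<dots> = (\<Sum>la\<in>parts_le n d. \<Sum>X\<in>F. cnj (a Y) * (c la * (a X * mat_trace (r la (X * H Y)))))"
        by (rule sum.swap)
      finally show "(\<Sum>X\<in>F. cnj (a Y) * a X * (\<Sum>la\<in>parts_le n d. c la * mat_trace (r la (X * H Y))))
        = cnj (a Y) * (\<Sum>la\<in>parts_le n d. c la * (\<Sum>X\<in>F. a X * mat_trace (r la (X * H Y))))"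
        by (simp add: sum_distrib_left)
    qed
    also have "\<dots> = 0" using tr0 Hc by (simp add: parts_le_def)
    finally have "(\<Sum>ps\<in>words d n n. complex_of_real ((cmod (s ps))\<^sup>2)) = 0"
      by (simp only: complex_norm_square)
    then have "(\<Sum>ps\<in>words d n n. (cmod (s ps))\<^sup>2) = 0" by (simp only: of_real_sum[symmetric] of_real_eq_0_iff)
    then have s0: "s ps = 0" if "ps \<in> words d n n" for ps
      using that by (subst (asm) sum_nonneg_eq_0_iff) auto
    obtain e where e: "\<forall>X\<in>carrier_mat n n. f X = (\<Sum>ps\<in>words d n n. e ps * word_mon ps X)"
      using f unfolding forms_def by blast
    have "(\<Sum>X\<in>F. a X * f X) = (\<Sum>X\<in>F. \<Sum>ps\<in>words d n n. e ps * (a X * word_mon ps X))"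
    proof (rule sum.cong)
      fix X assume "X \<in> F"
      then have "f X = (\<Sum>ps\<in>words d n n. e ps * word_mon ps X)" using e F by blast
      then show "a X * f X = (\<Sum>ps\<in>words d n n. e ps * (a X * word_mon ps X))"
        by (simp add: sum_distrib_left mult_ac)
    qed simp
    also have "\<dots> = (\<Sum>ps\<in>words d n n. e ps * s ps)"
      by (subst sum.swap) (simp add: s_def sum_distrib_left)
    finally show "(\<Sum>X\<in>F. a X * f X) = 0" using s0 by simp
  qed
  then obtain b where b: "\<And>X. X \<in> carrier_mat n n \<Longrightarrow> f X = (\<Sum>q\<in>I. b q * g q X)" by blast
  have "f X = (\<Sum>la\<in>partitions d. \<Sum>i<N la. \<Sum>j<N la. b (la, i, j) * r la X $$ (i, j))"
    if "X \<in> carrier_mat n n" for X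
  proof -
    have "(\<Sum>la\<in>partitions d. \<Sum>i<N la. \<Sum>j<N la. b (la, i, j) * r la X $$ (i, j))
      = (\<Sum>la\<in>partitions d. \<Sum>ij\<in>{..<N la} \<times> {..<N la}. b (la, ij) * g (la, ij) X)"
      by (simp add: g_def sum.cartesian_product split_def)
    also have "\<dots> = (\<Sum>q\<in>I. b q * g q X)" unfolding I_def by (subst sum.Sigma) auto
    finally show ?thesis using b[OF that] by simp
  qed
  then show ?thesis by (intro exI[of _ "\<lambda>la i j. b (la, i, j)"] ballI)
qed

lemma familyD:
  assumes "family n d N r" "la \<in> partitions d"
  shows "mrep d n (N la) (r la)" "mat_trace (r la (mat_diag n x)) = schur_poly n la x"
  using assms(1)[unfolded family_def, THEN conjunct1] assms(1)[unfolded family_def, THEN conjunct2, THEN conjunct1]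
    assms(2) by blast+

lemma family_independent:
  assumes fam: "family n d N r"
    and rel: "\<And>X. X \<in> carrier (GL n) \<Longrightarrow> (\<Sum>la\<in>partitions d. mat_trace (B la * r la X)) = 0"
    and B: "\<And>la. la \<in> partitions d \<Longrightarrow> B la \<in> carrier_mat (N la) (N la)"
    and la: "la \<in> partitions d"
  shows "B la = 0\<^sub>m (N la) (N la)"
proof -
  have "\<forall>A\<in>carrier (GL n). (\<Sum>la\<in>partitions d. \<Sum>i<N la. \<Sum>j<N la. B la $$ (j, i) * r la A $$ (i, j)) = 0"
  proof
    fix A assume AG: "A \<in> carrier (GL n)"
    then have A: "A \<in> carrier_mat n n" by (rule GL_carrierD)
    have "(\<Sum>i<N la. \<Sum>j<N la. B la $$ (j, i) * r la A $$ (i, j)) = mat_trace (B la * r la A)"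
      if "la \<in> partitions d" for la
      unfolding mat_trace_mult[OF B[OF that] mrepD(1)[OF familyD(1)[OF fam that] A]]
      by (rule sum.swap)
    then show "(\<Sum>la\<in>partitions d. \<Sum>i<N la. \<Sum>j<N la. B la $$ (j, i) * r la A $$ (i, j)) = 0"
      using rel[OF AG] by simp
  qed
  then have "\<forall>la\<in>partitions d. \<forall>i<N la. \<forall>j<N la. B la $$ (j, i) = 0"
    using fam[unfolded family_def, THEN conjunct2, THEN conjunct2, THEN spec[of _ "\<lambda>la i j. B la $$ (j, i)"]]
    by blast
  then show ?thesis using B[OF la] la by (intro eq_matI) auto
qed

lemma mat_trace_smult: "A \<in> carrier_mat a a \<Longrightarrow> mat_trace (c \<cdot>\<^sub>m A) = c * mat_trace A"
  by (simp add: mat_trace_def sum_distrib_left)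

lemma mat_trace_diff:
  "A \<in> carrier_mat a a \<Longrightarrow> B \<in> carrier_mat a a \<Longrightarrow> mat_trace (A - B) = mat_trace A - mat_trace B"
  by (simp add: mat_trace_def sum_subtractf)

lemma minus_mat_eq_zeroD:
  assumes "A \<in> carrier_mat a b" "B \<in> carrier_mat a b" "A - B = (0\<^sub>m a b :: complex mat)"
  shows "A = B"
proof (rule eq_matI)
  fix i j assume "i < dim_row B" "j < dim_col B"
  then show "A $$ (i, j) = B $$ (i, j)"
    using arg_cong[OF assms(3), of "\<lambda>M. M $$ (i, j)"] assms(1,2) by simp
qed (use assms in auto)

lemma mat_trace_zero: "A \<in> carrier_mat a a \<Longrightarrow> mat_trace (0\<^sub>m a a * A) = 0"
  by (auto simp: mat_trace_def)

lemma family_independent1: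
  assumes fam: "family n d N r" and la: "la \<in> partitions d"
    and rel: "\<And>X. X \<in> carrier (GL n) \<Longrightarrow> mat_trace (B * r la X) = 0"
    and B: "B \<in> carrier_mat (N la) (N la)"
  shows "B = 0\<^sub>m (N la) (N la)"
proof -
  define B' where "B' = (\<lambda>lb. if lb = la then B else 0\<^sub>m (N lb) (N lb))"
  have "B' la = 0\<^sub>m (N la) (N la)"
  proof (rule family_independent[OF fam _ _ la])
    fix X assume XG: "X \<in> carrier (GL n)"
    note X = GL_carrierD[OF XG]
    have "mat_trace (B' lb * r lb X) = 0" if "lb \<in> partitions d" for lb
      using rel[OF XG] mat_trace_zero[OF mrepD(1)[OF familyD(1)[OF fam that] X]] by (simp add: B'_def)
    then show "(\<Sum>lb\<in>partitions d. mat_trace (B' lb * r lb X)) = 0" by simp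
  qed (use B in \<open>auto simp: B'_def\<close>)
  then show ?thesis by (simp add: B'_def)
qed

lemma family_coefficients_independent1:
  assumes fam: "family n d N r" and la: "la \<in> partitions d"
    and rel: "\<And>X. X \<in> carrier (GL n) \<Longrightarrow> (\<Sum>k<N la. \<Sum>l<N la. b k l * r la X $$ (k, l)) = 0"
    and kl: "k < N la" "l < N la"
  shows "b k l = 0"
proof -
  define B where "B = mat (N la) (N la) (\<lambda>(l, k). b k l)"
  have B: "B \<in> carrier_mat (N la) (N la)" by (simp add: B_def)
  have "B = 0\<^sub>m (N la) (N la)"
  proof (rule family_independent1[OF fam la _ B])
    fix X assume XG: "X \<in> carrier (GL n)"
    note X = GL_carrierD[OF XG]
    have "mat_trace (B * r la X) = (\<Sum>l<N la. \<Sum>k<N la. b k l * r la X $$ (k, l))"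
      unfolding mat_trace_mult[OF B mrepD(1)[OF familyD(1)[OF fam la] X]] by (simp add: B_def)
    also have "\<dots> = (\<Sum>k<N la. \<Sum>l<N la. b k l * r la X $$ (k, l))" by (rule sum.swap)
    finally show "mat_trace (B * r la X) = 0" using rel[OF XG] by simp
  qed
  then have "B $$ (l, k) = 0" using kl by simp
  then show ?thesis using kl by (simp add: B_def)
qed

lemma family_spans_trace:
  assumes fam: "family n d N r" and f: "f \<in> forms d n n"
  shows "\<exists>B. (\<forall>la\<in>partitions d. B la \<in> carrier_mat (N la) (N la)) \<and>
    (\<forall>X\<in>carrier_mat n n. f X = (\<Sum>la\<in>partitions d. mat_trace (B la * r la X)))"
proof -
  from family_spans[OF fam f] obtain b where b: "\<forall>X\<in>carrier_mat n n.
      f X = (\<Sum>la\<in>partitions d. \<Sum>i<N la. \<Sum>j<N la. b la i j * r la X $$ (i, j))" ..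
  define B where "B = (\<lambda>la. mat (N la) (N la) (\<lambda>(j, i). b la i j))"
  have B: "B la \<in> carrier_mat (N la) (N la)" for la by (simp add: B_def)
  have "f X = (\<Sum>la\<in>partitions d. mat_trace (B la * r la X))" if X: "X \<in> carrier_mat n n" for X
    unfolding bspec[OF b X]
  proof (rule sum.cong)
    fix la assume la: "la \<in> partitions d"
    have "mat_trace (B la * r la X) = (\<Sum>j<N la. \<Sum>i<N la. b la i j * r la X $$ (i, j))"
      unfolding mat_trace_mult[OF B mrepD(1)[OF familyD(1)[OF fam la] X]] by (simp add: B_def)
    also have "\<dots> = (\<Sum>i<N la. \<Sum>j<N la. b la i j * r la X $$ (i, j))" by (rule sum.swap)
    finally show "(\<Sum>i<N la. \<Sum>j<N la. b la i j * r la X $$ (i, j)) = mat_trace (B la * r la X)" by simp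
  qed simp
  then show ?thesis using B by (intro exI[of _ B]) simp
qed

lemma forms_transpose: 
  assumes "f \<in> forms d m n" shows "(\<lambda>X. f X\<^sup>T) \<in> forms d n m"
proof (rule forms_comp[OF assms])
  fix i j assume "i < m" "j < n"
  then show "(\<lambda>X. X\<^sup>T $$ (i, j)) \<in> forms 1 n m"
    by (intro forms_cong[OF forms_entry[of j n i m]]) auto
qed auto

text \<open>Transposing both argument and value reverses products twice, and diagonal matrices are
  symmetric, so the character is unchanged. On forms \<open>A\<close> acts through
  \<open>A\<^sup>T\<close>, which calls for this variant of \<open>s\<close>.\<close>

lemma family_transpose:
  assumes fam: "family m d M s"
  shows "family m d M (\<lambda>la A. (s la A\<^sup>T)\<^sup>T)"
  unfolding family_def
proof (intro conjI ballI allI impI)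
  fix la assume la: "la \<in> partitions d"
  note s = familyD[OF fam la]
  note sc = mrepD(1)[OF s(1)]
  show "mrep d m (M la) (\<lambda>A. (s la A\<^sup>T)\<^sup>T)"
    unfolding mrep_def
  proof (intro conjI ballI allI impI)
    fix X Y :: "complex mat" assume X: "X \<in> carrier_mat m m" and Y: "Y \<in> carrier_mat m m"
    show "(s la X\<^sup>T)\<^sup>T \<in> carrier_mat (M la) (M la)" using sc[of "X\<^sup>T"] X by simp
    show "(s la (X * Y)\<^sup>T)\<^sup>T = (s la X\<^sup>T)\<^sup>T * (s la Y\<^sup>T)\<^sup>T"
      using X Y sc[of "X\<^sup>T"] sc[of "Y\<^sup>T"] mrepD(2)[OF s(1), of "Y\<^sup>T" "X\<^sup>T"]
      by (simp add: transpose_mult[OF X Y] transpose_mult[of "s la Y\<^sup>T" "M la" "M la" "s la X\<^sup>T" "M la"])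
  next
    show "(s la (1\<^sub>m m)\<^sup>T)\<^sup>T = 1\<^sub>m (M la)" by (simp add: mrepD(3)[OF s(1)])
    fix i j assume ij: "i < M la" "j < M la"
    show "(\<lambda>X. (s la X\<^sup>T)\<^sup>T $$ (i, j)) \<in> forms d m m"
    proof (rule forms_cong[OF forms_transpose[OF mrepD(4)[OF s(1) ij(2,1)]]])
      fix X :: "complex mat" assume "X \<in> carrier_mat m m"
      then show "(s la X\<^sup>T)\<^sup>T $$ (i, j) = s la X\<^sup>T $$ (j, i)" using sc[of "X\<^sup>T"] ij by simp
    qed
  qed
  fix x :: "nat \<Rightarrow> complex"
  have "(mat_diag m x)\<^sup>T = mat_diag m x" by (rule eq_matI) (auto simp: mat_diag_def)
  then show "mat_trace (s la (mat_diag m x)\<^sup>T)\<^sup>T = schur_poly m la x"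
    using mat_trace_transpose[OF sc[of "mat_diag m x"]] s(2)[of x] by simp
next
  fix b la i j
  assume rel: "\<forall>A\<in>carrier (GL m). (\<Sum>la\<in>partitions d. \<Sum>i<M la. \<Sum>j<M la. b la i j * (s la A\<^sup>T)\<^sup>T $$ (i, j)) = 0"
    and la: "la \<in> partitions d" and ij: "i < M la" "j < M la"
  have "\<forall>A\<in>carrier (GL m). (\<Sum>la\<in>partitions d. \<Sum>i<M la. \<Sum>j<M la. b la j i * s la A $$ (i, j)) = 0"
  proof
    fix A assume A: "A \<in> carrier (GL m)"
    have "(\<Sum>i<M la. \<Sum>j<M la. b la i j * (s la (A\<^sup>T)\<^sup>T)\<^sup>T $$ (i, j)) = (\<Sum>i<M la. \<Sum>j<M la. b la j i * s la A $$ (i, j))"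
      if "la \<in> partitions d" for la
      using mrepD(1)[OF familyD(1)[OF fam that] GL_carrierD[OF A]] by (subst sum.swap) simp
    then show "(\<Sum>la\<in>partitions d. \<Sum>i<M la. \<Sum>j<M la. b la j i * s la A $$ (i, j)) = 0"
      using bspec[OF rel GL_transpose[OF A]] by simp
  qed
  then have "\<forall>la\<in>partitions d. \<forall>i<M la. \<forall>j<M la. b la j i = 0"
    using fam[unfolded family_def, THEN conjunct2, THEN conjunct2, THEN spec[of _ "\<lambda>la i j. b la j i"]] by blast
  then show "b la i j = 0" using la ij by blast
qed

section \<open>Restriction to a corner\<close>

text \<open>Zero padding from the upper left corner, also for rectangular matrices. It is
  multiplicative when the sizes match, but sends the identity to an idempotent.\<close>

definition pad :: "nat \<Rightarrow> complex mat \<Rightarrow> complex mat" where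
  "pad n X = mat n n (\<lambda>(i, j). if i < dim_row X \<and> j < dim_col X then X $$ (i, j) else 0)"

definition trunc :: "nat \<Rightarrow> nat \<Rightarrow> complex mat \<Rightarrow> complex mat" where
  "trunc a b X = mat a b (\<lambda>ij. X $$ ij)"

lemma pad_carrier [simp]: "pad n X \<in> carrier_mat n n"
  by (simp add: pad_def)

lemma trunc_carrier [simp]: "trunc a b X \<in> carrier_mat a b"
  by (simp add: trunc_def)

lemma pad_mult:
  assumes A: "A \<in> carrier_mat a b" and B: "B \<in> carrier_mat b c" and "a \<le> n" "b \<le> n" "c \<le> n"
  shows "pad n A * pad n B = pad n (A * B)"
proof (rule eq_matI)
  fix i j assume "i < dim_row (pad n (A * B))" "j < dim_col (pad n (A * B))"
  then have ij: "i < n" "j < n" by (auto simp: pad_def)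
  have "(pad n A * pad n B) $$ (i, j) = (\<Sum>k<n. pad n A $$ (i, k) * pad n B $$ (k, j))"
    by (rule mat_mult_entry) (use ij in auto)
  also have "\<dots> = (\<Sum>k<b. if i < a \<and> j < c then A $$ (i, k) * B $$ (k, j) else 0)"
    using assms ij by (intro sum.mono_neutral_cong_right) (auto simp: pad_def)
  also have "\<dots> = pad n (A * B) $$ (i, j)"
    using assms ij mat_mult_entry[OF A B, of i j] by (auto simp: pad_def)
  finally show "(pad n A * pad n B) $$ (i, j) = pad n (A * B) $$ (i, j)" .
qed (auto simp: pad_def)

lemma pad_id: "X \<in> carrier_mat n n \<Longrightarrow> pad n X = X"
  by (rule eq_matI) (auto simp: pad_def)

lemma pad_one_mult: 
  assumes "X \<in> carrier_mat n n" "m \<le> n"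
  shows "pad n (1\<^sub>m m) * X = pad n (trunc m n X)"
proof -
  \<comment> \<open>\<open>X\<close> is split into its first \<open>m\<close> rows and the rest; the
    idempotent fixes the former and kills the latter.\<close>
  have "pad n (1\<^sub>m m) * X = pad n (1\<^sub>m m) * (pad n (trunc m n X) + (X - pad n (trunc m n X)))"
    using assms by (intro arg_cong2[of _ _ _ _ "(*)"] refl eq_matI) (auto simp: pad_def)
  also have "\<dots> = pad n (1\<^sub>m m) * pad n (trunc m n X) + pad n (1\<^sub>m m) * (X - pad n (trunc m n X))"
    using assms by (intro mult_add_distrib_mat[of _ n n _ n]) (auto intro: minus_carrier_mat)
  also have "pad n (1\<^sub>m m) * pad n (trunc m n X) = pad n (trunc m n X)"
    using assms(2) pad_mult[OF one_carrier_mat[of m] trunc_carrier[of m n X], of n]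
    by (simp add: left_mult_one_mat[OF trunc_carrier])
  also have "pad n (1\<^sub>m m) * (X - pad n (trunc m n X)) = 0\<^sub>m n n"
  proof (rule eq_matI)
    fix i j assume "i < dim_row (0\<^sub>m n n :: complex mat)" "j < dim_col (0\<^sub>m n n :: complex mat)"
    then have ij: "i < n" "j < n" by auto
    have "(pad n (1\<^sub>m m) * (X - pad n (trunc m n X))) $$ (i, j)
      = (\<Sum>k<n. pad n (1\<^sub>m m) $$ (i, k) * (X - pad n (trunc m n X)) $$ (k, j))"
      using assms ij by (intro mat_mult_entry) (auto intro: minus_carrier_mat)
    also have "\<dots> = 0" using assms ij by (intro sum.neutral) (auto simp: pad_def trunc_def)
    finally show "(pad n (1\<^sub>m m) * (X - pad n (trunc m n X))) $$ (i, j) = 0\<^sub>m n n $$ (i, j)" using ij by simp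
  qed (auto simp: pad_def)
  finally show ?thesis by simp
qed

lemma mult_pad_one:
  assumes X: "X \<in> carrier_mat m n" and "m \<le> n"
  shows "pad n X * pad n (1\<^sub>m m) = pad n (trunc m m X)"
proof (rule eq_matI)
  fix i j assume "i < dim_row (pad n (trunc m m X))" "j < dim_col (pad n (trunc m m X))"
  then have ij: "i < n" "j < n" by (auto simp: pad_def)
  have "(pad n X * pad n (1\<^sub>m m)) $$ (i, j) = (\<Sum>k<n. pad n X $$ (i, k) * pad n (1\<^sub>m m) $$ (k, j))"
    by (rule mat_mult_entry) (use ij in auto)
  also have "\<dots> = (\<Sum>k<n. if k = j then (if i < m \<and> j < m then X $$ (i, j) else 0) else 0)"
    using assms ij by (intro sum.cong) (auto simp: pad_def)
  finally show "(pad n X * pad n (1\<^sub>m m)) $$ (i, j) = pad n (trunc m m X) $$ (i, j)"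
    using ij assms by (auto simp: pad_def trunc_def)
qed (auto simp: pad_def)

lemma pad_one_conj:
  assumes "X \<in> carrier_mat n n" "m \<le> n"
  shows "pad n (1\<^sub>m m) * X * pad n (1\<^sub>m m) = pad n (trunc m m X)"
proof -
  have "trunc m m (trunc m n X) = trunc m m X" using assms(2) by (intro eq_matI) (auto simp: trunc_def)
  then show ?thesis unfolding pad_one_mult[OF assms] mult_pad_one[OF trunc_carrier assms(2)] by simp
qed

text \<open>Two class functions on the corner, equal on diagonal matrices by
  \<open>schur_poly_restrict\<close>. Since \<open>pad n P\<close> need not be invertible, the
  invariance of the left one comes from multiplicativity of the padding and cyclicity of the
  trace.\<close>

lemma pad_trace:
  assumes fr: "family n d N r" and fq: "family m d M q" and mn: "m \<le> n" and la: "la \<in> partitions d"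
    and A: "A \<in> carrier_mat m m"
  shows "mat_trace (r la (pad n A)) = mat_trace (q la A)"
proof -
  note r = familyD(1)[OF fr la] and q = familyD(1)[OF fq la]
  note rc = mrepD(1)[OF r]
  have "mat_trace (r la (pad n A)) - mat_trace (q la A) = 0"
  proof (rule class_function_zero[OF _ _ _ A])
    have "curve_poly m (\<lambda>X. mat_trace (r la (pad n X)))"
    proof (rule curve_poly_comp[OF mrep_trace_curve_poly[OF r]])
      fix i j assume ij: "i < n" "j < n"
      have "curve_poly m (\<lambda>X. if i < m \<and> j < m then X $$ (i, j) else 0)"
        by (cases "i < m \<and> j < m") (auto intro: curve_poly_entry curve_poly_const)
      then show "curve_poly m (\<lambda>X. pad n X $$ (i, j))"
        by (rule curve_poly_cong) (use ij in \<open>auto simp: pad_def\<close>)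
    qed simp
    then show "curve_poly m (\<lambda>X. mat_trace (r la (pad n X)) - mat_trace (q la X))"
      by (intro curve_poly_diff mrep_trace_curve_poly[OF q])
  next
    fix X P Q :: "complex mat"
    assume c: "X \<in> carrier_mat m m" "P \<in> carrier_mat m m" "Q \<in> carrier_mat m m" "Q * P = 1\<^sub>m m"
    have PXQ: "P * X * Q = P * (X * Q)" "(X * Q) * P = X"
      using c by (auto simp: assoc_mult_mat[of _ m m _ m _ m])
    have "mat_trace (r la (pad n (P * X * Q))) = mat_trace (r la (pad n P) * r la (pad n (X * Q)))"
    proof -
      have "pad n (P * (X * Q)) = pad n P * pad n (X * Q)"
        using c mn by (intro pad_mult[symmetric, of _ m m _ m]) auto
      then show ?thesis unfolding PXQ(1) by (simp only: mrepD(2)[OF r pad_carrier pad_carrier])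
    qed
    also have "\<dots> = mat_trace (r la (pad n (X * Q)) * r la (pad n P))"
      by (rule mat_trace_comm[OF rc[OF pad_carrier] rc[OF pad_carrier]])
    also have "\<dots> = mat_trace (r la (pad n X))"
      using c mn PXQ(2) by (simp add: mrepD(2)[OF r, symmetric] pad_mult[of _ m m _ m])
    finally show "mat_trace (r la (pad n (P * X * Q))) - mat_trace (q la (P * X * Q))
      = mat_trace (r la (pad n X)) - mat_trace (q la X)" using mrep_trace_conj[OF q c] by simp
  next
    fix x
    have "pad n (mat_diag m x) = mat_diag n (\<lambda>i. if i < m then x i else 0)"
      using mn by (intro eq_matI) (auto simp: pad_def mat_diag_def)
    then show "mat_trace (r la (pad n (mat_diag m x))) - mat_trace (q la (mat_diag m x)) = 0"
      by (simp add: familyD(2)[OF fr la] familyD(2)[OF fq la] schur_poly_restrict[OF mn])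
  qed
  then show ?thesis by simp
qed

text \<open>\<open>pad n A\<close> absorbs the idempotent on both sides, so by cyclicity only the
  corner of \<open>X\<close> matters; there the traces of \<open>r la\<close> and
  \<open>q la\<close> agree.\<close>

lemma pad_mult_trace:
  assumes fr: "family n d N r" and fq: "family m d M q" and mn: "m \<le> n" and la: "la \<in> partitions d"
    and A: "A \<in> carrier_mat m m" and X: "X \<in> carrier_mat n n"
  shows "mat_trace (r la (pad n A) * r la X) = mat_trace (q la A * q la (trunc m m X))"
proof -
  note r = familyD(1)[OF fr la] and q = familyD(1)[OF fq la]
  note rc = mrepD(1)[OF r]
  let ?e = "pad n (1\<^sub>m m)"
  have AX: "pad n A * X \<in> carrier_mat n n" using X by (intro mult_carrier_mat[of _ _ n]) auto
  have eA: "?e * pad n A = pad n A" "pad n A * ?e = pad n A" using A mn by (simp_all add: pad_mult[of _ m m _ m])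
  have "mat_trace (r la (pad n A) * r la X) = mat_trace (r la ?e * (r la (pad n A) * r la X))"
  proof -
    have "?e * (pad n A * X) = pad n A * X"
      unfolding assoc_mult_mat[OF pad_carrier pad_carrier X, symmetric] eA(1) ..
    then show ?thesis
      by (simp only: mrepD(2)[OF r pad_carrier X, symmetric] mrepD(2)[OF r pad_carrier AX, symmetric])
  qed
  also have "\<dots> = mat_trace ((r la (pad n A) * r la X) * r la ?e)"
    by (rule mat_trace_comm[OF rc[OF pad_carrier] mult_carrier_mat[OF rc[OF pad_carrier] rc[OF X]]])
  also have "(r la (pad n A) * r la X) * r la ?e = r la (pad n A * X * ?e)"
    by (simp only: mrepD(2)[OF r pad_carrier X] mrepD(2)[OF r AX pad_carrier])
  also have "pad n A * X * ?e = pad n A * (?e * X * ?e)"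
  proof -
    have Xe: "X * ?e \<in> carrier_mat n n" using X by (intro mult_carrier_mat[of _ _ n]) auto
    have "pad n A * (?e * X * ?e) = pad n A * ?e * (X * ?e)"
      unfolding assoc_mult_mat[OF pad_carrier X pad_carrier] assoc_mult_mat[OF pad_carrier pad_carrier Xe] ..
    then show ?thesis unfolding eA(2) assoc_mult_mat[OF pad_carrier X pad_carrier] ..
  qed
  also have "?e * X * ?e = pad n (trunc m m X)" by (rule pad_one_conj[OF X mn])
  also have "pad n A * pad n (trunc m m X) = pad n (A * trunc m m X)"
    using A mn by (intro pad_mult[of _ m m _ m]) auto
  also have "mat_trace (r la \<dots>) = mat_trace (q la (A * trunc m m X))"
    using A by (intro pad_trace[OF fr fq mn la]) auto
  also have "q la (A * trunc m m X) = q la A * q la (trunc m m X)"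
    using A by (intro mrepD(2)[OF q]) auto
  finally show ?thesis .
qed

text \<open>The coefficients of \<open>A \<mapsto> r(A \<oplus> 0)\<close> in terms of those of \<open>q\<close> form a system of matrix
  units, one row and one column of which are the wanted intertwiners.\<close>

lemma pad_intertwiners:
  assumes fr: "family n d N r" and fq: "family m d M q" and mn: "m \<le> n" and la: "la \<in> partitions d"
  shows "\<exists>K L. K \<in> carrier_mat (M la) (N la) \<and> L \<in> carrier_mat (N la) (M la) \<and> K * L = 1\<^sub>m (M la) \<and>
    L * K = r la (pad n (1\<^sub>m m)) \<and> (\<forall>A\<in>carrier_mat m m. K * r la (pad n A) = q la A * K)"
proof -
  define \<rho> \<kappa> where "\<rho> = r la" and "\<kappa> = q la"
  define a b where "a = N la" and "b = M la"
  note r = familyD(1)[OF fr la, folded \<rho>_def a_def] and q = familyD(1)[OF fq la, folded \<kappa>_def b_def]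
  note rc = mrepD(1)[OF r] and qc = mrepD(1)[OF q]
  let ?e = "pad n (1\<^sub>m m)"
  have ptr: "mat_trace (\<rho> (pad n A) * \<rho> X) = mat_trace (\<kappa> A * \<kappa> (trunc m m X))"
    if "A \<in> carrier_mat m m" "X \<in> carrier_mat n n" for A X
    using pad_mult_trace[OF fr fq mn la that] by (simp add: \<rho>_def \<kappa>_def)
  have indr: "B = 0\<^sub>m a a" if "\<And>X. X \<in> carrier_mat n n \<Longrightarrow> mat_trace (B * \<rho> X) = 0" "B \<in> carrier_mat a a" for B
    using family_independent1[OF fr la, of B] that GL_carrierD by (simp add: \<rho>_def a_def)
  have indq: "c k l = c' k l"
    if "\<And>X. X \<in> carrier_mat m m \<Longrightarrow> (\<Sum>k<b. \<Sum>l<b. \<kappa> X $$ (k, l) * c k l) = (\<Sum>k<b. \<Sum>l<b. \<kappa> X $$ (k, l) * c' k l)"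
      "k < b" "l < b" for c c' k l
  proof -
    have "c k l - c' k l = 0"
    proof (rule family_coefficients_independent1[OF fq la, of "\<lambda>k l. c k l - c' k l"])
      fix X assume "X \<in> carrier (GL m)"
      from that(1)[OF GL_carrierD[OF this]]
      show "(\<Sum>k<M la. \<Sum>l<M la. (c k l - c' k l) * q la X $$ (k, l)) = 0"
        by (simp add: \<kappa>_def b_def algebra_simps sum_subtractf)
    qed (use that in \<open>auto simp: b_def\<close>)
    then show ?thesis by simp
  qed
  \<comment> \<open>A formal sum killed by \<open>\<kappa>\<close> yields a matrix \<open>B\<close>
    whose product with every \<open>\<rho> X\<close> has trace 0, since that trace only sees the
    corner of \<open>X\<close>. Independence of the coefficients of \<open>\<rho>\<close> makes
    \<open>B\<close> zero.\<close>
  have ex: "\<exists>\<theta>. \<forall>A\<in>carrier_mat m m. \<rho> (pad n A) $$ (i, j) = (\<Sum>p\<in>{..<b} \<times> {..<b}. \<theta> p * \<kappa> A $$ p)"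
    if ij: "i < a" "j < a" for i j
  proof (rule functionals_span)
    fix F c
    assume F: "finite F" "F \<subseteq> carrier_mat m m"
      and k: "\<And>p. p \<in> {..<b} \<times> {..<b} \<Longrightarrow> (\<Sum>A\<in>F. c A * \<kappa> A $$ p) = 0"
    define B where "B = mat a a (\<lambda>ij. \<Sum>A\<in>F. c A * \<rho> (pad n A) $$ ij)"
    have B: "B \<in> carrier_mat a a" by (simp add: B_def)
    have "B = 0\<^sub>m a a"
    proof (rule indr[OF _ B])
      fix X :: "complex mat" assume X: "X \<in> carrier_mat n n"
      have "mat_trace (B * \<rho> X) = (\<Sum>i<a. \<Sum>j<a. \<Sum>A\<in>F. c A * (\<rho> (pad n A) $$ (i, j) * \<rho> X $$ (j, i)))"
        unfolding mat_trace_mult[OF B rc[OF X]] by (simp add: B_def sum_distrib_right mult.assoc)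
      also have "\<dots> = (\<Sum>i<a. \<Sum>A\<in>F. \<Sum>j<a. c A * (\<rho> (pad n A) $$ (i, j) * \<rho> X $$ (j, i)))"
        by (rule sum.cong[OF refl], rule sum.swap)
      also have "\<dots> = (\<Sum>A\<in>F. \<Sum>i<a. \<Sum>j<a. c A * (\<rho> (pad n A) $$ (i, j) * \<rho> X $$ (j, i)))"
        by (rule sum.swap)
      also have "\<dots> = (\<Sum>A\<in>F. \<Sum>k<b. \<Sum>l<b. c A * (\<kappa> A $$ (k, l) * \<kappa> (trunc m m X) $$ (l, k)))"
      proof (rule sum.cong)
        fix A assume "A \<in> F"
        then have A: "A \<in> carrier_mat m m" using F by blast
        show "(\<Sum>i<a. \<Sum>j<a. c A * (\<rho> (pad n A) $$ (i, j) * \<rho> X $$ (j, i)))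
          = (\<Sum>k<b. \<Sum>l<b. c A * (\<kappa> A $$ (k, l) * \<kappa> (trunc m m X) $$ (l, k)))"
          using ptr[OF A X]
          unfolding mat_trace_mult[OF rc[OF pad_carrier] rc[OF X]] mat_trace_mult[OF qc[OF A] qc[OF trunc_carrier]]
          by (simp add: sum_distrib_left[symmetric])
      qed simp
      also have "\<dots> = (\<Sum>k<b. \<Sum>A\<in>F. \<Sum>l<b. c A * (\<kappa> A $$ (k, l) * \<kappa> (trunc m m X) $$ (l, k)))"
        by (rule sum.swap)
      also have "\<dots> = (\<Sum>k<b. \<Sum>l<b. \<Sum>A\<in>F. c A * (\<kappa> A $$ (k, l) * \<kappa> (trunc m m X) $$ (l, k)))"
        by (rule sum.cong[OF refl], rule sum.swap)
      also have "\<dots> = (\<Sum>k<b. \<Sum>l<b. (\<Sum>A\<in>F. c A * \<kappa> A $$ (k, l)) * \<kappa> (trunc m m X) $$ (l, k))"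
        by (simp add: sum_distrib_right mult.assoc)
      also have "\<dots> = 0" using k by simp
      finally show "mat_trace (B * \<rho> X) = 0" .
    qed
    then have "B $$ (i, j) = 0" using ij by simp
    then show "(\<Sum>A\<in>F. c A * \<rho> (pad n A) $$ (i, j)) = 0" using ij by (simp add: B_def)
  qed simp
  define \<theta> where "\<theta> = (\<lambda>i j. SOME \<theta>. \<forall>A\<in>carrier_mat m m.
      \<rho> (pad n A) $$ (i, j) = (\<Sum>p\<in>{..<b} \<times> {..<b}. \<theta> p * \<kappa> A $$ p))"
  have \<theta>: "\<And>i j A. i < a \<Longrightarrow> j < a \<Longrightarrow> A \<in> carrier_mat m m \<Longrightarrow>
      \<rho> (pad n A) $$ (i, j) = (\<Sum>p\<in>{..<b} \<times> {..<b}. \<theta> i j p * \<kappa> A $$ p)"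
    unfolding \<theta>_def by (rule bspec[OF someI_ex[OF ex]])
  \<comment> \<open>These are the matrix units: with \<open>K\<close> and \<open>L\<close> found
    below, \<open>T k l\<close> is \<open>L\<close> times the elementary matrix at
    \<open>(k, l)\<close> times \<open>K\<close>.\<close>
  define T where "T = (\<lambda>k l. mat a a (\<lambda>(i, j). \<theta> i j (k, l)))"
  have T: "T k l \<in> carrier_mat a a" for k l by (simp add: T_def)
  have rT: "\<rho> (pad n A) $$ (i, j) = (\<Sum>k<b. \<Sum>l<b. \<kappa> A $$ (k, l) * T k l $$ (i, j))"
    if "i < a" "j < a" "A \<in> carrier_mat m m" for i j A
    unfolding \<theta>[OF that] using that by (simp add: T_def sum.cartesian_product split_def mult.commute)
  \<comment> \<open>The coefficients of \<open>\<kappa> A\<close> are compared in two expansions of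
    \<open>\<rho> (pad n (A * C))\<close>, one by multiplicativity of \<open>\<rho>\<close> and one
    by that of \<open>\<kappa>\<close>.\<close>
  have Tr: "(T k l * \<rho> (pad n C)) $$ (i, j) = (\<Sum>p<b. \<kappa> C $$ (l, p) * T k p $$ (i, j))"
    if kl: "k < b" "l < b" and ij: "i < a" "j < a" and C: "C \<in> carrier_mat m m" for k l i j C
  proof (rule indq[OF _ kl])
    fix A :: "complex mat" assume A: "A \<in> carrier_mat m m"
    have AC: "A * C \<in> carrier_mat m m" using A C by simp
    have "\<rho> (pad n (A * C)) = \<rho> (pad n A) * \<rho> (pad n C)"
      using A C mn by (simp add: pad_mult[of _ m m _ m, symmetric] mrepD(2)[OF r])
    then have "\<rho> (pad n (A * C)) $$ (i, j) = (\<Sum>h<a. \<rho> (pad n A) $$ (i, h) * \<rho> (pad n C) $$ (h, j))"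
      using mat_mult_entry[OF rc[OF pad_carrier] rc[OF pad_carrier] ij] by simp
    also have "\<dots> = (\<Sum>h<a. \<Sum>k<b. \<Sum>l<b. \<kappa> A $$ (k, l) * (T k l $$ (i, h) * \<rho> (pad n C) $$ (h, j)))"
      using rT[OF ij(1) _ A] by (simp add: sum_distrib_right mult.assoc)
    also have "\<dots> = (\<Sum>k<b. \<Sum>h<a. \<Sum>l<b. \<kappa> A $$ (k, l) * (T k l $$ (i, h) * \<rho> (pad n C) $$ (h, j)))"
      by (rule sum.swap)
    also have "\<dots> = (\<Sum>k<b. \<Sum>l<b. \<Sum>h<a. \<kappa> A $$ (k, l) * (T k l $$ (i, h) * \<rho> (pad n C) $$ (h, j)))"
      by (rule sum.cong[OF refl], rule sum.swap)
    also have "\<dots> = (\<Sum>k<b. \<Sum>l<b. \<kappa> A $$ (k, l) * (T k l * \<rho> (pad n C)) $$ (i, j))"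
      by (simp add: mat_mult_entry[OF T rc[OF pad_carrier] ij] sum_distrib_left)
    finally have e1: "\<rho> (pad n (A * C)) $$ (i, j) = (\<Sum>k<b. \<Sum>l<b. \<kappa> A $$ (k, l) * (T k l * \<rho> (pad n C)) $$ (i, j))" .
    have "\<rho> (pad n (A * C)) $$ (i, j) = (\<Sum>k<b. \<Sum>p<b. (\<Sum>l<b. \<kappa> A $$ (k, l) * \<kappa> C $$ (l, p)) * T k p $$ (i, j))"
      unfolding rT[OF ij AC] mrepD(2)[OF q A C] 
      by (intro sum.cong refl arg_cong2[of _ _ _ _ "(*)"] mat_mult_entry[OF qc[OF A] qc[OF C]]) auto
    also have "\<dots> = (\<Sum>k<b. \<Sum>l<b. \<kappa> A $$ (k, l) * (\<Sum>p<b. \<kappa> C $$ (l, p) * T k p $$ (i, j)))"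
    proof (rule sum.cong[OF refl])
      fix k
      have "(\<Sum>p<b. (\<Sum>l<b. \<kappa> A $$ (k, l) * \<kappa> C $$ (l, p)) * T k p $$ (i, j))
        = (\<Sum>p<b. \<Sum>l<b. \<kappa> A $$ (k, l) * (\<kappa> C $$ (l, p) * T k p $$ (i, j)))"
        by (simp add: sum_distrib_right mult.assoc)
      also have "\<dots> = (\<Sum>l<b. \<Sum>p<b. \<kappa> A $$ (k, l) * (\<kappa> C $$ (l, p) * T k p $$ (i, j)))"
        by (rule sum.swap)
      finally show "(\<Sum>p<b. (\<Sum>l<b. \<kappa> A $$ (k, l) * \<kappa> C $$ (l, p)) * T k p $$ (i, j))
        = (\<Sum>l<b. \<kappa> A $$ (k, l) * (\<Sum>p<b. \<kappa> C $$ (l, p) * T k p $$ (i, j)))"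
        by (simp add: sum_distrib_left)
    qed
    finally show "(\<Sum>k<b. \<Sum>l<b. \<kappa> A $$ (k, l) * (T k l * \<rho> (pad n C)) $$ (i, j))
      = (\<Sum>k<b. \<Sum>l<b. \<kappa> A $$ (k, l) * (\<Sum>p<b. \<kappa> C $$ (l, p) * T k p $$ (i, j)))" using e1 by simp
  qed
  \<comment> \<open>Comparing the coefficients of \<open>\<kappa> C\<close> in \<open>Tr\<close>
    gives the multiplication table of matrix units.\<close>
  have TT: "(T k l * T p p') $$ (i, j) = (if l = p then T k p' $$ (i, j) else 0)"
    if kl: "k < b" "l < b" and pq: "p < b" "p' < b" and ij: "i < a" "j < a" for k l p p' i j
  proof (rule indq[OF _ pq])
    fix C :: "complex mat" assume C: "C \<in> carrier_mat m m"
    have "(T k l * \<rho> (pad n C)) $$ (i, j) = (\<Sum>h<a. T k l $$ (i, h) * \<rho> (pad n C) $$ (h, j))"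
      by (rule mat_mult_entry[OF T rc[OF pad_carrier] ij])
    also have "\<dots> = (\<Sum>h<a. \<Sum>p<b. \<Sum>p'<b. \<kappa> C $$ (p, p') * (T k l $$ (i, h) * T p p' $$ (h, j)))"
      using rT[OF _ ij(2) C] by (simp add: sum_distrib_left mult_ac)
    also have "\<dots> = (\<Sum>p<b. \<Sum>h<a. \<Sum>p'<b. \<kappa> C $$ (p, p') * (T k l $$ (i, h) * T p p' $$ (h, j)))"
      by (rule sum.swap)
    also have "\<dots> = (\<Sum>p<b. \<Sum>p'<b. \<Sum>h<a. \<kappa> C $$ (p, p') * (T k l $$ (i, h) * T p p' $$ (h, j)))"
      by (rule sum.cong[OF refl], rule sum.swap)
    also have "\<dots> = (\<Sum>p<b. \<Sum>p'<b. \<kappa> C $$ (p, p') * (T k l * T p p') $$ (i, j))"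
      by (simp add: mat_mult_entry[OF T T ij] sum_distrib_left)
    finally have e1: "(T k l * \<rho> (pad n C)) $$ (i, j) = (\<Sum>p<b. \<Sum>p'<b. \<kappa> C $$ (p, p') * (T k l * T p p') $$ (i, j))" .
    have "(\<Sum>p<b. \<Sum>p'<b. \<kappa> C $$ (p, p') * (if l = p then T k p' $$ (i, j) else 0))
      = (\<Sum>p<b. if l = p then \<Sum>p'<b. \<kappa> C $$ (l, p') * T k p' $$ (i, j) else 0)"
      by (rule sum.cong) auto
    also have "\<dots> = (\<Sum>p'<b. \<kappa> C $$ (l, p') * T k p' $$ (i, j))" using kl by simp
    finally show "(\<Sum>p<b. \<Sum>p'<b. \<kappa> C $$ (p, p') * (T k l * T p p') $$ (i, j))
      = (\<Sum>p<b. \<Sum>p'<b. \<kappa> C $$ (p, p') * (if l = p then T k p' $$ (i, j) else 0))"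
      using e1 Tr[OF kl ij C] by simp
  qed
  have tre: "mat_trace (\<rho> (pad n A)) = mat_trace (\<kappa> A)" if "A \<in> carrier_mat m m" for A
    unfolding \<rho>_def \<kappa>_def by (rule pad_trace[OF fr fq mn la that])
  have "\<exists>K L. K \<in> carrier_mat b a \<and> L \<in> carrier_mat a b \<and> K * L = 1\<^sub>m b \<and> \<rho> ?e * L = L \<and>
    (\<forall>A\<in>carrier_mat m m. K * \<rho> (pad n A) = \<kappa> A * K)"
  proof (cases "b = 0")
    case True
    have "0\<^sub>m b a * \<rho> (pad n A) = \<kappa> A * 0\<^sub>m b a" if "A \<in> carrier_mat m m" for A
      by (rule eq_matI) (use True qc[OF that] rc[OF pad_carrier[of n A]] in auto)
    moreover have "\<rho> ?e * 0\<^sub>m a b = 0\<^sub>m a b" by (rule right_mult_zero_mat[OF rc[OF pad_carrier]])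
    moreover have "0\<^sub>m b a * 0\<^sub>m a b = (1\<^sub>m b :: complex mat)" by (rule eq_matI) (use True in auto)
    ultimately show ?thesis
      by (intro exI[where x = "0\<^sub>m b a" and P = "\<lambda>K. \<exists>L. _ K L"] exI[where x = "0\<^sub>m a b"] conjI ballI) simp_all
  next
    case False
    \<comment> \<open>If \<open>T 0 0\<close> were zero, all units would vanish, and with them the
      trace of \<open>\<rho>\<close> at the idempotent; but that trace equals the one of
      \<open>\<kappa>\<close> at the identity, which is \<open>b\<close>.\<close>
    have "\<exists>u<a. \<exists>v<a. T 0 0 $$ (u, v) \<noteq> 0"
    proof (rule ccontr)
      assume *: "\<not> ?thesis"
      then have T00: "T 0 0 = 0\<^sub>m a a" using T[of 0 0] by (intro eq_matI) auto
      have Tk0: "T k 0 $$ (i, j) = 0" if "k < b" "i < a" "j < a" for k i j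
        using TT[of k 0 0 0 i j] that False T[of k 0] by (simp add: T00)
      have "T k l $$ (i, j) = 0" if "k < b" "l < b" "i < a" "j < a" for k l i j
      proof -
        have "T k l $$ (i, j) = (T k 0 * T 0 l) $$ (i, j)" using TT[of k 0 0 l i j] that False by simp
        also have "\<dots> = (\<Sum>h<a. T k 0 $$ (i, h) * T 0 l $$ (h, j))" by (rule mat_mult_entry[OF T T that(3,4)])
        finally show ?thesis using Tk0 that by simp
      qed
      then have "mat_trace (\<rho> ?e) = 0" by (simp add: mat_trace_eq[OF rc[OF pad_carrier]] rT)
      then have "mat_trace (\<kappa> (1\<^sub>m m)) = 0" using tre[of "1\<^sub>m m"] by simp
      then show False using False by (simp add: mrepD(3)[OF q] mat_trace_one)
    qed
    then obtain u v where uv: "u < a" "v < a" "T 0 0 $$ (u, v) \<noteq> 0" by blast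
    \<comment> \<open>Row \<open>u\<close> of the units \<open>T 0 k\<close> and column
      \<open>v\<close> of the units \<open>T k 0\<close>; dividing by the entry
      \<open>(u, v)\<close> of \<open>T 0 0\<close> normalises \<open>K * L\<close> to the
      identity.\<close>
    define K where "K = mat b a (\<lambda>(k, j). T 0 k $$ (u, j))"
    define L where "L = mat a b (\<lambda>(i, k). T k 0 $$ (i, v) / T 0 0 $$ (u, v))"
    have KL: "K \<in> carrier_mat b a" "L \<in> carrier_mat a b" by (simp_all add: K_def L_def)
    have "K * L = 1\<^sub>m b"
    proof (rule eq_matI)
      fix k l assume "k < dim_row (1\<^sub>m b :: complex mat)" "l < dim_col (1\<^sub>m b :: complex mat)"
      then have kl: "k < b" "l < b" by auto
      have "(K * L) $$ (k, l) = (\<Sum>h<a. T 0 k $$ (u, h) * T l 0 $$ (h, v)) / T 0 0 $$ (u, v)"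
        unfolding mat_mult_entry[OF KL kl] using kl by (simp add: K_def L_def sum_divide_distrib)
      also have "\<dots> = (T 0 k * T l 0) $$ (u, v) / T 0 0 $$ (u, v)"
        unfolding mat_mult_entry[OF T T uv(1,2)] ..
      finally show "(K * L) $$ (k, l) = 1\<^sub>m b $$ (k, l)" using TT[of 0 k l 0 u v] kl uv False by simp
    qed (use KL in auto)
    moreover have "\<rho> ?e * L = L"
    proof (rule eq_matI)
      fix i k assume "i < dim_row L" "k < dim_col L"
      then have ik: "i < a" "k < b" by (auto simp: L_def)
      have e: "\<rho> ?e $$ (i, h) = (\<Sum>l<b. T l l $$ (i, h))" if h: "h < a" for h
      proof -
        have "\<rho> ?e $$ (i, h) = (\<Sum>p<b. \<Sum>l<b. if l = p then T l l $$ (i, h) else 0)"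
          unfolding rT[OF ik(1) h one_carrier_mat] mrepD(3)[OF q] by (intro sum.cong) auto
        then show ?thesis by simp
      qed
      have "(\<rho> ?e * L) $$ (i, k) = (\<Sum>h<a. (\<Sum>l<b. T l l $$ (i, h)) * L $$ (h, k))"
        unfolding mat_mult_entry[OF rc[OF pad_carrier] KL(2) ik] using e by simp
      also have "\<dots> = (\<Sum>h<a. \<Sum>l<b. T l l $$ (i, h) * T k 0 $$ (h, v) / T 0 0 $$ (u, v))"
        using ik by (simp add: L_def sum_distrib_right sum_divide_distrib)
      also have "\<dots> = (\<Sum>l<b. \<Sum>h<a. T l l $$ (i, h) * T k 0 $$ (h, v) / T 0 0 $$ (u, v))"
        by (rule sum.swap)
      also have "\<dots> = (\<Sum>l<b. (T l l * T k 0) $$ (i, v) / T 0 0 $$ (u, v))"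
        by (simp add: mat_mult_entry[OF T T ik(1) uv(2)] sum_divide_distrib)
      also have "\<dots> = (\<Sum>l<b. if l = k then T k 0 $$ (i, v) / T 0 0 $$ (u, v) else 0)"
        by (rule sum.cong) (use TT[OF _ _ ik(2) _ ik(1) uv(2)] False in auto)
      finally show "(\<rho> ?e * L) $$ (i, k) = L $$ (i, k)" using ik by (simp add: L_def)
    qed (use rc[OF pad_carrier[of n "1\<^sub>m m"]] in \<open>auto simp: L_def\<close>)
    moreover have "K * \<rho> (pad n A) = \<kappa> A * K" if A: "A \<in> carrier_mat m m" for A
    proof (rule eq_matI)
      fix k j assume "k < dim_row (\<kappa> A * K)" "j < dim_col (\<kappa> A * K)"
      then have kj: "k < b" "j < a" using qc[OF A] KL by auto
      have "(K * \<rho> (pad n A)) $$ (k, j) = (T 0 k * \<rho> (pad n A)) $$ (u, j)"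
        unfolding mat_mult_entry[OF KL(1) rc[OF pad_carrier] kj] mat_mult_entry[OF T rc[OF pad_carrier] uv(1) kj(2)]
        using kj by (simp add: K_def)
      also have "\<dots> = (\<Sum>p<b. \<kappa> A $$ (k, p) * T 0 p $$ (u, j))"
        by (rule Tr) (use kj uv A False in auto)
      also have "\<dots> = (\<kappa> A * K) $$ (k, j)"
        unfolding mat_mult_entry[OF qc[OF A] KL(1) kj] using kj by (simp add: K_def)
      finally show "(K * \<rho> (pad n A)) $$ (k, j) = (\<kappa> A * K) $$ (k, j)" .
    qed (use KL qc[OF A] rc[OF pad_carrier[of n A]] in auto)
    ultimately show ?thesis using KL by blast
  qed
  then obtain K L where KL: "K \<in> carrier_mat b a" "L \<in> carrier_mat a b" "K * L = 1\<^sub>m b" "\<rho> ?e * L = L"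
    and K: "\<And>A. A \<in> carrier_mat m m \<Longrightarrow> K * \<rho> (pad n A) = \<kappa> A * K" by blast
  have re: "\<rho> ?e \<in> carrier_mat a a" by (rule rc) simp
  have LK: "L * K \<in> carrier_mat a a" using KL by simp
  have Ke: "K * \<rho> ?e = K" using K[of "1\<^sub>m m"] KL by (simp add: mrepD(3)[OF q])
  \<comment> \<open>Against every \<open>\<rho> X\<close> both matrices have the same trace, namely
    that of \<open>\<kappa>\<close> at the corner of \<open>X\<close>; independence turns this into
    equality.\<close>
  have "\<rho> ?e - L * K = 0\<^sub>m a a"
  proof (rule indr)
    fix X :: "complex mat" assume X: "X \<in> carrier_mat n n"
    note rX = rc[OF X]
    have tX: "trunc m m X \<in> carrier_mat m m" by simp
    have eXe: "?e * X * ?e = pad n (trunc m m X)"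
      by (rule pad_one_conj[OF X mn])
    have "mat_trace (L * K * \<rho> X) = mat_trace (\<rho> ?e * L * (K * \<rho> ?e * \<rho> X))"
      using KL Ke rX by (simp add: assoc_mult_mat[of L a b K a "\<rho> X" a])
    also have "\<dots> = mat_trace (\<rho> ?e * (L * (K * \<rho> ?e * \<rho> X)))"
      using KL re rX by (intro arg_cong[of _ _ mat_trace] assoc_mult_mat) auto
    also have "\<dots> = mat_trace (L * (K * \<rho> ?e * \<rho> X) * \<rho> ?e)"
      using KL re rX by (intro mat_trace_comm) auto
    also have "\<dots> = mat_trace (L * ((K * \<rho> ?e * \<rho> X) * \<rho> ?e))"
      using KL re rX by (intro arg_cong[of _ _ mat_trace] assoc_mult_mat) auto
    also have "(K * \<rho> ?e * \<rho> X) * \<rho> ?e = K * (\<rho> ?e * \<rho> X * \<rho> ?e)"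
      using KL re rX by (simp add: assoc_mult_mat[of _ b a _ a _ a] assoc_mult_mat[of _ a a _ a _ a])
    also have "\<rho> ?e * \<rho> X * \<rho> ?e = \<rho> (pad n (trunc m m X))"
      unfolding eXe[symmetric] mrepD(2)[OF r mult_carrier_mat[OF pad_carrier X] pad_carrier] mrepD(2)[OF r pad_carrier X] ..
    also have "K * \<dots> = \<kappa> (trunc m m X) * K" by (rule K[OF tX])
    also have "mat_trace (L * (\<kappa> (trunc m m X) * K)) = mat_trace (\<kappa> (trunc m m X) * K * L)"
      using KL qc[OF tX] by (intro mat_trace_comm) auto
    also have "\<kappa> (trunc m m X) * K * L = \<kappa> (trunc m m X)"
      using KL qc[OF tX] by (simp add: assoc_mult_mat[of _ b b _ a _ b])
    also have "mat_trace (\<kappa> (trunc m m X)) = mat_trace (\<rho> ?e * \<rho> X)"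
      using ptr[OF one_carrier_mat X] qc[OF tX] by (simp add: mrepD(3)[OF q])
    finally have "mat_trace (\<rho> ?e * \<rho> X) - mat_trace (L * K * \<rho> X) = 0" by simp
    moreover have "mat_trace ((\<rho> ?e - L * K) * \<rho> X) = mat_trace (\<rho> ?e * \<rho> X) - mat_trace (L * K * \<rho> X)"
      unfolding minus_mult_distrib_mat[OF re LK rX]
      by (rule mat_trace_diff[OF mult_carrier_mat[OF re rX] mult_carrier_mat[OF LK rX]])
    ultimately show "mat_trace ((\<rho> ?e - L * K) * \<rho> X) = 0" by simp
  qed (use re LK in \<open>auto intro: minus_carrier_mat\<close>)
  then have "L * K = \<rho> ?e" using minus_mat_eq_zeroD[OF re LK] by simp
  then show ?thesis using KL K unfolding \<rho>_def \<kappa>_def a_def b_def by blast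
qed


lemma sum_mat_trace_add:
  assumes "\<And>l. l \<in> P \<Longrightarrow> A l \<in> carrier_mat (N l) (N l)" "\<And>l. l \<in> P \<Longrightarrow> B l \<in> carrier_mat (N l) (N l)"
  shows "(\<Sum>l\<in>P. mat_trace (A l + B l)) = (\<Sum>l\<in>P. mat_trace (A l)) + (\<Sum>l\<in>P. mat_trace (B l))"
proof -
  have "mat_trace (A l + B l) = mat_trace (A l) + mat_trace (B l)" if "l \<in> P" for l
    using assms[OF that] by (simp add: mat_trace_def sum.distrib)
  then show ?thesis by (simp add: sum.distrib)
qed

section \<open>The equivariant isomorphism from block matrices onto forms\<close>

definition blocks :: "nat \<Rightarrow> (nat list \<Rightarrow> nat) \<Rightarrow> (nat list \<Rightarrow> nat) \<Rightarrow> (nat list \<Rightarrow> complex mat) set" where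
  "blocks d N M = {Z. \<forall>la\<in>partitions d. Z la \<in> carrier_mat (N la) (M la)}"

text \<open>A block \<open>Z la\<close> is an element of the tensor product of the two
  representation spaces, written in coordinates. Recording properties of \<open>\<Psi>\<close>
  instead of a formula allows the case \<open>m \<le> n\<close> to be carried over to the other one.
  As \<open>Z\<close> is a total function, the first clause says that only its values at partitions
  of \<open>d\<close> count.\<close>

locale cauchy_map =
  fixes d m n :: nat and N M :: "nat list \<Rightarrow> nat" and r s :: "nat list \<Rightarrow> complex mat \<Rightarrow> complex mat"
    and \<Psi> :: "(nat list \<Rightarrow> complex mat) \<Rightarrow> complex mat \<Rightarrow> complex"
  assumes \<Psi>_cong: "(\<And>la. la \<in> partitions d \<Longrightarrow> Z la = Z' la) \<Longrightarrow> \<Psi> Z X = \<Psi> Z' X"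
    and \<Psi>_add: "Z \<in> blocks d N M \<Longrightarrow> Z' \<in> blocks d N M \<Longrightarrow> X \<in> carrier_mat m n \<Longrightarrow>
      \<Psi> (\<lambda>la. Z la + Z' la) X = \<Psi> Z X + \<Psi> Z' X"
    and \<Psi>_smult: "Z \<in> blocks d N M \<Longrightarrow> X \<in> carrier_mat m n \<Longrightarrow> \<Psi> (\<lambda>la. c \<cdot>\<^sub>m Z la) X = c * \<Psi> Z X"
    and \<Psi>_forms: "Z \<in> blocks d N M \<Longrightarrow> \<Psi> Z \<in> forms d m n"
    and \<Psi>_surj: "f \<in> forms d m n \<Longrightarrow> \<exists>Z\<in>blocks d N M. \<forall>X\<in>carrier_mat m n. \<Psi> Z X = f X"
    and \<Psi>_inj: "Z \<in> blocks d N M \<Longrightarrow> (\<And>X. X \<in> carrier_mat m n \<Longrightarrow> \<Psi> Z X = 0) \<Longrightarrow>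
      la \<in> partitions d \<Longrightarrow> Z la = 0\<^sub>m (N la) (M la)"
    and \<Psi>_equivariant: "Z \<in> blocks d N M \<Longrightarrow> A \<in> carrier_mat m m \<Longrightarrow> B \<in> carrier_mat n n \<Longrightarrow>
      X \<in> carrier_mat m n \<Longrightarrow> \<Psi> (\<lambda>la. r la B * Z la * (s la A)\<^sup>T) X = \<Psi> Z (A\<^sup>T * X * B)"

lemma cauchy_map_exists_le:
  assumes fr: "family n d N r" and fs: "family m d M s" and mn: "m \<le> n"
  shows "\<exists>\<Psi>. cauchy_map d m n N M r s \<Psi>"
proof -
  \<comment> \<open>Chosen so that \<open>(s la A)\<^sup>T = q la A\<^sup>T\<close>, which lets the
    right factor of the action pass through \<open>K la\<close>.\<close>
  define q where "q = (\<lambda>la A. (s la A\<^sup>T)\<^sup>T)"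
  have fq: "family m d M q" unfolding q_def by (rule family_transpose[OF fs])
  let ?P = "partitions d" and ?e = "pad n (1\<^sub>m m)"
  have "\<forall>la\<in>?P. \<exists>K L. K \<in> carrier_mat (M la) (N la) \<and> L \<in> carrier_mat (N la) (M la) \<and> K * L = 1\<^sub>m (M la) \<and>
    L * K = r la ?e \<and> (\<forall>A\<in>carrier_mat m m. K * r la (pad n A) = q la A * K)"
    using pad_intertwiners[OF fr fq mn] by blast
  from bchoice[OF this] obtain K where
    "\<forall>la\<in>?P. \<exists>L. K la \<in> carrier_mat (M la) (N la) \<and> L \<in> carrier_mat (N la) (M la) \<and> K la * L = 1\<^sub>m (M la) \<and>
    L * K la = r la ?e \<and> (\<forall>A\<in>carrier_mat m m. K la * r la (pad n A) = q la A * K la)" ..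
  from bchoice[OF this] obtain L where KL':
    "\<forall>la\<in>?P. K la \<in> carrier_mat (M la) (N la) \<and> L la \<in> carrier_mat (N la) (M la) \<and> K la * L la = 1\<^sub>m (M la) \<and>
    L la * K la = r la ?e \<and> (\<forall>A\<in>carrier_mat m m. K la * r la (pad n A) = q la A * K la)" ..
  have K: "K la \<in> carrier_mat (M la) (N la)" and L: "L la \<in> carrier_mat (N la) (M la)"
    and KL: "K la * L la = 1\<^sub>m (M la)" and LK: "L la * K la = r la ?e"
    and Kr: "\<And>A. A \<in> carrier_mat m m \<Longrightarrow> K la * r la (pad n A) = q la A * K la"
    if "la \<in> ?P" for la using KL' that by auto
  have r: "mrep d n (N la) (r la)" and s: "mrep d m (M la) (s la)" if "la \<in> ?P" for la
    using fr fs that familyD(1) by blast+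
  note rc = mrepD(1)[OF r]
  define \<Psi> where "\<Psi> = (\<lambda>(Z :: nat list \<Rightarrow> complex mat) X. \<Sum>la\<in>?P. mat_trace (Z la * K la * r la (pad n X)))"
  have ZK: "Z la * K la \<in> carrier_mat (N la) (N la)" if "Z \<in> blocks d N M" "la \<in> ?P" for Z la
    using that K[of la] by (auto simp: blocks_def)
  have ZKr: "Z la * K la * r la (pad n X) \<in> carrier_mat (N la) (N la)" if "Z \<in> blocks d N M" "la \<in> ?P" for Z la X
    by (rule mult_carrier_mat[OF ZK[OF that] rc[OF that(2) pad_carrier]])
  have Zc: "Z la \<in> carrier_mat (N la) (M la)" if "Z \<in> blocks d N M" "la \<in> ?P" for Z la
    using that by (simp add: blocks_def)
  have add: "\<Psi> (\<lambda>la. Z la + Z' la) X = \<Psi> Z X + \<Psi> Z' X" if Z: "Z \<in> blocks d N M" "Z' \<in> blocks d N M" for Z Z' X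
  proof -
    have "\<Psi> (\<lambda>la. Z la + Z' la) X = (\<Sum>la\<in>?P. mat_trace (Z la * K la * r la (pad n X) + Z' la * K la * r la (pad n X)))"
      unfolding \<Psi>_def
    proof (rule sum.cong)
      fix la assume la: "la \<in> ?P"
      show "mat_trace ((Z la + Z' la) * K la * r la (pad n X))
        = mat_trace (Z la * K la * r la (pad n X) + Z' la * K la * r la (pad n X))"
        unfolding add_mult_distrib_mat[OF Zc[OF Z(1) la] Zc[OF Z(2) la] K[OF la]]
          add_mult_distrib_mat[OF ZK[OF Z(1) la] ZK[OF Z(2) la] rc[OF la pad_carrier]] ..
    qed simp
    also have "\<dots> = \<Psi> Z X + \<Psi> Z' X" unfolding \<Psi>_def by (rule sum_mat_trace_add) (use ZKr Z in auto)
    finally show ?thesis .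
  qed
  have smult: "\<Psi> (\<lambda>la. c \<cdot>\<^sub>m Z la) X = c * \<Psi> Z X" if Z: "Z \<in> blocks d N M" for Z c X
    unfolding \<Psi>_def sum_distrib_left
  proof (rule sum.cong)
    fix la assume la: "la \<in> ?P"
    show "mat_trace (c \<cdot>\<^sub>m Z la * K la * r la (pad n X)) = c * mat_trace (Z la * K la * r la (pad n X))"
      unfolding mult_smult_assoc_mat[OF Zc[OF Z la] K[OF la]] mult_smult_assoc_mat[OF ZK[OF Z la] rc[OF la pad_carrier]]
      by (rule mat_trace_smult[OF ZKr[OF Z la]])
  qed simp
  have form: "\<Psi> Z \<in> forms d m n" if Z: "Z \<in> blocks d N M" for Z
    unfolding \<Psi>_def
  proof (rule forms_sum)
    fix la assume la: "la \<in> ?P"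
    have "(\<lambda>X. \<Sum>i<N la. \<Sum>j<N la. (Z la * K la) $$ (i, j) * r la (pad n X) $$ (j, i)) \<in> forms d m n"
    proof (intro forms_sum forms_scale)
      fix i j assume "i \<in> {..<N la}" "j \<in> {..<N la}"
      then have "(\<lambda>X. r la X $$ (j, i)) \<in> forms d n n" using mrepD(4)[OF r[OF la]] by simp
      then show "(\<lambda>X. r la (pad n X) $$ (j, i)) \<in> forms d m n"
      proof (rule forms_comp)
        fix a b assume ab: "a < n" "b < n"
        have "(\<lambda>X. if a < m then X $$ (a, b) else 0) \<in> forms 1 m n"
          using forms_entry[of a m b n] ab by (cases "a < m") (auto intro: forms_zero)
        then show "(\<lambda>X. pad n X $$ (a, b)) \<in> forms 1 m n"
          by (rule forms_cong) (use ab in \<open>auto simp: pad_def\<close>)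
      qed simp
    qed
    then show "(\<lambda>X. mat_trace (Z la * K la * r la (pad n X))) \<in> forms d m n"
      by (rule forms_cong) (rule mat_trace_mult[OF ZK[OF Z la] rc[OF la pad_carrier]])
  qed
  have surj: "\<exists>Z\<in>blocks d N M. \<forall>X\<in>carrier_mat m n. \<Psi> Z X = f X" if f: "f \<in> forms d m n" for f
  proof -
    \<comment> \<open>Ignoring the lower rows makes \<open>f\<close> a form on square matrices,
      where the coefficients of \<open>r\<close> span.\<close>
    have "(\<lambda>X. f (trunc m n X)) \<in> forms d n n"
    proof (rule forms_comp[OF f])
      fix i j assume ij: "i < m" "j < n"
      then show "(\<lambda>X. trunc m n X $$ (i, j)) \<in> forms 1 n n"
        using mn by (intro forms_cong[OF forms_entry[of i n j n]]) (auto simp: trunc_def)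
    qed simp
    from family_spans_trace[OF fr this] obtain B where
      B: "\<And>la. la \<in> ?P \<Longrightarrow> B la \<in> carrier_mat (N la) (N la)"
      and fB: "\<And>X. X \<in> carrier_mat n n \<Longrightarrow> f (trunc m n X) = (\<Sum>la\<in>?P. mat_trace (B la * r la X))" by blast
    \<comment> \<open>This is a preimage of \<open>f\<close> because \<open>L la * K la\<close> is
      \<open>r la\<close> at the idempotent, which fixes \<open>pad n X\<close>.\<close>
    have BL: "(\<lambda>la. B la * L la) \<in> blocks d N M" using mult_carrier_mat[OF B L] by (simp add: blocks_def)
    have "\<Psi> (\<lambda>la. B la * L la) X = f X" if X: "X \<in> carrier_mat m n" for X
    proof -
      have tp: "trunc m n (pad n X) = X" using X mn by (intro eq_matI) (auto simp: trunc_def pad_def)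
      have pX: "pad n (1\<^sub>m m) * pad n X = pad n X"
        using pad_one_mult[OF pad_carrier mn, of X] by (simp add: tp)
      have "B la * L la * K la * r la (pad n X) = B la * r la (pad n X)" if la: "la \<in> ?P" for la
      proof -
        have "B la * L la * K la * r la (pad n X) = B la * (r la ?e) * r la (pad n X)"
          unfolding assoc_mult_mat[OF B[OF la] L[OF la] K[OF la]] LK[OF la] ..
        also have "\<dots> = B la * (r la ?e * r la (pad n X))"
          by (rule assoc_mult_mat[OF B[OF la] rc[OF la pad_carrier] rc[OF la pad_carrier]])
        also have "r la ?e * r la (pad n X) = r la (pad n X)"
          unfolding mrepD(2)[OF r[OF la] pad_carrier pad_carrier, symmetric] pX ..
        finally show ?thesis .
      qed
      then have "\<Psi> (\<lambda>la. B la * L la) X = (\<Sum>la\<in>?P. mat_trace (B la * r la (pad n X)))"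
        by (simp add: \<Psi>_def)
      also have "\<dots> = f X" using fB[OF pad_carrier, of X] by (simp add: tp)
      finally show ?thesis .
    qed
    then show ?thesis by (intro bexI[of _ "\<lambda>la. B la * L la"] ballI BL)
  qed
  have inj: "Z la = 0\<^sub>m (N la) (M la)"
    if Z: "Z \<in> blocks d N M" and z: "\<And>X. X \<in> carrier_mat m n \<Longrightarrow> \<Psi> Z X = 0" and la: "la \<in> ?P" for Z la
  proof -
    \<comment> \<open>\<open>K la\<close> absorbs the idempotent, so the trace against
      \<open>r la X\<close> depends only on the first \<open>m\<close> rows of \<open>X\<close> and
      vanishes for every square \<open>X\<close>. Once independence has applied, \<open>L la\<close>
      undoes \<open>K la\<close>.\<close>
    have "Z la * K la = 0\<^sub>m (N la) (N la)"
    proof (rule family_independent[OF fr _ _ la, of "\<lambda>la. Z la * K la"])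
      fix X assume "X \<in> carrier (GL n)"
      then have X: "X \<in> carrier_mat n n" by (rule GL_carrierD)
      have "mat_trace (Z la * K la * r la X) = mat_trace (Z la * K la * r la (pad n (trunc m n X)))"
        if la: "la \<in> ?P" for la
      proof -
        have Ke: "K la * r la ?e = K la"
          unfolding Kr[OF la one_carrier_mat] using K[OF la] by (simp add: mrepD(3)[OF familyD(1)[OF fq la]])
        have "Z la * K la = Z la * K la * r la ?e"
          unfolding assoc_mult_mat[OF Zc[OF Z la] K[OF la] rc[OF la pad_carrier]] Ke ..
        then have "Z la * K la * r la X = Z la * K la * r la ?e * r la X" by simp
        also have "\<dots> = Z la * K la * (r la ?e * r la X)"
          by (rule assoc_mult_mat[OF ZK[OF Z la] rc[OF la pad_carrier] rc[OF la X]])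
        also have "r la ?e * r la X = r la (pad n (trunc m n X))"
          unfolding mrepD(2)[OF r[OF la] pad_carrier X, symmetric] pad_one_mult[OF X mn] ..
        finally show ?thesis by simp
      qed
      then have "(\<Sum>la\<in>?P. mat_trace (Z la * K la * r la X)) = \<Psi> Z (trunc m n X)" by (simp add: \<Psi>_def)
      then show "(\<Sum>la\<in>?P. mat_trace (Z la * K la * r la X)) = 0" using z[OF trunc_carrier] by simp
    qed (use ZK Z in auto)
    moreover have "Z la * K la * L la = Z la"
      unfolding assoc_mult_mat[OF Zc[OF Z la] K[OF la] L[OF la]] KL[OF la] using Zc[OF Z la] by simp
    ultimately show ?thesis using L[OF la] by simp
  qed
  have equiv: "\<Psi> (\<lambda>la. r la B * Z la * (s la A)\<^sup>T) X = \<Psi> Z (A\<^sup>T * X * B)"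
    if Z: "Z \<in> blocks d N M" and A: "A \<in> carrier_mat m m" and B: "B \<in> carrier_mat n n"
      and X: "X \<in> carrier_mat m n" for Z A B X
    unfolding \<Psi>_def
  proof (rule sum.cong)
    fix la assume la: "la \<in> ?P"
    note Zl = Zc[OF Z la] and Kl = K[OF la] and rB = rc[OF la B] and rX = rc[OF la pad_carrier[of n X]]
    have At: "A\<^sup>T \<in> carrier_mat m m" using A by simp
    have sA: "(s la A)\<^sup>T = q la A\<^sup>T" using A by (simp add: q_def)
    have qA: "q la A\<^sup>T \<in> carrier_mat (M la) (M la)" using mrepD(1)[OF familyD(1)[OF fq la] At] .
    note rA = rc[OF la pad_carrier[of n "A\<^sup>T"]]
    have "r la B * Z la * (s la A)\<^sup>T * K la = r la B * (Z la * (q la A\<^sup>T * K la))"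
      unfolding sA using rB Zl qA Kl by (simp add: assoc_mult_mat[of _ "N la" "M la" _ "M la" _ "N la"]
          assoc_mult_mat[of _ "N la" "N la" _ "M la" _ "N la"])
    \<comment> \<open>The intertwining property moves the action of \<open>A\<close> into the
      corner; afterwards cyclicity brings \<open>r la B\<close> behind
      \<open>pad n X\<close>.\<close>
    also have "Z la * (q la A\<^sup>T * K la) = Z la * K la * r la (pad n A\<^sup>T)"
      unfolding Kr[OF la At, symmetric] by (rule assoc_mult_mat[OF Zl Kl rA, symmetric])
    finally have "r la B * Z la * (s la A)\<^sup>T * K la * r la (pad n X)
      = r la B * (Z la * K la * r la (pad n A\<^sup>T)) * r la (pad n X)" by simp
    also have "\<dots> = r la B * (Z la * K la * r la (pad n A\<^sup>T) * r la (pad n X))"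
      by (rule assoc_mult_mat[OF rB mult_carrier_mat[OF ZK[OF Z la] rA] rX])
    finally have "mat_trace (r la B * Z la * (s la A)\<^sup>T * K la * r la (pad n X))
      = mat_trace (r la B * (Z la * K la * r la (pad n A\<^sup>T) * r la (pad n X)))" by simp
    also have "\<dots> = mat_trace (Z la * K la * r la (pad n A\<^sup>T) * r la (pad n X) * r la B)"
      by (rule mat_trace_comm[OF rB mult_carrier_mat[OF mult_carrier_mat[OF ZK[OF Z la] rA] rX]])
    also have "Z la * K la * r la (pad n A\<^sup>T) * r la (pad n X) * r la B
      = Z la * K la * (r la (pad n A\<^sup>T) * r la (pad n X) * r la B)"
      unfolding assoc_mult_mat[OF ZK[OF Z la] rA rX]
      by (rule assoc_mult_mat[OF ZK[OF Z la] mult_carrier_mat[OF rA rX] rB])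
    also have "r la (pad n A\<^sup>T) * r la (pad n X) * r la B = r la (pad n (A\<^sup>T * X * B))"
    proof -
      have "pad n (A\<^sup>T * X * B) = pad n (A\<^sup>T * X) * pad n B"
        by (rule pad_mult[symmetric, of _ m n _ n]) (use At X B mn in auto)
      also have "pad n (A\<^sup>T * X) = pad n A\<^sup>T * pad n X"
        by (rule pad_mult[symmetric, of _ m m _ n]) (use At X mn in auto)
      also have "pad n B = B" by (rule pad_id[OF B])
      finally show ?thesis
        using mrepD(2)[OF r[OF la] pad_carrier[of n "A\<^sup>T"] pad_carrier[of n X]]
          mrepD(2)[OF r[OF la] mult_carrier_mat[OF pad_carrier[of n "A\<^sup>T"] pad_carrier[of n X]] B] by simp
    qed
    finally show "mat_trace (r la B * Z la * (s la A)\<^sup>T * K la * r la (pad n X))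
      = mat_trace (Z la * K la * r la (pad n (A\<^sup>T * X * B)))" .
  qed simp
  have "cauchy_map d m n N M r s \<Psi>"
  proof (rule cauchy_map.intro)
    show "\<Psi> Z X = \<Psi> Z' X" if "\<And>la. la \<in> ?P \<Longrightarrow> Z la = Z' la" for Z Z' X
      using that by (simp add: \<Psi>_def)
  qed (rule add smult form surj inj equiv; assumption)+
  then show ?thesis by (rule exI[of _ \<Psi>])
qed

text \<open>Transposing both the blocks and the variable exchanges the roles of the two groups; this
  covers the case \<open>m > n\<close>.\<close>

lemma cauchy_map_swap:
  assumes ps: "cauchy_map d n m M N s r \<Psi>" and r: "\<And>la. la \<in> partitions d \<Longrightarrow> mrep d n (N la) (r la)"
    and s: "\<And>la. la \<in> partitions d \<Longrightarrow> mrep d m (M la) (s la)"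
  shows "cauchy_map d m n N M r s (\<lambda>Z X. \<Psi> (\<lambda>la. (Z la)\<^sup>T) X\<^sup>T)"
proof -
  have t: "(\<lambda>la. (Z la)\<^sup>T) \<in> blocks d M N" if "Z \<in> blocks d N M" for Z using that by (auto simp: blocks_def)
  have t': "(\<lambda>la. (Z la)\<^sup>T) \<in> blocks d N M" if "Z \<in> blocks d M N" for Z using that by (auto simp: blocks_def)
  have Xt: "X\<^sup>T \<in> carrier_mat n m" if "X \<in> carrier_mat m n" for X :: "complex mat" using that by simp
  interpret T: cauchy_map d n m M N s r \<Psi> by (rule ps)
  note cong = T.\<Psi>_cong
  have add: "\<Psi> (\<lambda>la. (Z la + Z' la)\<^sup>T) X\<^sup>T = \<Psi> (\<lambda>la. (Z la)\<^sup>T) X\<^sup>T + \<Psi> (\<lambda>la. (Z' la)\<^sup>T) X\<^sup>T"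
    if "Z \<in> blocks d N M" "Z' \<in> blocks d N M" "X \<in> carrier_mat m n" for Z Z' X
  proof -
    have "\<Psi> (\<lambda>la. (Z la + Z' la)\<^sup>T) X\<^sup>T = \<Psi> (\<lambda>la. (Z la)\<^sup>T + (Z' la)\<^sup>T) X\<^sup>T"
      using that by (intro cong transpose_add) (auto simp: blocks_def)
    also have "\<dots> = \<Psi> (\<lambda>la. (Z la)\<^sup>T) X\<^sup>T + \<Psi> (\<lambda>la. (Z' la)\<^sup>T) X\<^sup>T"
      by (intro T.\<Psi>_add t Xt that)
    finally show ?thesis .
  qed
  have smult: "\<Psi> (\<lambda>la. (c \<cdot>\<^sub>m Z la)\<^sup>T) X\<^sup>T = c * \<Psi> (\<lambda>la. (Z la)\<^sup>T) X\<^sup>T"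
    if "Z \<in> blocks d N M" "X \<in> carrier_mat m n" for c Z X
  proof -
    have "\<Psi> (\<lambda>la. (c \<cdot>\<^sub>m Z la)\<^sup>T) X\<^sup>T = \<Psi> (\<lambda>la. c \<cdot>\<^sub>m (Z la)\<^sup>T) X\<^sup>T"
      by (intro cong eq_matI) auto
    also have "\<dots> = c * \<Psi> (\<lambda>la. (Z la)\<^sup>T) X\<^sup>T" by (intro T.\<Psi>_smult t Xt that)
    finally show ?thesis .
  qed
  have form: "(\<lambda>X. \<Psi> (\<lambda>la. (Z la)\<^sup>T) X\<^sup>T) \<in> forms d m n" if "Z \<in> blocks d N M" for Z
    by (rule forms_transpose) (rule T.\<Psi>_forms[OF t[OF that]])
  have surj: "\<exists>Z\<in>blocks d N M. \<forall>X\<in>carrier_mat m n. \<Psi> (\<lambda>la. (Z la)\<^sup>T) X\<^sup>T = f X" if f: "f \<in> forms d m n" for f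
  proof -
    have "(\<lambda>X. f X\<^sup>T) \<in> forms d n m" by (rule forms_transpose[OF f])
    then obtain Z where Z: "Z \<in> blocks d M N" "\<And>X. X \<in> carrier_mat n m \<Longrightarrow> \<Psi> Z X = f X\<^sup>T"
      using T.\<Psi>_surj by blast
    have "\<Psi> (\<lambda>la. ((Z la)\<^sup>T)\<^sup>T) X\<^sup>T = f X" if "X \<in> carrier_mat m n" for X
      using Z(2)[OF Xt[OF that]] by simp
    then show ?thesis by (intro bexI[of _ "\<lambda>la. (Z la)\<^sup>T"] ballI t'[OF Z(1)])
  qed
  have inj: "Z la = 0\<^sub>m (N la) (M la)"
    if "Z \<in> blocks d N M" "\<And>X. X \<in> carrier_mat m n \<Longrightarrow> \<Psi> (\<lambda>la. (Z la)\<^sup>T) X\<^sup>T = 0" "la \<in> partitions d" for Z la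
  proof -
    have "(Z la)\<^sup>T = 0\<^sub>m (M la) (N la)"
    proof (rule T.\<Psi>_inj[OF t[OF that(1)] _ that(3)])
      fix X :: "complex mat" assume "X \<in> carrier_mat n m"
      then show "\<Psi> (\<lambda>la. (Z la)\<^sup>T) X = 0" using that(2)[of "X\<^sup>T"] by simp
    qed
    then have "((Z la)\<^sup>T)\<^sup>T = (0\<^sub>m (M la) (N la))\<^sup>T" by simp
    then show ?thesis by (auto intro!: eq_matI)
  qed
  have equiv: "\<Psi> (\<lambda>la. (r la B * Z la * (s la A)\<^sup>T)\<^sup>T) X\<^sup>T = \<Psi> (\<lambda>la. (Z la)\<^sup>T) (A\<^sup>T * X * B)\<^sup>T"
    if Z: "Z \<in> blocks d N M" and A: "A \<in> carrier_mat m m" and B: "B \<in> carrier_mat n n"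
      and X: "X \<in> carrier_mat m n" for Z A B X
  proof -
    have "\<Psi> (\<lambda>la. (r la B * Z la * (s la A)\<^sup>T)\<^sup>T) X\<^sup>T = \<Psi> (\<lambda>la. s la A * (Z la)\<^sup>T * (r la B)\<^sup>T) X\<^sup>T"
    proof (rule cong)
      fix la assume la: "la \<in> partitions d"
      have c: "r la B \<in> carrier_mat (N la) (N la)" "s la A \<in> carrier_mat (M la) (M la)" "Z la \<in> carrier_mat (N la) (M la)"
        using mrepD(1)[OF r[OF la] B] mrepD(1)[OF s[OF la] A] Z la by (auto simp: blocks_def)
      have "(r la B * Z la * (s la A)\<^sup>T)\<^sup>T = ((s la A)\<^sup>T)\<^sup>T * (r la B * Z la)\<^sup>T"
        by (rule transpose_mult[of _ "N la" "M la" _ "M la"]) (use c in auto)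
      also have "(r la B * Z la)\<^sup>T = (Z la)\<^sup>T * (r la B)\<^sup>T" by (rule transpose_mult[OF c(1,3)])
      also have "((s la A)\<^sup>T)\<^sup>T * ((Z la)\<^sup>T * (r la B)\<^sup>T) = s la A * (Z la)\<^sup>T * (r la B)\<^sup>T"
        using c by (simp add: assoc_mult_mat[of _ "M la" "M la" _ "N la" _ "N la"])
      finally show "(r la B * Z la * (s la A)\<^sup>T)\<^sup>T = s la A * (Z la)\<^sup>T * (r la B)\<^sup>T" .
    qed
    also have "\<dots> = \<Psi> (\<lambda>la. (Z la)\<^sup>T) (B\<^sup>T * X\<^sup>T * A)" by (rule T.\<Psi>_equivariant[OF t[OF Z] B A Xt[OF X]])
    also have "B\<^sup>T * X\<^sup>T * A = (A\<^sup>T * X * B)\<^sup>T"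
    proof -
      have "(A\<^sup>T * X * B)\<^sup>T = B\<^sup>T * (A\<^sup>T * X)\<^sup>T"
        by (rule transpose_mult[of _ m n _ n]) (use A B X in auto)
      also have "(A\<^sup>T * X)\<^sup>T = X\<^sup>T * (A\<^sup>T)\<^sup>T" by (rule transpose_mult[of _ m m _ n]) (use A X in auto)
      finally show ?thesis using A B X by (simp add: assoc_mult_mat[of _ n n _ m _ m])
    qed
    finally show ?thesis .
  qed
  show ?thesis
    by (rule cauchy_map.intro) (fact add smult form surj inj equiv | rule cong, simp)+
qed

section \<open>Spaces given by generators and relations\<close>

text \<open>The record spaces are only ever handled through such injective maps into function spaces,
  which take the place of universal properties.\<close>

locale lin_model =
  fixes V :: "(complex, 'v, 'e) module_scheme" and \<Phi> :: "'v \<Rightarrow> 'k \<Rightarrow> complex"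
  assumes zero_in: "\<zero>\<^bsub>V\<^esub> \<in> carrier V"
    and add_in: "v \<in> carrier V \<Longrightarrow> w \<in> carrier V \<Longrightarrow> v \<oplus>\<^bsub>V\<^esub> w \<in> carrier V"
    and smult_in: "v \<in> carrier V \<Longrightarrow> c \<odot>\<^bsub>V\<^esub> v \<in> carrier V"
    and \<Phi>_zero: "\<Phi> \<zero>\<^bsub>V\<^esub> = (\<lambda>_. 0)"
    and \<Phi>_add: "v \<in> carrier V \<Longrightarrow> w \<in> carrier V \<Longrightarrow> \<Phi> (v \<oplus>\<^bsub>V\<^esub> w) = (\<lambda>k. \<Phi> v k + \<Phi> w k)"
    and \<Phi>_smult: "v \<in> carrier V \<Longrightarrow> \<Phi> (c \<odot>\<^bsub>V\<^esub> v) = (\<lambda>k. c * \<Phi> v k)"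
    and \<Phi>_inj: "v \<in> carrier V \<Longrightarrow> w \<in> carrier V \<Longrightarrow> \<Phi> v = \<Phi> w \<Longrightarrow> v = w"
begin

lemma vectorspace: "vectorspace class_ring V"
proof -
  have "abelian_group V"
  proof (rule abelian_groupI)
    fix x assume x: "x \<in> carrier V"
    have "(- 1) \<odot>\<^bsub>V\<^esub> x \<oplus>\<^bsub>V\<^esub> x = \<zero>\<^bsub>V\<^esub>"
      by (rule \<Phi>_inj) (use x in \<open>simp_all add: zero_in add_in smult_in \<Phi>_zero \<Phi>_add \<Phi>_smult\<close>)
    then show "\<exists>y\<in>carrier V. y \<oplus>\<^bsub>V\<^esub> x = \<zero>\<^bsub>V\<^esub>" using smult_in[OF x] by blast
  qed (auto intro!: \<Phi>_inj simp: zero_in add_in \<Phi>_zero \<Phi>_add add_ac)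
  moreover have "cring (class_ring :: complex ring)" by (rule class_cring.is_cring)
  ultimately have "Module.module class_ring V"
    by (intro moduleI) (auto intro!: \<Phi>_inj simp: add_in smult_in \<Phi>_add \<Phi>_smult algebra_simps)
  then show ?thesis unfolding vectorspace_def using class_field by blast
qed

lemma subspace_sum:
  assumes U: "VectorSpace.subspace class_ring U V" and F: "finite F" "\<And>x. x \<in> F \<Longrightarrow> u x \<in> U"
  shows "\<exists>w\<in>U. \<Phi> w = (\<lambda>k. \<Sum>x\<in>F. c x * \<Phi> (u x) k)"
  using F
proof (induction F)
  case empty
  have "\<zero>\<^bsub>V\<^esub> \<in> U" using U by (simp add: VectorSpace.subspace_def LinearCombinations.submodule_def)
  then show ?case using \<Phi>_zero by auto
next
  case (insert x F)
  have sub: "U \<subseteq> carrier V" and add: "\<And>v w. v \<in> U \<Longrightarrow> w \<in> U \<Longrightarrow> v \<oplus>\<^bsub>V\<^esub> w \<in> U"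
    and smult: "\<And>c v. v \<in> U \<Longrightarrow> c \<odot>\<^bsub>V\<^esub> v \<in> U"
    using U by (auto simp: VectorSpace.subspace_def LinearCombinations.submodule_def)
  obtain w where w: "w \<in> U" "\<Phi> w = (\<lambda>k. \<Sum>x\<in>F. c x * \<Phi> (u x) k)" using insert by auto
  have ux: "u x \<in> U" using insert.prems by simp
  have uxV: "u x \<in> carrier V" and wV: "w \<in> carrier V" using ux w(1) sub by auto
  have "\<Phi> (c x \<odot>\<^bsub>V\<^esub> u x \<oplus>\<^bsub>V\<^esub> w) = (\<lambda>k. \<Sum>x\<in>insert x F. c x * \<Phi> (u x) k)"
    unfolding \<Phi>_add[OF smult_in[OF uxV] wV] \<Phi>_smult[OF uxV] w(2) using insert.hyps by simp
  then show ?case using add[OF smult[OF ux] w(1)] by blast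
qed

end

text \<open>Linearity and the group laws are verified for the action \<open>\<alpha>\<close> on
  functions and pulled back along the injective \<open>\<Phi>\<close>.\<close>

lemma representation_by_model:
  assumes V: "lin_model V \<Phi>" and G: "group G"
    and cl: "\<And>g v. g \<in> carrier G \<Longrightarrow> v \<in> carrier V \<Longrightarrow> \<rho> g v \<in> carrier V"
    and eq: "\<And>g v. g \<in> carrier G \<Longrightarrow> v \<in> carrier V \<Longrightarrow> \<Phi> (\<rho> g v) = \<alpha> g (\<Phi> v)"
    and add: "\<And>g f f'. \<alpha> g (\<lambda>k. f k + f' k) = (\<lambda>k. \<alpha> g f k + \<alpha> g f' k)"
    and smult: "\<And>g c f. \<alpha> g (\<lambda>k. c * f k) = (\<lambda>k. c * \<alpha> g f k)"
    and one: "\<And>v. v \<in> carrier V \<Longrightarrow> \<alpha> \<one>\<^bsub>G\<^esub> (\<Phi> v) = \<Phi> v"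
    and mult: "\<And>g h v. g \<in> carrier G \<Longrightarrow> h \<in> carrier G \<Longrightarrow> v \<in> carrier V \<Longrightarrow>
       \<alpha> (g \<otimes>\<^bsub>G\<^esub> h) (\<Phi> v) = \<alpha> g (\<alpha> h (\<Phi> v))"
  shows "representation G V \<rho>"
proof -
  interpret lin_model V \<Phi> by (rule V)
  have mon: "monoid G" using G by (rule group.is_monoid)
  note gc = monoid.m_closed[OF mon] monoid.one_closed[OF mon]
  have "\<rho> g \<in> LinearCombinations.module_hom class_ring V V" if g: "g \<in> carrier G" for g
    unfolding LinearCombinations.module_hom_def
    using g by (auto intro!: \<Phi>_inj simp: cl add_in smult_in eq \<Phi>_add \<Phi>_smult add smult)
  moreover have "\<rho> \<one>\<^bsub>G\<^esub> v = v" if "v \<in> carrier V" for v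
    using that gc by (intro \<Phi>_inj cl) (auto simp: eq one)
  moreover have "\<rho> (g \<otimes>\<^bsub>G\<^esub> h) v = \<rho> g (\<rho> h v)" if "g \<in> carrier G" "h \<in> carrier G" "v \<in> carrier V" for g h v
    using that gc by (intro \<Phi>_inj cl) (auto simp: eq mult cl)
  ultimately show ?thesis using G vectorspace by (simp add: representation_def)
qed

text \<open>The isomorphism sends \<open>v\<close> to the vector of \<open>W\<close> that has the
  same function; it is equivariant because one and the same \<open>\<alpha>\<close> describes both
  actions.\<close>

lemma rep_iso_by_models:
  assumes V: "lin_model V \<Phi>" and W: "lin_model W \<Theta>"
    and \<rho>: "representation G V \<rho>" and \<sigma>: "representation G W \<sigma>"
    and im: "\<Phi> ` carrier V = \<Theta> ` carrier W"
    and cl: "\<And>g v. g \<in> carrier G \<Longrightarrow> v \<in> carrier V \<Longrightarrow> \<rho> g v \<in> carrier V \<and> \<Phi> (\<rho> g v) = \<alpha> g (\<Phi> v)"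
    and cl': "\<And>g w. g \<in> carrier G \<Longrightarrow> w \<in> carrier W \<Longrightarrow> \<sigma> g w \<in> carrier W \<and> \<Theta> (\<sigma> g w) = \<alpha> g (\<Theta> w)"
  shows "rep_iso G V \<rho> W \<sigma>"
proof -
  interpret V: lin_model V \<Phi> by (rule V)
  interpret W: lin_model W \<Theta> by (rule W)
  define T where "T = (\<lambda>v. inv_into (carrier W) \<Theta> (\<Phi> v))"
  have T: "T v \<in> carrier W" "\<Theta> (T v) = \<Phi> v" if "v \<in> carrier V" for v
  proof -
    have "\<Phi> v \<in> \<Theta> ` carrier W" using im that by blast
    then show "T v \<in> carrier W" "\<Theta> (T v) = \<Phi> v"
      unfolding T_def by (auto intro: inv_into_into f_inv_into_f)
  qed
  have "T \<in> LinearCombinations.module_hom class_ring V W"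
    unfolding LinearCombinations.module_hom_def
    by (auto intro!: W.\<Phi>_inj simp: T V.add_in V.smult_in V.\<Phi>_add V.\<Phi>_smult W.add_in W.smult_in W.\<Phi>_add W.\<Phi>_smult)
  moreover have "bij_betw T (carrier V) (carrier W)"
    unfolding bij_betw_def
  proof
    show "inj_on T (carrier V)"
      by (rule inj_onI) (metis T(2) V.\<Phi>_inj)
    show "T ` carrier V = carrier W"
    proof
      show "carrier W \<subseteq> T ` carrier V"
      proof
        fix w assume w: "w \<in> carrier W"
        then obtain v where v: "v \<in> carrier V" "\<Phi> v = \<Theta> w" using im by (metis imageE imageI)
        then have "T v = w" using T[OF v(1)] w by (intro W.\<Phi>_inj) auto
        then show "w \<in> T ` carrier V" using v(1) by blast
      qed
    qed (use T in auto)
  qed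
  moreover have "T (\<rho> g v) = \<sigma> g (T v)" if "g \<in> carrier G" "v \<in> carrier V" for g v
    using that cl[OF that] cl'[OF that(1) T(1)[OF that(2)]] T by (intro W.\<Phi>_inj) auto
  ultimately show ?thesis using \<rho> \<sigma> unfolding rep_iso_def by blast
qed

section \<open>Quotients of free spaces, modelled by evaluating generators\<close>

lemma lookup_scale: "Poly_Mapping.lookup (Poly_Mapping.map (\<lambda>z. c * z) p) k = c * Poly_Mapping.lookup p k" for c :: complex
  by transfer (simp add: when_def)

lemma keys_scale: "Poly_Mapping.keys (Poly_Mapping.map (\<lambda>z. c * z) p) \<subseteq> Poly_Mapping.keys p" for c :: complex
  by (auto simp: in_keys_iff lookup_scale)

lemma free_space_simps [simp]:
  "carrier (free_space X) = {p. Poly_Mapping.keys p \<subseteq> X}"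
  "\<zero>\<^bsub>free_space X\<^esub> = 0"
  "p \<oplus>\<^bsub>free_space X\<^esub> q = p + q"
  "c \<odot>\<^bsub>free_space X\<^esub> p = Poly_Mapping.map (\<lambda>z. c * z) p"
  by (simp_all add: free_space_def)

lemma keys_add_subset: "Poly_Mapping.keys p \<subseteq> X \<Longrightarrow> Poly_Mapping.keys q \<subseteq> X \<Longrightarrow> Poly_Mapping.keys (p + q) \<subseteq> X"
  using Poly_Mapping.keys_add[of p q] by blast

lemma keys_diff_subset:
  fixes p q :: "'x \<Rightarrow>\<^sub>0 complex"
  shows "Poly_Mapping.keys p \<subseteq> X \<Longrightarrow> Poly_Mapping.keys q \<subseteq> X \<Longrightarrow> Poly_Mapping.keys (p - q) \<subseteq> X"
proof
  fix x assume pq: "Poly_Mapping.keys p \<subseteq> X" "Poly_Mapping.keys q \<subseteq> X" and x: "x \<in> Poly_Mapping.keys (p - q)"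
  have "x \<in> Poly_Mapping.keys p \<or> x \<in> Poly_Mapping.keys q"
    using x by (auto simp: in_keys_iff lookup_minus)
  then show "x \<in> X" using pq by blast
qed

lemma free_space_model: "lin_model (free_space X) Poly_Mapping.lookup"
  by unfold_locales
    (auto simp: lookup_scale lookup_add fun_eq_iff intro: poly_mapping_eqI
      dest: subsetD[OF Poly_Mapping.keys_add] subsetD[OF keys_scale])

interpretation free: lin_model "free_space X" Poly_Mapping.lookup for X
  by (rule free_space_model)

definition lin_ext :: "('x \<Rightarrow> 'k \<Rightarrow> complex) \<Rightarrow> ('x \<Rightarrow>\<^sub>0 complex) \<Rightarrow> 'k \<Rightarrow> complex" where
  "lin_ext ev p k = (\<Sum>x\<in>Poly_Mapping.keys p. Poly_Mapping.lookup p x * ev x k)"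

lemma lin_ext_superset:
  assumes "finite A" "Poly_Mapping.keys p \<subseteq> A"
  shows "lin_ext ev p k = (\<Sum>x\<in>A. Poly_Mapping.lookup p x * ev x k)"
  unfolding lin_ext_def using assms by (intro sum.mono_neutral_left) (auto simp: in_keys_iff)

lemma lin_ext_add: "lin_ext ev (p + q) k = lin_ext ev p k + lin_ext ev q k"
proof -
  let ?A = "Poly_Mapping.keys p \<union> Poly_Mapping.keys q"
  have "finite ?A" by simp
  then show ?thesis
    using Poly_Mapping.keys_add[of p q]
    by (simp add: lin_ext_superset[of ?A] lookup_add algebra_simps sum.distrib)
qed

lemma lin_ext_scale: "lin_ext ev (Poly_Mapping.map (\<lambda>z. c * z) p) k = c * lin_ext ev p k"
  using lin_ext_superset[OF finite_keys keys_scale, of ev c p k]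
  by (simp add: lin_ext_def lookup_scale sum_distrib_left mult.assoc)

lemma lin_ext_zero [simp]: "lin_ext ev 0 k = 0"
  by (simp add: lin_ext_def)

lemma lin_ext_single [simp]: "lin_ext ev (Poly_Mapping.single x c) k = c * ev x k"
  by (simp add: lin_ext_superset[of "{x}"])

lemma lin_ext_diff: "lin_ext ev (p - q) k = lin_ext ev p k - lin_ext ev q k"
  using lin_ext_add[of ev "p - q" q k] by simp

lemma lin_ext_sum: "lin_ext ev (\<Sum>i\<in>I. p i) k = (\<Sum>i\<in>I. lin_ext ev (p i) k)"
  by (induction I rule: infinite_finite_induct) (auto simp: lin_ext_add)

lemma push_forward_lin_ext: "lin_ext ev (push_forward f p) k = lin_ext (\<lambda>x. ev (f x)) p k"
  unfolding push_forward_def lin_ext_sum lin_ext_single by (simp add: lin_ext_def)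

lemma keys_push_forward: "Poly_Mapping.keys (push_forward f p) \<subseteq> f ` Poly_Mapping.keys p"
proof -
  have "Poly_Mapping.keys (\<Sum>x\<in>A. Poly_Mapping.single (f x) (Poly_Mapping.lookup p x)) \<subseteq> f ` A"
    if "finite A" for A
    using that
  proof (induction A)
    case (insert a A)
    have "Poly_Mapping.keys (Poly_Mapping.single (f a) (Poly_Mapping.lookup p a)) \<subseteq> f ` insert a A" by simp
    moreover have "Poly_Mapping.keys (\<Sum>x\<in>A. Poly_Mapping.single (f x) (Poly_Mapping.lookup p x)) \<subseteq> f ` insert a A"
      using insert.IH by blast
    ultimately show ?case unfolding sum.insert[OF insert.hyps] by (rule keys_add_subset)
  qed simp
  then show ?thesis unfolding push_forward_def by simp
qed

text \<open>The generators in \<open>Y\<close> become a basis of the quotient, which makes the evaluation \<open>ev\<close> injective on it.\<close>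

locale presentation =
  fixes X :: "'x set" and R :: "('x \<Rightarrow>\<^sub>0 complex) set" and ev :: "'x \<Rightarrow> 'k \<Rightarrow> complex" and Y :: "'x set"
  assumes R_sub: "r \<in> R \<Longrightarrow> Poly_Mapping.keys r \<subseteq> X"
    and R_zero: "r \<in> R \<Longrightarrow> lin_ext ev r k = 0"
    and Y_sub: "Y \<subseteq> X"
    and reduce: "x \<in> X \<Longrightarrow> \<exists>p. Poly_Mapping.keys p \<subseteq> Y \<and> gen x - p \<in> relation_span X R"
    and Y_independent: "Poly_Mapping.keys p \<subseteq> Y \<Longrightarrow> (\<And>k. lin_ext ev p k = 0) \<Longrightarrow> p = 0"

lemma relation_span_closed:
  assumes R: "\<And>r. r \<in> R \<Longrightarrow> Poly_Mapping.keys r \<subseteq> X"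
  shows "0 \<in> relation_span X R"
    and "p \<in> relation_span X R \<Longrightarrow> q \<in> relation_span X R \<Longrightarrow> p + q \<in> relation_span X R"
    and "p \<in> relation_span X R \<Longrightarrow> Poly_Mapping.map (\<lambda>z. c * z) p \<in> relation_span X R"
    and "r \<in> R \<Longrightarrow> r \<in> relation_span X R"
    and "p \<in> relation_span X R \<Longrightarrow> Poly_Mapping.keys p \<subseteq> X"
proof -
  interpret M: Module.module "class_ring :: complex ring" "free_space X"
    using free.vectorspace[of X] by (rule vectorspace.axioms(1))
  have sub: "R \<subseteq> carrier (free_space X)" using R by auto
  note s = M.span_is_submodule[OF sub, folded relation_span_def, unfolded LinearCombinations.submodule_def]
  show "0 \<in> relation_span X R"
    and "p \<in> relation_span X R \<Longrightarrow> q \<in> relation_span X R \<Longrightarrow> p + q \<in> relation_span X R"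
    and "p \<in> relation_span X R \<Longrightarrow> Poly_Mapping.map (\<lambda>z. c * z) p \<in> relation_span X R"
    and "p \<in> relation_span X R \<Longrightarrow> Poly_Mapping.keys p \<subseteq> X"
    using s by auto
  show "r \<in> R \<Longrightarrow> r \<in> relation_span X R"
    using M.in_own_span[OF sub] by (auto simp: relation_span_def)
qed

lemma relation_span_diff:
  assumes R: "\<And>r. r \<in> R \<Longrightarrow> Poly_Mapping.keys r \<subseteq> X"
    and p: "p \<in> relation_span X R" and q: "q \<in> relation_span X R"
  shows "p - q \<in> relation_span X R"
proof -
  have "p - q = p + Poly_Mapping.map (\<lambda>z. (- 1) * z) q"
    by (rule poly_mapping_eqI) (simp only: lookup_minus lookup_add lookup_scale, simp)
  then show ?thesis
    using relation_span_closed(2)[OF R p relation_span_closed(3)[OF R q]] by (simp only:)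
qed

context presentation
begin

abbreviation "S \<equiv> relation_span X R"

lemma S_closed:
  shows "0 \<in> S"
    and "p \<in> S \<Longrightarrow> q \<in> S \<Longrightarrow> p + q \<in> S"
    and "p \<in> S \<Longrightarrow> Poly_Mapping.map (\<lambda>z. c * z) p \<in> S"
    and "r \<in> R \<Longrightarrow> r \<in> S"
    and "p \<in> S \<Longrightarrow> Poly_Mapping.keys p \<subseteq> X"
    and "p \<in> S \<Longrightarrow> q \<in> S \<Longrightarrow> p - q \<in> S"
proof -
  have R: "\<And>r. r \<in> R \<Longrightarrow> Poly_Mapping.keys r \<subseteq> X" by (rule R_sub)
  show "0 \<in> S" by (rule relation_span_closed(1)[OF R])
  show "p \<in> S \<Longrightarrow> q \<in> S \<Longrightarrow> p + q \<in> S" by (rule relation_span_closed(2)[OF R])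
  show "p \<in> S \<Longrightarrow> Poly_Mapping.map (\<lambda>z. c * z) p \<in> S" by (rule relation_span_closed(3)[OF R])
  show "r \<in> R \<Longrightarrow> r \<in> S" by (rule relation_span_closed(4)[OF R])
  show "p \<in> S \<Longrightarrow> Poly_Mapping.keys p \<subseteq> X" by (rule relation_span_closed(5)[OF R])
  show "p \<in> S \<Longrightarrow> q \<in> S \<Longrightarrow> p - q \<in> S" by (rule relation_span_diff[OF R])
qed

lemma S_zero: "p \<in> S \<Longrightarrow> lin_ext ev p k = 0"
proof -
  interpret M: Module.module "class_ring :: complex ring" "free_space X"
    using free.vectorspace[of X] by (rule vectorspace.axioms(1))
  let ?K = "{p. Poly_Mapping.keys p \<subseteq> X \<and> (\<forall>k. lin_ext ev p k = 0)}"
  have "LinearCombinations.submodule class_ring ?K (free_space X)"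
    unfolding LinearCombinations.submodule_def
  proof (intro conjI allI impI)
    show "Module.module class_ring (free_space X)" by (rule M.module_axioms)
    fix v w c assume "v \<in> ?K"
    then show "c \<odot>\<^bsub>free_space X\<^esub> v \<in> ?K" using subset_trans[OF keys_scale[of c v], of X] by (simp add: lin_ext_scale)
    assume "w \<in> ?K"
    with \<open>v \<in> ?K\<close> show "v \<oplus>\<^bsub>free_space X\<^esub> w \<in> ?K"
      using keys_add_subset[of v X w] by (simp add: lin_ext_add)
  qed auto
  from M.span_is_subset[OF _ this, of R] have "S \<subseteq> {p. Poly_Mapping.keys p \<subseteq> X \<and> (\<forall>k. lin_ext ev p k = 0)}"
    using R_sub R_zero unfolding relation_span_def by auto
  then show "p \<in> S \<Longrightarrow> lin_ext ev p k = 0" by auto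
qed

lemma reduce_sum:
  assumes "finite A" "A \<subseteq> X"
  shows "\<exists>q. Poly_Mapping.keys q \<subseteq> Y \<and> (\<Sum>x\<in>A. Poly_Mapping.single x (c x)) - q \<in> S"
  using assms
proof (induction A)
  case empty
  show ?case by (intro exI[of _ 0]) (simp add: S_closed)
next
  case (insert a A)
  then obtain q where q: "Poly_Mapping.keys q \<subseteq> Y" "(\<Sum>x\<in>A. Poly_Mapping.single x (c x)) - q \<in> S" by auto
  obtain p where p: "Poly_Mapping.keys p \<subseteq> Y" "gen a - p \<in> S" using reduce[of a] insert.prems(1) by blast
  let ?cp = "Poly_Mapping.map (\<lambda>z. c a * z) p"
  have "(\<Sum>x\<in>insert a A. Poly_Mapping.single x (c x)) - (?cp + q)
    = Poly_Mapping.map (\<lambda>z. c a * z) (gen a - p) + ((\<Sum>x\<in>A. Poly_Mapping.single x (c x)) - q)"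
    unfolding sum.insert[OF insert.hyps]
    by (intro poly_mapping_eqI)
      (simp only: lookup_add lookup_minus lookup_scale lookup_single when_def, simp add: algebra_simps)
  moreover have "Poly_Mapping.map (\<lambda>z. c a * z) (gen a - p) + ((\<Sum>x\<in>A. Poly_Mapping.single x (c x)) - q) \<in> S"
    by (intro S_closed(2,3) p q)
  moreover have "Poly_Mapping.keys (?cp + q) \<subseteq> Y"
    using keys_scale[of "c a" p] p(1) q(1) by (intro keys_add_subset) auto
  ultimately show ?case by (intro exI[of _ "?cp + q"] conjI) (simp_all only:)
qed

text \<open>With \<open>S_zero\<close> this makes \<open>S\<close> exactly the kernel of the
  evaluation: modulo \<open>S\<close>, \<open>p\<close> becomes a combination of generators in
  \<open>Y\<close>, and on those the evaluation is injective.\<close>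

lemma kernel:
  assumes p: "Poly_Mapping.keys p \<subseteq> X" and z: "\<And>k. lin_ext ev p k = 0"
  shows "p \<in> S"
proof -
  have "(\<Sum>x\<in>Poly_Mapping.keys p. Poly_Mapping.single x (Poly_Mapping.lookup p x)) = p"
    by (intro poly_mapping_eqI) (simp add: lookup_sum lookup_single when_def in_keys_iff)
  then obtain q where q: "Poly_Mapping.keys q \<subseteq> Y" "p - q \<in> S"
    using reduce_sum[OF finite_keys p, of "Poly_Mapping.lookup p"] by auto
  have "lin_ext ev q k = 0" for k using S_zero[OF q(2), of k] z by (simp add: lin_ext_diff)
  then have "q = 0" using Y_independent[OF q(1)] by blast
  with q(2) show ?thesis by simp
qed

definition coset :: "('x \<Rightarrow>\<^sub>0 complex) \<Rightarrow> ('x \<Rightarrow>\<^sub>0 complex) set" where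
  "coset p = S +>\<^bsub>free_space X\<^esub> p"

lemma in_coset: "q \<in> coset p \<longleftrightarrow> q - p \<in> S"
proof -
  have "q \<in> coset p \<longleftrightarrow> (\<exists>h\<in>S. q = h + p)" by (simp add: coset_def a_r_coset_def')
  also have "\<dots> \<longleftrightarrow> q - p \<in> S"
  proof
    assume "q - p \<in> S"
    then show "\<exists>h\<in>S. q = h + p" by (intro bexI[of _ "q - p"]) auto
  qed auto
  finally show ?thesis .
qed

lemma coset_eq: "q - p \<in> S \<Longrightarrow> coset q = coset p"
proof -
  assume qp: "q - p \<in> S"
  have "r - q \<in> S \<longleftrightarrow> r - p \<in> S" for r
  proof -
    have "r - p = (r - q) + (q - p)" "r - q = (r - p) - (q - p)" by simp_all
    then show ?thesis using S_closed(2)[OF _ qp, of "r - q"] S_closed(6)[OF _ qp, of "r - p"] by metis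
  qed
  then show ?thesis by (auto simp: in_coset)
qed

lemma coset_self: "p \<in> coset p"
  by (simp add: in_coset S_closed)

abbreviation "P \<equiv> presented_space X R"

lemma carrier_P: "carrier P = coset ` {p. Poly_Mapping.keys p \<subseteq> X}"
  by (auto simp: presented_space_def quotient_space_def A_RCOSETS_def' coset_def)

lemma zero_P: "\<zero>\<^bsub>P\<^esub> = coset 0"
  by (auto simp: presented_space_def quotient_space_def in_coset)

lemma add_P: "coset p \<oplus>\<^bsub>P\<^esub> coset q = coset (p + q)"
proof -
  have "coset p \<oplus>\<^bsub>P\<^esub> coset q = (\<Union>a\<in>coset p. \<Union>b\<in>coset q. {a + b})"
    by (simp add: presented_space_def quotient_space_def set_add_def')
  also have "\<dots> = coset (p + q)"
  proof (rule subset_antisym; rule subsetI)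
    fix r assume "r \<in> (\<Union>a\<in>coset p. \<Union>b\<in>coset q. {a + b})"
    then obtain a b where "a - p \<in> S" "b - q \<in> S" "r = a + b" by (auto simp: in_coset)
    then show "r \<in> coset (p + q)" using S_closed(2)[of "a - p" "b - q"] by (simp add: in_coset algebra_simps)
  next
    fix r assume "r \<in> coset (p + q)"
    then have "r - q \<in> coset p" "r = (r - q) + q" by (auto simp: in_coset algebra_simps)
    then show "r \<in> (\<Union>a\<in>coset p. \<Union>b\<in>coset q. {a + b})" using coset_self[of q] by blast
  qed
  finally show ?thesis .
qed

text \<open>Scalar multiplication and induced maps are defined as unions of cosets over all
  representatives; for an \<open>h\<close> that respects \<open>S\<close> these cosets
  coincide.\<close>

lemma union_coset:
  assumes "\<And>p'. p' \<in> coset p \<Longrightarrow> h p' - h p \<in> S"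
  shows "(\<Union>p'\<in>coset p. S +>\<^bsub>free_space X\<^esub> h p') = coset (h p)"
proof -
  have "(\<Union>p'\<in>coset p. S +>\<^bsub>free_space X\<^esub> h p') = (\<Union>p'\<in>coset p. coset (h p))"
    unfolding coset_def[of "h _", symmetric] by (intro SUP_cong refl coset_eq assms)
  then show ?thesis using coset_self[of p] by blast
qed

lemma smult_P: "c \<odot>\<^bsub>P\<^esub> coset p = coset (Poly_Mapping.map (\<lambda>z. c * z) p)"
proof -
  have "c \<odot>\<^bsub>P\<^esub> coset p = (\<Union>p'\<in>coset p. S +>\<^bsub>free_space X\<^esub> (Poly_Mapping.map (\<lambda>z. c * z) p'))"
    by (simp add: presented_space_def quotient_space_def)
  also have "\<dots> = coset (Poly_Mapping.map (\<lambda>z. c * z) p)"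
  proof (rule union_coset)
    fix p' assume "p' \<in> coset p"
    then have "Poly_Mapping.map (\<lambda>z. c * z) (p' - p) \<in> S" by (simp add: in_coset S_closed)
    moreover have "Poly_Mapping.map (\<lambda>z. c * z) (p' - p)
      = Poly_Mapping.map (\<lambda>z. c * z) p' - Poly_Mapping.map (\<lambda>z. c * z) p"
      by (rule poly_mapping_eqI) (simp only: lookup_scale lookup_minus, simp add: algebra_simps)
    ultimately show "Poly_Mapping.map (\<lambda>z. c * z) p' - Poly_Mapping.map (\<lambda>z. c * z) p \<in> S" by simp
  qed
  finally show ?thesis .
qed

text \<open>The result is independent of the chosen representative because the evaluation vanishes
  on \<open>S\<close>.\<close>

definition model :: "('x \<Rightarrow>\<^sub>0 complex) set \<Rightarrow> 'k \<Rightarrow> complex" where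
  "model C = lin_ext ev (SOME p. p \<in> C)"

lemma model_coset: "model (coset p) = lin_ext ev p"
proof -
  have "(SOME q. q \<in> coset p) \<in> coset p" by (rule someI[of _ p]) (rule coset_self)
  then have "lin_ext ev ((SOME q. q \<in> coset p) - p) k = 0" for k by (intro S_zero) (simp add: in_coset)
  then show ?thesis by (auto simp: model_def lin_ext_diff fun_eq_iff)
qed

lemma presented_model: "lin_model P model"
proof (rule lin_model.intro)
  show "\<zero>\<^bsub>P\<^esub> \<in> carrier P" unfolding zero_P carrier_P by (rule imageI) simp
  show "model \<zero>\<^bsub>P\<^esub> = (\<lambda>_. 0)" unfolding zero_P model_coset by (rule ext) simp
next
  fix v c assume "v \<in> carrier P"
  then obtain p where p: "Poly_Mapping.keys p \<subseteq> X" "v = coset p" unfolding carrier_P by blast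
  have "Poly_Mapping.keys (Poly_Mapping.map (\<lambda>z. c * z) p) \<subseteq> X" using p(1) keys_scale[of c p] by blast
  then show "c \<odot>\<^bsub>P\<^esub> v \<in> carrier P" unfolding carrier_P p(2) smult_P by blast
  show "model (c \<odot>\<^bsub>P\<^esub> v) = (\<lambda>k. c * model v k)"
    unfolding p(2) smult_P model_coset by (rule ext) (rule lin_ext_scale)
next
  fix v w assume "v \<in> carrier P" "w \<in> carrier P"
  then obtain p q where pq: "Poly_Mapping.keys p \<subseteq> X" "v = coset p" "Poly_Mapping.keys q \<subseteq> X" "w = coset q"
    unfolding carrier_P by blast
  show "v \<oplus>\<^bsub>P\<^esub> w \<in> carrier P"
    unfolding carrier_P pq(2,4) add_P using keys_add_subset[OF pq(1,3)] by blast
  show "model (v \<oplus>\<^bsub>P\<^esub> w) = (\<lambda>k. model v k + model w k)"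
    unfolding pq(2,4) add_P model_coset by (rule ext) (rule lin_ext_add)
  assume vw: "model v = model w"
  show "v = w"
    unfolding pq(2,4)
  proof (rule coset_eq, rule kernel)
    show "Poly_Mapping.keys (p - q) \<subseteq> X" using pq by (intro keys_diff_subset)
    show "lin_ext ev (p - q) k = 0" for k
      using vw unfolding pq(2,4) model_coset lin_ext_diff by simp
  qed
qed

lemma model_image: "model ` carrier P = lin_ext ev ` {p. Poly_Mapping.keys p \<subseteq> X}"
  by (auto simp: carrier_P image_image model_coset)

text \<open>That \<open>f\<close> respects the relations is not checked one relation at a time:
  evaluation turns \<open>f\<close> into the operator \<open>\<alpha>\<close>, and the span of the
  relations is the kernel of the evaluation.\<close>

lemma presented_map_model:
  assumes f: "\<And>x. x \<in> X \<Longrightarrow> f x \<in> X" and ev: "\<And>x k. x \<in> X \<Longrightarrow> ev (f x) k = \<alpha> (ev x) k"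
    and \<alpha>: "\<And>A (c :: 'x \<Rightarrow> complex) k. finite A \<Longrightarrow> \<alpha> (\<lambda>k. \<Sum>x\<in>A. c x * ev x k) k = (\<Sum>x\<in>A. c x * \<alpha> (ev x) k)"
    and C: "C \<in> carrier P"
  shows "presented_map X R f C \<in> carrier P" "model (presented_map X R f C) = \<alpha> (model C)"
proof -
  obtain p where p: "Poly_Mapping.keys p \<subseteq> X" "C = coset p" using C by (auto simp: carrier_P)
  have push: "lin_ext ev (push_forward f q) = \<alpha> (lin_ext ev q)" if "Poly_Mapping.keys q \<subseteq> X" for q
  proof
    fix k
    have "lin_ext ev (push_forward f q) k = (\<Sum>x\<in>Poly_Mapping.keys q. Poly_Mapping.lookup q x * ev (f x) k)"
      by (simp only: push_forward_lin_ext, simp only: lin_ext_def)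
    also have "\<dots> = (\<Sum>x\<in>Poly_Mapping.keys q. Poly_Mapping.lookup q x * \<alpha> (ev x) k)"
      using that ev by (intro sum.cong) auto
    also have "\<dots> = \<alpha> (lin_ext ev q) k" by (simp add: \<alpha> lin_ext_def[abs_def])
    finally show "lin_ext ev (push_forward f q) k = \<alpha> (lin_ext ev q) k" .
  qed
  have kp: "Poly_Mapping.keys (push_forward f q) \<subseteq> X" if "Poly_Mapping.keys q \<subseteq> X" for q
    using keys_push_forward[of f q] that f by blast
  have "presented_map X R f C = coset (push_forward f p)"
    unfolding presented_map_def p(2)
  proof (rule union_coset)
    fix p' assume "p' \<in> coset p"
    then have S: "p' - p \<in> S" by (simp add: in_coset)
    have kp': "Poly_Mapping.keys p' \<subseteq> X" using keys_add_subset[OF S_closed(5)[OF S] p(1)] by simp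
    show "push_forward f p' - push_forward f p \<in> S"
    proof (rule kernel)
      show "Poly_Mapping.keys (push_forward f p' - push_forward f p) \<subseteq> X"
        by (intro keys_diff_subset kp kp' p(1))
      have "lin_ext ev p' = lin_ext ev p" using S_zero[OF S] by (auto simp: lin_ext_diff fun_eq_iff)
      then show "lin_ext ev (push_forward f p' - push_forward f p) k = 0" for k
        by (simp add: lin_ext_diff push kp' p(1))
    qed
  qed
  then show "presented_map X R f C \<in> carrier P" "model (presented_map X R f C) = \<alpha> (model C)"
    using kp[OF p(1)] p by (auto simp: carrier_P model_coset push)
qed

end

section \<open>Tensor products and symmetric powers\<close>

definition lin_closed :: "('x \<Rightarrow>\<^sub>0 complex) set \<Rightarrow> bool" where
  "lin_closed S \<longleftrightarrow> 0 \<in> S \<and> (\<forall>p\<in>S. \<forall>q\<in>S. p + q \<in> S) \<and> (\<forall>p\<in>S. \<forall>c. Poly_Mapping.map (\<lambda>z. c * z) p \<in> S)"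

lemma lin_closedD:
  assumes "lin_closed S"
  shows "0 \<in> S" "p \<in> S \<Longrightarrow> q \<in> S \<Longrightarrow> p + q \<in> S" "p \<in> S \<Longrightarrow> Poly_Mapping.map (\<lambda>z. c * z) p \<in> S"
  using assms by (auto simp: lin_closed_def)

lemma lin_closed_relation_span:
  assumes "\<And>r. r \<in> R \<Longrightarrow> Poly_Mapping.keys r \<subseteq> X"
  shows "lin_closed (relation_span X R)"
  unfolding lin_closed_def using relation_span_closed(1-3)[OF assms] by (intro conjI ballI allI) auto

lemma lin_closed_sum:
  assumes "lin_closed S" "finite I" "\<And>i. i \<in> I \<Longrightarrow> p i \<in> S"
  shows "(\<Sum>i\<in>I. p i) \<in> S"
  using assms(2,3) by (induction I rule: finite_induct) (auto intro: lin_closedD[OF assms(1)])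

text \<open>Reducibility to \<open>Y\<close> passes to combinations; this drives the elimination of
  generators outside \<open>Y\<close>, one slot at a time.\<close>

lemma reduce_combine:
  fixes a :: "'i \<Rightarrow> complex"
  assumes S: "lin_closed S" and I: "finite I"
    and x: "gen x - (\<Sum>i\<in>I. Poly_Mapping.single (y i) (a i)) \<in> S"
    and y: "\<And>i. i \<in> I \<Longrightarrow> \<exists>p. Poly_Mapping.keys p \<subseteq> Y \<and> gen (y i) - p \<in> S"
  shows "\<exists>p. Poly_Mapping.keys p \<subseteq> Y \<and> gen x - p \<in> S"
proof -
  obtain p where p: "\<And>i. i \<in> I \<Longrightarrow> Poly_Mapping.keys (p i) \<subseteq> Y" "\<And>i. i \<in> I \<Longrightarrow> gen (y i) - p i \<in> S"
    using y by metis
  define q where "q = (\<Sum>i\<in>I. Poly_Mapping.map (\<lambda>z. a i * z) (p i))"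
  have "Poly_Mapping.keys q \<subseteq> Y"
    unfolding q_def using I p(1)
  proof (induction I)
    case (insert i I)
    then show ?case unfolding sum.insert[OF insert.hyps]
      by (intro keys_add_subset) (auto dest: subsetD[OF keys_scale])
  qed simp
  moreover have "gen x - q \<in> S"
  proof -
    have "(\<Sum>i\<in>I. Poly_Mapping.map (\<lambda>z. a i * z) (gen (y i) - p i)) \<in> S"
      by (intro lin_closed_sum[OF S I] lin_closedD(3)[OF S] p(2))
    moreover have "(\<Sum>i\<in>I. Poly_Mapping.map (\<lambda>z. a i * z) (gen (y i) - p i))
      = (\<Sum>i\<in>I. Poly_Mapping.single (y i) (a i)) - q"
      unfolding q_def sum_subtractf[symmetric]
    proof (rule sum.cong[OF refl], rule poly_mapping_eqI)
      fix i k
      show "Poly_Mapping.lookup (Poly_Mapping.map (\<lambda>z. a i * z) (gen (y i) - p i)) k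
        = Poly_Mapping.lookup (Poly_Mapping.single (y i) (a i) - Poly_Mapping.map (\<lambda>z. a i * z) (p i)) k"
        by (simp only: lookup_minus lookup_scale lookup_single when_def) (simp add: algebra_simps)
    qed
    ultimately have "(\<Sum>i\<in>I. Poly_Mapping.single (y i) (a i)) - q \<in> S" by (simp only:)
    from lin_closedD(2)[OF S x this] show ?thesis by simp
  qed
  ultimately show ?thesis by blast
qed

text \<open>\<open>G\<close> puts a vector into one slot of a generator and holds the other slots
  fixed. Being linear modulo \<open>S\<close>, it can be expanded along any expression of
  \<open>u\<close> in terms of the \<open>e i\<close>.\<close>

lemma multilinear_reduce:
  fixes V :: "(complex, 'v, 'e) module_scheme" and \<Phi> :: "'v \<Rightarrow> 'k \<Rightarrow> complex" and G :: "'v \<Rightarrow> 'x"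
  assumes V: "lin_model V \<Phi>" and S: "lin_closed S" and I: "finite I"
    and e: "\<And>i. i \<in> I \<Longrightarrow> e i \<in> carrier V"
    and add: "\<And>v w. v \<in> carrier V \<Longrightarrow> w \<in> carrier V \<Longrightarrow> gen (G (v \<oplus>\<^bsub>V\<^esub> w)) - gen (G v) - gen (G w) \<in> S"
    and smult: "\<And>c v. v \<in> carrier V \<Longrightarrow> gen (G (c \<odot>\<^bsub>V\<^esub> v)) - Poly_Mapping.single (G v) c \<in> S"
    and u: "u \<in> carrier V" "\<Phi> u = (\<lambda>k. \<Sum>i\<in>I. a i * \<Phi> (e i) k)"
  shows "gen (G u) - (\<Sum>i\<in>I. Poly_Mapping.single (G (e i)) (a i)) \<in> S"
proof -
  interpret lin_model V \<Phi> by (rule V)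
  have "\<exists>w\<in>carrier V. \<Phi> w = (\<lambda>k. \<Sum>i\<in>I. a i * \<Phi> (e i) k) \<and>
      gen (G w) - (\<Sum>i\<in>I. Poly_Mapping.single (G (e i)) (a i)) \<in> S"
    using I e
  proof (induction I)
    case empty
    \<comment> \<open>The zero vector is written as 0 times \<open>u\<close>, so that the relation
      for scalars covers the empty sum.\<close>
    have z: "0 \<odot>\<^bsub>V\<^esub> u = \<zero>\<^bsub>V\<^esub>"
      by (rule \<Phi>_inj) (use u(1) in \<open>simp_all add: zero_in smult_in \<Phi>_zero \<Phi>_smult\<close>)
    have "gen (G \<zero>\<^bsub>V\<^esub>) \<in> S" using smult[OF u(1), of 0] unfolding z by simp
    then show ?case using zero_in \<Phi>_zero by (intro bexI[of _ "\<zero>\<^bsub>V\<^esub>"]) simp_all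
  next
    case (insert i I)
    then obtain w where w: "w \<in> carrier V" "\<Phi> w = (\<lambda>k. \<Sum>i\<in>I. a i * \<Phi> (e i) k)"
      "gen (G w) - (\<Sum>i\<in>I. Poly_Mapping.single (G (e i)) (a i)) \<in> S" by auto
    have ei: "e i \<in> carrier V" using insert.prems by simp
    let ?w = "a i \<odot>\<^bsub>V\<^esub> e i \<oplus>\<^bsub>V\<^esub> w"
    have "\<Phi> ?w = (\<lambda>k. \<Sum>i\<in>insert i I. a i * \<Phi> (e i) k)"
      unfolding \<Phi>_add[OF smult_in[OF ei] w(1)] \<Phi>_smult[OF ei] w(2) using insert.hyps by simp
    moreover have "gen (G ?w) - (\<Sum>i\<in>insert i I. Poly_Mapping.single (G (e i)) (a i)) \<in> S"
    proof -
      have "gen (G ?w) - (\<Sum>i\<in>insert i I. Poly_Mapping.single (G (e i)) (a i))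
        = (gen (G ?w) - gen (G (a i \<odot>\<^bsub>V\<^esub> e i)) - gen (G w))
          + ((gen (G (a i \<odot>\<^bsub>V\<^esub> e i)) - Poly_Mapping.single (G (e i)) (a i))
            + (gen (G w) - (\<Sum>i\<in>I. Poly_Mapping.single (G (e i)) (a i))))"
        unfolding sum.insert[OF insert.hyps] by simp
      then show ?thesis
        using lin_closedD(2)[OF S add[OF smult_in[OF ei] w(1)] lin_closedD(2)[OF S smult[OF ei] w(3)]] by (simp only:)
    qed
    ultimately show ?case using add_in[OF smult_in[OF ei] w(1)] by blast
  qed
  then obtain w where w: "w \<in> carrier V" "\<Phi> w = (\<lambda>k. \<Sum>i\<in>I. a i * \<Phi> (e i) k)"
      "gen (G w) - (\<Sum>i\<in>I. Poly_Mapping.single (G (e i)) (a i)) \<in> S" by blast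
  have "w = u" using w(1,2) u by (intro \<Phi>_inj) auto
  with w(3) show ?thesis by simp
qed

section \<open>Tensor products of coordinate spaces\<close>

definition vec_coord :: "nat \<Rightarrow> complex vec \<Rightarrow> nat \<Rightarrow> complex" where
  "vec_coord N v i = (if i < N then v $ i else 0)"

lemma cspace_model: "lin_model (cspace N) (vec_coord N)"
  by (rule lin_model.intro)
    (auto simp: module_vec_simps vec_coord_def fun_eq_iff intro!: eq_vecI split: if_splits)

definition tensor_ev :: "nat \<Rightarrow> nat \<Rightarrow> complex vec \<times> complex vec \<Rightarrow> nat \<times> nat \<Rightarrow> complex" where
  "tensor_ev N M vw ij = vec_coord N (fst vw) (fst ij) * vec_coord M (snd vw) (snd ij)"

definition unit_pair :: "nat \<Rightarrow> nat \<Rightarrow> nat \<times> nat \<Rightarrow> complex vec \<times> complex vec" where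
  "unit_pair N M ij = (unit_vec N (fst ij), unit_vec M (snd ij))"

lemma vec_coord_unit: "i < N \<Longrightarrow> vec_coord N (unit_vec N i) k = (if k = i then 1 else 0)"
  by (auto simp: vec_coord_def)

lemma vec_coord_sum: "vec_coord N v = (\<lambda>k. \<Sum>i<N. v $ i * vec_coord N (unit_vec N i) k)"
proof
  fix k
  have "(\<Sum>i<N. v $ i * vec_coord N (unit_vec N i) k) = (\<Sum>i<N. if k = i then v $ k else 0)"
    by (rule sum.cong) (auto simp: vec_coord_unit)
  then show "vec_coord N v k = (\<Sum>i<N. v $ i * vec_coord N (unit_vec N i) k)"
    by (simp add: vec_coord_def)
qed

abbreviation "tensor_gens N M \<equiv> carrier (cspace N) \<times> carrier (cspace M)"
abbreviation "tensor_rels N M \<equiv> tensor_relations (cspace N) (cspace M)"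
abbreviation "box N M \<equiv> {..<N} \<times> {..<M :: nat}"

lemma tensor_relationsI:
  shows "v \<in> carrier V \<Longrightarrow> v' \<in> carrier V \<Longrightarrow> w \<in> carrier W \<Longrightarrow>
      gen (v \<oplus>\<^bsub>V\<^esub> v', w) - gen (v, w) - gen (v', w) \<in> tensor_relations V W"
    and "v \<in> carrier V \<Longrightarrow> w \<in> carrier W \<Longrightarrow> w' \<in> carrier W \<Longrightarrow>
      gen (v, w \<oplus>\<^bsub>W\<^esub> w') - gen (v, w) - gen (v, w') \<in> tensor_relations V W"
    and "v \<in> carrier V \<Longrightarrow> w \<in> carrier W \<Longrightarrow>
      gen (c \<odot>\<^bsub>V\<^esub> v, w) - Poly_Mapping.single (v, w) c \<in> tensor_relations V W"
    and "v \<in> carrier V \<Longrightarrow> w \<in> carrier W \<Longrightarrow>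
      gen (v, c \<odot>\<^bsub>W\<^esub> w) - Poly_Mapping.single (v, w) c \<in> tensor_relations V W"
  unfolding tensor_relations_def
     apply (rule UnI1, rule UnI1, rule UnI1, rule CollectI, intro exI conjI, rule refl; assumption)
    apply (rule UnI1, rule UnI1, rule UnI2, rule CollectI, intro exI conjI, rule refl; assumption)
   apply (rule UnI1, rule UnI2, rule CollectI, intro exI conjI, rule refl; assumption)
  apply (rule UnI2, rule CollectI, intro exI conjI, rule refl; assumption)
  done

lemma sym_relationsI:
  shows "us @ [v] @ vs \<in> sym_words d V \<Longrightarrow> w \<in> carrier V \<Longrightarrow>
      gen (us @ [v \<oplus>\<^bsub>V\<^esub> w] @ vs) - gen (us @ [v] @ vs) - gen (us @ [w] @ vs) \<in> sym_relations d V"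
    and "us @ [v] @ vs \<in> sym_words d V \<Longrightarrow>
      gen (us @ [c \<odot>\<^bsub>V\<^esub> v] @ vs) - Poly_Mapping.single (us @ [v] @ vs) c \<in> sym_relations d V"
    and "us \<in> sym_words d V \<Longrightarrow> mset us = mset vs \<Longrightarrow> gen us - gen vs \<in> sym_relations d V"
  unfolding sym_relations_def
    apply (rule UnI1, rule UnI1, rule CollectI, intro exI conjI, rule refl; assumption)
   apply (rule UnI1, rule UnI2, rule CollectI, intro exI conjI, rule refl; assumption)
  apply (rule UnI2, rule CollectI, intro exI conjI, rule refl; assumption)
  done

lemma tensor_relations_keys:
  assumes "r \<in> tensor_rels N M" shows "Poly_Mapping.keys r \<subseteq> tensor_gens N M"
  using assms unfolding tensor_relations_def
  by (elim UnE CollectE exE conjE; hypsubst; intro keys_diff_subset)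
    (auto simp: module_vec_simps)

text \<open>Pairs of unit vectors span by expanding the first slot and then the second. They are
  independent because evaluation at \<open>q\<close> reads off the coefficient of the pair with
  index \<open>q\<close>.\<close>

lemma tensor_presentation:
  "presentation (tensor_gens N M) (tensor_rels N M) (tensor_ev N M) (unit_pair N M ` box N M)"
proof (rule presentation.intro)
  let ?S = "relation_span (tensor_gens N M) (tensor_rels N M)" and ?Y = "unit_pair N M ` box N M"
  have S: "lin_closed ?S" by (rule lin_closed_relation_span[OF tensor_relations_keys])
  have rel: "r \<in> ?S" if "r \<in> tensor_rels N M" for r
    by (rule relation_span_closed(4)[OF tensor_relations_keys that])
  fix r k
  show "r \<in> tensor_rels N M \<Longrightarrow> Poly_Mapping.keys r \<subseteq> tensor_gens N M" by (rule tensor_relations_keys)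
  show "r \<in> tensor_rels N M \<Longrightarrow> lin_ext (tensor_ev N M) r k = 0"
    unfolding tensor_relations_def
    by (elim UnE CollectE exE conjE; hypsubst;
        simp only: lin_ext_diff lin_ext_single;
        simp add: tensor_ev_def vec_coord_def module_vec_simps algebra_simps)
  show "?Y \<subseteq> tensor_gens N M" by (auto simp: unit_pair_def module_vec_simps)
  fix x assume "x \<in> tensor_gens N M"
  then obtain v w where x: "x = (v, w)" "v \<in> carrier (cspace N)" "w \<in> carrier (cspace M)" by auto
  show "\<exists>p. Poly_Mapping.keys p \<subseteq> ?Y \<and> gen x - p \<in> ?S"
    unfolding x(1)
  proof (rule reduce_combine[OF S finite_lessThan])
    show "gen (v, w) - (\<Sum>i<N. Poly_Mapping.single (unit_vec N i, w) (v $ i)) \<in> ?S"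
    proof (rule multilinear_reduce[where G = "\<lambda>v. (v, w)" and e = "unit_vec N", OF cspace_model S finite_lessThan _ _ _ x(2) vec_coord_sum])
      fix a b assume "a \<in> carrier (cspace N)" "b \<in> carrier (cspace N)"
      then show "gen (a \<oplus>\<^bsub>cspace N\<^esub> b, w) - gen (a, w) - gen (b, w) \<in> ?S"
        by (intro rel tensor_relationsI x(3))
    next
      fix c a assume "a \<in> carrier (cspace N)"
      then show "gen (c \<odot>\<^bsub>cspace N\<^esub> a, w) - Poly_Mapping.single (a, w) c \<in> ?S"
        by (intro rel tensor_relationsI x(3))
    qed (simp add: module_vec_simps)
    fix i assume "i \<in> {..<N}"
    then have i: "i < N" by simp
    show "\<exists>p. Poly_Mapping.keys p \<subseteq> ?Y \<and> gen (unit_vec N i, w) - p \<in> ?S"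
    proof (rule reduce_combine[OF S finite_lessThan])
      have ei: "unit_vec N i \<in> carrier (cspace N)" by (simp add: module_vec_simps)
      show "gen (unit_vec N i, w) - (\<Sum>j<M. Poly_Mapping.single (unit_vec N i, unit_vec M j) (w $ j)) \<in> ?S"
      proof (rule multilinear_reduce[where G = "\<lambda>w. (unit_vec N i, w)" and e = "unit_vec M", OF cspace_model S finite_lessThan _ _ _ x(3) vec_coord_sum])
        fix a b assume "a \<in> carrier (cspace M)" "b \<in> carrier (cspace M)"
        then show "gen (unit_vec N i, a \<oplus>\<^bsub>cspace M\<^esub> b) - gen (unit_vec N i, a) - gen (unit_vec N i, b) \<in> ?S"
          by (intro rel tensor_relationsI ei)
      next
        fix c a assume "a \<in> carrier (cspace M)"
        then show "gen (unit_vec N i, c \<odot>\<^bsub>cspace M\<^esub> a) - Poly_Mapping.single (unit_vec N i, a) c \<in> ?S"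
          by (intro rel tensor_relationsI ei)
      qed (simp add: module_vec_simps)
      fix j assume "j \<in> {..<M}"
      then have "(unit_vec N i, unit_vec M j) \<in> ?Y"
        using i by (intro image_eqI[of _ _ "(i, j)"]) (auto simp: unit_pair_def)
      then show "\<exists>p. Poly_Mapping.keys p \<subseteq> ?Y \<and> gen (unit_vec N i, unit_vec M j) - p \<in> ?S"
        by (intro exI[of _ "gen (unit_vec N i, unit_vec M j)"]) (simp add: lin_closedD(1)[OF S])
    qed
  qed
next
  fix p assume p: "Poly_Mapping.keys p \<subseteq> unit_pair N M ` box N M"
    and z: "\<And>k. lin_ext (tensor_ev N M) p k = 0"
  show "p = 0"
  proof (rule poly_mapping_eqI)
    fix x
    show "Poly_Mapping.lookup p x = Poly_Mapping.lookup 0 x"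
    proof (cases "x \<in> unit_pair N M ` box N M")
      case True
      then obtain q where q: "q \<in> box N M" "x = unit_pair N M q" by blast
      have inj: "inj_on (unit_pair N M) (box N M)"
        by (auto simp: inj_on_def unit_pair_def dest!: arg_cong[of "unit_vec _ _" _ "\<lambda>v. v $ _"] split: if_splits)
      have "0 = (\<Sum>y\<in>unit_pair N M ` box N M. Poly_Mapping.lookup p y * tensor_ev N M y q)"
        using z[of q] lin_ext_superset[OF _ p, of "tensor_ev N M" q] by simp
      also have "\<dots> = (\<Sum>q'\<in>box N M. Poly_Mapping.lookup p (unit_pair N M q') * tensor_ev N M (unit_pair N M q') q)"
        by (simp add: sum.reindex[OF inj])
      also have "\<dots> = (\<Sum>q'\<in>box N M. if q' = q then Poly_Mapping.lookup p x else 0)"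
        by (rule sum.cong) (use q in \<open>auto simp: tensor_ev_def unit_pair_def vec_coord_unit split: if_splits\<close>)
      finally show ?thesis using q(1) by simp
    next
      case False
      then show ?thesis using p by (auto simp: in_keys_iff)
    qed
  qed
qed

abbreviation "tens N M \<equiv> tensor (cspace N) (cspace M)"

definition tensor_model :: "nat \<Rightarrow> nat \<Rightarrow> (complex vec \<times> complex vec \<Rightarrow>\<^sub>0 complex) set \<Rightarrow> nat \<times> nat \<Rightarrow> complex" where
  "tensor_model N M = presentation.model (tensor_ev N M)"

lemma tensor_lin_model: "lin_model (tens N M) (tensor_model N M)"
  unfolding tensor_model_def tensor_def by (rule presentation.presented_model[OF tensor_presentation])

lemma tensor_model_support:
  assumes "C \<in> carrier (tens N M)" "q \<notin> box N M"
  shows "tensor_model N M C q = 0"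
proof -
  have "tensor_model N M C \<in> lin_ext (tensor_ev N M) ` {p. Poly_Mapping.keys p \<subseteq> tensor_gens N M}"
    using assms(1) presentation.model_image[OF tensor_presentation, of N M]
    unfolding tensor_model_def tensor_def by blast
  then obtain p where "tensor_model N M C = lin_ext (tensor_ev N M) p" by blast
  moreover have "tensor_ev N M x q = 0" for x using assms(2) by (cases q) (auto simp: tensor_ev_def vec_coord_def)
  ultimately show ?thesis by (simp add: lin_ext_def)
qed

lemma tensor_model_surj:
  "\<exists>C\<in>carrier (tens N M). \<forall>q\<in>box N M. tensor_model N M C q = g q"
proof -
  define p where "p = (\<Sum>q\<in>box N M. Poly_Mapping.single (unit_pair N M q) (g q))"
  have "Poly_Mapping.keys p \<subseteq> tensor_gens N M"
  proof -
    have "Poly_Mapping.keys (\<Sum>q\<in>A. Poly_Mapping.single (unit_pair N M q) (g q)) \<subseteq> tensor_gens N M" if "finite A" for A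
      using that
    proof (induction A)
      case (insert q A)
      then show ?case unfolding sum.insert[OF insert.hyps]
        by (intro keys_add_subset) (auto simp: unit_pair_def module_vec_simps)
    qed simp
    then show ?thesis by (simp add: p_def)
  qed
  then have "lin_ext (tensor_ev N M) p \<in> tensor_model N M ` carrier (tens N M)"
    using presentation.model_image[OF tensor_presentation, of N M] unfolding tensor_model_def tensor_def by blast
  then obtain C where C: "C \<in> carrier (tens N M)" "tensor_model N M C = lin_ext (tensor_ev N M) p" by force
  have "tensor_model N M C q = g q" if q: "q \<in> box N M" for q
  proof -
    have "tensor_model N M C q = (\<Sum>q'\<in>box N M. g q' * tensor_ev N M (unit_pair N M q') q)"
      by (simp add: C(2) p_def lin_ext_sum)
    also have "\<dots> = (\<Sum>q'\<in>box N M. if q' = q then g q else 0)"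
      by (rule sum.cong) (use q in \<open>auto simp: tensor_ev_def unit_pair_def vec_coord_unit split: if_splits\<close>)
    finally show ?thesis using q by simp
  qed
  then show ?thesis using C(1) by blast
qed

text \<open>The Kronecker product of \<open>A\<close> and \<open>B\<close> acting on coordinate
  arrays, cut off outside the box since \<open>tensor_model\<close> vanishes there.\<close>

definition tensor_act :: "nat \<Rightarrow> nat \<Rightarrow> complex mat \<Rightarrow> complex mat \<Rightarrow> (nat \<times> nat \<Rightarrow> complex) \<Rightarrow> nat \<times> nat \<Rightarrow> complex" where
  "tensor_act N M A B g q =
     (if q \<in> box N M then \<Sum>q'\<in>box N M. A $$ (fst q, fst q') * B $$ (snd q, snd q') * g q' else 0)"

lemma tensor_map_model:
  assumes A: "A \<in> carrier_mat N N" and B: "B \<in> carrier_mat M M" and C: "C \<in> carrier (tens N M)"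
  shows "tensor_map (cspace N) (cspace M) (\<lambda>v. A *\<^sub>v v) (\<lambda>w. B *\<^sub>v w) C \<in> carrier (tens N M)"
    and "tensor_model N M (tensor_map (cspace N) (cspace M) (\<lambda>v. A *\<^sub>v v) (\<lambda>w. B *\<^sub>v w) C)
      = tensor_act N M A B (tensor_model N M C)"
proof -
  have f: "map_prod (\<lambda>v. A *\<^sub>v v) (\<lambda>w. B *\<^sub>v w) x \<in> tensor_gens N M" if "x \<in> tensor_gens N M" for x
    using that A B by (auto simp: module_vec_simps)
  have ev: "tensor_ev N M (map_prod (\<lambda>v. A *\<^sub>v v) (\<lambda>w. B *\<^sub>v w) x) q = tensor_act N M A B (tensor_ev N M x) q"
    if "x \<in> tensor_gens N M" for x q
  proof (cases "q \<in> box N M")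
    case True
    obtain v w i j where x: "x = (v, w)" "q = (i, j)" by (metis surj_pair)
    have vw: "v \<in> carrier_vec N" "w \<in> carrier_vec M" "i < N" "j < M" using that True by (auto simp: x module_vec_simps)
    have "tensor_ev N M (map_prod (\<lambda>v. A *\<^sub>v v) (\<lambda>w. B *\<^sub>v w) x) q = (A *\<^sub>v v) $ i * (B *\<^sub>v w) $ j"
      using vw by (simp add: x tensor_ev_def vec_coord_def del: index_mult_mat_vec)
    also have "\<dots> = (\<Sum>k<N. \<Sum>l<M. (A $$ (i, k) * v $ k) * (B $$ (j, l) * w $ l))"
      unfolding mat_vec_entry[OF A vw(1,3)] mat_vec_entry[OF B vw(2,4)] by (rule sum_product)
    also have "\<dots> = tensor_act N M A B (tensor_ev N M x) q"
      using True unfolding sum.cartesian_product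
      by (auto simp: tensor_act_def x tensor_ev_def vec_coord_def intro!: sum.cong)
    finally show ?thesis .
  next
    case False
    then show ?thesis by (cases q) (auto simp: tensor_act_def tensor_ev_def vec_coord_def)
  qed
  have al: "tensor_act N M A B (\<lambda>k. \<Sum>x\<in>F. c x * tensor_ev N M x k) q = (\<Sum>x\<in>F. c x * tensor_act N M A B (tensor_ev N M x) q)"
    if "finite F" for F c q
  proof (cases "q \<in> box N M")
    case True
    have "tensor_act N M A B (\<lambda>k. \<Sum>x\<in>F. c x * tensor_ev N M x k) q
      = (\<Sum>q'\<in>box N M. \<Sum>x\<in>F. A $$ (fst q, fst q') * B $$ (snd q, snd q') * (c x * tensor_ev N M x q'))"
      using True by (simp add: tensor_act_def sum_distrib_left)
    also have "\<dots> = (\<Sum>x\<in>F. \<Sum>q'\<in>box N M. A $$ (fst q, fst q') * B $$ (snd q, snd q') * (c x * tensor_ev N M x q'))"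
      by (rule sum.swap)
    finally show ?thesis using True by (simp add: tensor_act_def sum_distrib_left mult_ac)
  qed (simp add: tensor_act_def)
  note * = presentation.presented_map_model[OF tensor_presentation f ev al C[unfolded tensor_def]]
  show "tensor_map (cspace N) (cspace M) (\<lambda>v. A *\<^sub>v v) (\<lambda>w. B *\<^sub>v w) C \<in> carrier (tens N M)"
    unfolding tensor_map_def tensor_def by (rule *(1))
  show "tensor_model N M (tensor_map (cspace N) (cspace M) (\<lambda>v. A *\<^sub>v v) (\<lambda>w. B *\<^sub>v w) C)
      = tensor_act N M A B (tensor_model N M C)"
    unfolding tensor_map_def tensor_model_def by (rule *(2))
qed

lemma triple_product_entry:
  assumes "Q \<in> carrier_mat a b" "X \<in> carrier_mat b c" "R \<in> carrier_mat c e" "i < a" "j < e"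
  shows "(Q * X * R) $$ (i, j) = (\<Sum>q\<in>box b c. Q $$ (i, fst q) * X $$ q * R $$ (snd q, j))"
proof -
  have "(Q * X * R) $$ (i, j) = (\<Sum>l<c. (\<Sum>k<b. Q $$ (i, k) * X $$ (k, l)) * R $$ (l, j))"
    unfolding mat_mult_entry[OF mult_carrier_mat[OF assms(1,2)] assms(3-5)]
    by (rule sum.cong) (use mat_mult_entry[OF assms(1,2,4)] in auto)
  also have "\<dots> = (\<Sum>l<c. \<Sum>k<b. Q $$ (i, k) * X $$ (k, l) * R $$ (l, j))" by (simp add: sum_distrib_right)
  also have "\<dots> = (\<Sum>k<b. \<Sum>l<c. Q $$ (i, k) * X $$ (k, l) * R $$ (l, j))" by (rule sum.swap)
  finally show ?thesis by (simp add: sum.cartesian_product split_def)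
qed

lemma mat_tensor_act:
  assumes A: "A \<in> carrier_mat N N" and B: "B \<in> carrier_mat M M"
  shows "mat N M (tensor_act N M A B g) = A * mat N M g * B\<^sup>T"
proof (rule eq_matI)
  fix i j assume "i < dim_row (A * mat N M g * B\<^sup>T)" "j < dim_col (A * mat N M g * B\<^sup>T)"
  then have ij: "i < N" "j < M" using A B by auto
  have "(A * mat N M g * B\<^sup>T) $$ (i, j) = (\<Sum>q\<in>box N M. A $$ (i, fst q) * mat N M g $$ q * B\<^sup>T $$ (snd q, j))"
    by (rule triple_product_entry) (use A B ij in auto)
  also have "\<dots> = tensor_act N M A B g (i, j)"
    using ij B by (auto simp: tensor_act_def intro!: sum.cong)
  finally show "mat N M (tensor_act N M A B g) $$ (i, j) = (A * mat N M g * B\<^sup>T) $$ (i, j)" using ij by simp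
qed (use A B in auto)


section \<open>Symmetric powers as spaces of forms\<close>

definition pairing :: "nat \<Rightarrow> nat \<Rightarrow> (nat \<times> nat \<Rightarrow> complex) \<Rightarrow> complex mat \<Rightarrow> complex" where
  "pairing m n g X = (\<Sum>q\<in>box m n. g q * X $$ q)"

text \<open>A form is constrained only on matrices of the right size; sending all others to 0 makes
  equality of forms an equality of functions.\<close>

definition on_mats :: "nat \<Rightarrow> nat \<Rightarrow> (complex mat \<Rightarrow> complex) \<Rightarrow> complex mat \<Rightarrow> complex" where
  "on_mats m n f X = (if X \<in> carrier_mat m n then f X else 0)"

text \<open>The transpose makes substitution in the left factor a left action; under
  \<open>pairing\<close> it corresponds to the Kronecker action on tensors.\<close>

definition translate :: "nat \<Rightarrow> nat \<Rightarrow> complex mat \<times> complex mat \<Rightarrow> (complex mat \<Rightarrow> complex) \<Rightarrow> complex mat \<Rightarrow> complex" where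
  "translate m n g f = on_mats m n (\<lambda>X. f ((fst g)\<^sup>T * X * snd g))"

lemma pairing_forms: "pairing m n g \<in> forms 1 m n"
proof -
  have "(\<lambda>X. \<Sum>q\<in>box m n. g q * X $$ q) \<in> forms 1 m n"
  proof (intro forms_sum forms_scale)
    fix q assume "q \<in> box m n"
    then show "(\<lambda>X. X $$ q) \<in> forms 1 m n" using forms_entry[of "fst q" m "snd q" n] by auto
  qed
  then show ?thesis by (simp add: pairing_def[abs_def])
qed

lemma pairing_tensor_act:
  assumes A: "A \<in> carrier_mat m m" and B: "B \<in> carrier_mat n n" and X: "X \<in> carrier_mat m n"
  shows "pairing m n (tensor_act m n A B g) X = pairing m n g (A\<^sup>T * X * B)"
proof -
  have "pairing m n (tensor_act m n A B g) X
    = (\<Sum>q\<in>box m n. \<Sum>q'\<in>box m n. A $$ (fst q, fst q') * B $$ (snd q, snd q') * g q' * X $$ q)"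
    by (simp add: pairing_def tensor_act_def sum_distrib_right)
  also have "\<dots> = (\<Sum>q'\<in>box m n. \<Sum>q\<in>box m n. A $$ (fst q, fst q') * B $$ (snd q, snd q') * g q' * X $$ q)"
    by (rule sum.swap)
  also have "\<dots> = pairing m n g (A\<^sup>T * X * B)"
    unfolding pairing_def
  proof (rule sum.cong[OF refl])
    fix q' assume q': "q' \<in> box m n"
    obtain k l where kl: "q' = (k, l)" "k < m" "l < n" using q' by auto
    have "(A\<^sup>T * X * B) $$ (k, l) = (\<Sum>q\<in>box m n. A\<^sup>T $$ (k, fst q) * X $$ q * B $$ (snd q, l))"
      by (rule triple_product_entry) (use A X B kl in auto)
    also have "\<dots> = (\<Sum>q\<in>box m n. A $$ (fst q, k) * X $$ q * B $$ (snd q, l))"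
      by (rule sum.cong) (use A kl in auto)
    finally have e: "(A\<^sup>T * X * B) $$ (k, l) = (\<Sum>q\<in>box m n. A $$ (fst q, k) * X $$ q * B $$ (snd q, l))" .
    show "(\<Sum>q\<in>box m n. A $$ (fst q, fst q') * B $$ (snd q, snd q') * g q' * X $$ q) = g q' * (A\<^sup>T * X * B) $$ q'"
      unfolding kl(1) e sum_distrib_left by (rule sum.cong) auto
  qed
  finally show ?thesis .
qed

lemma prod_list_count:
  fixes f :: "'a \<Rightarrow> complex"
  assumes "finite I" "set ps \<subseteq> I"
  shows "(\<Prod>q\<leftarrow>ps. f q) = (\<Prod>q\<in>I. f q ^ count (mset ps) q)"
  using assms(2)
proof (induction ps)
  case (Cons a ps)
  have "(\<Prod>q\<in>I. f q ^ count (mset (a # ps)) q) = (\<Prod>q\<in>I. (if q = a then f a else 1) * f q ^ count (mset ps) q)"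
    by (rule prod.cong) auto
  then show ?case using Cons assms(1) by (simp add: prod.distrib)
qed simp

text \<open>Isolates what the symmetric power uses of the tensor product, coordinates indexed by a
  box and a basis dual to them, so that the second quotient never looks into the cosets of the
  first.\<close>

locale coord_space = lin_model V \<Phi>
  for V :: "(complex, 'v, 'e) module_scheme" and \<Phi> :: "'v \<Rightarrow> nat \<times> nat \<Rightarrow> complex" +
  fixes m n :: nat and E :: "nat \<times> nat \<Rightarrow> 'v"
  assumes E_in: "q \<in> box m n \<Longrightarrow> E q \<in> carrier V"
    and E_coord: "q \<in> box m n \<Longrightarrow> \<Phi> (E q) = (\<lambda>q'. if q' = q then 1 else 0)"
    and support: "v \<in> carrier V \<Longrightarrow> q \<notin> box m n \<Longrightarrow> \<Phi> v q = 0"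
begin

lemma expand: "v \<in> carrier V \<Longrightarrow> \<Phi> v = (\<lambda>k. \<Sum>q\<in>box m n. \<Phi> v q * \<Phi> (E q) k)"
proof
  fix k assume v: "v \<in> carrier V"
  have "(\<Sum>q\<in>box m n. \<Phi> v q * \<Phi> (E q) k) = (\<Sum>q\<in>box m n. if q = k then \<Phi> v k else 0)"
    by (rule sum.cong) (auto simp: E_coord)
  then show "\<Phi> v k = (\<Sum>q\<in>box m n. \<Phi> v q * \<Phi> (E q) k)" using support[OF v, of k] by simp
qed

lemma pairing_E: "q \<in> box m n \<Longrightarrow> pairing m n (\<Phi> (E q)) X = X $$ q"
proof -
  assume q: "q \<in> box m n"
  have "pairing m n (\<Phi> (E q)) X = (\<Sum>q'\<in>box m n. if q' = q then X $$ q else 0)"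
    unfolding pairing_def by (rule sum.cong) (auto simp: E_coord[OF q])
  then show ?thesis using q by simp
qed

lemma pairing_word: "set ps \<subseteq> box m n \<Longrightarrow> (\<Prod>t\<leftarrow>map E ps. pairing m n (\<Phi> t) X) = word_mon ps X"
proof (induction ps)
  case (Cons q ps)
  then have "q \<in> box m n" "set ps \<subseteq> box m n" by auto
  with Cons.IH pairing_E show ?case by (simp only: list.map prod_list.Cons word_mon_def)
qed (simp add: word_mon_def)

lemma E_inj: "inj_on E (box m n)"
proof (rule inj_onI)
  fix q q' assume q: "q \<in> box m n" "q' \<in> box m n" "E q = E q'"
  then have "(\<lambda>k. if k = q then 1 else 0 :: complex) = (\<lambda>k. if k = q' then 1 else 0)"
    using E_coord by metis
  from fun_cong[OF this, of q] show "q = q'" by (simp split: if_splits)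
qed

text \<open>A symmetric product becomes the product of the linear forms that its factors define on
  matrices.\<close>

definition sym_ev :: "'v list \<Rightarrow> complex mat \<Rightarrow> complex" where
  "sym_ev ts = on_mats m n (\<lambda>X. \<Prod>t\<leftarrow>ts. pairing m n (\<Phi> t) X)"

text \<open>An arbitrary ordering of a multiset of positions, so that each monomial is represented
  by exactly one basis word.\<close>

definition word_of :: "(nat \<times> nat) multiset \<Rightarrow> (nat \<times> nat) list" where
  "word_of M = (SOME ps. mset ps = M)"

lemma mset_word_of [simp]: "mset (word_of M) = M"
  unfolding word_of_def by (rule someI_ex) (rule ex_mset)

definition sym_basis :: "nat \<Rightarrow> 'v list set" where
  "sym_basis d = (\<lambda>M. map E (word_of M)) ` mset ` words d m n"

lemma word_of_box: "M \<in> mset ` words d m n \<Longrightarrow> set (word_of M) \<subseteq> box m n \<and> length (word_of M) = d"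
  by (auto simp: words_def) (metis mset_word_of mset_eq_length mset_eq_setD subsetD set_mset_mset mem_Sigma_iff lessThan_iff)+

lemma sym_relations_keys:
  assumes "r \<in> sym_relations d V" shows "Poly_Mapping.keys r \<subseteq> sym_words d V"
proof -
  have w: "vs \<in> sym_words d V" if "us \<in> sym_words d V" "mset us = mset vs" for us vs
    using that mset_eq_length[OF that(2)] mset_eq_setD[OF that(2)] by (auto simp: sym_words_def)
  show ?thesis
    using assms unfolding sym_relations_def
  proof (elim UnE CollectE exE conjE)
    fix us v w' vs
    assume r: "r = gen (us @ [v \<oplus>\<^bsub>V\<^esub> w'] @ vs) - gen (us @ [v] @ vs) - gen (us @ [w'] @ vs)"
      and "us @ [v] @ vs \<in> sym_words d V" "w' \<in> carrier V"
    then show ?thesis unfolding r by (intro keys_diff_subset) (auto simp: sym_words_def add_in)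
  next
    fix us c v vs
    assume r: "r = gen (us @ [c \<odot>\<^bsub>V\<^esub> v] @ vs) - Poly_Mapping.single (us @ [v] @ vs) c"
      and "us @ [v] @ vs \<in> sym_words d V"
    then show ?thesis unfolding r by (intro keys_diff_subset) (auto simp: sym_words_def smult_in)
  next
    fix us vs
    assume r: "r = gen us - gen vs" and uv: "us \<in> sym_words d V" "mset us = mset vs"
    show ?thesis unfolding r using uv(1) w[OF uv] by (intro keys_diff_subset) auto
  qed
qed

text \<open>The basis words span, by expanding the slots one after another and reordering; they are
  independent because monomials with different exponents are linearly independent functions of the
  matrix entries.\<close>

lemma sym_presentation:
  "presentation (sym_words d V) (sym_relations d V) sym_ev (sym_basis d)"
proof (rule presentation.intro)
  let ?S = "relation_span (sym_words d V) (sym_relations d V)"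
  have S: "lin_closed ?S" by (rule lin_closed_relation_span[OF sym_relations_keys])
  have rel: "r \<in> ?S" if "r \<in> sym_relations d V" for r
    by (rule relation_span_closed(4)[OF sym_relations_keys that])
  fix r k
  show "r \<in> sym_relations d V \<Longrightarrow> Poly_Mapping.keys r \<subseteq> sym_words d V" by (rule sym_relations_keys)
  show "lin_ext sym_ev r k = 0" if r: "r \<in> sym_relations d V"
  proof -
    have pl: "(\<Prod>t\<leftarrow>us. pairing m n (\<Phi> t) X) = (\<Prod>t\<leftarrow>vs. pairing m n (\<Phi> t) X)" if "mset us = mset vs" for us vs X
      using arg_cong[OF that, of "\<lambda>M. prod_mset (image_mset (\<lambda>t. pairing m n (\<Phi> t) X) M)"]
      by (simp add: prod_mset_prod_list[symmetric] mset_map)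
    have pa: "pairing m n (\<lambda>k. g k + h k) X = pairing m n g X + pairing m n h X" for g h X
      by (simp add: pairing_def algebra_simps sum.distrib)
    have ps: "pairing m n (\<lambda>k. c * g k) X = c * pairing m n g X" for c g X
      by (simp add: pairing_def sum_distrib_left mult.assoc)
    show ?thesis
      using r unfolding sym_relations_def
    proof (elim UnE CollectE exE conjE)
      fix us v w vs
      assume r: "r = gen (us @ [v \<oplus>\<^bsub>V\<^esub> w] @ vs) - gen (us @ [v] @ vs) - gen (us @ [w] @ vs)"
        and "us @ [v] @ vs \<in> sym_words d V" "w \<in> carrier V"
      then have vw: "v \<in> carrier V" "w \<in> carrier V" by (auto simp: sym_words_def)
      show ?thesis
        unfolding r lin_ext_diff lin_ext_single
        by (simp add: sym_ev_def on_mats_def \<Phi>_add[OF vw] pa algebra_simps)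
    next
      fix us c v vs
      assume r: "r = gen (us @ [c \<odot>\<^bsub>V\<^esub> v] @ vs) - Poly_Mapping.single (us @ [v] @ vs) c"
        and "us @ [v] @ vs \<in> sym_words d V"
      then have v: "v \<in> carrier V" by (auto simp: sym_words_def)
      show ?thesis
        unfolding r lin_ext_diff lin_ext_single
        by (simp add: sym_ev_def on_mats_def \<Phi>_smult[OF v] ps algebra_simps)
    next
      fix us vs
      assume r: "r = gen us - gen vs" and uv: "mset us = mset vs"
      show ?thesis unfolding r lin_ext_diff lin_ext_single
        by (simp add: sym_ev_def on_mats_def pl[OF uv])
    qed
  qed
  show "sym_basis d \<subseteq> sym_words d V"
    using word_of_box E_in by (auto simp: sym_basis_def sym_words_def) (metis (no_types, lifting) E_in image_eqI subsetD word_of_box)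
  \<comment> \<open>\<open>us\<close> lists the indices of the slots already expanded,
    \<open>vs\<close> the vectors still waiting. When none is left, the permutation relation leads
    to the chosen ordering.\<close>
  have red: "\<exists>p. Poly_Mapping.keys p \<subseteq> sym_basis d \<and> gen (map E us @ vs) - p \<in> ?S"
    if "set us \<subseteq> box m n" "set vs \<subseteq> carrier V" "length us + length vs = d" for us vs
    using that
  proof (induction vs arbitrary: us)
    case Nil
    let ?us = "word_of (mset us)"
    have us: "us \<in> words d m n" using Nil by (auto simp: words_def)
    have "map E us \<in> sym_words d V" using Nil E_in by (auto simp: sym_words_def)
    moreover have "mset (map E us) = mset (map E ?us)" by (simp add: mset_map)
    ultimately have "gen (map E us) - gen (map E ?us) \<in> ?S"
      by (rule rel[OF sym_relationsI(3)])
    moreover have "map E ?us \<in> sym_basis d" using us by (auto simp: sym_basis_def)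
    ultimately show ?case by (intro exI[of _ "gen (map E ?us)"]) simp
  next
    case (Cons v vs)
    have v: "v \<in> carrier V" using Cons.prems by simp
    have E': "set (map E us) \<subseteq> carrier V" using Cons.prems E_in by auto
    have word: "map E us @ [a] @ vs \<in> sym_words d V" if "a \<in> carrier V" for a
      using that E' Cons.prems by (auto simp: sym_words_def)
    have "\<exists>p. Poly_Mapping.keys p \<subseteq> sym_basis d \<and> gen (map E us @ [v] @ vs) - p \<in> ?S"
    proof (rule reduce_combine[OF S])
      show "finite (box m n)" by simp
      show "gen (map E us @ [v] @ vs) - (\<Sum>q\<in>box m n. Poly_Mapping.single (map E us @ [E q] @ vs) (\<Phi> v q)) \<in> ?S"
      proof (rule multilinear_reduce[where G = "\<lambda>a. map E us @ [a] @ vs", OF lin_model_axioms S _ _ _ _ v expand[OF v]])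
        show "finite (box m n)" by simp
        show "E q \<in> carrier V" if "q \<in> box m n" for q by (rule E_in[OF that])
        fix a b assume "a \<in> carrier V" "b \<in> carrier V"
        then show "gen (map E us @ [a \<oplus>\<^bsub>V\<^esub> b] @ vs) - gen (map E us @ [a] @ vs) - gen (map E us @ [b] @ vs) \<in> ?S"
          by (intro rel sym_relationsI word)
      next
        fix c a assume "a \<in> carrier V"
        then show "gen (map E us @ [c \<odot>\<^bsub>V\<^esub> a] @ vs) - Poly_Mapping.single (map E us @ [a] @ vs) c \<in> ?S"
          by (intro rel sym_relationsI word)
      qed
      fix q assume "q \<in> box m n"
      then show "\<exists>p. Poly_Mapping.keys p \<subseteq> sym_basis d \<and> gen (map E us @ [E q] @ vs) - p \<in> ?S"
        using Cons.IH[of "us @ [q]"] Cons.prems by simp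
    qed
    then show ?case by simp
  qed
  fix x assume "x \<in> sym_words d V"
  then show "\<exists>p. Poly_Mapping.keys p \<subseteq> sym_basis d \<and> gen x - p \<in> ?S"
    using red[of "[]" x] by (simp add: sym_words_def)
next
  fix p assume p: "Poly_Mapping.keys p \<subseteq> sym_basis d" and z: "\<And>k. lin_ext sym_ev p k = 0"
  let ?M = "mset ` words d m n"
  \<comment> \<open>Multisets of positions are identified with exponent functions, the form in which
    \<open>monomials_independent\<close> expects its index set.\<close>
  define k where "k = (\<lambda>\<mu>. Poly_Mapping.lookup p (map E (word_of (Abs_multiset \<mu>))))"
  have inj: "inj_on (\<lambda>M. map E (word_of M)) ?M"
  proof (rule inj_onI)
    fix M M' assume M: "M \<in> ?M" "M' \<in> ?M" "map E (word_of M) = map E (word_of M')"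
    have "word_of M = word_of M'"
    proof (rule map_inj_on[OF M(3)])
      show "inj_on E (set (word_of M) \<union> set (word_of M'))"
        by (rule inj_on_subset[OF E_inj]) (use word_of_box M in blast)
    qed
    then show "M = M'" by (metis mset_word_of)
  qed
  have k0: "k (count M) = 0" if M: "M \<in> ?M" for M
  proof (rule monomials_independent[where I = "box m n" and E = "count ` ?M"])
    fix x :: "nat \<times> nat \<Rightarrow> complex"
    let ?X = "mat m n x"
    have "0 = (\<Sum>y\<in>sym_basis d. Poly_Mapping.lookup p y * sym_ev y ?X)"
      using z[of ?X] lin_ext_superset[OF _ p, of sym_ev ?X] by (simp add: sym_basis_def)
    also have "\<dots> = (\<Sum>M\<in>?M. Poly_Mapping.lookup p (map E (word_of M)) * sym_ev (map E (word_of M)) ?X)"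
      unfolding sym_basis_def by (subst sum.reindex[OF inj]) simp
    also have "\<dots> = (\<Sum>M\<in>?M. k (count M) * (\<Prod>q\<in>box m n. x q ^ count M q))"
    proof (rule sum.cong[OF refl])
      fix M assume "M \<in> ?M"
      then have b: "set (word_of M) \<subseteq> box m n" using word_of_box by blast
      have "sym_ev (map E (word_of M)) ?X = (\<Prod>q\<leftarrow>word_of M. ?X $$ q)"
        using pairing_word[OF b, of ?X] unfolding sym_ev_def on_mats_def word_mon_def by simp
      also have "\<dots> = (\<Prod>q\<leftarrow>word_of M. x q)" using b by (intro arg_cong[of _ _ prod_list]) auto
      also have "\<dots> = (\<Prod>q\<in>box m n. x q ^ count M q)" using prod_list_count[OF _ b, of x] by simp
      finally show "Poly_Mapping.lookup p (map E (word_of M)) * sym_ev (map E (word_of M)) ?X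
        = k (count M) * (\<Prod>q\<in>box m n. x q ^ count M q)" by (simp add: k_def count_inverse)
    qed
    also have "\<dots> = (\<Sum>\<mu>\<in>count ` ?M. k \<mu> * (\<Prod>q\<in>box m n. x q ^ \<mu> q))"
      by (subst sum.reindex) (auto simp: inj_on_def count_inject)
    finally show "(\<Sum>\<mu>\<in>count ` ?M. k \<mu> * (\<Prod>q\<in>box m n. x q ^ \<mu> q)) = 0" by simp
  next
    fix \<mu> \<nu> assume "\<mu> \<in> count ` ?M" "\<nu> \<in> count ` ?M" and eq: "\<And>q. q \<in> box m n \<Longrightarrow> \<mu> q = \<nu> q"
    then obtain us vs where uv: "us \<in> words d m n" "vs \<in> words d m n" "\<mu> = count (mset us)" "\<nu> = count (mset vs)" by blast
    show "\<mu> = \<nu>"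
    proof
      fix q
      show "\<mu> q = \<nu> q"
      proof (cases "q \<in> box m n")
        case False
        then have "q \<notin> set us" "q \<notin> set vs" using uv(1,2) by (auto simp: words_def)
        then have "count (mset us) q = 0" "count (mset vs) q = 0" by (simp_all add: count_eq_zero_iff)
        then show ?thesis by (simp only: uv(3,4))
      qed (rule eq)
    qed
  qed (use M in auto)
  show "p = 0"
  proof (rule poly_mapping_eqI)
    fix x
    show "Poly_Mapping.lookup p x = Poly_Mapping.lookup 0 x"
    proof (cases "x \<in> sym_basis d")
      case True
      then obtain M where "M \<in> ?M" "x = map E (word_of M)" by (auto simp: sym_basis_def)
      then show ?thesis using k0[of M] by (simp add: k_def count_inverse)
    next
      case False
      then show ?thesis using p by (auto simp: in_keys_iff)
    qed
  qed
qed

definition sym_model :: "('v list \<Rightarrow>\<^sub>0 complex) set \<Rightarrow> complex mat \<Rightarrow> complex" where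
  "sym_model = presentation.model sym_ev"

lemma sym_lin_model: "lin_model (sym_power d V) sym_model"
  unfolding sym_model_def sym_power_def by (rule presentation.presented_model[OF sym_presentation])

text \<open>A generator evaluates to a product of \<open>d\<close> linear forms, and words in the
  basis vectors evaluate to all the monomials.\<close>

lemma sym_model_image: "sym_model ` carrier (sym_power d V) = on_mats m n ` forms d m n"
proof -
  have im: "sym_model ` carrier (sym_power d V) = lin_ext sym_ev ` {p. Poly_Mapping.keys p \<subseteq> sym_words d V}"
    unfolding sym_model_def sym_power_def by (rule presentation.model_image[OF sym_presentation])
  show ?thesis
    unfolding im
  proof (rule subset_antisym; rule image_subsetI)
    fix p :: "'v list \<Rightarrow>\<^sub>0 complex" assume p: "p \<in> {p. Poly_Mapping.keys p \<subseteq> sym_words d V}"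
    let ?f = "\<lambda>X. \<Sum>ts\<in>Poly_Mapping.keys p. Poly_Mapping.lookup p ts * (\<Prod>t\<leftarrow>ts. pairing m n (\<Phi> t) X)"
    have "?f \<in> forms d m n"
    proof (intro forms_sum forms_scale)
      fix ts assume "ts \<in> Poly_Mapping.keys p"
      then have "length ts = d" using p by (auto simp: sym_words_def)
      then show "(\<lambda>X. \<Prod>t\<leftarrow>ts. pairing m n (\<Phi> t) X) \<in> forms d m n"
        using forms_prod_list[of ts "\<lambda>t. pairing m n (\<Phi> t)" m n] pairing_forms by simp
    qed
    moreover have "lin_ext sym_ev p = on_mats m n ?f"
      by (auto simp: fun_eq_iff lin_ext_def sym_ev_def on_mats_def)
    ultimately show "lin_ext sym_ev p \<in> on_mats m n ` forms d m n" by blast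
  next
    fix f assume "f \<in> forms d m n"
    then obtain c where c: "\<forall>X\<in>carrier_mat m n. f X = (\<Sum>ps\<in>words d m n. c ps * word_mon ps X)"
      unfolding forms_def by blast
    define p where "p = (\<Sum>ps\<in>words d m n. Poly_Mapping.single (map E ps) (c ps))"
    have "Poly_Mapping.keys (\<Sum>ps\<in>W. Poly_Mapping.single (map E ps) (c ps)) \<subseteq> sym_words d V"
      if "finite W" "W \<subseteq> words d m n" for W
      using that
    proof (induction W)
      case (insert ps W)
      have "map E ps \<in> sym_words d V" using insert.prems E_in by (auto simp: words_def sym_words_def)
      then show ?case unfolding sum.insert[OF insert.hyps]
        using insert by (intro keys_add_subset) auto
    qed simp
    then have "Poly_Mapping.keys p \<subseteq> sym_words d V" by (simp add: p_def)
    moreover have "on_mats m n f = lin_ext sym_ev p"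
    proof
      fix X
      have "sym_ev (map E ps) X = word_mon ps X" if "X \<in> carrier_mat m n" "ps \<in> words d m n" for ps
        using that pairing_word[of ps X] by (simp only: sym_ev_def on_mats_def words_def mem_Collect_eq if_True)
      moreover have "sym_ev (map E ps) X = 0" if "X \<notin> carrier_mat m n" for ps
        using that by (simp add: sym_ev_def on_mats_def)
      ultimately show "on_mats m n f X = lin_ext sym_ev p X"
        using c by (simp add: on_mats_def p_def lin_ext_sum)
    qed
    ultimately show "on_mats m n f \<in> lin_ext sym_ev ` {p. Poly_Mapping.keys p \<subseteq> sym_words d V}" by blast
  qed
qed

text \<open>The Kronecker action on a vector is a substitution in its linear form, by
  \<open>pairing_tensor_act\<close>, and substitution is compatible with products.\<close>

lemma sym_map_model:
  assumes A: "A \<in> carrier_mat m m" and B: "B \<in> carrier_mat n n" and C: "C \<in> carrier (sym_power d V)"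
    and f: "\<And>v. v \<in> carrier V \<Longrightarrow> f v \<in> carrier V"
    and fv: "\<And>v. v \<in> carrier V \<Longrightarrow> \<Phi> (f v) = tensor_act m n A B (\<Phi> v)"
  shows "sym_map d V f C \<in> carrier (sym_power d V)"
    and "sym_model (sym_map d V f C) = translate m n (A, B) (sym_model C)"
proof -
  have c: "A\<^sup>T * X * B \<in> carrier_mat m n" if "X \<in> carrier_mat m n" for X using A B that by simp
  have w: "map f ts \<in> sym_words d V" if "ts \<in> sym_words d V" for ts
    using that f by (auto simp: sym_words_def)
  have ev: "sym_ev (map f ts) X = translate m n (A, B) (sym_ev ts) X" if ts: "ts \<in> sym_words d V" for ts X
  proof (cases "X \<in> carrier_mat m n")
    case True
    have "sym_ev (map f ts) X = (\<Prod>t\<leftarrow>ts. pairing m n (\<Phi> (f t)) X)"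
      using True by (simp add: sym_ev_def on_mats_def o_def)
    also have "\<dots> = (\<Prod>t\<leftarrow>ts. pairing m n (\<Phi> t) (A\<^sup>T * X * B))"
      using ts by (intro arg_cong[of _ _ prod_list] map_cong refl)
        (auto simp: sym_words_def fv pairing_tensor_act[OF A B True])
    finally show ?thesis using True c[OF True] by (simp add: translate_def sym_ev_def on_mats_def)
  qed (simp add: sym_ev_def on_mats_def translate_def)
  have al: "translate m n (A, B) (\<lambda>X. \<Sum>x\<in>F. a x * sym_ev x X) X = (\<Sum>x\<in>F. a x * translate m n (A, B) (sym_ev x) X)"
    for F a X by (simp add: translate_def on_mats_def)
  note * = presentation.presented_map_model[OF sym_presentation w ev al C[unfolded sym_power_def]]
  show "sym_map d V f C \<in> carrier (sym_power d V)"
    unfolding sym_map_def sym_power_def by (rule *(1))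
  show "sym_model (sym_map d V f C) = translate m n (A, B) (sym_model C)"
    unfolding sym_map_def sym_model_def by (rule *(2))
qed

end

lemma tensor_coord_space:
  "\<exists>E. coord_space (tens m n) (tensor_model m n) m n E"
proof -
  have "\<forall>q\<in>box m n. \<exists>C\<in>carrier (tens m n). \<forall>q'\<in>box m n. tensor_model m n C q' = (if q' = q then 1 else 0)"
    by (intro ballI tensor_model_surj)
  from bchoice[OF this[unfolded Bex_def]] obtain E where E0: "\<forall>q\<in>box m n. E q \<in> carrier (tens m n) \<and>
    (\<forall>q'\<in>box m n. tensor_model m n (E q) q' = (if q' = q then 1 else 0))" ..
  have E: "E q \<in> carrier (tens m n)" if "q \<in> box m n" for q
    using bspec[OF E0 that] by (rule conjunct1)
  have E2: "tensor_model m n (E q) q' = (if q' = q then 1 else 0)" if "q \<in> box m n" "q' \<in> box m n" for q q'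
    using bspec[OF bspec[OF E0 that(1), THEN conjunct2] that(2)] .
  have "coord_space (tens m n) (tensor_model m n) m n E"
  proof (intro coord_space.intro coord_space_axioms.intro tensor_lin_model)
    fix q assume q: "q \<in> box m n"
    show "E q \<in> carrier (tens m n)" by (rule E[OF q])
    show "tensor_model m n (E q) = (\<lambda>q'. if q' = q then 1 else 0)"
    proof
      fix q'
      show "tensor_model m n (E q) q' = (if q' = q then 1 else 0)"
        using E2[OF q, of q'] tensor_model_support[OF E[OF q], of q'] q by (cases "q' \<in> box m n") auto
    qed
  qed (rule tensor_model_support)
  then show ?thesis by (rule exI[of _ E])
qed

section \<open>The decomposition\<close>

lemma translate_linear:
  "translate m n g (\<lambda>k. f k + f' k) = (\<lambda>k. translate m n g f k + translate m n g f' k)"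
  "translate m n g (\<lambda>k. c * f k) = (\<lambda>k. c * translate m n g f k)"
  by (auto simp: translate_def on_mats_def fun_eq_iff)

lemma translate_one: "translate m n (1\<^sub>m m, 1\<^sub>m n) (on_mats m n f) = on_mats m n f"
  by (auto simp: translate_def on_mats_def fun_eq_iff)

lemma translate_mult:
  assumes "A \<in> carrier_mat m m" "A' \<in> carrier_mat m m" "B \<in> carrier_mat n n" "B' \<in> carrier_mat n n"
  shows "translate m n (A * A', B * B') f = translate m n (A, B) (translate m n (A', B') f)"
proof
  fix X
  show "translate m n (A * A', B * B') f X = translate m n (A, B) (translate m n (A', B') f) X"
  proof (cases "X \<in> carrier_mat m n")
    case True
    have c: "A\<^sup>T \<in> carrier_mat m m" "A'\<^sup>T \<in> carrier_mat m m" "A\<^sup>T * X * B \<in> carrier_mat m n" using assms True by auto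
    have "(A * A')\<^sup>T * X * (B * B') = A'\<^sup>T * A\<^sup>T * X * (B * B')" using transpose_mult[OF assms(1,2)] by simp
    also have "\<dots> = A'\<^sup>T * A\<^sup>T * X * B * B'"
      by (rule assoc_mult_mat[symmetric, of _ m n _ n]) (use assms c True in auto)
    also have "A'\<^sup>T * A\<^sup>T * X * B = A'\<^sup>T * (A\<^sup>T * X * B)"
      using assms c True by (simp add: assoc_mult_mat[of _ m m _ m _ n] assoc_mult_mat[of _ m m _ n _ n])
    finally show ?thesis using True c(3) by (simp add: translate_def on_mats_def)
  qed (simp add: translate_def on_mats_def)
qed

lemma carrier_GL_prod: "g \<in> carrier (GL m \<times>\<times> GL n) \<Longrightarrow> \<exists>A B. g = (A, B) \<and> A \<in> carrier (GL m) \<and> B \<in> carrier (GL n)"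
  by (auto simp: DirProd_def)

lemma one_GL_prod: "\<one>\<^bsub>GL m \<times>\<times> GL n\<^esub> = (1\<^sub>m m, 1\<^sub>m n)"
  by (simp add: DirProd_def)

text \<open>The condition on the image makes the identity act trivially, as \<open>translate\<close>
  cuts off everything outside the \<open>m\<close> by \<open>n\<close> matrices.\<close>

lemma translate_representation:
  assumes V: "lin_model V \<Phi>" and im: "\<Phi> ` carrier V \<subseteq> range (on_mats m n)"
    and cl: "\<And>A B v. A \<in> carrier (GL m) \<Longrightarrow> B \<in> carrier (GL n) \<Longrightarrow> v \<in> carrier V \<Longrightarrow>
      \<rho> (A, B) v \<in> carrier V \<and> \<Phi> (\<rho> (A, B) v) = translate m n (A, B) (\<Phi> v)"
  shows "representation (GL m \<times>\<times> GL n) V \<rho>"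
proof (rule representation_by_model[OF V, where \<alpha> = "translate m n"])
  show "Group.group (GL m \<times>\<times> GL n)" by (rule DirProd_group[OF group_GL group_GL])
  fix g v assume "g \<in> carrier (GL m \<times>\<times> GL n)" "v \<in> carrier V"
  then show "\<rho> g v \<in> carrier V" "\<Phi> (\<rho> g v) = translate m n g (\<Phi> v)"
    using carrier_GL_prod[of g m n] cl by blast+
next
  fix v assume "v \<in> carrier V"
  then obtain f where "\<Phi> v = on_mats m n f" using im by blast
  then show "translate m n \<one>\<^bsub>GL m \<times>\<times> GL n\<^esub> (\<Phi> v) = \<Phi> v" by (simp add: one_GL_prod translate_one)
next
  fix g h v assume "g \<in> carrier (GL m \<times>\<times> GL n)" "h \<in> carrier (GL m \<times>\<times> GL n)"
  then obtain A B A' B' where gh: "g = (A, B)" "h = (A', B')" and c: "A \<in> carrier (GL m)" "B \<in> carrier (GL n)"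
    "A' \<in> carrier (GL m)" "B' \<in> carrier (GL n)" using carrier_GL_prod by meson
  show "translate m n (g \<otimes>\<^bsub>GL m \<times>\<times> GL n\<^esub> h) (\<Phi> v) = translate m n g (translate m n h (\<Phi> v))"
    unfolding gh mult_DirProd GL_mult
    by (rule translate_mult) (use c GL_carrierD in auto)
qed (simp_all add: translate_linear)

lemma dsum_simps:
  "carrier (dsum L V) = (\<Pi>\<^sub>E l\<in>L. carrier (V l))"
  "\<zero>\<^bsub>dsum L V\<^esub> = (\<lambda>l\<in>L. \<zero>\<^bsub>V l\<^esub>)"
  "p \<oplus>\<^bsub>dsum L V\<^esub> q = (\<lambda>l\<in>L. p l \<oplus>\<^bsub>V l\<^esub> q l)"
  "c \<odot>\<^bsub>dsum L V\<^esub> p = (\<lambda>l\<in>L. c \<odot>\<^bsub>V l\<^esub> p l)"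
  by (simp_all add: dsum_def)

section \<open>The direct sum of tensor products as the same space of forms\<close>

context cauchy_map
begin

abbreviation "W \<equiv> dsum (partitions d) (\<lambda>la. tens (N la) (M la))"

definition block :: "(nat list \<Rightarrow> (complex vec \<times> complex vec \<Rightarrow>\<^sub>0 complex) set) \<Rightarrow> nat list \<Rightarrow> complex mat" where
  "block p la = mat (N la) (M la) (tensor_model (N la) (M la) (p la))"

definition dsum_model :: "(nat list \<Rightarrow> (complex vec \<times> complex vec \<Rightarrow>\<^sub>0 complex) set) \<Rightarrow> complex mat \<Rightarrow> complex" where
  "dsum_model p = on_mats m n (\<Psi> (block p))"

lemma block_blocks: "block p \<in> blocks d N M"
  by (simp add: blocks_def block_def)

lemma W_component: "p \<in> carrier W \<Longrightarrow> la \<in> partitions d \<Longrightarrow> p la \<in> carrier (tens (N la) (M la))"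
  by (auto simp: dsum_simps)

lemma dsum_model_smult: "p \<in> carrier W \<Longrightarrow> dsum_model (c \<odot>\<^bsub>W\<^esub> p) = (\<lambda>k. c * dsum_model p k)"
proof
  fix X assume p: "p \<in> carrier W"
  have "\<Psi> (block (c \<odot>\<^bsub>W\<^esub> p)) X = \<Psi> (\<lambda>la. c \<cdot>\<^sub>m block p la) X"
  proof (rule \<Psi>_cong)
    fix la assume la: "la \<in> partitions d"
    then show "block (c \<odot>\<^bsub>W\<^esub> p) la = c \<cdot>\<^sub>m block p la"
      by (auto simp: block_def dsum_simps lin_model.\<Phi>_smult[OF tensor_lin_model W_component[OF p la]] intro!: eq_matI)
  qed
  then show "dsum_model (c \<odot>\<^bsub>W\<^esub> p) X = c * dsum_model p X"
    by (simp add: dsum_model_def on_mats_def \<Psi>_smult[OF block_blocks])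
qed

lemma dsum_model_add: 
  "p \<in> carrier W \<Longrightarrow> q \<in> carrier W \<Longrightarrow> dsum_model (p \<oplus>\<^bsub>W\<^esub> q) = (\<lambda>k. dsum_model p k + dsum_model q k)"
proof
  fix X assume p: "p \<in> carrier W" "q \<in> carrier W"
  have "\<Psi> (block (p \<oplus>\<^bsub>W\<^esub> q)) X = \<Psi> (\<lambda>la. block p la + block q la) X"
  proof (rule \<Psi>_cong)
    fix la assume la: "la \<in> partitions d"
    then show "block (p \<oplus>\<^bsub>W\<^esub> q) la = block p la + block q la"
      by (auto simp: block_def dsum_simps
          lin_model.\<Phi>_add[OF tensor_lin_model W_component[OF p(1) la] W_component[OF p(2) la]] intro!: eq_matI)
  qed
  then show "dsum_model (p \<oplus>\<^bsub>W\<^esub> q) X = dsum_model p X + dsum_model q X"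
    by (simp add: dsum_model_def on_mats_def \<Psi>_add[OF block_blocks block_blocks])
qed

lemma dsum_lin_model: "lin_model W dsum_model"
proof (rule lin_model.intro)
  note T = tensor_lin_model
  show z: "\<zero>\<^bsub>W\<^esub> \<in> carrier W" using lin_model.zero_in[OF T] by (auto simp: dsum_simps)
  have add: "v \<oplus>\<^bsub>W\<^esub> w \<in> carrier W" if "v \<in> carrier W" "w \<in> carrier W" for v w
    unfolding dsum_simps by (intro restrict_PiE_iff[THEN iffD2] ballI lin_model.add_in[OF T] W_component[OF that(1)] W_component[OF that(2)])
  have smult: "c \<odot>\<^bsub>W\<^esub> v \<in> carrier W" if "v \<in> carrier W" for c v
    unfolding dsum_simps by (intro restrict_PiE_iff[THEN iffD2] ballI lin_model.smult_in[OF T] W_component[OF that])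
  have comp: "v la = w la" if vw: "v \<in> carrier W" "w \<in> carrier W" and la: "la \<in> partitions d"
      and b: "block v la = block w la" for v w la
  proof (rule lin_model.\<Phi>_inj[OF T W_component[OF vw(1) la] W_component[OF vw(2) la]], rule ext)
    fix q
    show "tensor_model (N la) (M la) (v la) q = tensor_model (N la) (M la) (w la) q"
    proof (cases "q \<in> box (N la) (M la)")
      case True
      then show ?thesis using arg_cong[OF b, of "\<lambda>Z. Z $$ q"] by (cases q) (simp add: block_def)
    next
      case False
      then show ?thesis
        using tensor_model_support[OF W_component[OF vw(1) la]] tensor_model_support[OF W_component[OF vw(2) la]] by simp
    qed
  qed
  show "v \<oplus>\<^bsub>W\<^esub> w \<in> carrier W" if "v \<in> carrier W" "w \<in> carrier W" for v w by (rule add[OF that])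
  show "c \<odot>\<^bsub>W\<^esub> v \<in> carrier W" if "v \<in> carrier W" for c v by (rule smult[OF that])
  show "dsum_model (v \<oplus>\<^bsub>W\<^esub> w) = (\<lambda>k. dsum_model v k + dsum_model w k)" if "v \<in> carrier W" "w \<in> carrier W" for v w
    by (rule dsum_model_add[OF that])
  show "dsum_model (c \<odot>\<^bsub>W\<^esub> v) = (\<lambda>k. c * dsum_model v k)" if "v \<in> carrier W" for c v
    by (rule dsum_model_smult[OF that])
  show "v = w" if vw: "v \<in> carrier W" "w \<in> carrier W" and eq: "dsum_model v = dsum_model w" for v w
  proof -
    \<comment> \<open>Injectivity of \<open>\<Psi>\<close> speaks about the zero function, so it is
      applied to the difference of \<open>v\<close> and \<open>w\<close> formed inside the direct
      sum.\<close>
    let ?u = "v \<oplus>\<^bsub>W\<^esub> (- 1) \<odot>\<^bsub>W\<^esub> w"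
    have mw: "(- 1) \<odot>\<^bsub>W\<^esub> w \<in> carrier W" by (rule smult[OF vw(2)])
    have "\<Psi> (block ?u) X = 0" if X: "X \<in> carrier_mat m n" for X
    proof -
      have "dsum_model ?u X = dsum_model v X + (- 1) * dsum_model w X"
        by (simp only: dsum_model_add[OF vw(1) mw] dsum_model_smult[OF vw(2)])
      then have "dsum_model ?u X = 0" by (simp add: eq)
      then show ?thesis using X by (simp add: dsum_model_def on_mats_def)
    qed
    then have 0: "block ?u la = 0\<^sub>m (N la) (M la)" if "la \<in> partitions d" for la
      by (rule \<Psi>_inj[OF block_blocks _ that])
    have "block v la = block w la" if la: "la \<in> partitions d" for la
    proof (rule eq_matI)
      fix i j assume "i < dim_row (block w la)" "j < dim_col (block w la)"
      then have ij: "i < N la" "j < M la" by (auto simp: block_def)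
      note wl = W_component[OF vw(2) la]
      have "block ?u la $$ (i, j) = tensor_model (N la) (M la) (v la) (i, j) + (- 1) * tensor_model (N la) (M la) (w la) (i, j)"
        using ij la by (simp add: block_def dsum_simps lin_model.\<Phi>_add[OF T W_component[OF vw(1) la] lin_model.smult_in[OF T wl]]
            lin_model.\<Phi>_smult[OF T wl])
      then show "block v la $$ (i, j) = block w la $$ (i, j)" using arg_cong[OF 0[OF la], of "\<lambda>Z. Z $$ (i, j)"] ij by (simp add: block_def)
    qed (simp_all add: block_def)
    then have "v la = w la" if "la \<in> partitions d" for la using comp[OF vw that] that by blast
    then show "v = w" using vw unfolding dsum_simps by (intro PiE_ext) auto
  qed
  \<comment> \<open>Zero is written as 0 times itself, so that the rule for scalars gives the zero
    function.\<close>
  show "dsum_model \<zero>\<^bsub>W\<^esub> = (\<lambda>_. 0)"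
  proof -
    have "0 \<odot>\<^bsub>W\<^esub> \<zero>\<^bsub>W\<^esub> = \<zero>\<^bsub>W\<^esub>"
    proof -
      have "0 \<odot>\<^bsub>tens a b\<^esub> \<zero>\<^bsub>tens a b\<^esub> = \<zero>\<^bsub>tens a b\<^esub>" for a b
        by (rule lin_model.\<Phi>_inj[OF T[of a b]])
          (simp_all add: lin_model.smult_in[OF T] lin_model.zero_in[OF T] lin_model.\<Phi>_smult[OF T] lin_model.\<Phi>_zero[OF T])
      then show ?thesis unfolding dsum_simps by (intro restrict_ext) simp
    qed
    then show ?thesis using dsum_model_smult[OF z, of 0] by simp
  qed
qed

lemma dsum_model_image: "dsum_model ` carrier W = on_mats m n ` forms d m n"
proof (rule subset_antisym; rule image_subsetI)
  fix p
  show "dsum_model p \<in> on_mats m n ` forms d m n"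
    unfolding dsum_model_def by (rule imageI) (rule \<Psi>_forms[OF block_blocks])
next
  fix f assume "f \<in> forms d m n"
  then obtain Z where Z: "Z \<in> blocks d N M" "\<forall>X\<in>carrier_mat m n. \<Psi> Z X = f X" using \<Psi>_surj by blast
  have "\<forall>la. \<exists>C. C \<in> carrier (tens (N la) (M la)) \<and> (\<forall>q\<in>box (N la) (M la). tensor_model (N la) (M la) C q = Z la $$ q)"
    using tensor_model_surj unfolding Bex_def by (intro allI)
  from choice[OF this] obtain C where C: "\<forall>la. C la \<in> carrier (tens (N la) (M la)) \<and>
      (\<forall>q\<in>box (N la) (M la). tensor_model (N la) (M la) (C la) q = Z la $$ q)" ..
  let ?p = "restrict C (partitions d)"
  have p: "?p \<in> carrier W" unfolding dsum_simps by (intro restrict_PiE_iff[THEN iffD2] ballI) (use C in blast)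
  have "\<Psi> (block ?p) X = \<Psi> Z X" for X
  proof (rule \<Psi>_cong)
    fix la assume la: "la \<in> partitions d"
    show "block ?p la = Z la"
    proof (rule eq_matI)
      fix i j assume "i < dim_row (Z la)" "j < dim_col (Z la)"
      then have "i < N la" "j < M la" using Z(1) la by (auto simp: blocks_def)
      then show "block ?p la $$ (i, j) = Z la $$ (i, j)" using C la by (simp add: block_def)
    qed (use Z(1) la in \<open>auto simp: blocks_def block_def\<close>)
  qed
  then have "dsum_model ?p = on_mats m n f" using Z(2) by (simp add: dsum_model_def on_mats_def fun_eq_iff)
  then show "on_mats m n f \<in> dsum_model ` carrier W" using imageI[OF p, of dsum_model] by simp
qed

lemma dsum_map_model:
  assumes A: "A \<in> carrier (GL m)" and B: "B \<in> carrier (GL n)" and p: "p \<in> carrier W"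
    and R: "\<And>la. la \<in> partitions d \<Longrightarrow> R la B = r la B" "\<And>la. la \<in> partitions d \<Longrightarrow> r la B \<in> carrier_mat (N la) (N la)"
    and S: "\<And>la. la \<in> partitions d \<Longrightarrow> S la A = s la A" "\<And>la. la \<in> partitions d \<Longrightarrow> s la A \<in> carrier_mat (M la) (M la)"
  defines "p' \<equiv> dsum_map (partitions d) (\<lambda>la. tensor_map (cspace (N la)) (cspace (M la)) (\<lambda>v. R la B *\<^sub>v v) (\<lambda>w. S la A *\<^sub>v w)) p"
  shows "p' \<in> carrier W \<and> dsum_model p' = translate m n (A, B) (dsum_model p)"
proof
  have p': "p' la = tensor_map (cspace (N la)) (cspace (M la)) (\<lambda>v. r la B *\<^sub>v v) (\<lambda>w. s la A *\<^sub>v w) (p la)"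
    if "la \<in> partitions d" for la using that by (simp add: p'_def dsum_map_def R(1) S(1))
  have "p' la \<in> carrier (tens (N la) (M la))" if la: "la \<in> partitions d" for la
    unfolding p'[OF la] by (rule tensor_map_model(1)[OF R(2)[OF la] S(2)[OF la] W_component[OF p la]])
  then show "p' \<in> carrier W" unfolding dsum_simps by (intro PiE_I) (auto simp: p'_def dsum_map_def)
  show "dsum_model p' = translate m n (A, B) (dsum_model p)"
  proof
    fix X
    show "dsum_model p' X = translate m n (A, B) (dsum_model p) X"
    proof (cases "X \<in> carrier_mat m n")
      case True
      have AB: "A \<in> carrier_mat m m" "B \<in> carrier_mat n n" using A B GL_carrierD by auto
      have "\<Psi> (block p') X = \<Psi> (\<lambda>la. r la B * block p la * (s la A)\<^sup>T) X"
      proof (rule \<Psi>_cong)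
        fix la assume la: "la \<in> partitions d"
        show "block p' la = r la B * block p la * (s la A)\<^sup>T"
          unfolding block_def p'[OF la] tensor_map_model(2)[OF R(2)[OF la] S(2)[OF la] W_component[OF p la]]
          by (rule mat_tensor_act[OF R(2)[OF la] S(2)[OF la]])
      qed
      also have "\<dots> = \<Psi> (block p) (A\<^sup>T * X * B)" by (rule \<Psi>_equivariant[OF block_blocks AB True])
      finally show ?thesis using True AB by (simp add: dsum_model_def translate_def on_mats_def)
    qed (simp add: dsum_model_def translate_def on_mats_def)
  qed
qed

end

lemma cauchy_map_exists:
  assumes fr: "family n d N r" and fs: "family m d M s"
  shows "\<exists>\<Psi>. cauchy_map d m n N M r s \<Psi>"
proof (cases "m \<le> n")
  case True
  then show ?thesis by (rule cauchy_map_exists_le[OF fr fs])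
next
  case False
  then obtain \<Psi> where "cauchy_map d n m M N s r \<Psi>" using cauchy_map_exists_le[OF fs fr] by auto
  from cauchy_map_swap[OF this] familyD(1)[OF fr] familyD(1)[OF fs] show ?thesis by (intro exI) blast
qed

text \<open>Burnside's theorem: the operators \<open>r la A\<close> span all matrices. Otherwise, by
  duality, the coefficient at \<open>(k, l)\<close> would be a combination of the other ones,
  against their independence.\<close>

lemma family_burnside:
  assumes fam: "family n d N r" and la: "la \<in> partitions d" and kl: "(k, l) \<in> box (N la) (N la)"
  shows "\<exists>F c. finite F \<and> F \<subseteq> carrier (GL n) \<and>
    (\<forall>q\<in>box (N la) (N la). (\<Sum>A\<in>F. c A * r la A $$ q) = (if q = (k, l) then 1 else 0))"
proof -
  let ?I = "box (N la) (N la) - {(k, l)}"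
  have "\<exists>F c. finite F \<and> F \<subseteq> carrier (GL n) \<and> (\<forall>q\<in>?I. (\<Sum>A\<in>F. c A * r la A $$ q) = 0) \<and>
    (\<Sum>A\<in>F. c A * r la A $$ (k, l)) \<noteq> 0"
  proof (rule ccontr)
    assume no: "\<not> ?thesis"
    have "\<exists>b. \<forall>A\<in>carrier (GL n). r la A $$ (k, l) = (\<Sum>q\<in>?I. b q * r la A $$ q)"
      proof (rule functionals_span)
      fix F c assume F: "finite F" "F \<subseteq> carrier (GL n)" and 0: "\<And>q. q \<in> ?I \<Longrightarrow> (\<Sum>A\<in>F. c A * r la A $$ q) = 0"
      show "(\<Sum>A\<in>F. c A * r la A $$ (k, l)) = 0"
      proof (rule ccontr)
        assume "(\<Sum>A\<in>F. c A * r la A $$ (k, l)) \<noteq> 0"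
        then have "\<exists>F c. finite F \<and> F \<subseteq> carrier (GL n) \<and> (\<forall>q\<in>?I. (\<Sum>A\<in>F. c A * r la A $$ q) = 0) \<and>
            (\<Sum>A\<in>F. c A * r la A $$ (k, l)) \<noteq> 0"
          by (intro exI[of _ F] exI[of _ c] conjI ballI F 0)
        then show False using no by contradiction
      qed
    qed simp
    then obtain b where b: "\<And>A. A \<in> carrier (GL n) \<Longrightarrow> r la A $$ (k, l) = (\<Sum>q\<in>?I. b q * r la A $$ q)" by blast
    define b' where "b' = (\<lambda>i j. if (i, j) = (k, l) then 1 else - b (i, j))"
    have "b' k l = 0"
    proof (rule family_coefficients_independent1[OF fam la])
      fix A assume A: "A \<in> carrier (GL n)"
      have "(\<Sum>i<N la. \<Sum>j<N la. b' i j * r la A $$ (i, j)) = (\<Sum>q\<in>box (N la) (N la). b' (fst q) (snd q) * r la A $$ q)"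
        by (simp add: sum.cartesian_product split_def)
      also have "\<dots> = b' k l * r la A $$ (k, l) + (\<Sum>q\<in>?I. b' (fst q) (snd q) * r la A $$ q)"
        using kl by (subst sum.remove[of _ "(k, l)"]) auto
      also have "(\<Sum>q\<in>?I. b' (fst q) (snd q) * r la A $$ q) = - (\<Sum>q\<in>?I. b q * r la A $$ q)"
        unfolding sum_negf[symmetric] by (rule sum.cong) (auto simp: b'_def)
      finally show "(\<Sum>i<N la. \<Sum>j<N la. b' i j * r la A $$ (i, j)) = 0" using b[OF A] by (simp add: b'_def)
    qed (use kl in auto)
    then show False by (simp add: b'_def)
  qed
  then obtain F c where F: "finite F" "F \<subseteq> carrier (GL n)" "\<And>q. q \<in> ?I \<Longrightarrow> (\<Sum>A\<in>F. c A * r la A $$ q) = 0"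
    and nz: "(\<Sum>A\<in>F. c A * r la A $$ (k, l)) \<noteq> 0" by blast
  define \<beta> where "\<beta> = (\<Sum>A\<in>F. c A * r la A $$ (k, l))"
  have "(\<Sum>A\<in>F. c A / \<beta> * r la A $$ q) = (if q = (k, l) then 1 else 0)" if "q \<in> box (N la) (N la)" for q
  proof -
    have "(\<Sum>A\<in>F. c A / \<beta> * r la A $$ q) = (\<Sum>A\<in>F. c A * r la A $$ q) / \<beta>" by (simp add: sum_divide_distrib)
    then show ?thesis using F(3)[of q] that nz by (auto simp: \<beta>_def)
  qed
  then show ?thesis using F(1,2) by (intro exI[of _ F] exI[of _ "\<lambda>A. c A / \<beta>"] conjI ballI) auto
qed

lemma supported_eqI:
  assumes "\<And>q. q \<notin> box N M \<Longrightarrow> f q = 0" "\<And>q. q \<notin> box N M \<Longrightarrow> g q = 0" "mat N M f = mat N M g"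
  shows "f = g"
proof
  fix q
  show "f q = g q"
  proof (cases "q \<in> box N M")
    case True
    then show ?thesis using arg_cong[OF assms(3), of "\<lambda>Z. Z $$ q"] by (cases q) simp
  qed (use assms in simp)
qed

lemma tensor_act_support: "q \<notin> box N M \<Longrightarrow> tensor_act N M A B g q = 0"
  by (simp add: tensor_act_def)

lemma tensor_act_mult:
  assumes "A \<in> carrier_mat N N" "A' \<in> carrier_mat N N" "B \<in> carrier_mat M M" "B' \<in> carrier_mat M M"
  shows "tensor_act N M (A * A') (B * B') g = tensor_act N M A B (tensor_act N M A' B' g)"
proof (rule supported_eqI[of N M])
  have "mat N M (tensor_act N M (A * A') (B * B') g) = A * A' * mat N M g * (B * B')\<^sup>T"
    by (rule mat_tensor_act) (use assms in auto)
  also have "(B * B')\<^sup>T = B'\<^sup>T * B\<^sup>T" by (rule transpose_mult[OF assms(3,4)])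
  also have "A * A' * mat N M g * (B'\<^sup>T * B\<^sup>T) = A * A' * mat N M g * B'\<^sup>T * B\<^sup>T"
    by (rule assoc_mult_mat[symmetric, of _ N M _ M _ M]) (use assms in auto)
  also have "A * A' * mat N M g * B'\<^sup>T = A * (A' * mat N M g * B'\<^sup>T)"
    using assms by (simp add: assoc_mult_mat[of _ N N _ N _ M] assoc_mult_mat[of _ N N _ M _ M])
  also have "A' * mat N M g * B'\<^sup>T = mat N M (tensor_act N M A' B' g)"
    by (rule mat_tensor_act[symmetric, OF assms(2,4)])
  also have "A * \<dots> * B\<^sup>T = mat N M (tensor_act N M A B (tensor_act N M A' B' g))"
    by (rule mat_tensor_act[symmetric, OF assms(1,3)])
  finally show "mat N M (tensor_act N M (A * A') (B * B') g) = mat N M (tensor_act N M A B (tensor_act N M A' B' g))" .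
qed (simp_all add: tensor_act_support)

lemma tensor_act_one:
  assumes "\<And>q. q \<notin> box N M \<Longrightarrow> g q = 0" 
  shows "tensor_act N M (1\<^sub>m N) (1\<^sub>m M) g = g"
proof (rule supported_eqI[of N M])
  show "mat N M (tensor_act N M (1\<^sub>m N) (1\<^sub>m M) g) = mat N M g"
    by (subst mat_tensor_act) (auto simp: right_mult_one_mat[of _ N M] left_mult_one_mat[of _ N M])
qed (simp_all add: tensor_act_support assms)

text \<open>A nonzero vector has a nonzero coordinate \<open>(i0, j0)\<close>. Burnside's theorem
  for both factors gives combinations of operators that act as the matrix units
  \<open>(k, i0)\<close> and \<open>(l, j0)\<close>; together they move this coordinate to any
  position and kill the others, so every basis tensor lies in \<open>U\<close>.\<close>

lemma tensor_irreducible: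
  assumes fr: "family n d N r" and fs: "family m d M s" and la: "la \<in> partitions d"
    and R: "R \<in> hom (GL n) (GL (N la))" "\<And>B. B \<in> carrier (GL n) \<Longrightarrow> r la B = R B"
    and S: "S \<in> hom (GL m) (GL (M la))" "\<And>A. A \<in> carrier (GL m) \<Longrightarrow> s la A = S A"
    and pos: "N la > 0" "M la > 0"
  shows "irreducible_rep (GL m \<times>\<times> GL n) (tens (N la) (M la))
    (\<lambda>(A, B). tensor_map (cspace (N la)) (cspace (M la)) (\<lambda>v. R B *\<^sub>v v) (\<lambda>w. S A *\<^sub>v w))"
proof -
  define a b where "a = N la" and "b = M la"
  define \<rho> where "\<rho> = (\<lambda>(A, B). tensor_map (cspace a) (cspace b) (\<lambda>v. R B *\<^sub>v v) (\<lambda>w. S A *\<^sub>v w))"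
  interpret T: lin_model "tens a b" "tensor_model a b" by (rule tensor_lin_model)
  have hR: "R \<in> hom (GL n) (GL a)" and hS: "S \<in> hom (GL m) (GL b)" using R(1) S(1) by (auto simp: a_def b_def)
  have act: "\<rho> (A, B) C \<in> carrier (tens a b)" "tensor_model a b (\<rho> (A, B) C) = tensor_act a b (R B) (S A) (tensor_model a b C)"
    if "A \<in> carrier (GL m)" "B \<in> carrier (GL n)" "C \<in> carrier (tens a b)" for A B C
    unfolding \<rho>_def split_conv
    by (rule tensor_map_model[OF hom_GL(1)[OF hR that(2)] hom_GL(1)[OF hS that(1)] that(3)])+
  have rep: "representation (GL m \<times>\<times> GL n) (tens a b) \<rho>"
  proof (rule representation_by_model[OF tensor_lin_model, where \<alpha> = "\<lambda>(A, B). tensor_act a b (R B) (S A)"])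
    show "Group.group (GL m \<times>\<times> GL n)" by (rule DirProd_group[OF group_GL group_GL])
    fix g C assume g: "g \<in> carrier (GL m \<times>\<times> GL n)" and C: "C \<in> carrier (tens a b)"
    obtain A B where AB: "g = (A, B)" "A \<in> carrier (GL m)" "B \<in> carrier (GL n)" using carrier_GL_prod[OF g] by blast
    show "\<rho> g C \<in> carrier (tens a b)" unfolding AB(1) by (rule act(1)[OF AB(2,3) C])
    show "tensor_model a b (\<rho> g C) = (case g of (A, B) \<Rightarrow> tensor_act a b (R B) (S A)) (tensor_model a b C)"
      unfolding AB(1) split_conv by (rule act(2)[OF AB(2,3) C])
  next
    fix C assume "C \<in> carrier (tens a b)"
    then show "(case \<one>\<^bsub>GL m \<times>\<times> GL n\<^esub> of (A, B) \<Rightarrow> tensor_act a b (R B) (S A)) (tensor_model a b C) = tensor_model a b C"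
      unfolding one_GL_prod split_conv hom_GL(3)[OF hR] hom_GL(3)[OF hS]
      by (intro tensor_act_one tensor_model_support)
  next
    fix g h C assume "g \<in> carrier (GL m \<times>\<times> GL n)" "h \<in> carrier (GL m \<times>\<times> GL n)" "C \<in> carrier (tens a b)"
    then obtain A B A' B' where gh: "g = (A, B)" "h = (A', B')" and c: "A \<in> carrier (GL m)" "B \<in> carrier (GL n)"
      "A' \<in> carrier (GL m)" "B' \<in> carrier (GL n)" using carrier_GL_prod by meson
    show "(case g \<otimes>\<^bsub>GL m \<times>\<times> GL n\<^esub> h of (A, B) \<Rightarrow> tensor_act a b (R B) (S A)) (tensor_model a b C)
      = (case g of (A, B) \<Rightarrow> tensor_act a b (R B) (S A))
          ((case h of (A, B) \<Rightarrow> tensor_act a b (R B) (S A)) (tensor_model a b C))"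
      unfolding gh mult_DirProd GL_mult split_conv hom_GL(2)[OF hR c(2,4)] hom_GL(2)[OF hS c(1,3)]
      by (rule tensor_act_mult) (use c hom_GL(1)[OF hR] hom_GL(1)[OF hS] in auto)
  qed (auto simp: tensor_act_def fun_eq_iff sum.distrib sum_distrib_left algebra_simps)
  have nz: "carrier (tens a b) \<noteq> {\<zero>\<^bsub>tens a b\<^esub>}"
  proof
    assume e: "carrier (tens a b) = {\<zero>\<^bsub>tens a b\<^esub>}"
    obtain C where C: "C \<in> carrier (tens a b)" "\<forall>q\<in>box a b. tensor_model a b C q = 1"
      using tensor_model_surj[of a b "\<lambda>_. 1"] by blast
    have "C = \<zero>\<^bsub>tens a b\<^esub>" using C(1) e by blast
    then have "tensor_model a b C (0, 0) = 0" by (simp add: T.\<Phi>_zero)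
    then show False using C(2) pos by (simp add: a_def b_def)
  qed
  have "U = {\<zero>\<^bsub>tens a b\<^esub>} \<or> U = carrier (tens a b)"
    if U: "VectorSpace.subspace class_ring U (tens a b)" and st: "\<forall>g\<in>carrier (GL m \<times>\<times> GL n). \<rho> g ` U \<subseteq> U" for U
  proof (cases "U \<subseteq> {\<zero>\<^bsub>tens a b\<^esub>}")
    case True
    then show ?thesis using U by (auto simp: VectorSpace.subspace_def LinearCombinations.submodule_def)
  next
    case False
    have Uc: "U \<subseteq> carrier (tens a b)" using U by (simp add: VectorSpace.subspace_def LinearCombinations.submodule_def)
    obtain z where z: "z \<in> U" "z \<noteq> \<zero>\<^bsub>tens a b\<^esub>" using False by blast
    have zc: "z \<in> carrier (tens a b)" using z(1) Uc by blast
    define Z where "Z = tensor_model a b z"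
    have "\<exists>q\<in>box a b. Z q \<noteq> 0"
    proof (rule ccontr)
      assume "\<not> ?thesis"
      then have "Z q = 0" for q using tensor_model_support[OF zc, of q] unfolding Z_def by blast
      then have "Z = (\<lambda>_. 0)" by blast
      then show False using T.\<Phi>_inj[OF zc T.zero_in] z(2) by (simp add: Z_def T.\<Phi>_zero)
    qed
    then obtain i0 j0 where ij0: "i0 < a" "j0 < b" "Z (i0, j0) \<noteq> 0" by auto
    have "\<exists>w\<in>U. tensor_model a b w = (\<lambda>q. if q = p then Z (i0, j0) else 0)" if p: "p \<in> box a b" for p
    proof -
      obtain k l where kl: "p = (k, l)" "k < a" "l < b" using p by auto
      obtain F c where F: "finite F" "F \<subseteq> carrier (GL n)"
        "\<forall>q\<in>box a a. (\<Sum>B\<in>F. c B * r la B $$ q) = (if q = (k, i0) then 1 else 0)"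
        using family_burnside[OF fr la, of k i0] kl ij0 unfolding a_def by blast
      obtain F' c' where F': "finite F'" "F' \<subseteq> carrier (GL m)"
        "\<forall>q\<in>box b b. (\<Sum>A\<in>F'. c' A * s la A $$ q) = (if q = (l, j0) then 1 else 0)"
        using family_burnside[OF fs la, of l j0] kl ij0 unfolding b_def by blast
      have fin: "finite (F' \<times> F)" using F(1) F'(1) by simp
      have inU: "\<rho> x z \<in> U" if "x \<in> F' \<times> F" for x
      proof -
        have "x \<in> carrier (GL m \<times>\<times> GL n)" using that F(2) F'(2) by (auto simp: DirProd_def)
        then show ?thesis using st z(1) by blast
      qed
      \<comment> \<open>The weights are products of \<open>c'\<close> and \<open>c\<close>, so that
        the sum over pairs of group elements factors into the two matrix units.\<close>
      obtain w where w: "w \<in> U"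
        "tensor_model a b w = (\<lambda>q. \<Sum>x\<in>F' \<times> F. (c' (fst x) * c (snd x)) * tensor_model a b (\<rho> x z) q)"
        using T.subspace_sum[OF U fin inU, of "\<lambda>x. x" "\<lambda>x. c' (fst x) * c (snd x)"] by blast
      have "tensor_model a b w q = (if q = p then Z (i0, j0) else 0)" for q
      proof (cases "q \<in> box a b")
        case True
        obtain i j where q: "q = (i, j)" "i < a" "j < b" using True by auto
        have "tensor_model a b w q = (\<Sum>A\<in>F'. \<Sum>B\<in>F. \<Sum>q'\<in>box a b. (c' A * c B) * (R B $$ (i, fst q') * S A $$ (j, snd q') * Z q'))"
          unfolding w(2) sum.cartesian_product[of _ F]
        proof (rule sum.cong[OF refl])
          fix x assume "x \<in> F' \<times> F"
          then obtain A B where x: "x = (A, B)" "A \<in> F'" "B \<in> F" by auto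
          have "A \<in> carrier (GL m)" "B \<in> carrier (GL n)" using x F(2) F'(2) by auto
          note m = act(2)[OF this zc]
          show "c' (fst x) * c (snd x) * tensor_model a b (\<rho> x z) q
            = (case x of (A, B) \<Rightarrow> \<Sum>q'\<in>box a b. (c' A * c B) * (R B $$ (i, fst q') * S A $$ (j, snd q') * Z q'))"
            unfolding x(1) m using q by (simp add: tensor_act_def Z_def sum_distrib_left)
        qed
        also have "\<dots> = (\<Sum>A\<in>F'. \<Sum>q'\<in>box a b. \<Sum>B\<in>F. (c' A * c B) * (R B $$ (i, fst q') * S A $$ (j, snd q') * Z q'))"
          by (rule sum.cong[OF refl], rule sum.swap)
        also have "\<dots> = (\<Sum>q'\<in>box a b. \<Sum>A\<in>F'. \<Sum>B\<in>F. (c' A * c B) * (R B $$ (i, fst q') * S A $$ (j, snd q') * Z q'))"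
          by (rule sum.swap)
        also have "\<dots> = (\<Sum>q'\<in>box a b. (\<Sum>A\<in>F'. c' A * S A $$ (j, snd q')) * (\<Sum>B\<in>F. c B * R B $$ (i, fst q')) * Z q')"
          by (rule sum.cong[OF refl], subst sum_product, simp only: sum_distrib_right, intro sum.cong refl) simp
        also have "\<dots> = (\<Sum>q'\<in>box a b. if q' = (i0, j0) then (if q = p then Z (i0, j0) else 0) else 0)"
        proof (rule sum.cong[OF refl])
          fix q' assume q': "q' \<in> box a b"
          have 1: "(\<Sum>B\<in>F. c B * R B $$ (i, fst q')) = (if (i, fst q') = (k, i0) then 1 else 0)"
          proof -
            have "(\<Sum>B\<in>F. c B * R B $$ (i, fst q')) = (\<Sum>B\<in>F. c B * r la B $$ (i, fst q'))"
              using F(2) R(2) by (intro sum.cong refl) (auto simp: subset_iff)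
            then show ?thesis using bspec[OF F(3), of "(i, fst q')"] q q' by (cases q') simp
          qed
          have 2: "(\<Sum>A\<in>F'. c' A * S A $$ (j, snd q')) = (if (j, snd q') = (l, j0) then 1 else 0)"
          proof -
            have "(\<Sum>A\<in>F'. c' A * S A $$ (j, snd q')) = (\<Sum>A\<in>F'. c' A * s la A $$ (j, snd q'))"
              using F'(2) S(2) by (intro sum.cong refl) (auto simp: subset_iff)
            then show ?thesis using bspec[OF F'(3), of "(j, snd q')"] q q' by (cases q') simp
          qed
          show "(\<Sum>A\<in>F'. c' A * S A $$ (j, snd q')) * (\<Sum>B\<in>F. c B * R B $$ (i, fst q')) * Z q'
            = (if q' = (i0, j0) then (if q = p then Z (i0, j0) else 0) else 0)"
            unfolding 1 2 using q kl by (cases q') auto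
        qed
        finally show ?thesis using ij0 by simp
      next
        case False
        then show ?thesis using tensor_model_support[of w a b q] w(1) Uc p by auto
      qed
      then show ?thesis using w(1) by blast
    qed
    then have "\<forall>p\<in>box a b. \<exists>w. w \<in> U \<and> tensor_model a b w = (\<lambda>q. if q = p then Z (i0, j0) else 0)" by blast
    from bchoice[OF this] obtain w where w: "\<forall>p\<in>box a b. w p \<in> U \<and>
        tensor_model a b (w p) = (\<lambda>q. if q = p then Z (i0, j0) else 0)" ..
    have "v \<in> U" if v: "v \<in> carrier (tens a b)" for v
    proof -
      have fin: "finite (box a b)" by simp
      have "\<exists>u\<in>U. tensor_model a b u = (\<lambda>q. \<Sum>p\<in>box a b. (tensor_model a b v p / Z (i0, j0)) * tensor_model a b (w p) q)"
        by (rule T.subspace_sum[OF U fin]) (use w in blast)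
      then obtain u where u: "u \<in> U"
        "tensor_model a b u = (\<lambda>q. \<Sum>p\<in>box a b. (tensor_model a b v p / Z (i0, j0)) * tensor_model a b (w p) q)" by blast
      have "tensor_model a b u = tensor_model a b v"
      proof
        fix q
        have "tensor_model a b u q = (\<Sum>p\<in>box a b. if q = p then tensor_model a b v q else 0)"
          unfolding u(2) by (rule sum.cong) (use w ij0 in auto)
        then show "tensor_model a b u q = tensor_model a b v q"
          using tensor_model_support[OF v, of q] by simp
      qed
      then have "u = v" using u(1) Uc v by (intro T.\<Phi>_inj) auto
      then show ?thesis using u(1) by simp
    qed
    then show ?thesis using Uc by blast
  qed
  then have "irreducible_rep (GL m \<times>\<times> GL n) (tens a b) \<rho>"
    unfolding irreducible_rep_def using rep nz by blast
  then show ?thesis by (simp add: \<rho>_def a_def b_def)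
qed

theorem theorem19:
  fixes m n d :: nat
    and N M :: "nat list \<Rightarrow> nat"
    and R S :: "nat list \<Rightarrow> complex mat \<Rightarrow> complex mat"
  assumes "m \<ge> 1" and "n \<ge> 1"
    and "\<And>la. la \<in> partitions d \<Longrightarrow> schur_rep n la (N la) (R la)"
    and "\<And>la. la \<in> partitions d \<Longrightarrow> schur_rep m la (M la) (S la)"
  shows "rep_iso (GL m \<times>\<times> GL n)
           (sym_power d (tensor (cspace m) (cspace n)))
           (\<lambda>(A, B). sym_map d (tensor (cspace m) (cspace n))
              (tensor_map (cspace m) (cspace n) (\<lambda>v. A *\<^sub>v v) (\<lambda>w. B *\<^sub>v w)))
           (dsum (partitions d) (\<lambda>la. tensor (cspace (N la)) (cspace (M la))))
           (\<lambda>(A, B). dsum_map (partitions d) (\<lambda>la.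
              tensor_map (cspace (N la)) (cspace (M la)) (\<lambda>v. R la B *\<^sub>v v) (\<lambda>w. S la A *\<^sub>v w)))
         \<and> (\<forall>la\<in>partitions d. length la \<le> m \<and> length la \<le> n \<longrightarrow>
              irreducible_rep (GL m \<times>\<times> GL n)
                (tensor (cspace (N la)) (cspace (M la)))
                (\<lambda>(A, B). tensor_map (cspace (N la)) (cspace (M la))
                   (\<lambda>v. R la B *\<^sub>v v) (\<lambda>w. S la A *\<^sub>v w)))"
    (is "rep_iso ?G ?V ?\<rho> ?W ?\<sigma> \<and> _")
proof
  obtain r where r: "family n d N r" "\<And>la B. la \<in> partitions d \<Longrightarrow> B \<in> carrier (GL n) \<Longrightarrow> r la B = R la B"
    using family_exists[OF assms(3)] by blast
  obtain s where s: "family m d M s" "\<And>la A. la \<in> partitions d \<Longrightarrow> A \<in> carrier (GL m) \<Longrightarrow> s la A = S la A"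
    using family_exists[OF assms(4)] by blast
  obtain \<Psi> where "cauchy_map d m n N M r s \<Psi>" using cauchy_map_exists[OF r(1) s(1)] by blast
  then interpret \<Psi>: cauchy_map d m n N M r s \<Psi> .
  obtain E where "coord_space (tens m n) (tensor_model m n) m n E" using tensor_coord_space by blast
  then interpret T: coord_space "tens m n" "tensor_model m n" m n E .
  have \<rho>: "?\<rho> (A, B) v \<in> carrier ?V \<and> T.sym_model (?\<rho> (A, B) v) = translate m n (A, B) (T.sym_model v)"
    if A: "A \<in> carrier (GL m)" and B: "B \<in> carrier (GL n)" and v: "v \<in> carrier ?V" for A B v
  proof -
    note t = tensor_map_model[OF GL_carrierD[OF A] GL_carrierD[OF B]]
    show ?thesis
      unfolding split_conv using T.sym_map_model[OF GL_carrierD[OF A] GL_carrierD[OF B] v t] by blast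
  qed
  have \<sigma>: "?\<sigma> (A, B) w \<in> carrier ?W \<and> \<Psi>.dsum_model (?\<sigma> (A, B) w) = translate m n (A, B) (\<Psi>.dsum_model w)"
    if A: "A \<in> carrier (GL m)" and B: "B \<in> carrier (GL n)" and w: "w \<in> carrier ?W" for A B w
    unfolding split_conv
  proof (rule \<Psi>.dsum_map_model[OF A B w])
    fix la assume la: "la \<in> partitions d"
    show "R la B = r la B" "S la A = s la A" using r(2)[OF la B] s(2)[OF la A] by simp_all
    show "r la B \<in> carrier_mat (N la) (N la)" by (rule mrepD(1)[OF familyD(1)[OF r(1) la] GL_carrierD[OF B]])
    show "s la A \<in> carrier_mat (M la) (M la)" by (rule mrepD(1)[OF familyD(1)[OF s(1) la] GL_carrierD[OF A]])
  qed
  show "rep_iso ?G ?V ?\<rho> ?W ?\<sigma>"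
  \<comment> \<open>On both sides the functions are the forms of degree \<open>d\<close> cut off by
    \<open>on_mats m n\<close>, with the same action \<open>translate m n\<close>.\<close>
  proof (rule rep_iso_by_models[OF T.sym_lin_model \<Psi>.dsum_lin_model, where \<alpha> = "translate m n"])
    show "representation ?G ?V ?\<rho>"
      by (rule translate_representation[OF T.sym_lin_model _ \<rho>]) (auto simp: T.sym_model_image)
    show "representation ?G ?W ?\<sigma>"
      by (rule translate_representation[OF \<Psi>.dsum_lin_model _ \<sigma>]) (auto simp: \<Psi>.dsum_model_image)
    show "T.sym_model ` carrier ?V = \<Psi>.dsum_model ` carrier ?W"
      unfolding T.sym_model_image \<Psi>.dsum_model_image ..
    show "?\<rho> g v \<in> carrier ?V \<and> T.sym_model (?\<rho> g v) = translate m n g (T.sym_model v)"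
      if "g \<in> carrier ?G" "v \<in> carrier ?V" for g v using carrier_GL_prod[OF that(1)] \<rho>[OF _ _ that(2)] by blast
    show "?\<sigma> g w \<in> carrier ?W \<and> \<Psi>.dsum_model (?\<sigma> g w) = translate m n g (\<Psi>.dsum_model w)"
      if "g \<in> carrier ?G" "w \<in> carrier ?W" for g w using carrier_GL_prod[OF that(1)] \<sigma>[OF _ _ that(2)] by blast
  qed
  show "\<forall>la\<in>partitions d. length la \<le> m \<and> length la \<le> n \<longrightarrow> irreducible_rep ?G
      (tensor (cspace (N la)) (cspace (M la)))
      (\<lambda>(A, B). tensor_map (cspace (N la)) (cspace (M la)) (\<lambda>v. R la B *\<^sub>v v) (\<lambda>w. S la A *\<^sub>v w))"
  proof (intro ballI impI)
    \<comment> \<open>The bound on the length singles out the nonzero summands: with more than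
      \<open>m\<close> or more than \<open>n\<close> parts one of the two factors is the zero
      space.\<close>
    fix la assume la: "la \<in> partitions d" and len: "length la \<le> m \<and> length la \<le> n"
    have R: "irr n (N la) (R la)" and S: "irr m (M la) (S la)"
      using assms(3)[OF la] assms(4)[OF la] len by (auto simp: schur_rep_def polynomial_rep_def irr_def)
    show "irreducible_rep ?G (tensor (cspace (N la)) (cspace (M la)))
      (\<lambda>(A, B). tensor_map (cspace (N la)) (cspace (M la)) (\<lambda>v. R la B *\<^sub>v v) (\<lambda>w. S la A *\<^sub>v w))"
      by (rule tensor_irreducible[OF r(1) s(1) la _ r(2)[OF la] _ s(2)[OF la] irr_pos[OF R] irr_pos[OF S]])
        (use R S in \<open>auto simp: irr_def\<close>)
  qed
qed

end
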